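(* Assume: (1) for every $n\in\mathbb{N}$ there is $c_n>0$ with $\xi' A(x)\xi\ge c_n|\xi|^2$ for all $x\in E_n$, $\xi\in\mathbb{R}^d$, and there are constants $\overline{\kappa}\ge\underline{\kappa}>0$ with $\underline{\kappa}A(x)\le \overline{A}(x)\le\overline{\kappa}A(x)$ for all $x\in E$; (2) $\phi_0\in C^3(E)$ is non-negative and $\lim_{n\uparrow\infty}\sup_{x\in E\setminus E_n}\mathfrak{F}[\phi_0](x)=-\infty$; (3) the martingale problem for $\mathcal{L}^{\phi_0}$ on $E$ is well-posed; (4) $\lim_{n\uparrow\infty}\inf_{x\in E\setminus E_n}\phi_0(x)=\infty$, and there is $\delta>1$ with $\lim_{n\uparrow\infty}\sup_{x\in E\setminus E_n}\mathfrak{F}[\delta\phi_0](x)=-\infty$; (5) there are $\psi_0\in C^3(E)$ and $\alpha,K>0$ such that $\lim_{n\uparrow\infty}\inf_{x\in E\setminus E_n}\mathfrak{F}[\psi_0](x)=\infty$, $\lim_{n\uparrow\infty}\inf_{x\in E\setminus E_n}(\phi_0-\psi_0)(x)=\infty$, $\inf_{x\in E}(\psi_0+K\phi_0)(x)>-\infty$ and, with the same $\delta$ as in (4), $\sup_{x\in E}\big(\mathfrak{F}[\delta\phi_0]+\alpha(\delta\phi_0-\psi_0)\big)(x)<\infty$. Let $v_0\in C(E)$ satisfy $\sup_{x\in E}(|v_0|-\phi_0)(x)<\infty$, let $v$ be the unique classical solution of $\partial_t v=\mathfrak{F}[v]$ on $(0,\infty)\times E$, $v(0,\cdot)=v_0$,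 satisfying $\sup_{[0,T]\times E}(v(t,x)-\phi_0(x))<\infty$ for each $T\ge 0$, and let $h(t,x)=v(t,x)-\hat{\lambda}t-\hat{v}(x)$. Then, for any $t\ge 0$, as functions of $x\in E$: (i) $\lim_{T\to\infty}\mathbb{E}^{\mathbb{P}^{\hat{v},x}}\Big[\int_0^t(\nabla h)'\,\overline{A}\,\nabla h\,(T-s,X_s)\,ds\Big]=0$ in $C(E)$; (ii) $\lim_{T\to\infty}\mathbb{E}^{\mathbb{P}^{\hat{v},x}}\Big[\sup_{0\le s\le t}|h(T,x)-h(T-s,X_s)|\Big]=0$ in $C(E)$.
   Context: Convergence in $C(E)$ means locally uniform convergence on $E$; $'$ denotes transpose; inequalities between symmetric matrices are in the sense of positive semi-definiteness. Domain: $E\subseteq\mathbb{R}^d$ is open and connected, star shaped with respect to some $x_0\in E$ (the segment from $x_0$ to any $x\in E$ lies in $E$), and $(E_n)_{n\in\mathbb{N}}$ is a sequence of open, bounded, connected domains, each star shaped with respect to $x_0$ and with $C^{2,\gamma}$ boundary for some $\gamma\in(0,1]$, such that $\overline{E_n}\subset E_{n+1}$ and $E=\bigcup_nE_n$. Coefficients: $A=(A_{ij})$ and $\overline{A}=(\overline{A}_{ij})$ belong to $C^{2,\gamma}(E,\mathbb{S}^d)$, $B=(B_i)\in C^{1,\gamma}(E,\mathbb{R}^d)$, $V\in C^{1,\gamma}(E)$ for some $\gamma\in(0,1]$, where $\mathbb{S}^d$ is the space of real symmetric $d\times d$ matrices and $C^{k,\gamma}$ denotes $k$ times differentiable functions whose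 $k$-th derivatives are locally H\"older continuous with exponent $\gamma$. Operators: $\mathfrak{F}[\phi]=\frac12\sum_{i,j}A_{ij}D_{ij}\phi+\frac12\sum_{i,j}\overline{A}_{ij}D_i\phi D_j\phi+\sum_iB_iD_i\phi+V$, and $\mathcal{L}^{\phi}=\frac12\sum_{i,j}A_{ij}D_{ij}+\sum_i\big(B_i+\sum_j\overline{A}_{ij}D_j\phi\big)D_i$. A classical solution of the Cauchy problem $\partial_tv=\mathfrak{F}[v]$, $v(0,\cdot)=v_0$ is a function $v\in C^{1,2}((0,\infty)\times E)\cap C([0,\infty)\times E)$ satisfying it. Probability: $X$ is the coordinate process on the space of continuous paths in $E$ (possibly exploding, i.e. leaving every $E_n$ in finite time). $(\mathbb{P}^{\phi,x})_{x\in E}$ denotes the unique solution to the generalized martingale problem on $E$ for $\mathcal{L}^\phi$ (under $\mathbb{P}^{\phi,x}$, $X$ is the diffusion with generator $\mathcal{L}^\phi$ started at $x$, up to its explosion time). The martingale problem for $\mathcal{L}^\phi$ is well-posed if $X$ does not explode $\mathbb{P}^{\phi,x}$-a.s. for any $x\in E$. Ergodic pair (known, taken as given): under hypotheses (1) and (2), there is a unique $\hat{\lambda}\in\mathbb{R}$ for which there exists a (unique up to an additive constant) $\hat{v}\in C^2(E)$ with $\mathfrak{F}[\hat{v}]=\hat{\lambda}$ on $E$ such that $(\mathbb{P}^{\hat{v},x})_{x\in E}$ is ergodic (positive recurrent) with an invariant probability density $\hat{m}$. $(\hat{v},\hat{\lambda})$ denotes this pair. *)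

theory Defs
  imports "HOL-Probability.Probability"
begin

section \<open>Differential calculus on open subsets of Euclidean space\<close>

definition pd :: "'d \<Rightarrow> (real^'d::finite \<Rightarrow> real) \<Rightarrow> real^'d \<Rightarrow> real" where
  "pd i f x = frechet_derivative f (at x) (axis i 1)"

definition grad :: "(real^'d::finite \<Rightarrow> real) \<Rightarrow> real^'d \<Rightarrow> real^'d" where
  "grad f x = (\<chi> i. pd i f x)"

text \<open>The two classes below are meant for open \<open>E\<close>, where \<open>differentiable_on\<close> is
  differentiability at every point in the ordinary sense.\<close>

primrec Ck_on :: "(real^'d::finite) set \<Rightarrow> nat \<Rightarrow> (real^'d \<Rightarrow> real) \<Rightarrow> bool" where
  "Ck_on E 0 f \<longleftrightarrow> continuous_on E f"
| "Ck_on E (Suc k) f \<longleftrightarrow> f differentiable_on E \<and> (\<forall>i. Ck_on E k (pd i f))"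

definition locally_Hoelder_on :: "real \<Rightarrow> (real^'d::finite) set \<Rightarrow> (real^'d \<Rightarrow> real) \<Rightarrow> bool" where
  "locally_Hoelder_on \<gamma> E f \<longleftrightarrow>
     (\<forall>K. compact K \<and> K \<subseteq> E \<longrightarrow>
        (\<exists>C. \<forall>x\<in>K. \<forall>y\<in>K. \<bar>f x - f y\<bar> \<le> C * dist x y powr \<gamma>))"

primrec CkH_on :: "real \<Rightarrow> (real^'d::finite) set \<Rightarrow> nat \<Rightarrow> (real^'d \<Rightarrow> real) \<Rightarrow> bool" where
  "CkH_on \<gamma> E 0 f \<longleftrightarrow> locally_Hoelder_on \<gamma> E f"
| "CkH_on \<gamma> E (Suc k) f \<longleftrightarrow> f differentiable_on E \<and> (\<forall>i. CkH_on \<gamma> E k (pd i f))"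

definition CkH_vec_on :: "real \<Rightarrow> (real^'d::finite) set \<Rightarrow> nat \<Rightarrow> (real^'d \<Rightarrow> real^'d) \<Rightarrow> bool" where
  "CkH_vec_on \<gamma> E k F \<longleftrightarrow> (\<forall>i. CkH_on \<gamma> E k (\<lambda>x. F x $ i))"

definition CkH_symm_on :: "real \<Rightarrow> (real^'d::finite) set \<Rightarrow> nat \<Rightarrow> (real^'d \<Rightarrow> real^'d^'d) \<Rightarrow> bool" where
  "CkH_symm_on \<gamma> E k M \<longleftrightarrow>
     (\<forall>x\<in>E. transpose (M x) = M x) \<and> (\<forall>i j. CkH_on \<gamma> E k (\<lambda>x. M x $ i $ j))"

definition loewner_le :: "real^'d::finite^'d \<Rightarrow> real^'d^'d \<Rightarrow> bool" where
  "loewner_le M N \<longleftrightarrow> (\<forall>\<xi>. 0 \<le> \<xi> \<bullet> ((N - M) *v \<xi>))"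

section \<open>Domains\<close>

text \<open>A \<open>C\<^bsup>k,\<gamma>\<^esup>\<close> boundary, following Gilbarg and Trudinger: near each boundary point there is a
  \<open>C\<^bsup>k,\<gamma>\<^esup>\<close> diffeomorphism that straightens the boundary. The half space may be taken with respect
  to any coordinate, since the index type carries no distinguished last element.\<close>

definition CkH_boundary :: "real \<Rightarrow> nat \<Rightarrow> (real^'d::finite) set \<Rightarrow> bool" where
  "CkH_boundary \<gamma> k D \<longleftrightarrow>
     (\<forall>z\<in>frontier D. \<exists>r>0. \<exists>\<psi> \<psi>' i.
        open (\<psi> ` ball z r) \<and> (\<forall>x\<in>ball z r. \<psi>' (\<psi> x) = x) \<and>
        CkH_vec_on \<gamma> (ball z r) k \<psi> \<and> CkH_vec_on \<gamma> (\<psi> ` ball z r) k \<psi>' \<and>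
        (\<forall>x\<in>ball z r \<inter> D. \<psi> x $ i > 0) \<and>
        (\<forall>x\<in>ball z r \<inter> frontier D. \<psi> x $ i = 0))"

definition star_shaped_wrt :: "real^'d::finite \<Rightarrow> (real^'d) set \<Rightarrow> bool" where
  "star_shaped_wrt x0 D \<longleftrightarrow> x0 \<in> D \<and> (\<forall>x\<in>D. closed_segment x0 x \<subseteq> D)"

definition regular_exhaustion ::
  "real \<Rightarrow> real^'d::finite \<Rightarrow> (real^'d) set \<Rightarrow> (nat \<Rightarrow> (real^'d) set) \<Rightarrow> bool" where
  "regular_exhaustion \<gamma> x0 E En \<longleftrightarrow>
     (\<forall>n. open (En n) \<and> bounded (En n) \<and> connected (En n) \<and> star_shaped_wrt x0 (En n) \<and>
          CkH_boundary \<gamma> 2 (En n) \<and> closure (En n) \<subseteq> En (Suc n)) \<and>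
     E = (\<Union>n. En n)"

section \<open>Operators\<close>

definition F_op ::
  "(real^'d::finite \<Rightarrow> real^'d^'d) \<Rightarrow> (real^'d \<Rightarrow> real^'d^'d) \<Rightarrow> (real^'d \<Rightarrow> real^'d) \<Rightarrow>
   (real^'d \<Rightarrow> real) \<Rightarrow> (real^'d \<Rightarrow> real) \<Rightarrow> real^'d \<Rightarrow> real" where
  "F_op A Abar B V \<phi> x =
     1/2 * (\<Sum>i\<in>UNIV. \<Sum>j\<in>UNIV. A x $ i $ j * pd i (pd j \<phi>) x)
     + 1/2 * (\<Sum>i\<in>UNIV. \<Sum>j\<in>UNIV. Abar x $ i $ j * pd i \<phi> x * pd j \<phi> x)
     + (\<Sum>i\<in>UNIV. B x $ i * pd i \<phi> x) + V x"

definition L_op ::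
  "(real^'d::finite \<Rightarrow> real^'d^'d) \<Rightarrow> (real^'d \<Rightarrow> real^'d^'d) \<Rightarrow> (real^'d \<Rightarrow> real^'d) \<Rightarrow>
   (real^'d \<Rightarrow> real) \<Rightarrow> (real^'d \<Rightarrow> real) \<Rightarrow> real^'d \<Rightarrow> real" where
  "L_op A Abar B \<phi> f x =
     1/2 * (\<Sum>i\<in>UNIV. \<Sum>j\<in>UNIV. A x $ i $ j * pd i (pd j f) x)
     + (\<Sum>i\<in>UNIV. (B x $ i + (\<Sum>j\<in>UNIV. Abar x $ i $ j * pd j \<phi> x)) * pd i f x)"

definition C12_on :: "(real^'d::finite) set \<Rightarrow> (real \<Rightarrow> real^'d \<Rightarrow> real) \<Rightarrow> bool" where
  "C12_on E v \<longleftrightarrow>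
     (\<forall>t>0. \<forall>x\<in>E. (\<lambda>s. v s x) differentiable (at t)) \<and>
     (\<forall>t>0. Ck_on E 2 (v t)) \<and>
     continuous_on ({0<..} \<times> E) (\<lambda>(t, x). deriv (\<lambda>s. v s x) t) \<and>
     (\<forall>i. continuous_on ({0<..} \<times> E) (\<lambda>(t, x). pd i (v t) x)) \<and>
     (\<forall>i j. continuous_on ({0<..} \<times> E) (\<lambda>(t, x). pd i (pd j (v t)) x))"

definition classical_solution ::
  "(real^'d::finite \<Rightarrow> real^'d^'d) \<Rightarrow> (real^'d \<Rightarrow> real^'d^'d) \<Rightarrow> (real^'d \<Rightarrow> real^'d) \<Rightarrow>
   (real^'d \<Rightarrow> real) \<Rightarrow> (real^'d) set \<Rightarrow> (real^'d \<Rightarrow> real) \<Rightarrow> (real \<Rightarrow> real^'d \<Rightarrow> real) \<Rightarrow> bool" where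
  "classical_solution A Abar B V E v0 v \<longleftrightarrow>
     C12_on E v \<and> continuous_on ({0..} \<times> E) (\<lambda>(t, x). v t x) \<and>
     (\<forall>t>0. \<forall>x\<in>E. deriv (\<lambda>s. v s x) t = F_op A Abar B V (v t) x) \<and>
     (\<forall>x\<in>E. v 0 x = v0 x)"

section \<open>The generalized martingale problem\<close>

text \<open>Paths take values in the one-point compactification of \<open>E\<close>. The added point \<open>None\<close> is the
  cemetery, in which a path stays once it has left every compact subset of \<open>E\<close>.\<close>

type_synonym 'd path = "real \<Rightarrow> (real^'d) option"

definition cemetery_ext :: "(real^'d::finite) set \<Rightarrow> (real^'d) option topology" where
  "cemetery_ext E = Alexandroff_compactification (top_of_set E)"

definition paths :: "(real^'d::finite) set \<Rightarrow> 'd path set" where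
  "paths E = {\<omega> \<in> extensional {0..}.
     continuous_map (top_of_set {0..}) (cemetery_ext E) \<omega> \<and>
     (\<forall>s t. 0 \<le> s \<and> s \<le> t \<and> \<omega> s = None \<longrightarrow> \<omega> t = None)}"

text \<open>The \<open>\<sigma>\<close>-algebra generated by the coordinates with times in \<open>I\<close>; the filtration of the
  coordinate process is \<open>t \<mapsto> path_sigma E {0..t}\<close>.\<close>

definition path_sigma :: "(real^'d::finite) set \<Rightarrow> real set \<Rightarrow> 'd path measure" where
  "path_sigma E I =
     sigma (paths E) {{\<omega> \<in> paths E. \<omega> s \<in> U} | s U. s \<in> I \<and> openin (cemetery_ext E) U}"

definition is_martingale ::
  "'w measure \<Rightarrow> (real \<Rightarrow> 'w measure) \<Rightarrow> (real \<Rightarrow> 'w \<Rightarrow> real) \<Rightarrow> bool" where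
  "is_martingale P Fil M \<longleftrightarrow>
     (\<forall>t\<ge>0. M t \<in> borel_measurable (Fil t) \<and> integrable P (M t)) \<and>
     (\<forall>s t. 0 \<le> s \<and> s \<le> t \<longrightarrow> (AE \<omega> in P. real_cond_exp P (Fil s) (M t) \<omega> = M s \<omega>))"

definition exit_time :: "(real^'d::finite) set \<Rightarrow> 'd path \<Rightarrow> ereal" where
  "exit_time D \<omega> = (INF t\<in>{t. 0 \<le> t \<and> \<omega> t \<notin> Some ` D}. ereal t)"

definition stopped :: "(real^'d::finite) set \<Rightarrow> real \<Rightarrow> 'd path \<Rightarrow> real" where
  "stopped D t \<omega> = real_of_ereal (min (ereal t) (exit_time D \<omega>))"

text \<open>The law \<open>P\<close> solves the generalized martingale problem on \<open>E\<close> for \<open>\<L>\<^bsup>\<phi>\<^esup>\<close>, started at \<open>x\<close>.\<close>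

definition gmp_solution ::
  "(real^'d::finite \<Rightarrow> real^'d^'d) \<Rightarrow> (real^'d \<Rightarrow> real^'d^'d) \<Rightarrow> (real^'d \<Rightarrow> real^'d) \<Rightarrow>
   (real^'d) set \<Rightarrow> (nat \<Rightarrow> (real^'d) set) \<Rightarrow> (real^'d \<Rightarrow> real) \<Rightarrow> real^'d \<Rightarrow> 'd path measure \<Rightarrow> bool" where
  "gmp_solution A Abar B E En \<phi> x P \<longleftrightarrow>
     prob_space P \<and> space P = paths E \<and> sets P = sets (path_sigma E {0..}) \<and>
     (AE \<omega> in P. \<omega> 0 = Some x) \<and>
     (\<forall>n f. Ck_on E 2 f \<longrightarrow>
        is_martingale P (\<lambda>t. path_sigma E {0..t})
          (\<lambda>t \<omega>. f (the (\<omega> (stopped (En n) t \<omega>)))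
                - (LBINT s:{0..stopped (En n) t \<omega>}. L_op A Abar B \<phi> f (the (\<omega> s)))))"

definition gmp_family ::
  "(real^'d::finite \<Rightarrow> real^'d^'d) \<Rightarrow> (real^'d \<Rightarrow> real^'d^'d) \<Rightarrow> (real^'d \<Rightarrow> real^'d) \<Rightarrow>
   (real^'d) set \<Rightarrow> (nat \<Rightarrow> (real^'d) set) \<Rightarrow> (real^'d \<Rightarrow> real) \<Rightarrow> (real^'d \<Rightarrow> 'd path measure) \<Rightarrow> bool" where
  "gmp_family A Abar B E En \<phi> P \<longleftrightarrow> (\<forall>x\<in>E. gmp_solution A Abar B E En \<phi> x (P x))"

definition mp_well_posed ::
  "(real^'d::finite \<Rightarrow> real^'d^'d) \<Rightarrow> (real^'d \<Rightarrow> real^'d^'d) \<Rightarrow> (real^'d \<Rightarrow> real^'d) \<Rightarrow>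
   (real^'d) set \<Rightarrow> (nat \<Rightarrow> (real^'d) set) \<Rightarrow> (real^'d \<Rightarrow> real) \<Rightarrow> bool" where
  "mp_well_posed A Abar B E En \<phi> \<longleftrightarrow>
     (\<exists>P. gmp_family A Abar B E En \<phi> P \<and>
          (\<forall>x\<in>E. AE \<omega> in P x. \<forall>t\<ge>0. \<omega> t \<noteq> None))"

definition recurrent_family ::
  "(real^'d::finite) set \<Rightarrow> (real^'d \<Rightarrow> 'd path measure) \<Rightarrow> bool" where
  "recurrent_family E P \<longleftrightarrow>
     (\<forall>x\<in>E. \<forall>y\<in>E. \<forall>\<epsilon>>0. AE \<omega> in P x. \<exists>t\<ge>0. \<omega> t \<in> Some ` (E \<inter> ball y \<epsilon>))"

definition invariant_prob_density ::
  "(real^'d::finite) set \<Rightarrow> (real^'d \<Rightarrow> 'd path measure) \<Rightarrow> (real^'d \<Rightarrow> real) \<Rightarrow> bool" where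
  "invariant_prob_density E P m \<longleftrightarrow>
     set_borel_measurable lborel E m \<and> (\<forall>x\<in>E. 0 \<le> m x) \<and>
     (\<integral>\<^sup>+x\<in>E. ennreal (m x) \<partial>lborel) = 1 \<and>
     (\<forall>t\<ge>0. \<forall>G\<in>sets borel. G \<subseteq> E \<longrightarrow>
        (\<integral>\<^sup>+x\<in>E. (emeasure (P x) {\<omega> \<in> paths E. \<omega> t \<in> Some ` G} * ennreal (m x)) \<partial>lborel)
        = (\<integral>\<^sup>+x\<in>G. ennreal (m x) \<partial>lborel))"

definition ergodic_family ::
  "(real^'d::finite) set \<Rightarrow> (real^'d \<Rightarrow> 'd path measure) \<Rightarrow> (real^'d \<Rightarrow> real) \<Rightarrow> bool" where
  "ergodic_family E P m \<longleftrightarrow> recurrent_family E P \<and> invariant_prob_density E P m"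

section \<open>Locally uniform convergence\<close>

text \<open>Locally uniform convergence to zero, as \<open>T \<rightarrow> \<infinity>\<close>, of functions with values in \<open>[0, \<infinity>]\<close>.
  Extended values keep an expectation that fails to be finite from being read as zero.\<close>

definition vanishes_in_C :: "(real^'d::finite) set \<Rightarrow> (real \<Rightarrow> real^'d \<Rightarrow> ennreal) \<Rightarrow> bool" where
  "vanishes_in_C E g \<longleftrightarrow>
     (\<forall>K. compact K \<and> K \<subseteq> E \<longrightarrow> ((\<lambda>T. SUP x\<in>K. g T x) \<longlongrightarrow> 0) at_top)"

end

theory Submission
  imports Defs
begin

text \<open>With \<open>g = \<delta> \<phi>0 - vhat + const \<ge> 1\<close> and \<open>L\<close> the generator of the ergodic diffusion, the difference
  \<open>h\<close> solves \<open>\<partial>\<^sub>t h = L h + (\<nabla>h)' Abar \<nabla>h / 2\<close>. Since \<open>Abar \<ge> \<kappa>l A\<close>, sums of exponentials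
  \<open>exp (\<kappa>l (\<phi>\<^sub>k - v))\<close> obey a comparison principle. It bounds \<open>h\<close> locally uniformly in time and
  shows that a lower bound \<open>h \<ge> c - \<theta> g\<close> persists with exponentially decreasing \<open>\<theta>\<close>. Let
  \<open>climit\<close> be the best constant \<open>c\<close> for which \<open>\<theta>\<close> can eventually be taken arbitrarily small.
  If \<open>h\<close> were above \<open>climit\<close> at some late time and place, then equicontinuity (doubling of variables)
  and a moving barrier would spread the excess over a large compact set, contradicting the choice of
  \<open>climit\<close>; hence \<open>h \<rightarrow> climit\<close> locally uniformly.

  The function \<open>U = exp (\<kappa>l g)\<close> is a Lyapunov function with \<open>L U\<close> bounded above. Ito's formula for
  \<open>h(T - s, X\<^sub>s) - climit + \<theta> U(X\<^sub>s)\<close>, which is nonnegative for late \<open>T\<close>, bounds the expected cost in (i).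
  For (ii), \<open>exp (\<kappa>l (h(T - s, X\<^sub>s) - climit)) - 1 + 2 \<theta> U(X\<^sub>s)\<close> is nonnegative, a supermartingale up
  to a drift of order \<open>\<theta>\<close>, and dominates a multiple of \<open>(h(T - s, X\<^sub>s) - climit)\<^sup>2\<close>, so the maximal
  inequality applies.\<close>

section \<open>Second order calculus\<close>

text \<open>The coefficients are controlled only on compact subsets, so near the boundary of
  \<open>E\<close> everything rests on the test functions. Each comparison argument on all of
  \<open>E\<close> carries a penalty of arbitrarily small weight \<epsilon>: inside an exponential
  sum a weight is an additive constant, invisible to \<open>F\<close>, and it vanishes with
  \<epsilon>. The penalty has to outgrow \<open>v\<close>, known only to lie below \<phi>0 plus a
  constant; this is the use of \<delta> > 1, since \<delta> \<phi>0 - \<phi>0 tends to infinity. The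
  function \<psi>0 bounds \<open>vhat\<close> from below, which turns the hypothesis on \<delta>
  \<phi>0 into a restoring drift of rate \<alpha> for \<open>g\<close>; the bound of
  \<open>vhat\<close> by \<phi>0 behind g \<ge> 1 comes from recurrence. The exponent
  \<open>\<kappa>l\<close> is chosen so that the second order term created by exponentiation is
  dominated by the quadratic term of \<open>F\<close>. Interior estimates are obtained from doubled
  variables and explicit barriers, and Ito's formula for time-dependent functions from Riemann sums
  of martingales of fixed functions.\<close>

definition hess :: "(real^'d::finite \<Rightarrow> real) \<Rightarrow> real^'d \<Rightarrow> real^'d^'d" where
  "hess f x = (\<chi> i j. pd i (pd j f) x)"

text \<open>The Frobenius inner product. Half of it, taken between \<open>A x\<close> and a Hessian,
  is the second order part of both operators.\<close>

definition mdot :: "real^'d::finite^'d \<Rightarrow> real^'d^'d \<Rightarrow> real" where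
  "mdot M H = (\<Sum>i\<in>UNIV. \<Sum>j\<in>UNIV. M $ i $ j * H $ i $ j)"

definition outer :: "real^'d::finite \<Rightarrow> real^'d \<Rightarrow> real^'d^'d" where
  "outer u w = (\<chi> i j. u $ i * w $ j)"

section \<open>Linear algebra of positive semidefinite matrices\<close>

lemma inner_matrix_vector: "\<xi> \<bullet> (M *v \<eta>) = (\<Sum>i\<in>UNIV. \<Sum>j\<in>UNIV. M $ i $ j * \<xi> $ i * \<eta> $ j)"
  for \<xi> \<eta> :: "real^'d::finite"
  by (simp add: inner_vec_def matrix_vector_mult_def sum_distrib_left mult_ac)

lemma mdot_outer: "mdot M (outer u w) = u \<bullet> (M *v w)"
  by (simp add: inner_matrix_vector mdot_def outer_def mult_ac)

lemma mdot_outer': "mdot (outer u w) H = u \<bullet> (H *v w)"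
  by (simp add: inner_matrix_vector mdot_def outer_def mult_ac)

lemma mdot_add_left: "mdot (M + N) H = mdot M H + mdot N H"
  by (simp add: mdot_def algebra_simps sum.distrib)
lemma mdot_add_right: "mdot M (H + K) = mdot M H + mdot M K"
  by (simp add: mdot_def algebra_simps sum.distrib)
lemma mdot_scale_left: "mdot (c *\<^sub>R M) H = c * mdot M H"
  by (simp add: mdot_def sum_distrib_left mult_ac)
lemma mdot_scale_right: "mdot M (c *\<^sub>R H) = c * mdot M H"
  by (simp add: mdot_def sum_distrib_left mult_ac)
lemma mdot_diff_left: "mdot (M - N) H = mdot M H - mdot N H"
  by (simp add: mdot_def algebra_simps sum_subtractf)
lemma mdot_diff_right: "mdot M (H - K) = mdot M H - mdot M K"
  by (simp add: mdot_def algebra_simps sum_subtractf)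
lemma mdot_minus_right: "mdot M (- H) = - mdot M H"
  by (simp add: mdot_def sum_negf)
lemma mdot_zero_right [simp]: "mdot M 0 = 0" by (simp add: mdot_def)
lemma mdot_zero_left [simp]: "mdot 0 M = 0" by (simp add: mdot_def)
lemma mdot_sum_left: "mdot (\<Sum>k\<in>I. M k) H = (\<Sum>k\<in>I. mdot (M k) H)"
  by (induction I rule: infinite_finite_induct) (simp_all add: mdot_add_left)
lemma mdot_sum_right: "mdot M (\<Sum>k\<in>I. H k) = (\<Sum>k\<in>I. mdot M (H k))"
  by (induction I rule: infinite_finite_induct) (simp_all add: mdot_add_right)
lemma mdot_mat: "mdot M (mat 1) = trace M"
proof -
  have "(\<Sum>j\<in>UNIV. M $ i $ j * (mat 1 :: real^'a^'a) $ i $ j) = M $ i $ i" for i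
    by (simp add: mat_def if_distrib cong: if_cong)
  then show ?thesis by (simp add: mdot_def trace_def)
qed

lemmas mdot_simps = mdot_add_left mdot_add_right mdot_scale_left mdot_scale_right
  mdot_diff_left mdot_diff_right mdot_minus_right mdot_sum_right

text \<open>Completing the square, one coordinate at a time. A positive diagonal entry allows a rank
  one term to be subtracted that clears its row and column and leaves a Schur complement, again
  positive semidefinite. The set \<open>S\<close> holds the coordinates not yet cleared.\<close>

lemma psd_sum_outer_on:
  fixes M :: "real^'d::finite^'d"
  assumes "finite S" "\<And>i j. M $ i $ j = M $ j $ i" "\<And>\<xi>. 0 \<le> \<xi> \<bullet> (M *v \<xi>)"
    "\<And>i j. i \<notin> S \<Longrightarrow> M $ i $ j = 0"
  shows "\<exists>u. M = (\<Sum>k\<in>S. outer (u k) (u k))"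
  using assms
proof (induction S arbitrary: M rule: finite_induct)
  case empty
  then have "M = 0" by (simp add: vec_eq_iff)
  then show ?case by simp
next
  case (insert a S)
  have quad: "0 \<le> M $ a $ a * s\<^sup>2 + 2 * s * (\<Sum>j\<in>UNIV. M $ a $ j * \<xi> $ j) + \<xi> \<bullet> (M *v \<xi>)" for s \<xi>
  proof -
    have e1: "axis a 1 \<bullet> (M *v \<eta>) = (\<Sum>j\<in>UNIV. M $ a $ j * \<eta> $ j)" for \<eta>
      by (simp add: inner_axis' matrix_vector_mult_def)
    have e2: "\<eta> \<bullet> (M *v axis a 1) = (\<Sum>j\<in>UNIV. M $ a $ j * \<eta> $ j)" for \<eta>
    proof -
      have "\<eta> \<bullet> (M *v axis a 1) = (\<Sum>j\<in>UNIV. \<eta> $ j * M $ j $ a)"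
        by (simp add: inner_vec_def matrix_vector_mult_basis column_def)
      then show ?thesis using insert.prems(1) by (simp add: mult_ac)
    qed
    have "0 \<le> (s *\<^sub>R axis a 1 + \<xi>) \<bullet> (M *v (s *\<^sub>R axis a 1 + \<xi>))" by (rule insert.prems)
    also have "\<dots> = s\<^sup>2 * (axis a 1 \<bullet> (M *v axis a 1)) + s * (axis a 1 \<bullet> (M *v \<xi>))
        + s * (\<xi> \<bullet> (M *v axis a 1)) + \<xi> \<bullet> (M *v \<xi>)"
      by (simp add: matrix_vector_right_distrib matrix_vector_mult_scaleR inner_add_left inner_add_right
          power2_eq_square algebra_simps)
    also have "axis a 1 \<bullet> (M *v axis a 1) = M $ a $ a"
      by (simp add: inner_axis' matrix_vector_mult_basis column_def)
    finally show ?thesis by (simp add: e1 e2 algebra_simps)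
  qed
  show ?case
  proof (cases "M $ a $ a = 0")
    case True
    \<comment> \<open>With a zero diagonal entry the form is affine in \<open>s\<close>, so
      nonnegativity forces its slope to vanish.\<close>
    have z: "M $ a $ j = 0" for j
    proof (rule ccontr)
      assume nz: "M $ a $ j \<noteq> 0"
      define c where "c = axis j 1 \<bullet> (M *v axis j 1)"
      have sm: "(\<Sum>i\<in>UNIV. M $ a $ i * (axis j 1 :: real^'d) $ i) = M $ a $ j"
        by (simp add: axis_def if_distrib cong: if_cong)
      have "0 \<le> 2 * s * M $ a $ j + c" for s
        using quad[of s "axis j 1"] True sm by (simp add: c_def)
      from this[of "- (c + 1) / (2 * M $ a $ j)"] nz show False by (simp add: field_simps)
    qed
    have "M $ i $ j = 0" if "i \<notin> S" for i j
      using that insert.prems(3)[of i j] z by (cases "i = a") auto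
    then obtain u where u: "M = (\<Sum>k\<in>S. outer (u k) (u k))"
      using insert.IH[of M] insert.prems by blast
    have "(\<Sum>k\<in>S. outer ((u(a := 0)) k) ((u(a := 0)) k)) = (\<Sum>k\<in>S. outer (u k) (u k))"
      using insert.hyps by (intro sum.cong) auto
    moreover have "outer 0 0 = (0 :: real^'d^'d)" by (simp add: outer_def vec_eq_iff)
    ultimately have "(\<Sum>k\<in>insert a S. outer ((u(a := 0)) k) ((u(a := 0)) k)) = M"
      using insert.hyps u by simp
    then show ?thesis by metis
  next
    case False
    have pos: "M $ a $ a > 0" using quad[of 1 0] False by simp
    \<comment> \<open>The normalised pivot row: \<open>outer w w\<close> agrees with
      \<open>M\<close> in row and column \<open>a\<close>.\<close>
    define w where "w = (\<chi> j. M $ a $ j / sqrt (M $ a $ a))"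
    have ww: "w $ i * w $ j = M $ a $ i * M $ a $ j / M $ a $ a" for i j
      using pos by (simp add: w_def)
    define N where "N = M - outer w w"
    have Nsym: "N $ i $ j = N $ j $ i" for i j
      using insert.prems(1)[of i j] by (simp add: N_def outer_def)
    have Npsd: "0 \<le> \<xi> \<bullet> (N *v \<xi>)" for \<xi>
    proof -
      define b where "b = (\<Sum>j\<in>UNIV. M $ a $ j * \<xi> $ j)"
      have "\<xi> \<bullet> (outer w w *v \<xi>) = (\<xi> \<bullet> w)\<^sup>2"
        unfolding inner_matrix_vector by (simp add: outer_def inner_vec_def power2_eq_square sum_product mult_ac)
      also have "\<xi> \<bullet> w = b / sqrt (M $ a $ a)"
        by (simp add: inner_vec_def w_def b_def sum_divide_distrib mult_ac)
      finally have o: "\<xi> \<bullet> (outer w w *v \<xi>) = b\<^sup>2 / M $ a $ a"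
        using pos by (simp add: power_divide)
      \<comment> \<open>The quadratic polynomial in \<open>s\<close> is evaluated at its
        minimiser.\<close>
      have "0 \<le> \<xi> \<bullet> (M *v \<xi>) - b\<^sup>2 / M $ a $ a"
        using quad[of "- b / M $ a $ a" \<xi>, folded b_def] pos
        by (simp add: field_simps power2_eq_square)
      then show ?thesis
        by (simp add: N_def matrix_vector_mult_diff_rdistrib inner_diff_right o)
    qed
    have Nz: "N $ i $ j = 0" if "i \<notin> S" for i j
    proof (cases "i = a")
      case True
      then show ?thesis using pos by (simp add: N_def outer_def ww)
    next
      case False
      then have "M $ i $ j = 0" "M $ a $ i = 0" 
        using insert.prems(3)[of i j] insert.prems(3)[of i a] insert.prems(1)[of a i] that by auto
      then show ?thesis by (simp add: N_def outer_def ww)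
    qed
    obtain u where u: "N = (\<Sum>k\<in>S. outer (u k) (u k))"
      using insert.IH[OF Nsym Npsd Nz] by blast
    have "(\<Sum>k\<in>S. outer ((u(a := w)) k) ((u(a := w)) k)) = (\<Sum>k\<in>S. outer (u k) (u k))"
      using insert.hyps by (intro sum.cong) auto
    then have "(\<Sum>k\<in>insert a S. outer ((u(a := w)) k) ((u(a := w)) k)) = outer w w + N"
      using insert.hyps u by simp
    then have "M = (\<Sum>k\<in>insert a S. outer ((u(a := w)) k) ((u(a := w)) k))"
      by (simp add: N_def)
    then show ?thesis by blast
  qed
qed

definition psd :: "real^'d::finite^'d \<Rightarrow> bool" where
  "psd M \<longleftrightarrow> transpose M = M \<and> (\<forall>\<xi>. 0 \<le> \<xi> \<bullet> (M *v \<xi>))"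

lemma psd_sum_outer:
  fixes M :: "real^'d::finite^'d"
  assumes "psd M"
  obtains u :: "'d \<Rightarrow> real^'d" where "M = (\<Sum>k\<in>UNIV. outer (u k) (u k))"
proof -
  have "M $ i $ j = M $ j $ i" for i j
    using assms unfolding psd_def by (metis transpose_def vec_lambda_beta)
  then have "\<exists>u::'d \<Rightarrow> real^'d. M = (\<Sum>k\<in>UNIV. outer (u k) (u k))"
    using assms psd_sum_outer_on[of UNIV M] by (simp add: psd_def)
  then show ?thesis using that by blast
qed

text \<open>By the rank one decomposition of \<open>M\<close> the left side becomes a sum of values
  of the quadratic form of \<open>H\<close>.\<close>

lemma mdot_psd_nonneg:
  assumes "psd M" "\<And>\<xi>. 0 \<le> \<xi> \<bullet> (H *v \<xi>)"
  shows "0 \<le> mdot M H"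
proof -
  obtain u :: "'a \<Rightarrow> real^'a" where u: "M = (\<Sum>k\<in>UNIV. outer (u k) (u k))"
    using psd_sum_outer[OF assms(1)] .
  show ?thesis unfolding u mdot_sum_left mdot_outer' by (intro sum_nonneg assms)
qed

lemma mdot_psd_le_trace:
  assumes "psd M" "\<And>\<xi>. \<xi> \<bullet> (H *v \<xi>) \<le> c * (norm \<xi>)\<^sup>2"
  shows "mdot M H \<le> c * trace M"
proof -
  have "0 \<le> mdot M (c *\<^sub>R mat 1 - H)"
    using assms(2) by (intro mdot_psd_nonneg[OF assms(1)])
      (simp add: matrix_vector_mult_diff_rdistrib inner_diff_right scaleR_matrix_vector_assoc[symmetric]
        dot_square_norm)
  then show ?thesis by (simp add: mdot_simps mdot_mat)
qed

subsection \<open>Twice continuously differentiable functions\<close>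

lemma pd_eqI:
  assumes "(f has_derivative f') (at x)"
  shows "pd i f x = f' (axis i 1)"
  using frechet_derivative_at[OF assms] by (simp add: pd_def)

lemma grad_eqI:
  assumes "(f has_derivative (\<lambda>v. G \<bullet> v)) (at x)"
  shows "grad f x = G"
  using pd_eqI[OF assms] by (simp add: grad_def vec_eq_iff inner_axis)

lemma differentiable_has_derivative_grad:
  assumes "f differentiable (at x)"
  shows "(f has_derivative (\<lambda>v. grad f x \<bullet> v)) (at x)"
proof -
  define f' where "f' = frechet_derivative f (at x)"
  have f': "(f has_derivative f') (at x)"
    using assms by (simp add: f'_def frechet_derivative_works)
  then have lin: "linear f'" by (rule has_derivative_linear)
  have "f' v = grad f x \<bullet> v" for v
  proof -
    have "f' v = f' (\<Sum>i\<in>UNIV. v $ i *\<^sub>R axis i 1)"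
      by (metis basis_expansion scalar_mult_eq_scaleR)
    also have "\<dots> = (\<Sum>i\<in>UNIV. v $ i * f' (axis i 1))"
      by (simp add: linear_sum[OF lin] linear_scale[OF lin])
    finally show ?thesis by (simp add: grad_def inner_vec_def pd_eqI[OF f'] mult_ac)
  qed
  then have "f' = (\<lambda>v. grad f x \<bullet> v)" by auto
  then show ?thesis using f' by simp
qed

lemma Ck_on_has_derivative:
  assumes "open E" "Ck_on E (Suc k) f" "x \<in> E"
  shows "(f has_derivative (\<lambda>v. grad f x \<bullet> v)) (at x)"
  using assms by (intro differentiable_has_derivative_grad)
    (auto simp: differentiable_on_eq_differentiable_at)

lemma Ck_on_continuous: "Ck_on E k f \<Longrightarrow> continuous_on E f"
  by (cases k) (auto dest: differentiable_imp_continuous_on)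

lemma Ck_on_Suc_imp: "Ck_on E (Suc k) f \<Longrightarrow> Ck_on E k f"
  by (induction k arbitrary: f) (auto dest: differentiable_imp_continuous_on)

lemma C2_eq: "Ck_on E 2 f \<longleftrightarrow> f differentiable_on E \<and> (\<forall>i. pd i f differentiable_on E) \<and>
   (\<forall>i j. continuous_on E (pd i (pd j f)))"
  by (auto simp: numeral_2_eq_2)

lemma C2_has_derivative:
  assumes "open E" "Ck_on E 2 f" "x \<in> E"
  shows "(f has_derivative (\<lambda>v. grad f x \<bullet> v)) (at x)"
  using Ck_on_has_derivative assms by (metis numeral_2_eq_2)

lemma C2_has_derivative_grad:
  assumes "open E" "Ck_on E 2 f" "x \<in> E"
  shows "((\<lambda>y. grad f y $ j) has_derivative (\<lambda>v. \<Sum>i\<in>UNIV. hess f x $ i $ j * v $ i)) (at x)"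
proof -
  have "Ck_on E (Suc 0) (pd j f)" using assms by (simp add: numeral_2_eq_2)
  from Ck_on_has_derivative[OF assms(1) this assms(3)]
  show ?thesis by (simp add: grad_def hess_def inner_vec_def)
qed

lemma C2_continuous_grad:
  assumes "open E" "Ck_on E 2 f"
  shows "continuous_on E (\<lambda>x. grad f x $ i)" "continuous_on E (grad f)"
proof -
  show *: "continuous_on E (\<lambda>x. grad f x $ i)" for i
    using assms by (auto simp: C2_eq grad_def intro: differentiable_imp_continuous_on)
  show "continuous_on E (grad f)"
    using * by (auto simp: continuous_on_componentwise[where f="grad f"] Basis_vec_def inner_axis)
qed

lemma C2_continuous_hess:
  assumes "Ck_on E 2 f"
  shows "continuous_on E (\<lambda>x. hess f x $ i $ j)"
  using assms by (auto simp: C2_eq hess_def)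

text \<open>The calculus of C2 functions is derived by exhibiting candidates for gradient and
  Hessian. The candidates agree with \<open>pd\<close> only on \<open>E\<close>, so openness is what
  lets a derivative of the candidate be transferred to \<open>pd j f\<close>.\<close>

lemma C2I:
  assumes E: "open E"
    and G: "\<And>x. x \<in> E \<Longrightarrow> (f has_derivative (\<lambda>v. G x \<bullet> v)) (at x)"
    and H: "\<And>x j. x \<in> E \<Longrightarrow> ((\<lambda>y. G y $ j) has_derivative (\<lambda>v. \<Sum>i\<in>UNIV. H x $ i $ j * v $ i)) (at x)"
    and c: "\<And>i j. continuous_on E (\<lambda>x. H x $ i $ j)"
  shows "Ck_on E 2 f" "x \<in> E \<Longrightarrow> grad f x = G x" "x \<in> E \<Longrightarrow> hess f x = H x"
proof -
  have g: "grad f x = G x" if "x \<in> E" for x using grad_eqI[OF G[OF that]] .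
  have pdj: "(pd j f has_derivative (\<lambda>v. \<Sum>i\<in>UNIV. H x $ i $ j * v $ i)) (at x)" if "x \<in> E" for x j
    using H[OF that, of j]
  proof (rule has_derivative_transform_within_open[OF _ E that])
    show "G y $ j = pd j f y" if "y \<in> E" for y using g[OF that] by (auto simp: grad_def vec_eq_iff)
  qed
  have h: "hess f x = H x" if "x \<in> E" for x
  proof -
    have "pd i (pd j f) x = H x $ i $ j" for i j
      using pd_eqI[OF pdj[OF that], of i j] by (simp add: axis_def if_distrib cong: if_cong)
    then show ?thesis by (simp add: hess_def vec_eq_iff)
  qed
  have "continuous_on E (pd i (pd j f))" for i j
    using c[of i j] by (rule continuous_on_eq) (use h in \<open>auto simp: hess_def vec_eq_iff\<close>)
  then show "Ck_on E 2 f"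
    using G pdj unfolding C2_eq differentiable_on_def
    by (meson differentiableI differentiable_at_withinI)
  show "x \<in> E \<Longrightarrow> grad f x = G x" "x \<in> E \<Longrightarrow> hess f x = H x" using g h by auto
qed

lemma C2_add:
  assumes E: "open E" and f: "Ck_on E 2 f" and g: "Ck_on E 2 g"
  shows "Ck_on E 2 (\<lambda>x. f x + g x)"
    "x \<in> E \<Longrightarrow> grad (\<lambda>x. f x + g x) x = grad f x + grad g x"
    "x \<in> E \<Longrightarrow> hess (\<lambda>x. f x + g x) x = hess f x + hess g x"
proof -
  note * = C2I[OF E, where f="\<lambda>x. f x + g x" and G="\<lambda>x. grad f x + grad g x" and H="\<lambda>x. hess f x + hess g x"]
  have 1: "((\<lambda>x. f x + g x) has_derivative (\<lambda>v. (grad f x + grad g x) \<bullet> v)) (at x)" if "x \<in> E" for x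
    using has_derivative_add[OF C2_has_derivative[OF E f that] C2_has_derivative[OF E g that]]
    by (simp add: inner_add_left)
  have 2: "((\<lambda>y. (grad f y + grad g y) $ j) has_derivative (\<lambda>v. \<Sum>i\<in>UNIV. (hess f x + hess g x) $ i $ j * v $ i)) (at x)"
    if "x \<in> E" for x j
    using has_derivative_add[OF C2_has_derivative_grad[OF E f that, of j] C2_has_derivative_grad[OF E g that, of j]]
    by (simp add: distrib_right sum.distrib)
  have 3: "continuous_on E (\<lambda>x. (hess f x + hess g x) $ i $ j)" for i j
    using continuous_on_add[OF C2_continuous_hess[OF f, of i j] C2_continuous_hess[OF g, of i j]] by simp
  show "Ck_on E 2 (\<lambda>x. f x + g x)" using *(1) 1 2 3 by blast
  show "x \<in> E \<Longrightarrow> grad (\<lambda>x. f x + g x) x = grad f x + grad g x" using *(2) 1 2 3 by blast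
  show "x \<in> E \<Longrightarrow> hess (\<lambda>x. f x + g x) x = hess f x + hess g x" using *(3) 1 2 3 by blast
qed

lemma C2_compose:
  assumes E: "open E" and f: "Ck_on E 2 f"
    and g: "\<And>x. x \<in> E \<Longrightarrow> (g has_real_derivative g' (f x)) (at (f x))"
    and g': "\<And>x. x \<in> E \<Longrightarrow> (g' has_real_derivative g'' (f x)) (at (f x))"
    and g'': "continuous_on E (\<lambda>x. g'' (f x))"
  shows "Ck_on E 2 (\<lambda>x. g (f x))"
    "x \<in> E \<Longrightarrow> grad (\<lambda>x. g (f x)) x = g' (f x) *\<^sub>R grad f x"
    "x \<in> E \<Longrightarrow> hess (\<lambda>x. g (f x)) x = g' (f x) *\<^sub>R hess f x + g'' (f x) *\<^sub>R outer (grad f x) (grad f x)"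
proof -
  let ?G = "\<lambda>x. g' (f x) *\<^sub>R grad f x"
  let ?H = "\<lambda>x. g' (f x) *\<^sub>R hess f x + g'' (f x) *\<^sub>R outer (grad f x) (grad f x)"
  note * = C2I[OF E, where f="\<lambda>x. g (f x)" and G="?G" and H="?H"]
  have comp: "((\<lambda>x. k (f x)) has_derivative (\<lambda>v. k' * (grad f x \<bullet> v))) (at x)"
    if "x \<in> E" "(k has_real_derivative k') (at (f x))" for x k k'
    using has_derivative_compose[OF C2_has_derivative[OF E f that(1)]
        that(2)[unfolded has_field_derivative_def]] by simp
  have 1: "((\<lambda>x. g (f x)) has_derivative (\<lambda>v. ?G x \<bullet> v)) (at x)" if "x \<in> E" for x
    using comp[OF that g[OF that]] by simp
  have 2: "((\<lambda>y. ?G y $ j) has_derivative (\<lambda>v. \<Sum>i\<in>UNIV. ?H x $ i $ j * v $ i)) (at x)"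
    if "x \<in> E" for x j
  proof -
    have "((\<lambda>y. g' (f y) * grad f y $ j) has_derivative
       (\<lambda>v. g' (f x) * (\<Sum>i\<in>UNIV. hess f x $ i $ j * v $ i) + g'' (f x) * (grad f x \<bullet> v) * grad f x $ j)) (at x)"
      by (rule has_derivative_mult[OF comp[OF that g'[OF that]] C2_has_derivative_grad[OF E f that, of j]])
    then show ?thesis
      by (simp add: distrib_left sum.distrib sum_distrib_left sum_distrib_right outer_def inner_vec_def mult_ac)
  qed
  have contf: "continuous_on E f" using f by (rule Ck_on_continuous)
  have 3: "continuous_on E (\<lambda>x. ?H x $ i $ j)" for i j
  proof -
    have "continuous_on E (\<lambda>x. g' (f x))"
      by (auto simp: continuous_on_eq_continuous_at[OF E] intro!: has_derivative_continuous comp g')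
    then show ?thesis
      using C2_continuous_hess[OF f, of i j] C2_continuous_grad[OF E f] g''
      by (auto simp: outer_def intro!: continuous_intros)
  qed
  show "Ck_on E 2 (\<lambda>x. g (f x))" using *(1) 1 2 3 by blast
  show "x \<in> E \<Longrightarrow> grad (\<lambda>x. g (f x)) x = ?G x" using *(2) 1 2 3 by blast
  show "x \<in> E \<Longrightarrow> hess (\<lambda>x. g (f x)) x = ?H x" using *(3) 1 2 3 by blast
qed

lemma C2_cmult:
  assumes E: "open E" and f: "Ck_on E 2 f"
  shows "Ck_on E 2 (\<lambda>x. c * f x)"
    "x \<in> E \<Longrightarrow> grad (\<lambda>x. c * f x) x = c *\<^sub>R grad f x"
    "x \<in> E \<Longrightarrow> hess (\<lambda>x. c * f x) x = c *\<^sub>R hess f x"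
proof -
  have "((\<lambda>y. c * y) has_real_derivative c) (at y)" for y by (auto intro!: derivative_eq_intros)
  then show "Ck_on E 2 (\<lambda>x. c * f x)"
    "x \<in> E \<Longrightarrow> grad (\<lambda>x. c * f x) x = c *\<^sub>R grad f x"
    "x \<in> E \<Longrightarrow> hess (\<lambda>x. c * f x) x = c *\<^sub>R hess f x"
    using C2_compose[OF E f, of "\<lambda>y. c * y" "\<lambda>_. c" "\<lambda>_. 0"] by simp_all
qed

lemma C2_add_const:
  assumes E: "open E" and f: "Ck_on E 2 f"
  shows "Ck_on E 2 (\<lambda>x. f x + c)"
    "x \<in> E \<Longrightarrow> grad (\<lambda>x. f x + c) x = grad f x"
    "x \<in> E \<Longrightarrow> hess (\<lambda>x. f x + c) x = hess f x"
proof -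
  have "((\<lambda>y. y + c) has_real_derivative 1) (at y)" for y by (auto intro!: derivative_eq_intros)
  then show "Ck_on E 2 (\<lambda>x. f x + c)"
    "x \<in> E \<Longrightarrow> grad (\<lambda>x. f x + c) x = grad f x"
    "x \<in> E \<Longrightarrow> hess (\<lambda>x. f x + c) x = hess f x"
    using C2_compose[OF E f, of "\<lambda>y. y + c" "\<lambda>_. 1" "\<lambda>_. 0"] by simp_all
qed

lemma C2_diff:
  assumes E: "open E" and f: "Ck_on E 2 f" and g: "Ck_on E 2 g"
  shows "Ck_on E 2 (\<lambda>x. f x - g x)"
    "x \<in> E \<Longrightarrow> grad (\<lambda>x. f x - g x) x = grad f x - grad g x"
    "x \<in> E \<Longrightarrow> hess (\<lambda>x. f x - g x) x = hess f x - hess g x"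
  using C2_add[OF E f C2_cmult(1)[OF E g, of "-1"]] C2_cmult(2,3)[OF E g, of _ "-1"] by simp_all

lemma C2_exp:
  assumes E: "open E" and f: "Ck_on E 2 f"
  shows "Ck_on E 2 (\<lambda>x. exp (c * f x))"
    "x \<in> E \<Longrightarrow> grad (\<lambda>x. exp (c * f x)) x = (c * exp (c * f x)) *\<^sub>R grad f x"
    "x \<in> E \<Longrightarrow> hess (\<lambda>x. exp (c * f x)) x =
       (c * exp (c * f x)) *\<^sub>R hess f x + (c\<^sup>2 * exp (c * f x)) *\<^sub>R outer (grad f x) (grad f x)"
proof -
  have c: "continuous_on E (\<lambda>x. c\<^sup>2 * exp (c * f x))"
    using Ck_on_continuous[OF f] by (auto intro!: continuous_intros)
  have *: "((\<lambda>y. exp (c * y)) has_real_derivative c * exp (c * y)) (at y)"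
    "((\<lambda>y. c * exp (c * y)) has_real_derivative c\<^sup>2 * exp (c * y)) (at y)" for y
    by (auto intro!: derivative_eq_intros simp: power2_eq_square)
  show "Ck_on E 2 (\<lambda>x. exp (c * f x))"
    "x \<in> E \<Longrightarrow> grad (\<lambda>x. exp (c * f x)) x = (c * exp (c * f x)) *\<^sub>R grad f x"
    "x \<in> E \<Longrightarrow> hess (\<lambda>x. exp (c * f x)) x =
       (c * exp (c * f x)) *\<^sub>R hess f x + (c\<^sup>2 * exp (c * f x)) *\<^sub>R outer (grad f x) (grad f x)"
    using C2_compose[OF E f, of "\<lambda>y. exp (c * y)" "\<lambda>y. c * exp (c * y)" "\<lambda>y. c\<^sup>2 * exp (c * y)"] * c
    by auto
qed

lemma C2_sum:
  assumes E: "open E" and "finite I" and f: "\<And>k. k \<in> I \<Longrightarrow> Ck_on E 2 (f k)"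
  shows "Ck_on E 2 (\<lambda>x. \<Sum>k\<in>I. f k x) \<and>
    (\<forall>x\<in>E. grad (\<lambda>x. \<Sum>k\<in>I. f k x) x = (\<Sum>k\<in>I. grad (f k) x) \<and>
           hess (\<lambda>x. \<Sum>k\<in>I. f k x) x = (\<Sum>k\<in>I. hess (f k) x))"
  using assms(2) f
proof (induction I rule: finite_induct)
  case empty
  show ?case
    using C2I[OF E, of "\<lambda>x. 0" "\<lambda>x. 0" "\<lambda>x. 0"] by simp
next
  case (insert a I)
  then show ?case
    using C2_add[OF E, of "f a" "\<lambda>x. \<Sum>k\<in>I. f k x"] by simp
qed

lemma C2_norm_sq:
  assumes E: "open E"
  shows "Ck_on E 2 (\<lambda>x. (norm (x - y))\<^sup>2)"
    "x \<in> E \<Longrightarrow> grad (\<lambda>x. (norm (x - y))\<^sup>2) x = 2 *\<^sub>R (x - y)"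
    "x \<in> E \<Longrightarrow> hess (\<lambda>x. (norm (x - y))\<^sup>2) x = 2 *\<^sub>R mat 1"
proof -
  note * = C2I[OF E, of "\<lambda>x. (norm (x - y))\<^sup>2" "\<lambda>x. 2 *\<^sub>R (x - y)" "\<lambda>x. 2 *\<^sub>R mat 1"]
  have 1: "((\<lambda>x. (norm (x - y))\<^sup>2) has_derivative (\<lambda>v. (2 *\<^sub>R (x - y)) \<bullet> v)) (at x)" for x
    unfolding power2_norm_eq_inner
    by (auto intro!: derivative_eq_intros simp: inner_commute algebra_simps)
  have 2: "((\<lambda>z. (2 *\<^sub>R (z - y)) $ j) has_derivative (\<lambda>v. \<Sum>i\<in>UNIV. (2 *\<^sub>R (mat 1 :: real^'a^'a)) $ i $ j * v $ i)) (at x)" for x j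
  proof -
    have "(\<Sum>i\<in>UNIV. (2 *\<^sub>R (mat 1 :: real^'a^'a)) $ i $ j * v $ i) = 2 * v $ j" for v :: "real^'a"
      by (simp add: mat_def if_distrib if_distribR cong: if_cong)
    then show ?thesis
      by (auto intro!: derivative_eq_intros bounded_linear.has_derivative[OF bounded_linear_vec_nth])
  qed
  show "Ck_on E 2 (\<lambda>x. (norm (x - y))\<^sup>2)"
    "x \<in> E \<Longrightarrow> grad (\<lambda>x. (norm (x - y))\<^sup>2) x = 2 *\<^sub>R (x - y)"
    "x \<in> E \<Longrightarrow> hess (\<lambda>x. (norm (x - y))\<^sup>2) x = 2 *\<^sub>R mat 1"
    using * 1 2 by auto
qed

lemma C2_line_derivative:
  assumes E: "open E" and f: "Ck_on E 2 f" and "x + s *\<^sub>R \<xi> \<in> E"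
  shows "((\<lambda>s. f (x + s *\<^sub>R \<xi>)) has_real_derivative grad f (x + s *\<^sub>R \<xi>) \<bullet> \<xi>) (at s)"
    "((\<lambda>s. grad f (x + s *\<^sub>R \<xi>) \<bullet> \<xi>) has_real_derivative \<xi> \<bullet> (hess f (x + s *\<^sub>R \<xi>) *v \<xi>)) (at s)"
proof -
  have l: "((\<lambda>s. x + s *\<^sub>R \<xi>) has_derivative (\<lambda>r. r *\<^sub>R \<xi>)) (at s)"
    by (auto intro!: derivative_eq_intros)
  show "((\<lambda>s. f (x + s *\<^sub>R \<xi>)) has_real_derivative grad f (x + s *\<^sub>R \<xi>) \<bullet> \<xi>) (at s)"
    using has_derivative_compose[OF l C2_has_derivative[OF E f assms(3)]]
    by (simp add: has_field_derivative_def mult_commute_abs)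
  have "((\<lambda>s. grad f (x + s *\<^sub>R \<xi>) $ j) has_real_derivative (\<Sum>i\<in>UNIV. hess f (x + s *\<^sub>R \<xi>) $ i $ j * \<xi> $ i)) (at s)" for j
  proof -
    have "(\<lambda>r. \<Sum>i\<in>UNIV. hess f (x + s *\<^sub>R \<xi>) $ i $ j * (r *\<^sub>R \<xi>) $ i) =
      (*) (\<Sum>i\<in>UNIV. hess f (x + s *\<^sub>R \<xi>) $ i $ j * \<xi> $ i)"
      by (auto simp: sum_distrib_left mult_ac)
    then show ?thesis
      using has_derivative_compose[OF l C2_has_derivative_grad[OF E f assms(3), of j]]
      by (simp add: has_field_derivative_def)
  qed
  then have "((\<lambda>s. \<Sum>j\<in>UNIV. grad f (x + s *\<^sub>R \<xi>) $ j * \<xi> $ j) has_real_derivative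
     (\<Sum>j\<in>UNIV. (\<Sum>i\<in>UNIV. hess f (x + s *\<^sub>R \<xi>) $ i $ j * \<xi> $ i) * \<xi> $ j)) (at s)"
    by (intro DERIV_sum DERIV_cmult_right)
  moreover have "(\<Sum>j\<in>UNIV. (\<Sum>i\<in>UNIV. hess f (x + s *\<^sub>R \<xi>) $ i $ j * \<xi> $ i) * \<xi> $ j) = \<xi> \<bullet> (hess f (x + s *\<^sub>R \<xi>) *v \<xi>)"
    unfolding inner_matrix_vector sum_distrib_right by (rule sum.swap)
  ultimately show "((\<lambda>s. grad f (x + s *\<^sub>R \<xi>) \<bullet> \<xi>) has_real_derivative \<xi> \<bullet> (hess f (x + s *\<^sub>R \<xi>) *v \<xi>)) (at s)"
    by (simp add: inner_vec_def)
qed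

text \<open>If \<open>D\<close> were negative, \<open>g'\<close> would be negative just to the right
  of 0, and the mean value theorem would produce a value below \<open>g 0\<close>.\<close>

lemma second_derivative_test:
  fixes g :: "real \<Rightarrow> real"
  assumes "0 < e" and g: "\<And>s. \<bar>s\<bar> < e \<Longrightarrow> (g has_real_derivative g' s) (at s)"
    and g': "(g' has_real_derivative D) (at 0)"
    and min: "\<And>s. \<bar>s\<bar> < e \<Longrightarrow> g 0 \<le> g s"
  shows "g' 0 = 0" "0 \<le> D"
proof -
  show g0: "g' 0 = 0"
    using DERIV_local_min[OF g[of 0], of e] min \<open>0 < e\<close> by auto
  show "0 \<le> D"
  proof (rule ccontr)
    assume "\<not> 0 \<le> D"
    then obtain d where d: "d > 0" "\<And>h. h > 0 \<Longrightarrow> h < d \<Longrightarrow> g' (0 + h) < g' 0"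
      using DERIV_neg_dec_right[OF g'] by force
    define r where "r = min d e / 2"
    have r: "0 < r" "r < d" "r < e" using d(1) \<open>0 < e\<close> by (auto simp: r_def)
    have "\<exists>z>0. z < r \<and> g r - g 0 = (r - 0) * g' z"
      by (rule MVT2) (use r g in auto)
    then obtain z where z: "0 < z" "z < r" "g r - g 0 = r * g' z" by auto
    have "g' z < 0" using d(2)[of z] z r g0 by auto
    then have "r * g' z < 0" using r by (intro mult_pos_neg)
    then have "g r < g 0" using z by simp
    then show False using min[of r] r by auto
  qed
qed

lemma C2_local_min:
  assumes E: "open E" and f: "Ck_on E 2 f" and x: "x \<in> E"
    and min: "\<And>y. y \<in> ball x e \<Longrightarrow> f x \<le> f y" and "0 < e"
  shows "grad f x = 0" "0 \<le> \<xi> \<bullet> (hess f x *v \<xi>)"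
proof -
  have *: "grad f x \<bullet> \<xi> = 0 \<and> 0 \<le> \<xi> \<bullet> (hess f x *v \<xi>)" for \<xi>
  proof -
    obtain r where r: "r > 0" "ball x r \<subseteq> E" using E x open_contains_ball by blast
    \<comment> \<open>Small enough that the points at parameter |s| < d stay in \<open>E\<close> and
      in the ball; the added 1 covers \<xi> = 0.\<close>
    define d where "d = min r e / (norm \<xi> + 1)"
    have n1: "norm \<xi> + 1 > 0" by (simp add: add_nonneg_pos)
    have d: "0 < d" using r \<open>0 < e\<close> n1 by (auto simp: d_def)
    have dd: "\<bar>s\<bar> * norm \<xi> < min r e" if "\<bar>s\<bar> < d" for s
    proof -
      have "\<bar>s\<bar> * norm \<xi> \<le> \<bar>s\<bar> * (norm \<xi> + 1)" by (simp add: mult_left_mono)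
      also have "\<dots> < d * (norm \<xi> + 1)" using that n1 by (simp add: mult_strict_right_mono)
      finally show ?thesis using n1 by (simp add: d_def)
    qed
    have in1: "x + s *\<^sub>R \<xi> \<in> E" "x + s *\<^sub>R \<xi> \<in> ball x e" if "\<bar>s\<bar> < d" for s
      using dd[OF that] r(2) by (auto simp: dist_norm subset_iff)
    note ld = C2_line_derivative[OF E f, of x _ \<xi>]
    have "grad f (x + 0 *\<^sub>R \<xi>) \<bullet> \<xi> = 0" "0 \<le> \<xi> \<bullet> (hess f (x + 0 *\<^sub>R \<xi>) *v \<xi>)"
    proof -
      note t = second_derivative_test[where g="\<lambda>s. f (x + s *\<^sub>R \<xi>)" and
           g'="\<lambda>s. grad f (x + s *\<^sub>R \<xi>) \<bullet> \<xi>" and D="\<xi> \<bullet> (hess f (x + 0 *\<^sub>R \<xi>) *v \<xi>)", OF d]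
      have D: "((\<lambda>s. grad f (x + s *\<^sub>R \<xi>) \<bullet> \<xi>) has_real_derivative \<xi> \<bullet> (hess f (x + 0 *\<^sub>R \<xi>) *v \<xi>)) (at 0)"
        by (rule ld(2)) (use x in simp)
      show "grad f (x + 0 *\<^sub>R \<xi>) \<bullet> \<xi> = 0"
        by (rule t(1)[OF _ D]) (use in1 min ld(1) in auto)
      show "0 \<le> \<xi> \<bullet> (hess f (x + 0 *\<^sub>R \<xi>) *v \<xi>)"
        by (rule t(2)[OF _ D]) (use in1 min ld(1) in auto)
    qed
    then show ?thesis by simp
  qed
  show "grad f x = 0" using *[of "grad f x"] by simp
  show "0 \<le> \<xi> \<bullet> (hess f x *v \<xi>)" using * by blast
qed

section \<open>The operators and a comparison principle\<close>

lemma F_op_eq: "F_op A Abar B V \<phi> x =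
  1/2 * mdot (A x) (hess \<phi> x) + 1/2 * (grad \<phi> x \<bullet> (Abar x *v grad \<phi> x)) + B x \<bullet> grad \<phi> x + V x"
  unfolding inner_matrix_vector by (simp add: F_op_def mdot_def hess_def grad_def inner_vec_def)

lemma L_op_eq: "L_op A Abar B \<phi> f x =
  1/2 * mdot (A x) (hess f x) + (B x + Abar x *v grad \<phi> x) \<bullet> grad f x"
  by (simp add: L_op_def mdot_def hess_def grad_def inner_vec_def matrix_vector_mult_def)

lemma L_op_cong: "grad f x = grad g x \<Longrightarrow> hess f x = hess g x \<Longrightarrow> L_op A Abar B \<phi> f x = L_op A Abar B \<phi> g x"
  by (simp add: L_op_eq)

lemma F_op_cong: "grad f x = grad g x \<Longrightarrow> hess f x = hess g x \<Longrightarrow> F_op A Abar B V f x = F_op A Abar B V g x"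
  by (simp add: F_op_eq)

lemma symm_inner: "transpose M = M \<Longrightarrow> u \<bullet> (M *v w) = w \<bullet> (M *v u)" for u w :: "real^'d::finite"
  by (metis dot_matrix_vector_mul inner_commute matrix_transpose_mul transpose_matrix_vector dot_lmul_matrix)

lemma quad_add:
  fixes u w :: "real^'d::finite"
  assumes "transpose M = M"
  shows "(u + w) \<bullet> (M *v (u + w)) = u \<bullet> (M *v u) + 2 * (u \<bullet> (M *v w)) + w \<bullet> (M *v w)"
  using symm_inner[OF assms, of w u]
  by (simp add: matrix_vector_right_distrib inner_add_left inner_add_right)

lemma quad_diff:
  fixes u w :: "real^'d::finite"
  assumes "transpose M = M"
  shows "(u - w) \<bullet> (M *v (u - w)) = u \<bullet> (M *v u) - 2 * (u \<bullet> (M *v w)) + w \<bullet> (M *v w)"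
  using symm_inner[OF assms, of w u]
  by (simp add: matrix_vector_mult_diff_distrib inner_diff_left inner_diff_right)

text \<open>Only earlier times compete, so that a minimum reached at the final time of an interval
  is covered.\<close>

lemma deriv_nonpos_of_left_min:
  fixes f :: "real \<Rightarrow> real"
  assumes "(f has_real_derivative D) (at t)" "a < t" "\<And>s. a < s \<Longrightarrow> s < t \<Longrightarrow> f t \<le> f s"
  shows "D \<le> 0"
proof (rule ccontr)
  assume "\<not> D \<le> 0"
  then obtain d where d: "d > 0" "\<And>h. h > 0 \<Longrightarrow> h < d \<Longrightarrow> f (t - h) < f t"
    using DERIV_pos_inc_left[OF assms(1)] by force
  define h where "h = min d (t - a) / 2"
  have "0 < h" "h < d" "a < t - h" using d(1) assms(2) by (auto simp: h_def min_def field_simps)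
  then show False using d(2)[of h] assms(3)[of "t - h"] by auto
qed

section \<open>The nonlinear operator, its linearisation and exponential transforms\<close>

locale quad_op =
  fixes E :: "(real^'d::finite) set" and A Abar :: "real^'d \<Rightarrow> real^'d^'d"
    and B :: "real^'d \<Rightarrow> real^'d" and V :: "real^'d \<Rightarrow> real" and \<kappa> :: real
  assumes openE: "open E" and A_psd: "x \<in> E \<Longrightarrow> psd (A x)"
    and Abar_sym: "x \<in> E \<Longrightarrow> transpose (Abar x) = Abar x"
    and kappa: "0 < \<kappa>" and Abar_ge: "x \<in> E \<Longrightarrow> \<kappa> * (\<xi> \<bullet> (A x *v \<xi>)) \<le> \<xi> \<bullet> (Abar x *v \<xi>)"
begin

abbreviation "F \<equiv> F_op A Abar B V"
abbreviation "L \<equiv> L_op A Abar B"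

lemma A_nonneg: "x \<in> E \<Longrightarrow> 0 \<le> \<xi> \<bullet> (A x *v \<xi>)"
  using A_psd by (auto simp: psd_def)

lemma Abar_nonneg: "x \<in> E \<Longrightarrow> 0 \<le> \<xi> \<bullet> (Abar x *v \<xi>)"
  using A_nonneg[of x \<xi>] Abar_ge[of x \<xi>] kappa by (meson less_eq_real_def mult_nonneg_nonneg order_trans)

lemma L_add:
  "Ck_on E 2 f \<Longrightarrow> Ck_on E 2 g \<Longrightarrow> x \<in> E \<Longrightarrow> L \<phi> (\<lambda>x. f x + g x) x = L \<phi> f x + L \<phi> g x"
  by (simp add: L_op_eq C2_add[OF openE] mdot_simps inner_add_right algebra_simps)

lemma L_cmult:
  "Ck_on E 2 f \<Longrightarrow> x \<in> E \<Longrightarrow> L \<phi> (\<lambda>x. c * f x) x = c * L \<phi> f x"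
  by (simp add: L_op_eq C2_cmult[OF openE] mdot_simps algebra_simps)

lemma L_add_const:
  "Ck_on E 2 f \<Longrightarrow> x \<in> E \<Longrightarrow> L \<phi> (\<lambda>x. f x + c) x = L \<phi> f x"
  by (rule L_op_cong) (simp_all add: C2_add_const[OF openE])

lemma L_compose:
  assumes "Ck_on E 2 f" "x \<in> E"
    "\<And>x. x \<in> E \<Longrightarrow> (g has_real_derivative g' (f x)) (at (f x))"
    "\<And>x. x \<in> E \<Longrightarrow> (g' has_real_derivative g'' (f x)) (at (f x))"
    "continuous_on E (\<lambda>x. g'' (f x))"
  shows "L \<phi> (\<lambda>x. g (f x)) x = g' (f x) * L \<phi> f x + 1/2 * g'' (f x) * (grad f x \<bullet> (A x *v grad f x))"
  using C2_compose(2,3)[OF openE assms(1,3,4,5,2)]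
  by (simp add: L_op_eq mdot_simps mdot_outer algebra_simps)

lemma L_exp:
  assumes "Ck_on E 2 f" "x \<in> E"
  shows "L \<phi> (\<lambda>x. exp (c * f x)) x = c * exp (c * f x) * (L \<phi> f x + c / 2 * (grad f x \<bullet> (A x *v grad f x)))"
  using C2_exp(2,3)[OF openE assms]
  by (simp add: L_op_eq mdot_simps mdot_outer algebra_simps power2_eq_square)

lemma F_add_const: "Ck_on E 2 f \<Longrightarrow> x \<in> E \<Longrightarrow> F (\<lambda>x. f x + c) x = F f x"
  by (rule F_op_cong) (simp_all add: C2_add_const[OF openE])

text \<open>The linearisation of \<open>F\<close> at \<open>w\<close> is \<open>L w\<close>. As
  \<open>F\<close> is quadratic in the gradient, the Taylor remainder is exactly half the
  \<open>Abar\<close> form of the difference of the gradients.\<close>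

lemma F_diff:
  assumes f: "Ck_on E 2 f" and w: "Ck_on E 2 w" and x: "x \<in> E"
  shows "F f x - F w x = L w (\<lambda>x. f x - w x) x
     + 1/2 * (grad (\<lambda>x. f x - w x) x \<bullet> (Abar x *v grad (\<lambda>x. f x - w x) x))"
proof -
  have "(Abar x *v grad w x) \<bullet> (grad f x - grad w x) = grad f x \<bullet> (Abar x *v grad w x) - grad w x \<bullet> (Abar x *v grad w x)"
    by (simp add: inner_diff_right inner_commute)
  then show ?thesis
    unfolding F_op_eq L_op_eq C2_diff(2,3)[OF openE f w x] quad_diff[OF Abar_sym[OF x]] inner_add_left
    by (simp add: mdot_simps inner_diff_right field_simps)
qed

text \<open>Exponentiation creates \<kappa>/2 times the \<open>A\<close> form of the gradient, which
  is at most the \<open>Abar\<close> remainder in \<open>F_diff\<close>. Hence the exponential has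
  nonpositive drift wherever \<open>F f\<close> is at most \<open>F w\<close>.\<close>

lemma L_exp_diff_le:
  assumes f: "Ck_on E 2 f" and w: "Ck_on E 2 w" and x: "x \<in> E"
  shows "L w (\<lambda>x. exp (\<kappa> * (f x - w x))) x \<le> \<kappa> * exp (\<kappa> * (f x - w x)) * (F f x - F w x)"
proof -
  let ?d = "grad (\<lambda>x. f x - w x) x"
  have "L w (\<lambda>x. f x - w x) x + \<kappa> / 2 * (?d \<bullet> (A x *v ?d)) \<le> F f x - F w x"
    using F_diff[OF f w x] Abar_ge[OF x, of ?d] by simp
  then show ?thesis unfolding L_exp[OF C2_diff(1)[OF openE f w] x] using kappa by (intro mult_left_mono) auto
qed

text \<open>The sum is \<open>\<ge> 1\<close> exactly where \<open>w\<close> lies below the soft maximum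
  \<open>ln (\<Sum>k. exp (\<kappa> \<phi>\<^sub>k)) / \<kappa>\<close>, which inherits the supersolution property from the \<open>\<phi>\<^sub>k\<close>.\<close>

lemma soft_max_local_min:
  assumes I: "finite I" and \<phi>: "\<And>k. k \<in> I \<Longrightarrow> Ck_on E 2 (\<phi> k)" and w: "Ck_on E 2 w"
    and x: "x \<in> E" and "0 < r"
    and min: "\<And>y. y \<in> ball x r \<Longrightarrow> (\<Sum>k\<in>I. exp (\<kappa> * (\<phi> k x - w x))) \<le> (\<Sum>k\<in>I. exp (\<kappa> * (\<phi> k y - w y)))"
  shows "0 \<le> (\<Sum>k\<in>I. exp (\<kappa> * (\<phi> k x - w x)) * (F (\<phi> k) x - F w x))"
proof -
  define e where "e k = exp (\<kappa> * (\<phi> k x - w x))" for k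
  define d where "d k = grad (\<phi> k) x - grad w x" for k
  define H where "H k = hess (\<phi> k) x - hess w x" for k
  have D: "Ck_on E 2 (\<lambda>x. \<phi> k x - w x)" if "k \<in> I" for k using C2_diff[OF openE \<phi>[OF that] w] by auto
  have ge: "Ck_on E 2 (\<lambda>y. exp (\<kappa> * (\<phi> k y - w y)))" if "k \<in> I" for k
    using C2_exp[OF openE D[OF that]] by auto
  have gr: "grad (\<lambda>y. exp (\<kappa> * (\<phi> k y - w y))) x = (\<kappa> * e k) *\<^sub>R d k"
    and he: "hess (\<lambda>y. exp (\<kappa> * (\<phi> k y - w y))) x = (\<kappa> * e k) *\<^sub>R H k + (\<kappa>\<^sup>2 * e k) *\<^sub>R outer (d k) (d k)"
    if "k \<in> I" for k
    using C2_exp(2,3)[OF openE D[OF that], of x \<kappa>] C2_diff(2,3)[OF openE \<phi>[OF that] w x] x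
    by (auto simp: e_def d_def H_def)
  note S = C2_sum[OF openE I ge]
  note m = C2_local_min[OF openE conjunct1[OF S] x, OF _ min \<open>0 < r\<close>]
  have "(\<Sum>k\<in>I. (\<kappa> * e k) *\<^sub>R d k) = 0"
    using m(1) S x gr by simp
  then have "\<kappa> *\<^sub>R (\<Sum>k\<in>I. e k *\<^sub>R d k) = 0" by (simp add: scaleR_sum_right)
  then have d0: "(\<Sum>k\<in>I. e k *\<^sub>R d k) = 0" using kappa by simp
  have "0 \<le> mdot (A x) (hess (\<lambda>y. \<Sum>k\<in>I. exp (\<kappa> * (\<phi> k y - w y))) x)"
    using m(2) by (intro mdot_psd_nonneg A_psd x)
  also have "hess (\<lambda>y. \<Sum>k\<in>I. exp (\<kappa> * (\<phi> k y - w y))) x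
      = (\<Sum>k\<in>I. (\<kappa> * e k) *\<^sub>R H k + (\<kappa>\<^sup>2 * e k) *\<^sub>R outer (d k) (d k))"
    using S x he by simp
  also have "mdot (A x) \<dots> = \<kappa> * (\<Sum>k\<in>I. e k * (mdot (A x) (H k) + \<kappa> * (d k \<bullet> (A x *v d k))))"
    by (simp add: mdot_simps mdot_outer sum_distrib_left algebra_simps power2_eq_square)
  finally have 1: "0 \<le> (\<Sum>k\<in>I. e k * (mdot (A x) (H k) + \<kappa> * (d k \<bullet> (A x *v d k))))"
    using kappa by (simp add: zero_le_mult_iff)
  \<comment> \<open>The first order condition says that the weighted gradients cancel; this removes
    every term linear in \<open>d k\<close>, in particular the drift and the cross terms with the
    gradient of \<open>w\<close>.\<close>
  have lin: "(\<Sum>k\<in>I. e k * (d k \<bullet> z)) = 0" for z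
  proof -
    have "(\<Sum>k\<in>I. e k * (d k \<bullet> z)) = (\<Sum>k\<in>I. e k *\<^sub>R d k) \<bullet> z" by (simp add: inner_sum_left)
    then show ?thesis using d0 by simp
  qed
  have expand: "F (\<phi> k) x - F w x = 1/2 * mdot (A x) (H k) + 1/2 * (d k \<bullet> (Abar x *v d k))
      + d k \<bullet> (Abar x *v grad w x) + d k \<bullet> B x" for k
  proof -
    have g: "grad (\<phi> k) x = d k + grad w x" by (simp add: d_def)
    show ?thesis
      unfolding F_op_eq H_def g quad_add[OF Abar_sym[OF x]]
      by (simp add: mdot_simps inner_add_right inner_commute algebra_simps)
  qed
  have "(\<Sum>k\<in>I. e k * (F (\<phi> k) x - F w x))
      = 1/2 * (\<Sum>k\<in>I. e k * (mdot (A x) (H k) + d k \<bullet> (Abar x *v d k)))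
       + (\<Sum>k\<in>I. e k * (d k \<bullet> (Abar x *v grad w x))) + (\<Sum>k\<in>I. e k * (d k \<bullet> B x))"
    unfolding expand by (simp add: sum.distrib sum_distrib_left algebra_simps)
  also have "\<dots> = 1/2 * (\<Sum>k\<in>I. e k * (mdot (A x) (H k) + d k \<bullet> (Abar x *v d k)))"
    using lin by simp
  also have "\<dots> \<ge> 1/2 * (\<Sum>k\<in>I. e k * (mdot (A x) (H k) + \<kappa> * (d k \<bullet> (A x *v d k))))"
    using Abar_ge[OF x] by (intro mult_left_mono sum_mono) (auto simp: e_def)
  finally show ?thesis using 1 by (simp add: e_def)
qed

text \<open>A parabolic maximum principle. At a first value below 1 the minimum of \<open>Q\<close>
  over the compact cylinder is interior, and its second order and time conditions contradict
  \<open>strict\<close>. That inequality is required only for the weighted sums: in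
  \<open>upper_bound\<close> one of the functions is not a supersolution by itself.\<close>

lemma comparison:
  fixes I :: "'k set" and Ti Tf :: real and \<phi> \<phi>' :: "'k \<Rightarrow> real \<Rightarrow> real^'d \<Rightarrow> real" and w w' :: "real \<Rightarrow> real^'d \<Rightarrow> real"
  defines "Q \<equiv> \<lambda>t x. \<Sum>k\<in>I. exp (\<kappa> * (\<phi> k t x - w t x))"
  assumes I: "finite I" and C: "compact C" "C \<subseteq> E"
    and cont: "\<And>k. k \<in> I \<Longrightarrow> continuous_on ({Ti..Tf} \<times> E) (\<lambda>p. \<phi> k (fst p) (snd p))"
      "continuous_on ({Ti..Tf} \<times> E) (\<lambda>p. w (fst p) (snd p))"
    and C2: "\<And>k t. k \<in> I \<Longrightarrow> Ti < t \<Longrightarrow> t \<le> Tf \<Longrightarrow> Ck_on E 2 (\<phi> k t)"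
      "\<And>t. Ti < t \<Longrightarrow> t \<le> Tf \<Longrightarrow> Ck_on E 2 (w t)"
    and der: "\<And>k t x. k \<in> I \<Longrightarrow> Ti < t \<Longrightarrow> t \<le> Tf \<Longrightarrow> x \<in> E \<Longrightarrow> ((\<lambda>s. \<phi> k s x) has_real_derivative \<phi>' k t x) (at t)"
      "\<And>t x. Ti < t \<Longrightarrow> t \<le> Tf \<Longrightarrow> x \<in> E \<Longrightarrow> ((\<lambda>s. w s x) has_real_derivative w' t x) (at t)"
    and init: "\<And>x. x \<in> E \<Longrightarrow> 1 \<le> Q Ti x"
    and outside: "\<And>t x. Ti \<le> t \<Longrightarrow> t \<le> Tf \<Longrightarrow> x \<in> E \<Longrightarrow> x \<notin> C \<Longrightarrow> 1 \<le> Q t x"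
    and strict: "\<And>t x. Ti < t \<Longrightarrow> t \<le> Tf \<Longrightarrow> x \<in> E \<Longrightarrow>
      (\<Sum>k\<in>I. exp (\<kappa> * (\<phi> k t x - w t x)) * (w' t x - F (w t) x))
      < (\<Sum>k\<in>I. exp (\<kappa> * (\<phi> k t x - w t x)) * (\<phi>' k t x - F (\<phi> k t) x))"
    and t: "Ti \<le> t" "t \<le> Tf" and x: "x \<in> E"
  shows "1 \<le> Q t x"
proof (rule ccontr)
  assume neg: "\<not> 1 \<le> Q t x"
  have xC: "x \<in> C" using outside[OF t x] neg by auto
  have contQ: "continuous_on ({Ti..Tf} \<times> E) (\<lambda>p. Q (fst p) (snd p))"
    unfolding Q_def using cont by (intro continuous_intros)
  have "compact ({Ti..Tf} \<times> C)" using C by (intro compact_Times) auto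
  moreover have "continuous_on ({Ti..Tf} \<times> C) (\<lambda>p. Q (fst p) (snd p))"
    using contQ by (rule continuous_on_subset) (use C in auto)
  moreover have "{Ti..Tf} \<times> C \<noteq> {}" using t xC by auto
  ultimately obtain p where p: "p \<in> {Ti..Tf} \<times> C"
    "\<And>q. q \<in> {Ti..Tf} \<times> C \<Longrightarrow> Q (fst p) (snd p) \<le> Q (fst q) (snd q)"
    using continuous_attains_inf[of "{Ti..Tf} \<times> C" "\<lambda>p. Q (fst p) (snd p)"] by meson
  define t1 x1 where "t1 = fst p" and "x1 = snd p"
  have tx: "Ti \<le> t1" "t1 \<le> Tf" "x1 \<in> C" "x1 \<in> E" using p(1) C by (auto simp: t1_def x1_def)
  have lt1: "Q t1 x1 < 1" using p(2)[of "(t, x)"] neg t xC by (auto simp: t1_def x1_def)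
  \<comment> \<open>The minimum over \<open>C\<close> is a minimum over \<open>E\<close>, because
    \<open>Q\<close> is at least 1 off \<open>C\<close> and below 1 at (t1, x1).\<close>
  have min: "Q t1 x1 \<le> Q s y" if "Ti \<le> s" "s \<le> Tf" "y \<in> E" for s y
  proof (cases "y \<in> C")
    case True
    then show ?thesis using p(2)[of "(s, y)"] that by (auto simp: t1_def x1_def)
  next
    case False
    then show ?thesis using outside[OF that] lt1 by auto
  qed
  have t1: "Ti < t1" using init[OF tx(4)] lt1 tx(1) by (cases "t1 = Ti") auto
  obtain e where e: "0 < e" "ball x1 e \<subseteq> E" using openE tx(4) open_contains_ball by blast
  have sp: "0 \<le> (\<Sum>k\<in>I. exp (\<kappa> * (\<phi> k t1 x1 - w t1 x1)) * (F (\<phi> k t1) x1 - F (w t1) x1))"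
    by (rule soft_max_local_min[OF I _ _ tx(4) e(1)])
      (use C2 t1 tx e min[of t1] in \<open>auto simp: Q_def\<close>)
  define D where "D = (\<Sum>k\<in>I. exp (\<kappa> * (\<phi> k t1 x1 - w t1 x1)) * (\<kappa> * (\<phi>' k t1 x1 - w' t1 x1)))"
  have "((\<lambda>s. Q s x1) has_real_derivative D) (at t1)"
    unfolding Q_def D_def
    by (intro DERIV_sum) (auto intro!: derivative_eq_intros der t1 tx)
  then have "D \<le> 0"
    by (rule deriv_nonpos_of_left_min[OF _ t1]) (use min tx in auto)
  moreover have "D = \<kappa> * (\<Sum>k\<in>I. exp (\<kappa> * (\<phi> k t1 x1 - w t1 x1)) * (\<phi>' k t1 x1 - w' t1 x1))"
    by (simp add: D_def sum_distrib_left algebra_simps)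
  ultimately have "(\<Sum>k\<in>I. exp (\<kappa> * (\<phi> k t1 x1 - w t1 x1)) * (\<phi>' k t1 x1 - w' t1 x1)) \<le> 0"
    using kappa by (simp add: mult_le_0_iff)
  then show False
    using sp strict[OF t1 tx(2,4)] by (simp add: algebra_simps sum_subtractf)
qed

end

section \<open>Growth bounds\<close>

lemma le_of_le_add_eps:
  fixes a c m :: real
  assumes "\<And>\<epsilon>. 0 < \<epsilon> \<Longrightarrow> m \<le> a + \<epsilon> * c" "0 < c"
  shows "m \<le> a"
proof (rule field_le_epsilon)
  fix e :: real assume "0 < e"
  then show "m \<le> a + e" using assms(1)[of "e / c"] assms(2) by simp
qed

lemma cont_snd: "continuous_on E f \<Longrightarrow> continuous_on (S \<times> E) (\<lambda>p. f (snd p))"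
  by (rule continuous_on_compose2[where g=f and t=E]) (auto intro!: continuous_intros)

locale exhausted_op = quad_op E A Abar B V \<kappa>
  for E :: "(real^'d::finite) set" and A Abar B V \<kappa> +
  fixes En :: "nat \<Rightarrow> (real^'d) set" and x0 :: "real^'d"
  assumes En_open: "open (En n)" and En_bounded: "bounded (En n)"
    and En_closure: "closure (En n) \<subseteq> En (Suc n)" and E_eq: "E = (\<Union>n. En n)"
    and x0: "x0 \<in> En n" and En_star: "x \<in> En n \<Longrightarrow> closed_segment x0 x \<subseteq> En n"
    and elliptic: "\<exists>c>0. \<forall>x\<in>En n. \<forall>\<xi>. c * (norm \<xi>)\<^sup>2 \<le> \<xi> \<bullet> (A x *v \<xi>)"
    and A_cont: "continuous_on E (\<lambda>x. A x $ i $ j)" and Abar_cont: "continuous_on E (\<lambda>x. Abar x $ i $ j)"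
    and B_cont: "continuous_on E (\<lambda>x. B x $ i)" and V_cont: "continuous_on E V"
begin

lemma En_mono: "m \<le> n \<Longrightarrow> En m \<subseteq> En n"
  using lift_Suc_mono_le[of En] En_closure closure_subset by (metis order_trans)

lemma En_subset: "En n \<subseteq> E" using E_eq by auto

lemma closure_En_subset: "closure (En n) \<subseteq> E" using En_closure En_subset by blast

lemma compact_closure_En: "compact (closure (En n))" using En_bounded by (simp add: compact_closure)

lemma x0_E: "x0 \<in> E" using x0 En_subset by blast

lemma compact_in_En:
  assumes "compact C" "C \<subseteq> E"
  obtains n where "C \<subseteq> En n"
proof -
  obtain F' where F': "finite F'" "C \<subseteq> (\<Union>n\<in>F'. En n)"
    using compactE_image[OF assms(1), of UNIV En] En_open assms(2) E_eq by auto
  show ?thesis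
  proof (rule that)
    show "C \<subseteq> En (Max (insert 0 F'))"
    proof
      fix x assume "x \<in> C"
      then obtain n where "n \<in> F'" "x \<in> En n" using F' by auto
      moreover have "n \<le> Max (insert 0 F')" using F'(1) \<open>n \<in> F'\<close> by (intro Max_ge) auto
      ultimately show "x \<in> En (Max (insert 0 F'))" using En_mono by blast
    qed
  qed
qed

lemmas cont_rules = continuous_on_add continuous_on_mult continuous_on_sum continuous_on_const A_cont Abar_cont B_cont V_cont

lemma L_continuous:
  assumes "Ck_on E 2 \<phi>" "Ck_on E 2 f"
  shows "continuous_on E (L \<phi> f)"
proof -
  have "L \<phi> f = (\<lambda>x. 1/2 * (\<Sum>i\<in>UNIV. \<Sum>j\<in>UNIV. A x $ i $ j * hess f x $ i $ j)
     + (\<Sum>i\<in>UNIV. (B x $ i + (\<Sum>j\<in>UNIV. Abar x $ i $ j * grad \<phi> x $ j)) * grad f x $ i))"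
    by (auto simp: L_op_def hess_def grad_def)
  then show ?thesis
    by (simp only:) (intro cont_rules C2_continuous_grad(1)[OF openE] C2_continuous_hess assms)
qed

lemma F_continuous:
  assumes "Ck_on E 2 \<phi>"
  shows "continuous_on E (F \<phi>)"
proof -
  have "F \<phi> = (\<lambda>x. 1/2 * (\<Sum>i\<in>UNIV. \<Sum>j\<in>UNIV. A x $ i $ j * hess \<phi> x $ i $ j)
     + 1/2 * (\<Sum>i\<in>UNIV. \<Sum>j\<in>UNIV. Abar x $ i $ j * grad \<phi> x $ i * grad \<phi> x $ j)
     + (\<Sum>i\<in>UNIV. B x $ i * grad \<phi> x $ i) + V x)"
    by (auto simp: F_op_def hess_def grad_def)
  then show ?thesis
    by (simp only:) (intro cont_rules C2_continuous_grad(1)[OF openE] C2_continuous_hess assms)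
qed

lemma bounded_on_En:
  fixes f :: "real^'d \<Rightarrow> real"
  assumes "continuous_on E f"
  obtains C where "0 < C" "\<And>x. x \<in> closure (En n) \<Longrightarrow> \<bar>f x\<bar> \<le> C"
proof -
  have "bounded (f ` closure (En n))"
    using compact_continuous_image[OF continuous_on_subset[OF assms closure_En_subset] compact_closure_En]
    by (rule compact_imp_bounded)
  then show ?thesis using that unfolding bounded_pos by auto
qed

lemma bounded_above_on:
  assumes "continuous_on E f" "\<And>x. x \<in> E - En n \<Longrightarrow> f x \<le> (c::real)"
  obtains C where "\<And>x. x \<in> E \<Longrightarrow> f x \<le> C"
proof -
  obtain C where "\<And>x. x \<in> closure (En n) \<Longrightarrow> \<bar>f x\<bar> \<le> C" using bounded_on_En[OF assms(1)] by metis
  then have "f x \<le> max C c" if "x \<in> E" for x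
    using assms(2)[of x] that closure_subset[of "En n"] by (cases "x \<in> En n") (fastforce simp: le_max_iff_disj)+
  then show ?thesis using that by blast
qed

text \<open>Divergence to infinity at the boundary of \<open>E\<close> or at infinity: each sublevel
  set lies in a compact subset of \<open>E\<close>.\<close>

definition escapes :: "(real^'d \<Rightarrow> real) \<Rightarrow> bool" where
  "escapes f \<longleftrightarrow> (\<forall>c. \<exists>n. \<forall>x\<in>E - En n. c \<le> f x)"

lemma escapesD:
  assumes "escapes f"
  obtains n where "n0 \<le> n" "\<And>x. x \<in> E - En n \<Longrightarrow> c \<le> f x"
proof -
  obtain n where "\<forall>x\<in>E - En n. c \<le> f x" using assms by (auto simp: escapes_def)
  then show ?thesis using that[of "max n n0"] En_mono[of n "max n n0"] by auto
qed

lemma escapes_attains_min: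
  assumes "continuous_on E f" "escapes f"
  obtains x where "x \<in> E" "\<And>y. y \<in> E \<Longrightarrow> f x \<le> f y"
proof -
  obtain n where n: "\<And>x. x \<in> E - En n \<Longrightarrow> f x0 \<le> f x" using escapesD[OF assms(2)] by metis
  obtain x where x: "x \<in> closure (En n)" "\<And>y. y \<in> closure (En n) \<Longrightarrow> f x \<le> f y"
    using continuous_attains_inf[OF compact_closure_En _ continuous_on_subset[OF assms(1) closure_En_subset], of n]
      x0[of n] closure_subset by (metis empty_iff subsetD)
  show ?thesis
  proof (rule that[of x])
    show "x \<in> E" using x(1) closure_En_subset by auto
    show "f x \<le> f y" if "y \<in> E" for y
    proof (cases "y \<in> En n")
      case True then show ?thesis using x(2) closure_subset by blast
    next
      case False
      then have "f x0 \<le> f y" using n that by auto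
      then show ?thesis using x(2)[of x0] x0[of n] closure_subset by force
    qed
  qed
qed

text \<open>The penalty \<open>\<phi>\<close> forces the minimum of the soft maximum into a fixed compact set.\<close>

lemma stationary_lower_bound:
  assumes u: "Ck_on E 2 u" and \<psi>: "Ck_on E 2 \<psi>" and \<phi>: "Ck_on E 2 \<phi>"
    and Fu: "\<And>x. x \<in> E - En N \<Longrightarrow> F u x < F \<psi> x" and F\<phi>: "\<And>x. x \<in> E - En N \<Longrightarrow> F \<phi> x < F \<psi> x"
    and esc: "escapes (\<lambda>x. \<phi> x - \<psi> x)"
  obtains C where "\<And>x. x \<in> E \<Longrightarrow> \<psi> x \<le> u x + C"
proof -
  have cont: "continuous_on E u" "continuous_on E \<psi>" "continuous_on E \<phi>"
    using u \<psi> \<phi> by (auto intro: Ck_on_continuous)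
  obtain C where C: "0 < C" "\<And>x. x \<in> closure (En N) \<Longrightarrow> \<bar>u x - \<psi> x\<bar> \<le> C"
    using bounded_on_En[of "\<lambda>x. u x - \<psi> x" N] cont by (metis continuous_on_diff)
  have main: "exp (- \<kappa> * C) \<le> exp (\<kappa> * (u y - \<psi> y)) + \<epsilon> * exp (\<kappa> * (\<phi> y - \<psi> y))"
    if "0 < \<epsilon>" "y \<in> E" for \<epsilon> y
  proof -
    \<comment> \<open>A weight \<epsilon> on the exponential of \<phi> is the constant ln \<epsilon>
      / \<kappa> added to \<phi>, which leaves \<open>F\<close> unchanged.\<close>
    define f where "f k = (if k then u else (\<lambda>x. \<phi> x + ln \<epsilon> / \<kappa>))" for k
    define Q where "Q x = (\<Sum>k\<in>UNIV. exp (\<kappa> * (f k x - \<psi> x)))" for x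
    have e: "exp (\<kappa> * (\<phi> x + ln \<epsilon> / \<kappa> - \<psi> x)) = \<epsilon> * exp (\<kappa> * (\<phi> x - \<psi> x))" for x
      using kappa that(1) by (simp add: algebra_simps exp_add[symmetric] exp_diff exp_add)
    have Q: "Q x = exp (\<kappa> * (u x - \<psi> x)) + \<epsilon> * exp (\<kappa> * (\<phi> x - \<psi> x))" for x
      by (simp add: Q_def f_def UNIV_bool e)
    have "continuous_on E Q" unfolding Q using cont by (intro continuous_intros)
    moreover have "escapes Q"
      unfolding escapes_def
    proof
      fix c :: real
      obtain n where n: "\<And>x. x \<in> E - En n \<Longrightarrow> ln (max c 1 / \<epsilon>) / \<kappa> \<le> \<phi> x - \<psi> x"
        using escapesD[OF esc] by metis
      have "c \<le> Q x" if "x \<in> E - En n" for x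
      proof -
        have "ln (max c 1 / \<epsilon>) \<le> \<kappa> * (\<phi> x - \<psi> x)"
          using n[OF that] kappa by (simp add: pos_divide_le_eq mult.commute)
        then have "exp (ln (max c 1 / \<epsilon>)) \<le> exp (\<kappa> * (\<phi> x - \<psi> x))" by (simp only: exp_le_cancel_iff)
        moreover have "exp (ln (max c 1 / \<epsilon>)) = max c 1 / \<epsilon>" using \<open>0 < \<epsilon>\<close> by (intro exp_ln) simp
        ultimately have "max c 1 / \<epsilon> \<le> exp (\<kappa> * (\<phi> x - \<psi> x))" by linarith
        then have "max c 1 \<le> \<epsilon> * exp (\<kappa> * (\<phi> x - \<psi> x))"
          using \<open>0 < \<epsilon>\<close> by (simp add: pos_divide_le_eq mult.commute)
        then show ?thesis unfolding Q using exp_gt_zero[of "\<kappa> * (u x - \<psi> x)"] by linarith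
      qed
      then show "\<exists>n. \<forall>x\<in>E - En n. c \<le> Q x" by blast
    qed
    ultimately obtain z where z: "z \<in> E" "\<And>y. y \<in> E \<Longrightarrow> Q z \<le> Q y"
      using escapes_attains_min by blast
    obtain r where r: "0 < r" "ball z r \<subseteq> E" using openE z(1) open_contains_ball by blast
    have fC2: "Ck_on E 2 (f k)" for k
      using u C2_add_const(1)[OF openE \<phi>] by (simp add: f_def)
    have "0 \<le> (\<Sum>k\<in>UNIV. exp (\<kappa> * (f k z - \<psi> z)) * (F (f k) z - F \<psi> z))"
      by (rule soft_max_local_min[OF _ fC2 \<psi> z(1) r(1)]) (use z r in \<open>auto simp: Q_def\<close>)
    moreover have "F (f False) z = F \<phi> z" using F_add_const[OF \<phi> z(1)] by (simp add: f_def)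
    moreover have "f True = u" by (simp add: f_def)
    ultimately have nonneg: "0 \<le> exp (\<kappa> * (f True z - \<psi> z)) * (F u z - F \<psi> z)
        + exp (\<kappa> * (f False z - \<psi> z)) * (F \<phi> z - F \<psi> z)"
      by (simp add: UNIV_bool)
    \<comment> \<open>Off \<open>En N\<close> both differences are negative and the weighted sum
      could not be nonnegative. Neither \<open>En N\<close> nor the bound \<open>C\<close> on it
      depends on \<epsilon>, so the resulting lower bound survives the limit.\<close>
    have "z \<in> En N"
    proof (rule ccontr)
      assume "z \<notin> En N"
      then have "F u z - F \<psi> z < 0" "F \<phi> z - F \<psi> z < 0" using Fu F\<phi> z(1) by auto
      then have "exp (\<kappa> * (f True z - \<psi> z)) * (F u z - F \<psi> z) < 0"
        "exp (\<kappa> * (f False z - \<psi> z)) * (F \<phi> z - F \<psi> z) < 0"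
        by (auto simp: mult_less_0_iff)
      then show False using nonneg by linarith
    qed
    then have "- C \<le> u z - \<psi> z" using C(2)[of z] closure_subset by force
    then have "\<kappa> * (- C) \<le> \<kappa> * (u z - \<psi> z)" using kappa by (intro mult_left_mono) auto
    then have "exp (- \<kappa> * C) \<le> exp (\<kappa> * (u z - \<psi> z))" by simp
    also have "\<dots> \<le> Q z" unfolding Q using that(1) by simp
    also have "\<dots> \<le> Q y" using z that by auto
    finally show ?thesis unfolding Q .
  qed
  have "\<psi> y \<le> u y + C" if "y \<in> E" for y
  proof -
    have "exp (- \<kappa> * C) \<le> exp (\<kappa> * (u y - \<psi> y))"
      by (rule le_of_le_add_eps[OF main]) (use that in auto)
    then have "\<kappa> * (- C) \<le> \<kappa> * (u y - \<psi> y)" by simp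
    then show ?thesis using kappa by (simp only: mult_le_cancel_left_pos)
  qed
  then show ?thesis using that by blast
qed

end

text \<open>The hypotheses in the form used by the analytic part. The function \<phi> will be
  \<delta> \<phi>0 plus a constant, \<psi>0 has been absorbed into the bound on F \<phi> + \<alpha>
  (\<phi> - vhat), and the lower growth of the initial value is measured by \<phi> - vhat.\<close>

locale cauchy_problem = exhausted_op E A Abar B V \<kappa> En x0
  for E :: "(real^'d::finite) set" and A Abar B V \<kappa> En x0 +
  fixes \<phi>0 \<phi> vhat :: "real^'d \<Rightarrow> real" and v :: "real \<Rightarrow> real^'d \<Rightarrow> real" and \<alpha> C\<alpha> lhat :: real
  assumes \<phi>0_C2: "Ck_on E 2 \<phi>0" and \<phi>_C2: "Ck_on E 2 \<phi>" and vhat_C2: "Ck_on E 2 vhat"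
    and F_vhat: "x \<in> E \<Longrightarrow> F vhat x = lhat"
    and F_\<phi>0: "\<exists>n. \<forall>x\<in>E - En n. F \<phi>0 x \<le> lhat - 1"
    and F_\<phi>: "\<exists>n. \<forall>x\<in>E - En n. F \<phi> x \<le> lhat"
    and alpha: "0 < \<alpha>" and F_\<phi>_le: "x \<in> E \<Longrightarrow> F \<phi> x + \<alpha> * (\<phi> x - vhat x) \<le> C\<alpha>"
    and ge1: "x \<in> E \<Longrightarrow> 1 \<le> \<phi> x - vhat x"
    and esc_vhat: "escapes (\<lambda>x. \<phi> x - vhat x)" and esc_\<phi>0: "escapes (\<lambda>x. \<phi> x - \<phi>0 x)"
    and v_C2: "0 < t \<Longrightarrow> Ck_on E 2 (v t)"
    and v_der: "0 < t \<Longrightarrow> x \<in> E \<Longrightarrow> ((\<lambda>s. v s x) has_real_derivative F (v t) x) (at t)"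
    and v_cont: "continuous_on ({0..} \<times> E) (\<lambda>p. v (fst p) (snd p))"
    and v_upper: "0 \<le> T \<Longrightarrow> \<exists>C. \<forall>s\<in>{0..T}. \<forall>x\<in>E. v s x \<le> \<phi>0 x + C"
    and v_init: "\<exists>C\<ge>0. \<forall>x\<in>E. - (C * (\<phi> x - vhat x)) - C \<le> v 0 x - vhat x"
begin

definition g :: "real^'d \<Rightarrow> real" where "g x = \<phi> x - vhat x"

definition h :: "real \<Rightarrow> real^'d \<Rightarrow> real" where "h t x = v t x - lhat * t - vhat x"

lemma g_C2: "Ck_on E 2 g" and \<phi>_eq: "\<phi> x = g x + vhat x"
  unfolding g_def[abs_def] using C2_diff(1)[OF openE \<phi>_C2 vhat_C2] by auto

lemma g_ge1: "x \<in> E \<Longrightarrow> 1 \<le> g x" using ge1 by (simp add: g_def)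

lemma F_\<phi>_le_C\<alpha>: "x \<in> E \<Longrightarrow> F \<phi> x \<le> C\<alpha> - \<alpha> * g x" using F_\<phi>_le[of x] by (simp add: g_def)

lemma F_\<phi>_le_const: "x \<in> E \<Longrightarrow> F \<phi> x \<le> C\<alpha>"
  using F_\<phi>_le_C\<alpha>[of x] g_ge1[of x] alpha by (smt (verit) mult_pos_pos)

text \<open>Along the line through \<open>vhat\<close> and \<phi> the operator is a quadratic
  polynomial in \<open>s\<close>, determined by its values at 0 and 1 and by its second derivative,
  the \<open>Abar\<close> form of the gradient of \<open>g\<close>. For negative \<open>s\<close>
  the last term is nonnegative, which is the convexity exploited below.\<close>

lemma F_perturb:
  assumes "x \<in> E"
  shows "F (\<lambda>x. vhat x + s * g x + c) x = lhat + s * (F \<phi> x - lhat)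
     + (s\<^sup>2 - s) / 2 * (grad g x \<bullet> (Abar x *v grad g x))"
proof -
  have sg: "Ck_on E 2 (\<lambda>x. s * g x)" using C2_cmult(1)[OF openE g_C2] .
  have 1: "F (\<lambda>x. vhat x + s * g x + c) x = F (\<lambda>x. vhat x + s * g x) x"
    using F_add_const[OF C2_add(1)[OF openE vhat_C2 sg] assms, of c] by simp
  have "F (\<lambda>x. vhat x + s * g x) x - F vhat x = L vhat (\<lambda>x. s * g x) x
     + 1/2 * (grad (\<lambda>x. s * g x) x \<bullet> (Abar x *v grad (\<lambda>x. s * g x) x))"
    using F_diff[OF C2_add(1)[OF openE vhat_C2 sg] vhat_C2 assms] by simp
  moreover have "F \<phi> x - F vhat x = L vhat g x + 1/2 * (grad g x \<bullet> (Abar x *v grad g x))"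
    using F_diff[OF \<phi>_C2 vhat_C2 assms] unfolding g_def[symmetric, abs_def] by (simp add: g_def[abs_def])
  ultimately show ?thesis
    unfolding 1
    using F_vhat[OF assms] L_cmult[OF g_C2 assms, of vhat s] C2_cmult(2)[OF openE g_C2 assms, of s]
    by (simp add: matrix_vector_mult_scaleR field_simps power2_eq_square)
qed

lemma v_cont_sub: "0 \<le> a \<Longrightarrow> continuous_on ({a..b} \<times> E) (\<lambda>p. v (fst p) (snd p))"
  by (rule continuous_on_subset[OF v_cont]) auto

lemma cont: "continuous_on E \<phi>" "continuous_on E vhat" "continuous_on E g" "continuous_on E \<phi>0"
  using \<phi>_C2 vhat_C2 g_C2 \<phi>0_C2 by (auto intro: Ck_on_continuous)

text \<open>Since \<open>F\<close> is convex, \<open>vhat - \<theta> g\<close> is nearly a subsolution, and \<open>F \<phi> + \<alpha> g \<le> C\<alpha>\<close>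
  allows the weight \<open>\<theta>\<close> to decay at rate \<open>\<alpha>\<close>.\<close>

lemma lower_propagation:
  assumes T0: "0 \<le> T0" and \<theta>: "0 < \<theta>"
    and init: "\<And>x. x \<in> E \<Longrightarrow> c - \<theta> * g x \<le> h T0 x"
    and t: "T0 \<le> t" and x: "x \<in> E"
  shows "c - \<theta> * exp (- \<alpha> * (t - T0)) * g x - \<theta> * ((\<bar>C\<alpha> - lhat\<bar> + 1) / \<alpha>) \<le> h t x"
proof -
  \<comment> \<open>The constant \<gamma> is \<open>c\<close> lowered by \<open>M\<close> times the
    time integral of \<Theta>, in total at most \<theta> M / \<alpha>. The 1 in \<open>M\<close>
    makes \<open>w\<close> a strict subsolution.\<close>
  define M where "M = \<bar>C\<alpha> - lhat\<bar> + 1"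
  define \<Theta> where "\<Theta> t = \<theta> * exp (- \<alpha> * (t - T0))" for t
  define \<gamma> where "\<gamma> t = c - M / \<alpha> * (\<theta> - \<Theta> t)" for t
  define w where "w t x = vhat x + (- \<Theta> t) * g x + (lhat * t + \<gamma> t)" for t x
  define w' where "w' t x = \<alpha> * \<Theta> t * g x + lhat - M * \<Theta> t" for t x
  have \<Theta>_pos: "0 < \<Theta> t" for t using \<theta> by (simp add: \<Theta>_def)
  have \<Theta>_le: "\<Theta> t \<le> \<theta>" if "T0 \<le> t" for t
  proof -
    have "exp (- \<alpha> * (t - T0)) \<le> 1" using that alpha by (simp add: mult_nonneg_nonneg)
    then show ?thesis using \<theta> by (simp add: \<Theta>_def mult_left_le)
  qed
  have M: "0 < M" by (simp add: M_def)
  have \<gamma>_le: "\<gamma> t \<le> c" if "T0 \<le> t" for t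
  proof -
    have "0 \<le> M / \<alpha> * (\<theta> - \<Theta> t)" using \<Theta>_le[OF that] M alpha by (intro mult_nonneg_nonneg) auto
    then show ?thesis by (simp add: \<gamma>_def)
  qed
  have \<Theta>_der: "(\<Theta> has_real_derivative - \<alpha> * \<Theta> t) (at t)" for t
    unfolding \<Theta>_def[abs_def] by (auto intro!: derivative_eq_intros)
  have w_der: "((\<lambda>s. w s x) has_real_derivative w' t x) (at t)" for t x
    unfolding w_def \<gamma>_def w'_def
    using alpha by (auto intro!: derivative_eq_intros \<Theta>_der simp: field_simps)
  have w_C2: "Ck_on E 2 (w t)" for t
    unfolding w_def by (intro C2_add C2_add_const C2_cmult vhat_C2 g_C2 openE)
  have w_F: "w' t x - F (w t) x \<le> - \<Theta> t" if "x \<in> E" for t x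
  proof -
    define q where "q = ((\<Theta> t)\<^sup>2 + \<Theta> t) / 2 * (grad g x \<bullet> (Abar x *v grad g x))"
    have "F (w t) x = lhat - \<Theta> t * (F \<phi> x - lhat) + q"
      unfolding w_def F_perturb[OF that] by (simp add: q_def)
    moreover have "0 \<le> q"
      unfolding q_def using \<Theta>_pos[of t] Abar_nonneg[OF that] by (intro mult_nonneg_nonneg) auto
    moreover have "\<Theta> t * F \<phi> x \<le> \<Theta> t * (C\<alpha> - \<alpha> * g x)"
      using \<Theta>_pos[of t] F_\<phi>_le_C\<alpha>[OF that] by (intro mult_left_mono) auto
    moreover have "\<Theta> t * (C\<alpha> - lhat) \<le> \<Theta> t * (M - 1)"
      using \<Theta>_pos[of t] by (intro mult_left_mono) (auto simp: M_def)
    ultimately show ?thesis by (simp add: w'_def algebra_simps)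
  qed
  \<comment> \<open>The penalty \<phi> + C\<alpha> (t - T0) is a supersolution because F \<phi>
    \<le> C\<alpha>, and it lies above \<open>w\<close> off a compact set because \<open>g\<close>
    escapes.\<close>
  have main: "1 \<le> exp (\<kappa> * (v t x - w t x)) + \<epsilon> * exp (\<kappa> * (\<phi> x + C\<alpha> * (t - T0) - w t x))"
    if "0 < \<epsilon>" for \<epsilon>
  proof -
    define b where "b = ln \<epsilon> / \<kappa>"
    define f where "f k t x = (if k then v t x else \<phi> x + (C\<alpha> * (t - T0) + b))" for k t x
    define f' where "f' k t x = (if k then F (v t) x else C\<alpha>)" for k t x
    define Q where "Q t x = (\<Sum>k\<in>UNIV. exp (\<kappa> * (f k t x - w t x)))" for t x
    have Q: "Q t x = exp (\<kappa> * (v t x - w t x)) + exp (\<kappa> * (\<phi> x + (C\<alpha> * (t - T0) + b) - w t x))" for t x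
      by (simp add: Q_def f_def UNIV_bool)
    \<comment> \<open>A bound for all terms of the penalty minus \<open>w\<close> other than those
      in \<open>g\<close>, uniform over the time interval.\<close>
    define c0 where "c0 = \<bar>C\<alpha>\<bar> * (t - T0) + \<bar>b\<bar> + \<bar>lhat\<bar> * t + \<bar>c\<bar>"
    obtain n where n: "\<And>x. x \<in> E - En n \<Longrightarrow> c0 \<le> g x"
      using escapesD[OF esc_vhat] unfolding g_def by metis
    have f_C2: "Ck_on E 2 (f k s)" if "0 < s" for k s
      using v_C2[OF that] C2_add_const(1)[OF openE \<phi>_C2] by (cases k) (auto simp: f_def[abs_def])
    have f_F: "F (f False s) x = F \<phi> x" if "x \<in> E" for s x
      using F_add_const[OF \<phi>_C2 that] by (simp add: f_def[abs_def])
    have "1 \<le> (\<Sum>k\<in>UNIV. exp (\<kappa> * (f k t x - w t x)))"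
    proof (rule comparison[where I=UNIV and \<phi>=f and w=w and t=t and x=x and Ti=T0 and Tf=t and C="closure (En n)" and \<phi>'=f' and w'=w'])
      show "compact (closure (En n))" "closure (En n) \<subseteq> E"
        using compact_closure_En closure_En_subset by auto
      show "continuous_on ({T0..t} \<times> E) (\<lambda>p. f k (fst p) (snd p))" for k
        using v_cont_sub[OF T0] cont_snd[OF cont(1)] by (cases k) (auto simp: f_def intro!: continuous_intros)
      show "continuous_on ({T0..t} \<times> E) (\<lambda>p. w (fst p) (snd p))"
        unfolding w_def \<gamma>_def \<Theta>_def by (intro continuous_intros cont_snd cont)
      show "Ck_on E 2 (f k s)" if "T0 < s" for k s using f_C2 that T0 by auto
      show "Ck_on E 2 (w s)" for s by (rule w_C2)
      show "((\<lambda>s. f k s x) has_real_derivative f' k s x) (at s)" if "T0 < s" "x \<in> E" for k s x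
      proof (cases k)
        case True
        then show ?thesis using v_der[of s x] that T0 by (simp add: f_def f'_def)
      next
        case False
        then show ?thesis by (auto simp: f_def f'_def intro!: derivative_eq_intros)
      qed
      show "((\<lambda>s. w s x) has_real_derivative w' s x) (at s)" for s x by (rule w_der)
      show "1 \<le> (\<Sum>k\<in>UNIV. exp (\<kappa> * (f k T0 x - w T0 x)))" if "x \<in> E" for x
      proof -
        have "w T0 x \<le> v T0 x"
          using init[OF that] by (simp add: w_def \<gamma>_def \<Theta>_def h_def)
        then have "1 \<le> exp (\<kappa> * (v T0 x - w T0 x))" using kappa by simp
        then have "1 \<le> Q T0 x" unfolding Q by (smt (verit) exp_gt_zero)
        then show ?thesis unfolding Q_def .
      qed
      show "1 \<le> (\<Sum>k\<in>UNIV. exp (\<kappa> * (f k s x - w s x)))"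
        if "T0 \<le> s" "s \<le> t" "x \<in> E" "x \<notin> closure (En n)" for s x
      proof -
        have "c0 \<le> g x" using n that closure_subset by auto
        moreover have "0 \<le> \<Theta> s * g x" using \<Theta>_pos[of s] g_ge1[OF that(3)] by simp
        moreover have "\<bar>C\<alpha> * (s - T0)\<bar> \<le> \<bar>C\<alpha>\<bar> * (t - T0)"
          using that by (simp add: abs_mult mult_left_mono)
        moreover have "\<bar>lhat * s\<bar> \<le> \<bar>lhat\<bar> * t"
          using that T0 by (simp add: abs_mult mult_left_mono)
        ultimately have "0 \<le> \<phi> x + (C\<alpha> * (s - T0) + b) - w s x"
          using \<gamma>_le[OF that(1)] by (simp add: w_def \<phi>_eq c0_def)
        then have "1 \<le> exp (\<kappa> * (\<phi> x + (C\<alpha> * (s - T0) + b) - w s x))" using kappa by simp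
        then have "1 \<le> Q s x" unfolding Q by (smt (verit) exp_gt_zero)
        then show ?thesis unfolding Q_def .
      qed
      show "(\<Sum>k\<in>UNIV. exp (\<kappa> * (f k s x - w s x)) * (w' s x - F (w s) x))
          < (\<Sum>k\<in>UNIV. exp (\<kappa> * (f k s x - w s x)) * (f' k s x - F (f k s) x))"
        if "T0 < s" "x \<in> E" for s x
      proof -
        have neg: "w' s x - F (w s) x < 0" using w_F[OF that(2), of s] \<Theta>_pos[of s] by linarith
        have pos: "0 \<le> f' k s x - F (f k s) x" for k
        proof (cases k)
          case True
          then show ?thesis by (simp add: f_def[abs_def] f'_def)
        next
          case False
          then show ?thesis using f_F[OF that(2)] F_\<phi>_le_const[OF that(2)] by (simp add: f'_def)
        qed
        have "exp (\<kappa> * (f k s x - w s x)) * (w' s x - F (w s) x)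
            < exp (\<kappa> * (f k s x - w s x)) * (f' k s x - F (f k s) x)" for k
          using neg pos[of k] by (intro mult_strict_left_mono) auto
        then show ?thesis by (intro sum_strict_mono) (rule finite, rule UNIV_not_empty)
      qed
    qed (use t x in auto)
    then have "1 \<le> Q t x" by (simp add: Q_def)
    moreover have "exp (\<kappa> * (\<phi> x + (C\<alpha> * (t - T0) + b) - w t x))
        = \<epsilon> * exp (\<kappa> * (\<phi> x + C\<alpha> * (t - T0) - w t x))"
    proof -
      have "\<kappa> * (\<phi> x + (C\<alpha> * (t - T0) + b) - w t x) = ln \<epsilon> + \<kappa> * (\<phi> x + C\<alpha> * (t - T0) - w t x)"
        using kappa by (simp add: b_def field_simps)
      then show ?thesis using that by (simp only: exp_add) simp
    qed
    ultimately show ?thesis unfolding Q by simp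
  qed
  have "1 \<le> exp (\<kappa> * (v t x - w t x))"
    by (rule le_of_le_add_eps[OF main]) auto
  then have "w t x \<le> v t x" using kappa by (simp add: zero_le_mult_iff)
  moreover have "M / \<alpha> * (\<theta> - \<Theta> t) \<le> \<theta> * (M / \<alpha>)"
  proof -
    have "M / \<alpha> * (\<theta> - \<Theta> t) \<le> M / \<alpha> * \<theta>"
      using \<Theta>_pos[of t] M alpha by (intro mult_left_mono) auto
    then show ?thesis by (simp add: mult.commute)
  qed
  moreover have "w t x = vhat x - \<Theta> t * g x + (lhat * t + (c - M / \<alpha> * (\<theta> - \<Theta> t)))"
    by (simp add: w_def \<gamma>_def)
  ultimately show ?thesis
    unfolding h_def M_def[symmetric] \<Theta>_def[symmetric] by linarith
qed

text \<open>The weight of \<open>vhat\<close> in the soft maximum absorbs, on the compact set where \<open>F \<phi>0\<close> is not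
  negative enough, the error made by letting \<open>\<phi>0\<close> decay at the constant rate \<open>1/2\<close>.\<close>

lemma upper_bound:
  assumes v0: "\<And>x. x \<in> E \<Longrightarrow> v 0 x \<le> \<phi>0 x + C0"
  obtains C where "\<And>t x. 0 \<le> t \<Longrightarrow> x \<in> E \<Longrightarrow> exp (\<kappa> * h t x) \<le> C + exp (\<kappa> * (\<phi>0 x + C0 - vhat x))"
proof -
  obtain N where N: "\<And>x. x \<in> E - En N \<Longrightarrow> F \<phi>0 x \<le> lhat - 1" using F_\<phi>0 by blast
  have c1: "continuous_on E (\<lambda>x. F \<phi>0 x - lhat)" and c2: "continuous_on E (\<lambda>x. \<phi>0 x + C0 - vhat x)"
    by (intro continuous_intros F_continuous[OF \<phi>0_C2] cont)+
  obtain C1 where C1: "0 < C1" "\<And>x. x \<in> closure (En N) \<Longrightarrow> \<bar>F \<phi>0 x - lhat\<bar> \<le> C1"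
    using bounded_on_En[OF c1, of N] by blast
  obtain C2 where C2: "0 < C2" "\<And>x. x \<in> closure (En N) \<Longrightarrow> \<bar>\<phi>0 x + C0 - vhat x\<bar> \<le> C2"
    using bounded_on_En[OF c2, of N] by blast
  \<comment> \<open>On \<open>En N\<close> the term of \<phi>0 misses being a supersolution by at
    most C1 + 1/2, while its weight relative to that of \<open>vhat\<close> is at most exp (\<kappa>
    C2 - \<kappa> t / 2). The rise \<open>a'\<close> of the first term pays for the product; being
    integrable in time, it keeps \<open>a\<close> bounded.\<close>
  define a1 where "a1 = (C1 + 1) * exp (\<kappa> * C2)"
  have a1: "0 < a1" using C1 by (simp add: a1_def)
  define a where "a t = a1 * (2 / \<kappa>) * (1 - exp (- \<kappa> / 2 * t))" for t
  define a' where "a' t = a1 * exp (- \<kappa> / 2 * t)" for t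
  have a_der: "(a has_real_derivative a' t) (at t)" for t
    unfolding a_def[abs_def] a'_def using kappa by (auto intro!: derivative_eq_intros simp: field_simps)
  have a_pos: "0 \<le> a t" if "0 \<le> t" for t
    unfolding a_def using that a1 kappa by (intro mult_nonneg_nonneg) auto
  have a_le: "a t \<le> a1 * (2 / \<kappa>)" for t
    unfolding a_def using a1 kappa by (intro mult_left_le) auto
  have main: "1 \<le> exp (\<kappa> * (vhat x + lhat * t + a t - v t x)) + exp (\<kappa> * (\<phi>0 x + C0 + (lhat - 1/2) * t - v t x))
     + \<epsilon> * exp (\<kappa> * (\<phi> x + C\<alpha> * t - v t x))"
    if t: "0 \<le> t" and x: "x \<in> E" and \<epsilon>: "0 < \<epsilon>" for t x \<epsilon>
  proof -
    define b where "b = ln \<epsilon> / \<kappa>"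
    define f :: "nat \<Rightarrow> real \<Rightarrow> real^'d \<Rightarrow> real" where "f k t x = (if k = 0 then vhat x + (lhat * t + a t) else if k = 1 then \<phi>0 x + (C0 + (lhat - 1/2) * t)
        else \<phi> x + (C\<alpha> * t + b))" for k t x
    define f' :: "nat \<Rightarrow> real \<Rightarrow> real^'d \<Rightarrow> real" where "f' k t x = (if k = 0 then lhat + a' t else if k = 1 then lhat - 1/2 else C\<alpha>)" for k t x
    have I: "{..<3} = {0, 1, 2::nat}" by auto
    have sum3: "(\<Sum>k<3. F' k) = F' 0 + F' 1 + F' (2::nat)" for F' :: "nat \<Rightarrow> real" by (simp add: I)
    \<comment> \<open>Above \<open>v\<close> there is only \<phi>0 plus a constant depending on the
      time horizon; the penalty exceeds it off a compact set because \<phi> - \<phi>0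
      escapes.\<close>
    obtain CT where CT: "\<And>s x. 0 \<le> s \<Longrightarrow> s \<le> t \<Longrightarrow> x \<in> E \<Longrightarrow> v s x \<le> \<phi>0 x + CT"
      using v_upper[OF t] by (metis atLeastAtMost_iff)
    define c0 where "c0 = \<bar>C\<alpha>\<bar> * t + \<bar>b\<bar> + CT"
    obtain n where n: "\<And>x. x \<in> E - En n \<Longrightarrow> c0 \<le> \<phi> x - \<phi>0 x"
      using escapesD[OF esc_\<phi>0] by metis
    have f_F: "F (f k s) x = F (if k = 0 then vhat else if k = 1 then \<phi>0 else \<phi>) x" if "x \<in> E" for k s x
      using F_add_const[OF \<phi>_C2 that] F_add_const[OF \<phi>0_C2 that] F_add_const[OF vhat_C2 that] by (simp add: f_def[abs_def])
    have "1 \<le> (\<Sum>k<3. exp (\<kappa> * (f k t x - v t x)))"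
    proof (rule comparison[where I="{..<3}" and \<phi>=f and w=v and t=t and x=x and Ti=0 and Tf=t and C="closure (En n)" and \<phi>'=f' and w'="\<lambda>s x. F (v s) x"])
      show "compact (closure (En n))" "closure (En n) \<subseteq> E"
        using compact_closure_En closure_En_subset by auto
      show "continuous_on ({0..t} \<times> E) (\<lambda>p. f k (fst p) (snd p))" for k
      proof -
        have "continuous_on UNIV a"
          using a_der by (intro DERIV_continuous_on) (auto intro: has_field_derivative_at_within)
        then have ca: "continuous_on ({0..t} \<times> E) (\<lambda>p. a (fst p))"
          by (rule continuous_on_compose2) (auto intro!: continuous_intros)
        have "continuous_on ({0..t} \<times> E) (\<lambda>p. vhat (snd p) + (lhat * fst p + a (fst p)))"
          "continuous_on ({0..t} \<times> E) (\<lambda>p. \<phi>0 (snd p) + (C0 + (lhat - 1/2) * fst p))"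
          "continuous_on ({0..t} \<times> E) (\<lambda>p. \<phi> (snd p) + (C\<alpha> * fst p + b))"
          by (intro continuous_intros ca cont_snd cont)+
        then show ?thesis unfolding f_def by (cases "k = 0"; cases "k = 1"; simp)
      qed
      show "continuous_on ({0..t} \<times> E) (\<lambda>p. v (fst p) (snd p))" by (rule v_cont_sub) simp
      show "Ck_on E 2 (f k s)" for k s
        using C2_add_const(1)[OF openE \<phi>_C2] C2_add_const(1)[OF openE \<phi>0_C2] C2_add_const(1)[OF openE vhat_C2]
        by (cases "k = 0"; cases "k = 1"; simp add: f_def[abs_def])
      show "Ck_on E 2 (v s)" if "0 < s" for s using v_C2[OF that] .
      show "((\<lambda>s. f k s x) has_real_derivative f' k s x) (at s)" for k s x
        unfolding f_def f'_def by (cases "k = 0"; cases "k = 1"; simp) (auto intro!: derivative_eq_intros a_der)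
      show "((\<lambda>s. v s x) has_real_derivative F (v s) x) (at s)" if "0 < s" "x \<in> E" for s x
        using v_der[OF that] .
      show "1 \<le> (\<Sum>k<3. exp (\<kappa> * (f k 0 x - v 0 x)))" if "x \<in> E" for x
      proof -
        have "1 \<le> exp (\<kappa> * (f 1 0 x - v 0 x))" using v0[OF that] kappa by (simp add: f_def)
        then show ?thesis unfolding sum3 by (smt (verit) exp_gt_zero)
      qed
      show "1 \<le> (\<Sum>k<3. exp (\<kappa> * (f k s x - v s x)))"
        if "0 \<le> s" "s \<le> t" "x \<in> E" "x \<notin> closure (En n)" for s x
      proof -
        have "c0 \<le> \<phi> x - \<phi>0 x" using n that closure_subset by auto
        moreover have "\<bar>C\<alpha> * s\<bar> \<le> \<bar>C\<alpha>\<bar> * t" using that by (simp add: abs_mult mult_left_mono)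
        ultimately have "0 \<le> f 2 s x - v s x"
          using CT[OF that(1,2,3)] by (simp add: f_def c0_def)
        then have "1 \<le> exp (\<kappa> * (f 2 s x - v s x))" using kappa by simp
        then show ?thesis unfolding sum3 by (smt (verit) exp_gt_zero)
      qed
      show "(\<Sum>k<3. exp (\<kappa> * (f k s x - v s x)) * (F (v s) x - F (v s) x))
          < (\<Sum>k<3. exp (\<kappa> * (f k s x - v s x)) * (f' k s x - F (f k s) x))"
        if s: "0 < s" and x: "x \<in> E" for s x
      proof -
        define e where "e k = exp (\<kappa> * (f k s x - v s x))" for k
        have e_pos: "0 < e k" for k by (simp add: e_def)
        have t3: "0 \<le> e 2 * (C\<alpha> - F \<phi> x)" using e_pos[of 2] F_\<phi>_le_const[OF x] by simp
        have a'_pos: "0 < a' s" using a1 by (simp add: a'_def)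
        have "0 < e 0 * a' s + e 1 * (lhat - 1/2 - F \<phi>0 x)"
        proof (cases "x \<in> En N")
          case False
          then have "0 < e 1 * (lhat - 1/2 - F \<phi>0 x)" using N[of x] x e_pos[of 1] by simp
          then show ?thesis using e_pos[of 0] a'_pos by (simp add: add_pos_pos)
        next
          case True
          then have xc: "x \<in> closure (En N)" using closure_subset by auto
          have "\<kappa> * (f 1 s x - f 0 s x) \<le> \<kappa> * (C2 - s / 2)"
            using C2(2)[OF xc] a_pos[of s] s kappa by (intro mult_left_mono) (auto simp: f_def algebra_simps)
          then have "exp (\<kappa> * (f 1 s x - f 0 s x)) \<le> exp (\<kappa> * C2) * exp (- \<kappa> / 2 * s)"
            by (simp add: exp_add[symmetric] algebra_simps)
          moreover have "e 1 = e 0 * exp (\<kappa> * (f 1 s x - f 0 s x))"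
            by (simp add: e_def exp_add[symmetric] algebra_simps)
          ultimately have "e 1 \<le> e 0 * (exp (\<kappa> * C2) * exp (- \<kappa> / 2 * s))"
            using e_pos[of 0] by simp
          then have "e 1 * (C1 + 1) \<le> e 0 * (exp (\<kappa> * C2) * exp (- \<kappa> / 2 * s)) * (C1 + 1)"
            using C1 by (intro mult_right_mono) auto
          also have "\<dots> = e 0 * a' s" by (simp add: a'_def a1_def)
          finally have "e 1 * (C1 + 1) \<le> e 0 * a' s" .
          moreover have "e 1 * (- C1 - 1/2) \<le> e 1 * (lhat - 1/2 - F \<phi>0 x)"
            using C1(2)[OF xc] e_pos[of 1] by (intro mult_left_mono) auto
          ultimately show ?thesis using e_pos[of 1] by (simp add: algebra_simps)
        qed
        then show ?thesis
          unfolding sum3 f_F[OF x] e_def[symmetric] using t3 F_vhat[OF x] by (simp add: f'_def)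
      qed
    qed (use t x in auto)
    moreover have "exp (\<kappa> * (f 2 t x - v t x)) = \<epsilon> * exp (\<kappa> * (\<phi> x + C\<alpha> * t - v t x))"
    proof -
      have "\<kappa> * (f 2 t x - v t x) = ln \<epsilon> + \<kappa> * (\<phi> x + C\<alpha> * t - v t x)"
        using kappa by (simp add: f_def b_def field_simps)
      then show ?thesis using \<epsilon> by (simp only: exp_add) simp
    qed
    ultimately show ?thesis unfolding sum3 by (simp add: f_def algebra_simps)
  qed
  have "exp (\<kappa> * h t x) \<le> exp (\<kappa> * (a1 * (2 / \<kappa>))) + exp (\<kappa> * (\<phi>0 x + C0 - vhat x))"
    if t: "0 \<le> t" and x: "x \<in> E" for t x
  proof -
    let ?p = "exp (\<kappa> * (vhat x + lhat * t + a t - v t x))" and ?q = "exp (\<kappa> * (\<phi>0 x + C0 + (lhat - 1/2) * t - v t x))"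
    have "1 \<le> ?p + ?q"
      by (rule le_of_le_add_eps[OF main[OF t x]]) auto
    \<comment> \<open>Multiplying by exp (\<kappa> h) eliminates \<open>v\<close> from the
      exponents.\<close>
    then have "exp (\<kappa> * h t x) * 1 \<le> exp (\<kappa> * h t x) * (?p + ?q)" by (intro mult_left_mono) auto
    also have "\<dots> = exp (\<kappa> * a t) + exp (\<kappa> * (\<phi>0 x + C0 - t / 2 - vhat x))"
      by (simp add: distrib_left exp_add[symmetric] h_def algebra_simps)
    also have "\<dots> \<le> exp (\<kappa> * (a1 * (2 / \<kappa>))) + exp (\<kappa> * (\<phi>0 x + C0 - vhat x))"
    proof (rule add_mono)
      have "\<kappa> * a t \<le> \<kappa> * (a1 * (2 / \<kappa>))"
        using a_le[of t] kappa by (intro mult_left_mono) auto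
      then show "exp (\<kappa> * a t) \<le> exp (\<kappa> * (a1 * (2 / \<kappa>)))" by (simp only: exp_le_cancel_iff)
      have "\<kappa> * (\<phi>0 x + C0 - t / 2 - vhat x) \<le> \<kappa> * (\<phi>0 x + C0 - vhat x)"
        using kappa t by (intro mult_left_mono) auto
      then show "exp (\<kappa> * (\<phi>0 x + C0 - t / 2 - vhat x)) \<le> exp (\<kappa> * (\<phi>0 x + C0 - vhat x))"
        by (simp only: exp_le_cancel_iff)
    qed
    finally show ?thesis by simp
  qed
  then show ?thesis using that by blast
qed

end

section \<open>Local equicontinuity by doubling of variables\<close>

lemma trace_outer: "trace (outer u u) = (norm u)\<^sup>2"
  by (simp add: trace_def outer_def power2_norm_eq_inner inner_vec_def)

lemma trace_scaleR: "trace (c *\<^sub>R M) = c * trace M"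
  by (simp add: trace_def sum_distrib_left)

lemma transpose_outer: "transpose (outer u u) = outer u u"
  by (simp add: transpose_def outer_def vec_eq_iff mult.commute)

lemma transpose_diff: "transpose (M - N) = transpose M - transpose N"
  by (simp add: transpose_def vec_eq_iff)

lemma transpose_scaleR: "transpose (c *\<^sub>R M) = c *\<^sub>R transpose M"
  by (simp add: transpose_def vec_eq_iff)

lemma outer_quad: "\<xi> \<bullet> (outer u u *v \<xi>) = (u \<bullet> \<xi>)\<^sup>2"
  unfolding inner_matrix_vector
  by (simp add: outer_def inner_vec_def power2_eq_square sum_product mult_ac)

lemma scaleR_quad: "\<xi> \<bullet> ((c *\<^sub>R M) *v \<xi>) = c * (\<xi> \<bullet> (M *v \<xi>))" for \<xi> :: "real^'d::finite"
  by (simp add: scaleR_matrix_vector_assoc[symmetric])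

lemma diff_quad: "\<xi> \<bullet> ((M - N) *v \<xi>) = \<xi> \<bullet> (M *v \<xi>) - \<xi> \<bullet> (N *v \<xi>)" for \<xi> :: "real^'d::finite"
  by (simp add: matrix_vector_mult_diff_rdistrib inner_diff_right)

lemma trace_mono_quad:
  fixes M N :: "real^'d::finite^'d"
  assumes "\<And>\<xi>. \<xi> \<bullet> (M *v \<xi>) \<le> \<xi> \<bullet> (N *v \<xi>)"
  shows "trace M \<le> trace N"
proof -
  have "M $ i $ i \<le> N $ i $ i" for i
    using assms[of "axis i 1"] by (simp add: inner_axis' matrix_vector_mult_basis column_def)
  then show ?thesis unfolding trace_def by (intro sum_mono)
qed

text \<open>All of \<open>A\<close> near \<open>z\<close> is coupled synchronously, except for a multiple of the projection onto the
  direction \<open>e\<close> of \<open>x - y\<close>, which is reflected; this is where the negative term comes from.\<close>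

lemma doubling_second_order:
  fixes Ax Ay Az X Y :: "real^'d::finite^'d"
  assumes sym: "transpose Ax = Ax" "transpose Ay = Ay" "transpose Az = Az"
    and ell: "\<And>\<xi>. c * (norm \<xi>)\<^sup>2 \<le> \<xi> \<bullet> (Az *v \<xi>)"
    and close: "\<And>\<xi>. \<bar>\<xi> \<bullet> ((Ax - Az) *v \<xi>)\<bar> \<le> \<epsilon> * (norm \<xi>)\<^sup>2" "\<And>\<xi>. \<bar>\<xi> \<bullet> ((Ay - Az) *v \<xi>)\<bar> \<le> \<epsilon> * (norm \<xi>)\<^sup>2"
    and \<epsilon>: "0 \<le> \<epsilon>" "\<epsilon> \<le> c / 2" "16 * \<epsilon> * real CARD('d) \<le> c"
    and e: "norm e = 1" and l: "0 \<le> l" and K: "0 \<le> K"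
    and XY: "\<And>\<xi>. \<xi> \<bullet> ((X - Y) *v \<xi>) \<le> 2 * K * (norm \<xi>)\<^sup>2" "e \<bullet> ((X - Y) *v e) \<le> - l + 2 * K"
    and X: "\<And>\<xi>. \<xi> \<bullet> (X *v \<xi>) \<le> (l / 2 + 2 * K) * (norm \<xi>)\<^sup>2"
    and Y: "\<And>\<xi>. - (\<xi> \<bullet> (Y *v \<xi>)) \<le> l / 2 * (norm \<xi>)\<^sup>2"
    and tr: "trace Az \<le> Ct"
  shows "mdot Ax X - mdot Ay Y \<le> - (3/8) * c * l + 2 * K * Ct + K * c / 2"
proof -
  define d where "d = real CARD('d)"
  have d1: "1 \<le> d" unfolding d_def by (simp add: Suc_leI)
  \<comment> \<open>A common lower bound of \<open>Ax\<close> and \<open>Ay\<close>. The remainders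
    \<open>R Ax\<close> and \<open>R Ay\<close> have trace at most 2 \<epsilon> d, so for them the
    crude one-sided bounds on \<open>X\<close> and \<open>Y\<close> separately are enough.\<close>
  define A0 where "A0 = Az - \<epsilon> *\<^sub>R mat 1"
  define R where "R M = M - A0" for M
  define A1 where "A1 = A0 - (c / 2) *\<^sub>R outer e e"
  have symA0: "transpose A0 = A0" by (simp add: A0_def transpose_diff transpose_scaleR sym)
  have A0: "\<xi> \<bullet> (A0 *v \<xi>) = \<xi> \<bullet> (Az *v \<xi>) - \<epsilon> * (norm \<xi>)\<^sup>2" for \<xi>
    by (simp add: A0_def diff_quad scaleR_quad dot_square_norm)
  have psdR: "psd (R M) \<and> trace (R M) \<le> 2 * \<epsilon> * d"
    if "transpose M = M" "\<And>\<xi>. \<bar>\<xi> \<bullet> ((M - Az) *v \<xi>)\<bar> \<le> \<epsilon> * (norm \<xi>)\<^sup>2" for M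
  proof -
    have q: "\<xi> \<bullet> (R M *v \<xi>) = \<xi> \<bullet> ((M - Az) *v \<xi>) + \<epsilon> * (norm \<xi>)\<^sup>2" for \<xi>
      by (simp add: R_def diff_quad A0)
    have "0 \<le> \<xi> \<bullet> (R M *v \<xi>)" for \<xi> using that(2)[of \<xi>] by (simp add: q)
    moreover have "\<xi> \<bullet> (R M *v \<xi>) \<le> \<xi> \<bullet> (((2 * \<epsilon>) *\<^sub>R mat 1) *v \<xi>)" for \<xi>
      using that(2)[of \<xi>] by (simp add: q scaleR_quad dot_square_norm)
    then have "trace (R M) \<le> trace ((2 * \<epsilon>) *\<^sub>R (mat 1 :: real^'d^'d))" by (rule trace_mono_quad)
    ultimately show ?thesis
      using symA0 that(1) by (simp add: psd_def R_def transpose_diff trace_scaleR trace_I d_def)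
  qed
  note Rx = psdR[OF sym(1) close(1)] and Ry = psdR[OF sym(2) close(2)]
  \<comment> \<open>The ellipticity constant is spent in halves, one on \<epsilon> and one on the
    direction \<open>e\<close>.\<close>
  have psdA1: "psd A1"
  proof -
    have "0 \<le> \<xi> \<bullet> (A1 *v \<xi>)" for \<xi>
    proof -
      have "\<bar>e \<bullet> \<xi>\<bar> \<le> norm \<xi>" using Cauchy_Schwarz_ineq2[of e \<xi>] e by simp
      then have "(e \<bullet> \<xi>)\<^sup>2 \<le> (norm \<xi>)\<^sup>2" by (simp add: abs_le_square_iff[symmetric])
      then have "c / 2 * (e \<bullet> \<xi>)\<^sup>2 \<le> c / 2 * (norm \<xi>)\<^sup>2" using \<epsilon> by (intro mult_left_mono) auto
      moreover have "\<epsilon> * (norm \<xi>)\<^sup>2 \<le> c / 2 * (norm \<xi>)\<^sup>2" using \<epsilon> by (intro mult_right_mono) auto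
      ultimately show ?thesis
        using ell[of \<xi>] by (simp add: A1_def diff_quad scaleR_quad outer_quad A0 algebra_simps)
    qed
    then show ?thesis
      using symA0 by (simp add: psd_def A1_def transpose_diff transpose_scaleR transpose_outer)
  qed
  have trA1: "trace A1 \<le> Ct - c / 2"
  proof -
    have "trace A1 = trace Az - \<epsilon> * d - c / 2"
      by (simp add: A1_def A0_def trace_sub trace_scaleR trace_I trace_outer e d_def)
    then show ?thesis using tr \<epsilon>(1) d1 by simp (smt (verit) mult_nonneg_nonneg)
  qed
  have "mdot Ax X - mdot Ay Y = mdot A1 (X - Y) + c / 2 * (e \<bullet> ((X - Y) *v e)) + mdot (R Ax) X + mdot (R Ay) (- Y)"
    by (simp add: A1_def R_def mdot_simps mdot_outer' algebra_simps)
  also have "mdot A1 (X - Y) \<le> 2 * K * trace A1"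
    using XY(1) by (intro mdot_psd_le_trace psdA1)
  also have "\<dots> \<le> 2 * K * (Ct - c / 2)" using K trA1 by (intro mult_left_mono) auto
  also have "c / 2 * (e \<bullet> ((X - Y) *v e)) \<le> c / 2 * (- l + 2 * K)"
    using XY(2) \<epsilon> by (intro mult_left_mono) auto
  also have "mdot (R Ax) X \<le> (l / 2 + 2 * K) * trace (R Ax)"
    using Rx X by (intro mdot_psd_le_trace) auto
  also have "\<dots> \<le> (l / 2 + 2 * K) * (2 * \<epsilon> * d)" using Rx l K by (intro mult_left_mono) auto
  also have "mdot (R Ay) (- Y) \<le> l / 2 * trace (R Ay)"
  proof (rule mdot_psd_le_trace)
    show "\<xi> \<bullet> (- Y *v \<xi>) \<le> l / 2 * (norm \<xi>)\<^sup>2" for \<xi>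
      using Y[of \<xi>] diff_quad[of \<xi> 0 Y] by simp
  qed (use Ry in auto)
  also have "\<dots> \<le> l / 2 * (2 * \<epsilon> * d)" using Ry l by (intro mult_left_mono) auto
  finally have "mdot Ax X - mdot Ay Y \<le> 2 * K * (Ct - c / 2) + c / 2 * (- l + 2 * K)
     + (l + 2 * K) * (2 * \<epsilon> * d)" by (simp add: algebra_simps)
  \<comment> \<open>Of the gain c l / 2 along \<open>e\<close>, the remainders consume at most c l /
    8.\<close>
  also have "(l + 2 * K) * (2 * \<epsilon> * d) \<le> (l + 2 * K) * (c / 8)"
    using \<epsilon> l K by (intro mult_left_mono) (auto simp: d_def)
  finally have "mdot Ax X - mdot Ay Y \<le> 2 * K * (Ct - c / 2) + c / 2 * (- l + 2 * K) + (l + 2 * K) * (c / 8)" by simp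
  moreover have "0 \<le> c * K" using \<epsilon> K by simp
  ultimately show ?thesis by (simp add: field_simps)
qed

text \<open>Moving the two points simultaneously in the directions \<open>a\<close> and
  \<open>b\<close> gives joint first and second order conditions; \<open>q\<close> is any penalty
  along the motion that touches at 0.\<close>

lemma line_test:
  assumes E: "open E" and u: "Ck_on E 2 u" and "0 < e"
    and q: "\<And>s. \<bar>s\<bar> < e \<Longrightarrow> (q has_real_derivative q' s) (at s)" "(q' has_real_derivative q2) (at 0)"
    and inE: "\<And>s. \<bar>s\<bar> < e \<Longrightarrow> x + s *\<^sub>R a \<in> E" "\<And>s. \<bar>s\<bar> < e \<Longrightarrow> y + s *\<^sub>R b \<in> E"
    and max: "\<And>s. \<bar>s\<bar> < e \<Longrightarrow> u (x + s *\<^sub>R a) - u (y + s *\<^sub>R b) - q s \<le> u x - u y - q 0"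
  shows "grad u x \<bullet> a - grad u y \<bullet> b = q' 0" "a \<bullet> (hess u x *v a) - b \<bullet> (hess u y *v b) \<le> q2"
proof -
  define G where "G s = q s - u (x + s *\<^sub>R a) + u (y + s *\<^sub>R b)" for s
  define G' where "G' s = q' s - grad u (x + s *\<^sub>R a) \<bullet> a + grad u (y + s *\<^sub>R b) \<bullet> b" for s
  have 1: "(G has_real_derivative G' s) (at s)" if "\<bar>s\<bar> < e" for s
    unfolding G_def[abs_def] G'_def
    by (intro DERIV_add DERIV_diff q that C2_line_derivative(1)[OF E u] inE)
  have 2: "(G' has_real_derivative q2 - a \<bullet> (hess u (x + 0 *\<^sub>R a) *v a) + b \<bullet> (hess u (y + 0 *\<^sub>R b) *v b)) (at 0)"
    unfolding G'_def[abs_def]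
    by (intro DERIV_add DERIV_diff q C2_line_derivative(2)[OF E u] inE) (use \<open>0 < e\<close> in auto)
  have 3: "G 0 \<le> G s" if "\<bar>s\<bar> < e" for s using max[OF that] by (simp add: G_def)
  show "grad u x \<bullet> a - grad u y \<bullet> b = q' 0"
    using second_derivative_test(1)[OF \<open>0 < e\<close> 1 2 3] by (simp add: G'_def)
  show "a \<bullet> (hess u x *v a) - b \<bullet> (hess u y *v b) \<le> q2"
    using second_derivative_test(2)[OF \<open>0 < e\<close> 1 2 3] by simp
qed

text \<open>The tangent at b^2 of the concave fourth root, evaluated at a^2. It bounds the square
  root of a norm by an expression quadratic in the displacement.\<close>

lemma sqrt_tangent:
  assumes "0 \<le> (a::real)" "0 < b"
  shows "sqrt a \<le> sqrt b + (a\<^sup>2 - b\<^sup>2) / (4 * (b * sqrt b))"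
proof -
  define p q where "p = sqrt a" and "q = sqrt b"
  have pq: "0 \<le> p" "0 < q" "a = p\<^sup>2" "b = q\<^sup>2" using assms by (auto simp: p_def q_def)
  have "0 \<le> (p - q)\<^sup>2 * ((p + q)\<^sup>2 + 2 * q\<^sup>2)" by simp
  then have "4 * q ^ 3 * p \<le> p ^ 4 + 3 * q ^ 4" by (simp add: power2_eq_square eval_nat_numeral algebra_simps)
  then have "p \<le> q + (p ^ 4 - q ^ 4) / (4 * q ^ 3)"
    using pq by (simp add: field_simps eval_nat_numeral)
  then show ?thesis using pq(1,2)
    by (simp add: p_def[symmetric] q_def[symmetric] pq(3,4) eval_nat_numeral mult_ac)
qed

text \<open>Moving both points by \<xi> leaves x - y unchanged and gives the third bound; moving
  only one of them gives the two crude bounds. Moving them in opposite directions along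
  \<open>e\<close> detects the strict concavity of the square root of the distance, which is the
  source of the term - l.\<close>

lemma doubling_max:
  fixes x y z :: "real^'d::finite"
  assumes E: "open E" and u: "Ck_on E 2 u" and xE: "x \<in> E" and yE: "y \<in> E" and ne: "x \<noteq> y" and "0 < \<rho>" and Lp: "0 < Lc"
    and max: "\<And>x' y'. x' \<in> ball x \<rho> \<Longrightarrow> y' \<in> ball y \<rho> \<Longrightarrow>
      u x' - u y' - Lc * sqrt (norm (x' - y')) - K * (norm (x' - z))\<^sup>2
      \<le> u x - u y - Lc * sqrt (norm (x - y)) - K * (norm (x - z))\<^sup>2"
  defines "r \<equiv> norm (x - y)"
  defines "l \<equiv> Lc / (r * sqrt r)"
  defines "e \<equiv> (1 / r) *\<^sub>R (x - y)"
  shows "grad u x = (l / 2) *\<^sub>R (x - y) + (2 * K) *\<^sub>R (x - z)" "grad u y = (l / 2) *\<^sub>R (x - y)"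
    "\<xi> \<bullet> ((hess u x - hess u y) *v \<xi>) \<le> 2 * K * (norm \<xi>)\<^sup>2"
    "e \<bullet> ((hess u x - hess u y) *v e) \<le> - l + 2 * K"
    "\<xi> \<bullet> (hess u x *v \<xi>) \<le> (l / 2 + 2 * K) * (norm \<xi>)\<^sup>2"
    "- (\<xi> \<bullet> (hess u y *v \<xi>)) \<le> l / 2 * (norm \<xi>)\<^sup>2"
proof -
  have r: "0 < r" using ne by (simp add: r_def)
  have e1: "norm e = 1" using r by (simp add: e_def r_def)
  obtain \<rho>' where \<rho>': "0 < \<rho>'" "\<rho>' \<le> \<rho>" "\<rho>' \<le> r" "ball x \<rho>' \<subseteq> E" "ball y \<rho>' \<subseteq> E"
  proof -
    obtain a b where "0 < a" "ball x a \<subseteq> E" "0 < b" "ball y b \<subseteq> E"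
      using E xE yE open_contains_ball by metis
    then show ?thesis
      by (intro that[of "min (min a b) (min \<rho> r)"]) (use \<open>0 < \<rho>\<close> r in \<open>auto simp: subset_iff\<close>)
  qed
  have small: "\<exists>\<eta>>0. \<eta> \<le> r / 2 \<and> (\<forall>s. \<bar>s\<bar> < \<eta> \<longrightarrow> x + s *\<^sub>R a \<in> ball x \<rho>' \<and> y + s *\<^sub>R b \<in> ball y \<rho>')" for a b :: "real^'d"
  proof -
    define m where "m = norm a + norm b + 1"
    have m: "0 < m" "norm a \<le> m" "norm b \<le> m" by (auto simp: m_def add_nonneg_pos)
    have "\<bar>s\<bar> * norm w < \<rho>'" if "\<bar>s\<bar> < \<rho>' / m" "norm w \<le> m" for s and w :: "real^'d"
    proof -
      have "\<bar>s\<bar> * norm w \<le> \<bar>s\<bar> * m" using that by (intro mult_left_mono) auto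
      also have "\<dots> < \<rho>'" using that m by (simp add: pos_less_divide_eq)
      finally show ?thesis .
    qed
    then show ?thesis using m \<rho>' r min.cobounded2[of "\<rho>' / m" "r / 2"]
      by (intro exI[of _ "min (\<rho>' / m) (r / 2)"]) (auto simp: dist_norm)
  qed
  have quadz: "(norm (x + s *\<^sub>R a - z))\<^sup>2 = (norm (x - z))\<^sup>2 + 2 * s * ((x - z) \<bullet> a) + s\<^sup>2 * (norm a)\<^sup>2" for s a
    unfolding power2_norm_eq_inner
    by (simp add: inner_diff_left inner_diff_right inner_add_left inner_add_right
        inner_commute power2_eq_square algebra_simps)
  \<comment> \<open>A function touching the penalty from above at the maximum may replace it.\<close>
  have test: "grad u x \<bullet> a - grad u y \<bullet> b = Lc * p' 0 + 2 * K * ((x - z) \<bullet> a) \<and>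
      a \<bullet> (hess u x *v a) - b \<bullet> (hess u y *v b) \<le> Lc * p2 + 2 * K * (norm a)\<^sup>2"
    if p: "\<And>s. \<bar>s\<bar> < r / 2 \<Longrightarrow> (p has_real_derivative p' s) (at s)" "(p' has_real_derivative p2) (at 0)"
      "\<And>s. \<bar>s\<bar> < r / 2 \<Longrightarrow> sqrt (norm ((x + s *\<^sub>R a) - (y + s *\<^sub>R b))) \<le> p s" "p 0 = sqrt r" for a b p p' p2
  proof -
    obtain \<eta> where \<eta>: "0 < \<eta>" "\<eta> \<le> r / 2"
      "\<And>s. \<bar>s\<bar> < \<eta> \<Longrightarrow> x + s *\<^sub>R a \<in> ball x \<rho>' \<and> y + s *\<^sub>R b \<in> ball y \<rho>'" using small[of a b] by blast
    define q where "q s = Lc * p s + K * ((norm (x - z))\<^sup>2 + 2 * s * ((x - z) \<bullet> a) + s\<^sup>2 * (norm a)\<^sup>2)" for s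
    define q' where "q' s = Lc * p' s + K * (2 * ((x - z) \<bullet> a) + 2 * s * (norm a)\<^sup>2)" for s
    have 1: "(q has_real_derivative q' s) (at s)" if "\<bar>s\<bar> < \<eta>" for s
      unfolding q_def[abs_def] q'_def
      by (rule derivative_eq_intros p(1) refl | use that \<eta> in simp)+
    have 2: "(q' has_real_derivative Lc * p2 + 2 * K * (norm a)\<^sup>2) (at 0)"
      unfolding q'_def[abs_def] by (rule derivative_eq_intros p(2) refl | simp)+
    have 3: "u (x + s *\<^sub>R a) - u (y + s *\<^sub>R b) - q s \<le> u x - u y - q 0" if "\<bar>s\<bar> < \<eta>" for s
    proof -
      have "Lc * sqrt (norm ((x + s *\<^sub>R a) - (y + s *\<^sub>R b))) \<le> Lc * p s"
        using p(3)[of s] that \<eta> Lp by (intro mult_left_mono) auto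
      moreover have "x + s *\<^sub>R a \<in> ball x \<rho>" "y + s *\<^sub>R b \<in> ball y \<rho>" using \<eta>(3)[OF that] \<rho>'(2) by auto
      ultimately show ?thesis
        using max[of "x + s *\<^sub>R a" "y + s *\<^sub>R b"] p(4) by (simp add: q_def quadz r_def)
    qed
    have 4: "x + s *\<^sub>R a \<in> E" "y + s *\<^sub>R b \<in> E" if "\<bar>s\<bar> < \<eta>" for s using \<eta>(3)[OF that] \<rho>'(4,5) by auto
    show ?thesis
      using line_test[OF E u \<eta>(1) 1 2 4 3] by (simp add: q'_def)
  qed
  have tangent: "sqrt (norm (x - y + s *\<^sub>R a)) \<le> sqrt r + (2 * s * ((x - y) \<bullet> a) + s\<^sup>2 * (norm a)\<^sup>2) / (4 * (r * sqrt r))" for s a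
  proof -
    have "(norm (x - y + s *\<^sub>R a))\<^sup>2 = r\<^sup>2 + (2 * s * ((x - y) \<bullet> a) + s\<^sup>2 * (norm a)\<^sup>2)"
      unfolding r_def power2_norm_eq_inner
      by (simp add: inner_add_left inner_add_right inner_commute power2_eq_square algebra_simps)
    then show ?thesis using sqrt_tangent[OF norm_ge_zero r, of "x - y + s *\<^sub>R a"] by simp
  qed
  have quad_test: "grad u x \<bullet> a - grad u y \<bullet> b = l / 2 * ((x - y) \<bullet> (a - b)) + 2 * K * ((x - z) \<bullet> a) \<and>
      a \<bullet> (hess u x *v a) - b \<bullet> (hess u y *v b) \<le> l / 2 * (norm (a - b))\<^sup>2 + 2 * K * (norm a)\<^sup>2" for a b
  proof -
    define k where "k = 1 / (4 * (r * sqrt r))"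
    define p where "p s = sqrt r + (2 * s * ((x - y) \<bullet> (a - b)) + s\<^sup>2 * (norm (a - b))\<^sup>2) * k" for s
    define p' where "p' s = (2 * ((x - y) \<bullet> (a - b)) + 2 * s * (norm (a - b))\<^sup>2) * k" for s
    have "(p has_real_derivative p' s) (at s)" for s
      unfolding p_def[abs_def] p'_def by (auto intro!: derivative_eq_intros)
    moreover have "(p' has_real_derivative (2 * (norm (a - b))\<^sup>2) * k) (at 0)"
      unfolding p'_def[abs_def] by (auto intro!: derivative_eq_intros)
    moreover have "sqrt (norm ((x + s *\<^sub>R a) - (y + s *\<^sub>R b))) \<le> p s" for s
    proof -
      have eq: "(x + s *\<^sub>R a) - (y + s *\<^sub>R b) = x - y + s *\<^sub>R (a - b)" by (simp add: algebra_simps)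
      show ?thesis unfolding eq using tangent[of s "a - b"] by (simp add: p_def k_def)
    qed
    moreover have "p 0 = sqrt r" by (simp add: p_def)
    ultimately have "grad u x \<bullet> a - grad u y \<bullet> b = Lc * p' 0 + 2 * K * ((x - z) \<bullet> a) \<and>
      a \<bullet> (hess u x *v a) - b \<bullet> (hess u y *v b) \<le> Lc * ((2 * (norm (a - b))\<^sup>2) * k) + 2 * K * (norm a)\<^sup>2"
      by (intro test[where p=p and p'=p']) auto
    then show ?thesis by (simp add: p'_def l_def k_def)
  qed
  have "grad u x \<bullet> a = ((l / 2) *\<^sub>R (x - y) + (2 * K) *\<^sub>R (x - z)) \<bullet> a" for a
    using quad_test[of a 0] by (simp add: inner_add_left)
  then show "grad u x = (l / 2) *\<^sub>R (x - y) + (2 * K) *\<^sub>R (x - z)" by (metis vector_eq_rdot)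
  have "grad u y \<bullet> b = ((l / 2) *\<^sub>R (x - y)) \<bullet> b" for b
    using quad_test[of 0 b] by simp
  then show "grad u y = (l / 2) *\<^sub>R (x - y)" by (metis vector_eq_rdot)
  show "\<xi> \<bullet> ((hess u x - hess u y) *v \<xi>) \<le> 2 * K * (norm \<xi>)\<^sup>2" using quad_test[of \<xi> \<xi>] by (simp add: diff_quad)
  show "\<xi> \<bullet> (hess u x *v \<xi>) \<le> (l / 2 + 2 * K) * (norm \<xi>)\<^sup>2" using quad_test[of \<xi> 0] by (simp add: distrib_right)
  show "- (\<xi> \<bullet> (hess u y *v \<xi>)) \<le> l / 2 * (norm \<xi>)\<^sup>2" using quad_test[of 0 \<xi>] by simp
  \<comment> \<open>Along \<open>e\<close> and \<open>- e\<close> the distance is exactly r + 2 s,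
    so the penalty itself is used here in place of its tangent.\<close>
  have "grad u x \<bullet> e - grad u y \<bullet> (- e) = Lc * (1 / sqrt (r + 2 * 0)) + 2 * K * ((x - z) \<bullet> e) \<and>
      e \<bullet> (hess u x *v e) - (- e) \<bullet> (hess u y *v (- e)) \<le> Lc * (- (1 / (r * sqrt r))) + 2 * K * (norm e)\<^sup>2"
  proof (rule test)
    show "((\<lambda>s. sqrt (r + 2 * s)) has_real_derivative 1 / sqrt (r + 2 * s)) (at s)" if "\<bar>s\<bar> < r / 2" for s
      using that by (auto intro!: derivative_eq_intros simp: field_simps)
    show "((\<lambda>s. 1 / sqrt (r + 2 * s)) has_real_derivative - (1 / (r * sqrt r))) (at 0)"
      using r by (auto intro!: derivative_eq_intros simp: field_simps)
    show "sqrt (norm ((x + s *\<^sub>R e) - (y + s *\<^sub>R - e))) \<le> sqrt (r + 2 * s)" if "\<bar>s\<bar> < r / 2" for s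
    proof -
      have "(x + s *\<^sub>R e) - (y + s *\<^sub>R - e) = ((r + 2 * s) / r) *\<^sub>R (x - y)"
      proof -
        have "x - y = r *\<^sub>R e" using r by (simp add: e_def)
        then have "(x + s *\<^sub>R e) - (y + s *\<^sub>R - e) = r *\<^sub>R e + s *\<^sub>R e + s *\<^sub>R e" by (simp add: algebra_simps)
        also have "\<dots> = (r + 2 * s) *\<^sub>R e" by (simp only: scaleR_add_left[symmetric]) simp
        finally show ?thesis by (simp add: e_def)
      qed
      then have "norm ((x + s *\<^sub>R e) - (y + s *\<^sub>R - e)) = \<bar>r + 2 * s\<bar>"
        using r by (simp add: r_def[symmetric])
      then show ?thesis using that by simp
    qed
    show "sqrt (r + 2 * 0) = sqrt r" by simp
  qed
  moreover have "hess u y *v (- e) = - (hess u y *v e)"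
    using matrix_vector_mult_scaleR[of "hess u y" "- 1" e] by simp
  ultimately show "e \<bullet> ((hess u x - hess u y) *v e) \<le> - l + 2 * K"
    using e1 diff_quad[of e "hess u x" "hess u y"] by (simp add: l_def)
qed

lemma bilinear_bound:
  fixes M :: "real^'d::finite^'d"
  assumes "\<And>i j. \<bar>M $ i $ j\<bar> \<le> C"
  shows "\<bar>\<xi> \<bullet> (M *v \<eta>)\<bar> \<le> C * (real CARD('d))\<^sup>2 * (norm \<xi> * norm \<eta>)"
proof -
  have "\<bar>\<xi> \<bullet> (M *v \<eta>)\<bar> \<le> (\<Sum>i\<in>UNIV. \<Sum>j\<in>UNIV. \<bar>M $ i $ j * \<xi> $ i * \<eta> $ j\<bar>)"
    unfolding inner_matrix_vector by (rule order_trans[OF sum_abs sum_mono[OF sum_abs]])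
  also have "\<dots> \<le> (\<Sum>i\<in>(UNIV::'d set). \<Sum>j\<in>(UNIV::'d set). C * (norm \<xi> * norm \<eta>))"
  proof (intro sum_mono)
    fix i j
    have "\<bar>M $ i $ j\<bar> * (\<bar>\<xi> $ i\<bar> * \<bar>\<eta> $ j\<bar>) \<le> C * (norm \<xi> * norm \<eta>)"
      using assms[of i j] component_le_norm_cart[of \<xi> i] component_le_norm_cart[of \<eta> j]
      by (intro mult_mono) auto
    then show "\<bar>M $ i $ j * \<xi> $ i * \<eta> $ j\<bar> \<le> C * (norm \<xi> * norm \<eta>)" by (simp add: abs_mult mult.assoc)
  qed
  finally show ?thesis by (simp add: power2_eq_square mult_ac)
qed

section \<open>Interior equicontinuity for bounded solutions\<close>

context exhausted_op
begin

lemma matrix_bounded_on_En: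
  fixes M :: "real^'d \<Rightarrow> real^'d^'d"
  assumes "\<And>i j. continuous_on E (\<lambda>x. M x $ i $ j)"
  obtains C where "0 < C" "\<And>x \<xi> \<eta>. x \<in> closure (En n) \<Longrightarrow> \<bar>\<xi> \<bullet> (M x *v \<eta>)\<bar> \<le> C * (norm \<xi> * norm \<eta>)"
proof -
  have "\<forall>i j. \<exists>C>0. \<forall>x\<in>closure (En n). \<bar>M x $ i $ j\<bar> \<le> C"
    using bounded_on_En[OF assms, of n] by metis
  then obtain C where C: "\<And>i j. 0 < C i j" "\<And>i j x. x \<in> closure (En n) \<Longrightarrow> \<bar>M x $ i $ j\<bar> \<le> C i j" by metis
  define C' where "C' = (\<Sum>i\<in>UNIV. \<Sum>j\<in>UNIV. C i j)"
  have le: "C i j \<le> C'" for i j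
  proof -
    have "C i j \<le> (\<Sum>j\<in>UNIV. C i j)" using C(1) by (intro member_le_sum) (auto intro: less_imp_le)
    also have "\<dots> \<le> C'" unfolding C'_def using C(1)
      by (intro member_le_sum[where f="\<lambda>i. \<Sum>j\<in>UNIV. C i j"]) (auto intro: sum_nonneg less_imp_le)
    finally show ?thesis .
  qed
  have C': "0 < C'" using C(1)[of undefined undefined] le[of undefined undefined] by linarith
  show ?thesis
  proof (rule that)
    show "0 < C' * (real CARD('d))\<^sup>2" using C' by simp
    show "\<bar>\<xi> \<bullet> (M x *v \<eta>)\<bar> \<le> C' * (real CARD('d))\<^sup>2 * (norm \<xi> * norm \<eta>)"
      if "x \<in> closure (En n)" for x \<xi> \<eta>
      using C(2)[OF that] le order_trans by (intro bilinear_bound) blast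
  qed
qed

lemma vector_bounded_on_En:
  fixes b :: "real^'d \<Rightarrow> real^'d"
  assumes "\<And>i. continuous_on E (\<lambda>x. b x $ i)"
  obtains C where "0 < C" "\<And>x \<xi>. x \<in> closure (En n) \<Longrightarrow> \<bar>b x \<bullet> \<xi>\<bar> \<le> C * norm \<xi>"
proof -
  have "continuous_on E (\<lambda>x. norm (b x))"
    unfolding norm_eq_sqrt_inner inner_vec_def by (intro continuous_intros assms)
  then obtain C where C: "0 < C" "\<And>x. x \<in> closure (En n) \<Longrightarrow> \<bar>norm (b x)\<bar> \<le> C"
    using bounded_on_En by blast
  show ?thesis
  proof (rule that[OF C(1)])
    show "\<bar>b x \<bullet> \<xi>\<bar> \<le> C * norm \<xi>" if "x \<in> closure (En n)" for x \<xi>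
      using Cauchy_Schwarz_ineq2[of "b x" \<xi>] mult_right_mono[of "norm (b x)" C "norm \<xi>"] C(2)[OF that] by simp
  qed
qed

lemma matrix_unif_cont:
  fixes M :: "real^'d \<Rightarrow> real^'d^'d"
  assumes M: "\<And>i j. continuous_on E (\<lambda>x. M x $ i $ j)" and "0 < \<epsilon>"
  obtains d where "0 < d" "\<And>x y \<xi>. x \<in> closure (En n) \<Longrightarrow> y \<in> closure (En n) \<Longrightarrow> dist x y < d \<Longrightarrow>
     \<bar>\<xi> \<bullet> ((M x - M y) *v \<xi>)\<bar> \<le> \<epsilon> * (norm \<xi>)\<^sup>2"
proof -
  define \<epsilon>' where "\<epsilon>' = \<epsilon> / (real CARD('d))\<^sup>2"
  have \<epsilon>': "0 < \<epsilon>'" using \<open>0 < \<epsilon>\<close> by (simp add: \<epsilon>'_def)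
  have "uniformly_continuous_on (closure (En n)) (\<lambda>x. M x $ i $ j)" for i j
    using compact_uniformly_continuous[OF continuous_on_subset[OF M closure_En_subset] compact_closure_En] .
  then have "\<forall>i j. \<exists>d>0. \<forall>y\<in>closure (En n). \<forall>x\<in>closure (En n). dist x y < d \<longrightarrow> \<bar>M x $ i $ j - M y $ i $ j\<bar> < \<epsilon>'"
    unfolding uniformly_continuous_on_def dist_real_def using \<epsilon>' by blast
  then obtain d where "\<forall>i j. 0 < d i j \<and>
    (\<forall>y\<in>closure (En n). \<forall>x\<in>closure (En n). dist x y < d i j \<longrightarrow> \<bar>M x $ i $ j - M y $ i $ j\<bar> < \<epsilon>')"
    by metis
  then have d: "\<And>i j. 0 < d i j"
    "\<And>i j x y. x \<in> closure (En n) \<Longrightarrow> y \<in> closure (En n) \<Longrightarrow> dist x y < d i j \<Longrightarrow> \<bar>M x $ i $ j - M y $ i $ j\<bar> < \<epsilon>'"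
    by blast+
  define d' where "d' = Min (range (\<lambda>(i, j). d i j))"
  have d': "0 < d'" "d' \<le> d i j" for i j
    unfolding d'_def using d(1) by (auto intro!: Min_le)
  show ?thesis
  proof (rule that[OF d'(1)])
    fix x y \<xi> assume xy: "x \<in> closure (En n)" "y \<in> closure (En n)" "dist x y < d'"
    have "\<bar>(M x - M y) $ i $ j\<bar> \<le> \<epsilon>'" for i j
      using d(2)[OF xy(1,2), of i j] d'(2)[of i j] xy(3) by simp
    then show "\<bar>\<xi> \<bullet> ((M x - M y) *v \<xi>)\<bar> \<le> \<epsilon> * (norm \<xi>)\<^sup>2"
      using bilinear_bound[of "M x - M y" \<epsilon>' \<xi> \<xi>] by (simp add: \<epsilon>'_def power2_eq_square)
  qed
qed

lemma cball_in_En: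
  obtains r where "0 < r" "\<And>x. x \<in> closure (En n) \<Longrightarrow> cball x r \<subseteq> En (Suc n)"
proof -
  obtain r where r: "0 < r" "(\<Union>x\<in>closure (En n). cball x r) \<subseteq> En (Suc n)"
    by (rule compact_subset_open_imp_cball_epsilon_subset[OF compact_closure_En[of n] En_open[of "Suc n"] En_closure])
  show ?thesis
  proof (rule that[OF r(1)])
    show "cball x r \<subseteq> En (Suc n)" if "x \<in> closure (En n)" for x
      using r(2) that by (meson UN_upper order_trans)
  qed
qed

text \<open>A Hoelder modulus of exponent 1/2 in space which depends on the solution only through
  its bound \<open>M\<close>, and is therefore uniform in \<open>T\<close>. The quadratic term is
  harmless: at a doubled maximum the squared gradient is of order \<open>l\<close>, the same order
  as the second order gain.\<close>

lemma local_equicontinuity: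
  fixes u :: "real \<Rightarrow> real^'d \<Rightarrow> real" and b :: "real^'d \<Rightarrow> real^'d"
  assumes c: "0 < c" "\<And>x \<xi>. x \<in> En (Suc N) \<Longrightarrow> c * (norm \<xi>)\<^sup>2 \<le> \<xi> \<bullet> (A x *v \<xi>)"
    and b: "\<And>i. continuous_on E (\<lambda>x. b x $ i)"
    and u_C2: "\<And>t. 0 < t \<Longrightarrow> Ck_on E 2 (u t)"
    and u_der: "\<And>t x. 0 < t \<Longrightarrow> x \<in> E \<Longrightarrow> ((\<lambda>s. u s x) has_real_derivative
        (1/2 * mdot (A x) (hess (u t) x) + b x \<bullet> grad (u t) x + 1/2 * (grad (u t) x \<bullet> (Abar x *v grad (u t) x)))) (at t)"
    and u_cont: "continuous_on ({0..} \<times> E) (\<lambda>p. u (fst p) (snd p))"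
    and u_bd: "\<And>t x. 0 \<le> t \<Longrightarrow> x \<in> closure (En (Suc N)) \<Longrightarrow> \<bar>u t x\<bar> \<le> M"
    and \<epsilon>: "0 < \<epsilon>"
  obtains r where "0 < r" "\<And>T z y. 2 \<le> T \<Longrightarrow> z \<in> closure (En N) \<Longrightarrow> norm (z - y) \<le> r \<Longrightarrow> u T z - u T y \<le> \<epsilon>"
proof -
  let ?K = "closure (En (Suc N))"
  \<comment> \<open>More than the oscillation of \<open>u\<close>. Each of the three penalties is
    scaled to reach \<open>P\<close> at the edge of its region, so that a positive value of \<Phi>
    forces the maximum into the interior or onto the final time.\<close>
  define P where "P = 2 * M + 1"
  have M0: "0 \<le> M" using u_bd[of 0 x0] x0[of "Suc N"] closure_subset by force
  have P: "1 \<le> P" using M0 by (simp add: P_def)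
  define d where "d = real CARD('d)"
  have d1: "1 \<le> d" unfolding d_def by (simp add: Suc_leI)
  define \<epsilon>1 where "\<epsilon>1 = c / (16 * d)"
  have \<epsilon>1: "0 < \<epsilon>1" "\<epsilon>1 \<le> c / 2" "16 * \<epsilon>1 * d \<le> c" using c(1) d1 by (auto simp: \<epsilon>1_def field_simps)
  obtain \<rho>1 where \<rho>1: "0 < \<rho>1" "\<And>x. x \<in> closure (En N) \<Longrightarrow> cball x \<rho>1 \<subseteq> En (Suc N)" using cball_in_En by blast
  obtain \<rho>2 where \<rho>2: "0 < \<rho>2" "\<And>x y \<xi>. x \<in> ?K \<Longrightarrow> y \<in> ?K \<Longrightarrow> dist x y < \<rho>2 \<Longrightarrow> \<bar>\<xi> \<bullet> ((A x - A y) *v \<xi>)\<bar> \<le> \<epsilon>1 * (norm \<xi>)\<^sup>2"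
    using matrix_unif_cont[OF A_cont \<epsilon>1(1)] by blast
  \<comment> \<open>The variation of \<open>Abar\<close> multiplies a squared gradient of size at
    most l P / 4, hence the division by \<open>P\<close>.\<close>
  have "0 < c / (2 * P)" using c(1) P by simp
  then obtain \<rho>3 where \<rho>3: "0 < \<rho>3" "\<And>x y \<xi>. x \<in> ?K \<Longrightarrow> y \<in> ?K \<Longrightarrow> dist x y < \<rho>3 \<Longrightarrow> \<bar>\<xi> \<bullet> ((Abar x - Abar y) *v \<xi>)\<bar> \<le> c / (2 * P) * (norm \<xi>)\<^sup>2"
    using matrix_unif_cont[OF Abar_cont] by blast
  obtain Ca where Ca: "0 < Ca" "\<And>x \<xi> \<eta>. x \<in> ?K \<Longrightarrow> \<bar>\<xi> \<bullet> (Abar x *v \<eta>)\<bar> \<le> Ca * (norm \<xi> * norm \<eta>)"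
    using matrix_bounded_on_En[OF Abar_cont] by blast
  obtain Cb where Cb: "0 < Cb" "\<And>x \<xi>. x \<in> ?K \<Longrightarrow> \<bar>b x \<bullet> \<xi>\<bar> \<le> Cb * norm \<xi>"
    using vector_bounded_on_En[OF b] by blast
  obtain Ct where Ct: "0 < Ct" "\<And>x. x \<in> ?K \<Longrightarrow> \<bar>trace (A x)\<bar> \<le> Ct"
  proof -
    have "continuous_on E (\<lambda>x. trace (A x))" unfolding trace_def by (intro continuous_intros A_cont)
    then show ?thesis using bounded_on_En that by blast
  qed
  define R where "R = min 1 (min (\<rho>1 / 2) (min (\<rho>2 / 3) (\<rho>3 / 3)))"
  have R: "0 < R" "R \<le> 1" "2 * R \<le> \<rho>1" "2 * R < \<rho>2" "2 * R < \<rho>3" using \<rho>1 \<rho>2 \<rho>3 by (auto simp: R_def min_def)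
  define K where "K = P / R\<^sup>2"
  have K: "0 < K" using P R by (simp add: K_def)
  define C3 where "C3 = K * Ct + K * c / 4 + 2 * Cb * K + 2 * Ca * K\<^sup>2"
  have C3: "0 < C3" using K Ct c Cb Ca by (simp add: C3_def add_pos_pos)
  \<comment> \<open>The last two bounds keep the lower order terms below c l / 16 and make the
    remaining c l / 16 exceed C3 + P.\<close>
  define r0 where "r0 = min (min R 1) (min (c / (16 * (Cb + Ca * K))) (c * P / (16 * (C3 + P))))"
  have CbCa: "0 < Cb + Ca * K" using Cb Ca K by (simp add: add_pos_pos)
  have r0: "0 < r0" "r0 \<le> R" "r0 \<le> 1" "r0 * (Cb + Ca * K) \<le> c / 16" "16 * (C3 + P) * r0 \<le> c * P"
  proof -
    show "0 < r0" "r0 \<le> R" "r0 \<le> 1" using R c P C3 CbCa by (auto simp: r0_def)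
    have "r0 \<le> c / (16 * (Cb + Ca * K))" "r0 \<le> c * P / (16 * (C3 + P))" by (auto simp: r0_def)
    then show "r0 * (Cb + Ca * K) \<le> c / 16" "16 * (C3 + P) * r0 \<le> c * P"
      using CbCa C3 P by (auto simp: field_simps)
  qed
  define Lc where "Lc = P / sqrt r0"
  have Lc: "0 < Lc" using P r0 by (simp add: Lc_def)
  have main: "u T z - u T y1 \<le> Lc * sqrt (norm (z - y1))"
    if T: "2 \<le> T" and z: "z \<in> closure (En N)" and y1: "norm (z - y1) \<le> r0" for T z y1
  proof (rule ccontr)
    assume neg: "\<not> ?thesis"
    define \<Phi> where "\<Phi> t x y = u t x - u t y - Lc * sqrt (norm (x - y)) - K * (norm (x - z))\<^sup>2 - P * (T - t)" for t x y
    \<comment> \<open>The ball for \<open>y\<close> follows from the conditions on \<open>x\<close>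
      and x - y, as r0 \<le> R; listing it makes \<open>D\<close> visibly compact.\<close>
    define D where "D = ({T - 1..T} \<times> cball z R \<times> cball z (2 * R)) \<inter> {(t, x, y). norm (x - y) \<le> r0}"
    have inK: "cball z (2 * R) \<subseteq> En (Suc N)" using \<rho>1(2)[OF z] R(3) by auto
    then have inE: "cball z (2 * R) \<subseteq> E" and inK': "cball z (2 * R) \<subseteq> ?K" using En_subset closure_subset by blast+
    have "closed {(t :: real, x, y). norm (x - y :: real^'d) \<le> r0}"
      unfolding case_prod_beta by (intro closed_Collect_le continuous_intros)
    then have compD: "compact D" unfolding D_def by (intro compact_Int_closed compact_Times) auto
    have sub: "(\<lambda>p. (fst p, fst (snd p))) ` D \<subseteq> {0..} \<times> E" "(\<lambda>p. (fst p, snd (snd p))) ` D \<subseteq> {0..} \<times> E"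
      using T inE R by (auto simp: D_def subset_iff)
    have "continuous_on D (\<lambda>p. (fst p, fst (snd p)))" "continuous_on D (\<lambda>p. (fst p, snd (snd p)))"
      by (intro continuous_intros)+
    from continuous_on_compose2[OF u_cont this(1) sub(1)] continuous_on_compose2[OF u_cont this(2) sub(2)]
    have ctD: "continuous_on D (\<lambda>p. u (fst p) (fst (snd p)))" "continuous_on D (\<lambda>p. u (fst p) (snd (snd p)))"
      by simp_all
    have contD: "continuous_on D (\<lambda>p. \<Phi> (fst p) (fst (snd p)) (snd (snd p)))"
      unfolding \<Phi>_def by (intro continuous_intros ctD)
    have pD: "(T, z, y1) \<in> D" using y1 r0 R by (auto simp: D_def dist_norm)
    obtain p where p: "p \<in> D" "\<And>q. q \<in> D \<Longrightarrow> \<Phi> (fst q) (fst (snd q)) (snd (snd q)) \<le> \<Phi> (fst p) (fst (snd p)) (snd (snd p))"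
      using continuous_attains_sup[OF compD _ contD] pD by blast
    define t x y where "t = fst p" and "x = fst (snd p)" and "y = snd (snd p)"
    define r where "r = norm (x - y)"
    have max: "\<Phi> s x' y' \<le> \<Phi> t x y" if "(s, x', y') \<in> D" for s x' y'
      using p(2)[OF that] by (simp add: t_def x_def y_def)
    have in_D: "T - 1 \<le> t" "t \<le> T" "norm (x - z) \<le> R" "norm (y - z) \<le> 2 * R" "r \<le> r0" "x \<in> cball z (2 * R)" "y \<in> cball z (2 * R)"
      using p(1) R by (auto simp: D_def t_def x_def y_def r_def dist_norm norm_minus_commute)
    have pos: "0 < \<Phi> t x y" using max[OF pD] neg by (simp add: \<Phi>_def)
    have xyK: "x \<in> ?K" "y \<in> ?K" "x \<in> E" "y \<in> E" "z \<in> ?K"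
      using in_D inK' inE R by (auto simp: subset_iff)
    have u2M: "u t x - u t y < P" using u_bd[of t x] u_bd[of t y] xyK in_D T by (simp add: P_def)
    have nn: "0 \<le> Lc * sqrt (norm (x - y))" "0 \<le> K * (norm (x - z))\<^sup>2" "0 \<le> P * (T - t)"
      using Lc K P in_D by auto
    have t_gt: "T - 1 < t"
    proof (rule ccontr)
      assume "\<not> T - 1 < t"
      then have "t = T - 1" using in_D by simp
      then have "P * (T - t) = P" by simp
      then show False using pos u2M nn by (simp add: \<Phi>_def)
    qed
    have x_lt: "norm (x - z) < R"
    proof (rule ccontr)
      assume "\<not> norm (x - z) < R"
      then have "K * (norm (x - z))\<^sup>2 = P" using in_D R by (simp add: K_def)
      then show False using pos u2M nn by (simp add: \<Phi>_def)
    qed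
    have r_lt: "r < r0"
    proof (rule ccontr)
      assume "\<not> r < r0"
      then have "Lc * sqrt (norm (x - y)) = P" using in_D r0 by (simp add: Lc_def r_def)
      then show False using pos u2M nn by (simp add: \<Phi>_def)
    qed
    have ne: "x \<noteq> y" using pos nn by (auto simp: \<Phi>_def)
    then have r: "0 < r" by (simp add: r_def)
    define \<rho> where "\<rho> = min (R - norm (x - z)) ((r0 - r) / 2)"
    have \<rho>: "0 < \<rho>" using x_lt r_lt by (simp add: \<rho>_def)
    have near: "(t, x', y') \<in> D" if "x' \<in> ball x \<rho>" "y' \<in> ball y \<rho>" for x' y'
    proof -
      have a: "norm (x' - x) < R - norm (x - z)" "norm (x' - x) < (r0 - r) / 2" "norm (y' - y) < (r0 - r) / 2"
        using that by (auto simp: \<rho>_def dist_norm norm_minus_commute)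
      have "norm (x' - z) \<le> norm (x' - x) + norm (x - z)" using norm_triangle_ineq[of "x' - x" "x - z"] by simp
      then have 1: "norm (x' - z) \<le> R" using a by simp
      have "x' - y' = (x' - x) + (x - y) - (y' - y)" by simp
      then have "norm (x' - y') \<le> norm ((x' - x) + (x - y)) + norm (y' - y)"
        by (metis norm_triangle_ineq4)
      moreover have "norm ((x' - x) + (x - y)) \<le> norm (x' - x) + r"
        unfolding r_def by (rule norm_triangle_ineq)
      ultimately have "norm (x' - y') \<le> norm (x' - x) + r + norm (y' - y)" by linarith
      then have 2: "norm (x' - y') \<le> r0" using a by simp
      have "norm (y' - z) \<le> norm (x' - z) + norm (x' - y')" using norm_triangle_ineq4[of "x' - z" "x' - y'"] by simp
      then have "norm (y' - z) \<le> 2 * R" using 1 2 r0 by simp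
      then show ?thesis using 1 2 in_D by (auto simp: D_def dist_norm norm_minus_commute)
    qed
    have t0: "0 < t" using t_gt T by simp
    have max': "u t x' - u t y' - Lc * sqrt (norm (x' - y')) - K * (norm (x' - z))\<^sup>2
      \<le> u t x - u t y - Lc * sqrt (norm (x - y)) - K * (norm (x - z))\<^sup>2"
      if "x' \<in> ball x \<rho>" "y' \<in> ball y \<rho>" for x' y'
      using max[OF near[OF that]] by (simp add: \<Phi>_def)
    define l where "l = Lc / (r * sqrt r)"
    define e where "e = (1 / r) *\<^sub>R (x - y)"
    define m where "m = x - y"
    define X Y where "X = hess (u t) x" and "Y = hess (u t) y"
    note dm = doubling_max[OF openE u_C2[OF t0] xyK(3,4) ne \<rho> Lc max', folded r_def, folded l_def e_def m_def X_def Y_def]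
    have l: "0 < l" using Lc r by (simp add: l_def)
    have second: "mdot (A x) X - mdot (A y) Y \<le> - (3/8) * c * l + 2 * K * Ct + K * c / 2"
    proof (rule doubling_second_order[where Az="A z" and \<epsilon>=\<epsilon>1 and e=e])
      show "transpose (A x) = A x" "transpose (A y) = A y" "transpose (A z) = A z"
        using A_psd xyK closure_En_subset by (auto simp: psd_def)
      show "c * (norm \<xi>)\<^sup>2 \<le> \<xi> \<bullet> (A z *v \<xi>)" for \<xi>
        using c(2)[of z \<xi>] En_closure[of N] z by auto
      have "dist x z < \<rho>2" "dist y z < \<rho>2" using in_D R by (auto simp: dist_norm)
      then show "\<bar>\<xi> \<bullet> ((A x - A z) *v \<xi>)\<bar> \<le> \<epsilon>1 * (norm \<xi>)\<^sup>2" "\<bar>\<xi> \<bullet> ((A y - A z) *v \<xi>)\<bar> \<le> \<epsilon>1 * (norm \<xi>)\<^sup>2" for \<xi>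
        using \<rho>2(2) xyK by auto
      show "norm e = 1" using r by (simp add: e_def r_def)
      show "trace (A z) \<le> Ct" using Ct(2)[OF xyK(5)] by simp
    qed (use \<epsilon>1 l K dm in \<open>auto simp: d_def\<close>)
    define p q where "p = (l / 2) *\<^sub>R m" and "q = (2 * K) *\<^sub>R (x - z)"
    have np: "norm p = l / 2 * r" using l by (simp add: p_def m_def r_def)
    have nq: "norm q \<le> 2 * K" using K x_lt R by (simp add: q_def)
    \<comment> \<open>The product l r^2 is the penalty term Lc sqrt r, hence at most
      \<open>P\<close>.\<close>
    have np2: "(norm p)\<^sup>2 \<le> l / 4 * P"
    proof -
      have "l * r\<^sup>2 = Lc * sqrt r" using r by (simp add: l_def power2_eq_square field_simps real_sqrt_mult_self)
      also have "\<dots> \<le> Lc * sqrt r0" using r_lt Lc by (intro mult_left_mono) auto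
      also have "\<dots> = P" using r0 by (simp add: Lc_def)
      finally have "l / 4 * (l * r\<^sup>2) \<le> l / 4 * P" using l by (intro mult_left_mono) auto
      then show ?thesis by (simp add: np power2_eq_square mult_ac)
    qed
    have gx: "grad (u t) x = p + q" and gy: "grad (u t) y = p" using dm(1,2) by (auto simp: p_def q_def)
    have npl: "norm p \<le> l / 2 * r0" using np l r_lt by simp
    have drift: "b x \<bullet> (p + q) - b y \<bullet> p \<le> l * (r0 * Cb) + 2 * Cb * K"
    proof -
      have "b x \<bullet> (p + q) - b y \<bullet> p = b x \<bullet> p + b x \<bullet> q - b y \<bullet> p" by (simp add: inner_add_right)
      also have "\<dots> \<le> Cb * norm p + Cb * norm q + Cb * norm p"
        using Cb(2)[OF xyK(1), of p] Cb(2)[OF xyK(1), of q] Cb(2)[OF xyK(2), of p] by linarith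
      also have "\<dots> \<le> Cb * (l / 2 * r0) + Cb * (2 * K) + Cb * (l / 2 * r0)"
        using npl nq Cb(1) by (intro add_mono mult_left_mono) auto
      finally show ?thesis by (simp add: algebra_simps)
    qed
    have quad: "(p + q) \<bullet> (Abar x *v (p + q)) - p \<bullet> (Abar y *v p) \<le> c * l / 8 + 2 * (l * (r0 * (Ca * K))) + 4 * Ca * K\<^sup>2"
    proof -
      have "(p + q) \<bullet> (Abar x *v (p + q)) - p \<bullet> (Abar y *v p)
         = p \<bullet> ((Abar x - Abar y) *v p) + 2 * (p \<bullet> (Abar x *v q)) + q \<bullet> (Abar x *v q)"
        by (simp add: quad_add[OF Abar_sym[OF xyK(3)]] diff_quad)
      also have "\<dots> \<le> c / (2 * P) * (norm p)\<^sup>2 + 2 * (Ca * (norm p * norm q)) + Ca * (norm q * norm q)"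
      proof -
        have "norm (x - y) \<le> R" using in_D r0 unfolding r_def by simp
        then have "dist x y < \<rho>3" using R by (simp add: dist_norm)
        then show ?thesis
          using \<rho>3(2)[OF xyK(1,2), of p] Ca(2)[OF xyK(1), of p q] Ca(2)[OF xyK(1), of q q] by linarith
      qed
      also have "\<dots> \<le> c / (2 * P) * (l / 4 * P) + 2 * (Ca * ((l / 2 * r0) * (2 * K))) + Ca * ((2 * K) * (2 * K))"
        using np2 npl nq Ca(1) c(1) P l r0(1) K by (intro add_mono mult_left_mono mult_mono) auto
      finally show ?thesis using P by (simp add: power2_eq_square algebra_simps)
    qed
    define ux uy where "ux = 1/2 * mdot (A x) X + b x \<bullet> (p + q) + 1/2 * ((p + q) \<bullet> (Abar x *v (p + q)))"
      and "uy = 1/2 * mdot (A y) Y + b y \<bullet> p + 1/2 * (p \<bullet> (Abar y *v p))"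
    have dux: "((\<lambda>s. u s x) has_real_derivative ux) (at t)" and duy: "((\<lambda>s. u s y) has_real_derivative uy) (at t)"
      using u_der[OF t0 xyK(3)] u_der[OF t0 xyK(4)] by (auto simp: ux_def uy_def X_def Y_def gx gy)
    have "((\<lambda>s. - \<Phi> s x y) has_real_derivative - (ux - uy + P)) (at t)"
      unfolding \<Phi>_def by (auto intro!: derivative_eq_intros dux duy)
    then have "- (ux - uy + P) \<le> 0"
    proof (rule deriv_nonpos_of_left_min[OF _ t_gt])
      show "- \<Phi> t x y \<le> - \<Phi> s x y" if "T - 1 < s" "s < t" for s
        using max[of s x y] that in_D p(1) by (auto simp: D_def dist_norm norm_minus_commute r_def)
    qed
    moreover have "ux - uy \<le> - (1/16) * c * l + C3"
    proof -
      have "ux - uy = 1/2 * (mdot (A x) X - mdot (A y) Y) + (b x \<bullet> (p + q) - b y \<bullet> p)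
          + 1/2 * ((p + q) \<bullet> (Abar x *v (p + q)) - p \<bullet> (Abar y *v p))" by (simp add: ux_def uy_def algebra_simps)
      also have "\<dots> \<le> 1/2 * (- (3/8) * c * l + 2 * K * Ct + K * c / 2) + (l * (r0 * Cb) + 2 * Cb * K)
          + 1/2 * (c * l / 8 + 2 * (l * (r0 * (Ca * K))) + 4 * Ca * K\<^sup>2)"
        using second drift quad by (intro add_mono mult_left_mono) auto
      also have "\<dots> = - (1/8) * c * l + l * (r0 * (Cb + Ca * K)) + C3" by (simp add: C3_def algebra_simps)
      also have "l * (r0 * (Cb + Ca * K)) \<le> l * (c / 16)" using r0(4) l by (intro mult_left_mono) auto
      finally show ?thesis by simp
    qed
    \<comment> \<open>A small distance makes \<open>l\<close> large, of order at least P / r0^2; the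
      choice of \<open>r0\<close> concludes.\<close>
    moreover have "C3 + P < 1/16 * c * l"
    proof -
      have "r * sqrt r \<le> r0 * sqrt r0" using r r_lt by (intro mult_mono) auto
      then have "P / r0\<^sup>2 \<le> Lc / (r0 * sqrt r0)" using r0 by (simp add: Lc_def power2_eq_square field_simps)
      also have "\<dots> \<le> l" unfolding l_def using Lc r r0(1) \<open>r * sqrt r \<le> _\<close> by (intro divide_left_mono) auto
      finally have Pl: "P / r0\<^sup>2 \<le> l" .
      have "16 * (C3 + P) * r0\<^sup>2 \<le> 16 * (C3 + P) * r0"
        using r0 C3 P by (intro mult_left_mono) (auto simp: power2_eq_square mult_left_le)
      then have "16 * (C3 + P) * r0\<^sup>2 \<le> c * P" using r0(5) by linarith
      then have "16 * (C3 + P) \<le> c * (P / r0\<^sup>2)" using r0(1) by (simp add: field_simps)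
      also have "\<dots> \<le> c * l" using Pl c(1) by (intro mult_left_mono) auto
      finally have le: "C3 + P \<le> 1/16 * c * l" by simp
      have "r * sqrt r < r0 * sqrt r0" using r r_lt by (intro mult_strict_mono) auto
      then have "Lc / (r0 * sqrt r0) < l" unfolding l_def using Lc r r0(1) by (intro divide_strict_left_mono) auto
      then have "P / r0\<^sup>2 < l" using \<open>P / r0\<^sup>2 \<le> Lc / _\<close> by simp
      then have "c * (P / r0\<^sup>2) < c * l" using c(1) by (intro mult_strict_left_mono) auto
      then show ?thesis using \<open>16 * (C3 + P) \<le> c * (P / r0\<^sup>2)\<close> by simp
    qed
    ultimately show False by simp
  qed
  define r where "r = min r0 ((\<epsilon> / Lc)\<^sup>2)"
  show ?thesis
  proof (rule that[of r])
    show "0 < r" using r0 Lc \<epsilon> by (simp add: r_def)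
    fix T :: real and z y assume H: "2 \<le> T" "z \<in> closure (En N)" "norm (z - y) \<le> r"
    have "sqrt (norm (z - y)) \<le> sqrt ((\<epsilon> / Lc)\<^sup>2)" using H(3) by (intro real_sqrt_le_mono) (auto simp: r_def)
    also have "\<dots> = \<epsilon> / Lc" using Lc \<epsilon> by simp
    finally have "Lc * sqrt (norm (z - y)) \<le> \<epsilon>" using Lc by (simp add: field_simps)
    then show "u T z - u T y \<le> \<epsilon>" using main[OF H(1,2), of y] H(3) by (simp add: r_def)
  qed
qed

end

section \<open>Spreading of positivity and convergence\<close>

context exhausted_op
begin

text \<open>The origin of the decay rate of the barrier. Near the edge of the ball, where
  \<open>G\<close> is small, ellipticity alone wins; in the interior the term in G^2 has to absorb
  \<open>C * G\<close>. The coefficient comes from completing the square.\<close>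

lemma barrier_quadratic:
  fixes a c C G :: real
  assumes "0 < a" "0 < c" "0 \<le> C"
  shows "C * G < 4 * a * c * (1 - G) + (C + 4 * a * c)\<^sup>2 / (4 * a * c) * G\<^sup>2"
proof -
  define p where "p = 4 * a * c"
  define B' where "B' = C + p"
  have p: "0 < p" using assms by (simp add: p_def)
  have "0 < p\<^sup>2 * (3/4) + (B' * G - p / 2)\<^sup>2" using p by (simp add: add_pos_nonneg)
  then have "0 < p * p - B' * G * p + B'\<^sup>2 * G\<^sup>2" by (simp add: power2_eq_square algebra_simps)
  then have "0 < (p * p - B' * G * p + B'\<^sup>2 * G\<^sup>2) / p" using p by simp
  also have "\<dots> = p - B' * G + B'\<^sup>2 / p * G\<^sup>2" using p by (simp add: field_simps)
  finally show ?thesis unfolding B'_def p_def[symmetric] by (simp add: algebra_simps)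
qed

text \<open>The barrier is \<open>exp (- k (t - T)) (1 - |x - y(t)|\<^sup>2 / r\<^sup>2)\<^sup>2\<close> in a ball moving at speed at most \<open>S\<close>.\<close>

lemma moving_barrier:
  fixes u u' :: "real \<Rightarrow> real^'d \<Rightarrow> real" and b :: "real^'d \<Rightarrow> real^'d"
  assumes b: "\<And>i. continuous_on E (\<lambda>x. b x $ i)"
    and u_C2: "\<And>t. 0 < t \<Longrightarrow> Ck_on E 2 (u t)"
    and u_der: "\<And>t x. 0 < t \<Longrightarrow> x \<in> E \<Longrightarrow> ((\<lambda>s. u s x) has_real_derivative u' t x) (at t)"
    and u_super: "\<And>t x. 0 < t \<Longrightarrow> x \<in> E \<Longrightarrow> 1/2 * mdot (A x) (hess (u t) x) + b x \<bullet> grad (u t) x \<le> u' t x"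
    and u_cont: "continuous_on ({0..} \<times> E) (\<lambda>p. u (fst p) (snd p))"
    and r: "0 < r" and S: "0 \<le> S"
  shows "\<exists>k. \<forall>T \<tau> y0 W m \<rho>. 0 \<le> T \<longrightarrow> 0 \<le> \<tau> \<longrightarrow> norm W \<le> S \<longrightarrow> 0 < \<rho> \<longrightarrow>
     (\<forall>s\<in>{0..\<tau>}. cball (y0 + s *\<^sub>R W) r \<subseteq> En N) \<longrightarrow>
     (\<forall>t\<in>{T..T + \<tau>}. \<forall>x\<in>En N. m \<le> u t x) \<longrightarrow>
     (\<forall>x\<in>cball y0 r. m + \<rho> \<le> u T x) \<longrightarrow>
     (\<forall>x\<in>cball (y0 + \<tau> *\<^sub>R W) r. m + \<rho> * exp (- k * \<tau>) * (1 - (norm (x - (y0 + \<tau> *\<^sub>R W)))\<^sup>2 / r\<^sup>2)\<^sup>2 \<le> u (T + \<tau>) x)"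
proof -
  obtain c where c: "0 < c" "\<And>x \<xi>. x \<in> En N \<Longrightarrow> c * (norm \<xi>)\<^sup>2 \<le> \<xi> \<bullet> (A x *v \<xi>)" using elliptic[of N] by blast
  obtain Cb where Cb: "0 < Cb" "\<And>x \<xi>. x \<in> closure (En N) \<Longrightarrow> \<bar>b x \<bullet> \<xi>\<bar> \<le> Cb * norm \<xi>"
    by (rule vector_bounded_on_En[OF b, of N]) auto
  have trc: "continuous_on E (\<lambda>x. trace (A x))" unfolding trace_def by (intro continuous_intros A_cont)
  obtain Ct where Ct: "0 < Ct" "\<And>x. x \<in> closure (En N) \<Longrightarrow> \<bar>trace (A x)\<bar> \<le> Ct"
    by (rule bounded_on_En[OF trc, of N]) auto
  define a where "a = 1 / r\<^sup>2"
  have a: "0 < a" "a * r\<^sup>2 = 1" using r by (auto simp: a_def)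
  \<comment> \<open>The contributions of the motion, of the trace of \<open>A\<close> and of the
    drift, all of first order in \<open>G\<close>.\<close>
  define C where "C = 4 * a * (r * S) + 2 * a * Ct + 4 * a * (Cb * r)"
  have C: "0 \<le> C" using a r S Ct Cb by (simp add: C_def)
  \<comment> \<open>Fixed before the starting time, the path and the heights are given; the gain is
    thus uniform in \<open>T\<close>.\<close>
  define k where "k = (C + 4 * a * c)\<^sup>2 / (4 * a * c)"
  show ?thesis
  proof (intro exI[of _ k] allI impI ballI)
    fix T \<tau> :: real and y0 W :: "real^'d" and m \<rho> :: real and x :: "real^'d"
    assume T: "0 \<le> T" and \<tau>: "0 \<le> \<tau>" and W: "norm W \<le> S" and \<rho>: "0 < \<rho>"
      and tube': "\<forall>s\<in>{0..\<tau>}. cball (y0 + s *\<^sub>R W) r \<subseteq> En N"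
      and low': "\<forall>t\<in>{T..T + \<tau>}. \<forall>x\<in>En N. m \<le> u t x"
      and init': "\<forall>x\<in>cball y0 r. m + \<rho> \<le> u T x"
      and x: "x \<in> cball (y0 + \<tau> *\<^sub>R W) r"
    have tube: "cball (y0 + s *\<^sub>R W) r \<subseteq> En N" if "0 \<le> s" "s \<le> \<tau>" for s using tube' that by auto
    have low: "m \<le> u t x" if "T \<le> t" "t \<le> T + \<tau>" "x \<in> En N" for t x using low' that by auto
    have init: "m + \<rho> \<le> u T x" if "x \<in> cball y0 r" for x using init' that by auto
    define y where "y t = y0 + (t - T) *\<^sub>R W" for t
    define G where "G t x = 1 - a * (norm (x - y t))\<^sup>2" for t x
    define w where "w t x = \<rho> * exp (- k * (t - T)) * (G t x)\<^sup>2" for t x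
    have "m + w (T + \<tau>) x \<le> u (T + \<tau>) x"
    proof (rule ccontr)
      assume neg: "\<not> ?thesis"
      define D where "D = ({T..T + \<tau>} \<times> cball y0 (r + \<tau> * S)) \<inter> {p. norm (snd p - y (fst p)) \<le> r}"
      have D_iff: "(t, x) \<in> D \<longleftrightarrow> T \<le> t \<and> t \<le> T + \<tau> \<and> norm (x - y t) \<le> r" for t x
      proof -
        have "norm (x - y0) \<le> r + \<tau> * S" if "T \<le> t" "t \<le> T + \<tau>" "norm (x - y t) \<le> r"
        proof -
          have "norm (x - y0) \<le> norm (x - y t) + norm ((t - T) *\<^sub>R W)"
            using norm_triangle_ineq[of "x - y t" "(t - T) *\<^sub>R W"] by (simp add: y_def)
          also have "norm ((t - T) *\<^sub>R W) \<le> \<tau> * S" using that W \<tau> by (simp add: mult_mono)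
          finally show ?thesis using that by simp
        qed
        then show ?thesis by (auto simp: D_def dist_norm norm_minus_commute)
      qed
      have "closed {p. norm (snd p - y (fst p)) \<le> r}"
        unfolding y_def by (intro closed_Collect_le continuous_intros)
      then have compD: "compact D" unfolding D_def by (intro compact_Int_closed compact_Times) auto
      have D_En: "x \<in> En N" if "(t, x) \<in> D" for t x
        using that tube[of "t - T"] unfolding D_iff by (auto simp: y_def dist_norm norm_minus_commute subset_iff)
      have sub: "D \<subseteq> {0..} \<times> E"
      proof
        fix p assume "p \<in> D"
        then show "p \<in> {0..} \<times> E"
          using D_En[of "fst p" "snd p"] D_iff[of "fst p" "snd p"] T En_subset by (cases p) auto
      qed
      have "continuous_on D (\<lambda>p. u (fst p) (snd p))" using u_cont sub by (rule continuous_on_subset)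
      then have contD: "continuous_on D (\<lambda>p. u (fst p) (snd p) - w (fst p) (snd p))"
        unfolding w_def G_def y_def by (intro continuous_intros)
      have pD: "(T + \<tau>, x) \<in> D" using x \<tau> unfolding D_iff by (simp add: y_def dist_norm norm_minus_commute)
      obtain p where p: "p \<in> D" "\<And>q. q \<in> D \<Longrightarrow> u (fst p) (snd p) - w (fst p) (snd p) \<le> u (fst q) (snd q) - w (fst q) (snd q)"
        using continuous_attains_inf[OF compD _ contD] pD by blast
      define t z where "t = fst p" and "z = snd p"
      have tzD: "(t, z) \<in> D" using p(1) by (simp add: t_def z_def)
      have min: "u t z - w t z \<le> u s z' - w s z'" if "(s, z') \<in> D" for s z'
        using p(2)[OF that] by (simp add: t_def z_def)
      have lt: "u t z - w t z < m" using min[OF pD] neg by simp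
      have tz: "T \<le> t" "t \<le> T + \<tau>" "norm (z - y t) \<le> r" "z \<in> En N" "z \<in> E"
        using tzD D_En[OF tzD] En_subset unfolding D_iff by auto
      have G01: "0 \<le> G s z'" "G s z' \<le> 1" if "(s, z') \<in> D" for s z'
      proof -
        have "(norm (z' - y s))\<^sup>2 \<le> r\<^sup>2" using that unfolding D_iff by (auto intro: power_mono)
        then have "a * (norm (z' - y s))\<^sup>2 \<le> a * r\<^sup>2" using a by (intro mult_left_mono) auto
        then show "0 \<le> G s z'" "G s z' \<le> 1" using a by (auto simp: G_def)
      qed
      have t_gt: "T < t"
      proof (rule ccontr)
        assume "\<not> T < t"
        then have tT: "t = T" using tz by simp
        then have "m + \<rho> \<le> u t z" using init[of z] tz by (simp add: y_def dist_norm norm_minus_commute)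
        moreover have "w t z \<le> \<rho>"
          using G01[OF tzD] \<rho> tT by (simp add: w_def mult_left_le power_le_one)
        ultimately show False using lt by simp
      qed
      have Gpos: "0 < G t z"
      proof (rule ccontr)
        assume "\<not> 0 < G t z"
        then have "w t z = 0" using G01(1)[OF tzD] by (simp add: w_def)
        then show False using lt low[OF tz(1,2,4)] by simp
      qed
      have z_lt: "norm (z - y t) < r"
      proof (rule ccontr)
        assume "\<not> norm (z - y t) < r"
        then have "G t z = 0" using tz a by (simp add: G_def)
        then show False using Gpos by simp
      qed
      have t0: "0 < t" using t_gt T by simp
      define e where "e = \<rho> * exp (- k * (t - T))"
      have e: "0 < e" using \<rho> by (simp add: e_def)
      define P where "P = z - y t"
      define q where "q x = (- a) * (norm (x - y t))\<^sup>2 + 1" for x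
      have q_eq: "q x = G t x" for x by (simp add: q_def G_def)
      have n2: "Ck_on E 2 (\<lambda>x. (- a) * (norm (x - y t))\<^sup>2)"
        using C2_cmult(1)[OF openE C2_norm_sq(1)[OF openE]] .
      have q_C2: "Ck_on E 2 q" unfolding q_def[abs_def] by (rule C2_add_const(1)[OF openE n2])
      have gq: "grad q z = (- (2 * a)) *\<^sub>R P" and hq: "hess q z = (- (2 * a)) *\<^sub>R mat 1"
        unfolding q_def[abs_def] C2_add_const(2,3)[OF openE n2 tz(5)]
          C2_cmult(2,3)[OF openE C2_norm_sq(1)[OF openE] tz(5)] C2_norm_sq(2,3)[OF openE tz(5)]
        by (simp_all add: P_def)
      have d1: "((\<lambda>s. e * s\<^sup>2) has_real_derivative 2 * e * s) (at s)" "((\<lambda>s. 2 * e * s) has_real_derivative 2 * e) (at s)" for s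
        by (auto intro!: derivative_eq_intros)
      have w_eq: "w t = (\<lambda>x. e * (q x)\<^sup>2)" by (auto simp: w_def e_def q_eq)
      note qq = C2_compose[OF openE q_C2, of "\<lambda>s. e * s\<^sup>2" "\<lambda>s. 2 * e * s" "\<lambda>_. 2 * e", OF d1 continuous_on_const, folded w_eq]
      have w_C2: "Ck_on E 2 (w t)" by (rule qq(1))
      have gw: "grad (w t) z = (- (4 * a * e * G t z)) *\<^sub>R P"
        using qq(2)[OF tz(5)] by (simp add: gq q_eq mult_ac)
      have hw: "hess (w t) z = (- (4 * a * e * G t z)) *\<^sub>R mat 1 + (8 * a\<^sup>2 * e) *\<^sub>R outer P P"
        using qq(3)[OF tz(5)] by (simp add: gq hq q_eq outer_def vec_eq_iff power2_eq_square mult_ac)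
      define w' where "w' = e * (- k * (G t z)\<^sup>2 + 4 * a * G t z * (P \<bullet> W))"
      have w_der: "((\<lambda>s. w s z) has_real_derivative w') (at t)"
      proof -
        have ny: "(norm (z - y s))\<^sup>2 = (norm (z - y0))\<^sup>2 - 2 * (s - T) * ((z - y0) \<bullet> W) + (s - T)\<^sup>2 * (norm W)\<^sup>2" for s
          unfolding power2_norm_eq_inner y_def
          by (simp add: inner_diff_left inner_diff_right inner_add_left inner_add_right
            inner_commute power2_eq_square algebra_simps)
        have PW: "P \<bullet> W = (z - y0) \<bullet> W - (t - T) * (norm W)\<^sup>2"
          by (simp add: P_def y_def inner_diff_left inner_add_left power2_norm_eq_inner)
        have dn: "((\<lambda>s. (norm (z - y s))\<^sup>2) has_real_derivative - 2 * (P \<bullet> W)) (at t)"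
        proof -
          have "((\<lambda>s. c0 - 2 * (s - T) * c1 + (s - T)\<^sup>2 * c2) has_real_derivative - 2 * (c1 - (t - T) * c2)) (at t)" for c0 c1 c2
            by (auto intro!: derivative_eq_intros)
          then show ?thesis unfolding ny PW .
        qed
        have dG: "((\<lambda>s. G s z) has_real_derivative 2 * a * (P \<bullet> W)) (at t)"
          using DERIV_diff[OF DERIV_const[of 1] DERIV_cmult[OF dn, of a]] unfolding G_def by (simp add: mult_ac)
        have "((\<lambda>s. \<rho> * exp (- k * (s - T))) has_real_derivative - k * e) (at t)"
          unfolding e_def by (auto intro!: derivative_eq_intros)
        from DERIV_mult[OF this DERIV_power[OF dG, of 2]]
        show ?thesis unfolding w_def
          by (rule DERIV_cong) (simp add: w'_def e_def algebra_simps)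
      qed
      have D_C2: "Ck_on E 2 (\<lambda>x. u t x - w t x)" by (rule C2_diff(1)[OF openE u_C2[OF t0] w_C2])
      have loc: "u t z - w t z \<le> u t z' - w t z'" if "z' \<in> ball z (r - norm (z - y t))" for z'
      proof (rule min)
        have "norm (z' - y t) \<le> norm (z' - z) + norm (z - y t)" using norm_triangle_ineq[of "z' - z" "z - y t"] by simp
        then show "(t, z') \<in> D" using that tz unfolding D_iff by (simp add: dist_norm norm_minus_commute)
      qed
      have rp: "0 < r - norm (z - y t)" using z_lt by simp
      have g0: "grad (u t) z = grad (w t) z"
        using C2_local_min(1)[OF openE D_C2 tz(5) loc rp] C2_diff(2)[OF openE u_C2[OF t0] w_C2 tz(5)] by simp
      have "0 \<le> mdot (A z) (hess (\<lambda>x. u t x - w t x) z)"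
        using C2_local_min(2)[OF openE D_C2 tz(5) loc rp] by (intro mdot_psd_nonneg A_psd tz)
      then have h0: "mdot (A z) (hess (w t) z) \<le> mdot (A z) (hess (u t) z)"
        using C2_diff(3)[OF openE u_C2[OF t0] w_C2 tz(5)] by (simp add: mdot_simps)
      \<comment> \<open>The ball moves, so an earlier time is admissible only while it still
        contains \<open>z\<close>; as \<open>z\<close> is interior at time \<open>t\<close>, this
        holds for nearby times.\<close>
      have "continuous (at t) (\<lambda>s. norm (z - y s))" unfolding y_def by (intro continuous_intros)
      then have "\<exists>\<eta>>0. \<forall>s. \<bar>s - t\<bar> < \<eta> \<longrightarrow> \<bar>norm (z - y s) - norm (z - y t)\<bar> < r - norm (z - y t)"
        unfolding continuous_at_eps_delta dist_real_def using rp by blast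
      then obtain \<eta> where \<eta>: "0 < \<eta>" "\<And>s. \<bar>s - t\<bar> < \<eta> \<Longrightarrow> \<bar>norm (z - y s) - norm (z - y t)\<bar> < r - norm (z - y t)"
        by blast
      have "u' t z - w' \<le> 0"
      proof (rule deriv_nonpos_of_left_min[where f="\<lambda>s. u s z - w s z"])
        show "((\<lambda>s. u s z - w s z) has_real_derivative u' t z - w') (at t)"
          by (intro DERIV_diff u_der w_der t0 tz)
        show "max T (t - \<eta>) < t" using t_gt \<eta> by simp
        show "u t z - w t z \<le> u s z - w s z" if "max T (t - \<eta>) < s" "s < t" for s
        proof (rule min)
          have "norm (z - y s) \<le> r" using \<eta>(2)[of s] that by auto
          then show "(s, z) \<in> D" using that tz unfolding D_iff by auto
        qed
      qed
      moreover have "w' < 1/2 * mdot (A z) (hess (w t) z) + b z \<bullet> grad (w t) z"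
      proof -
        have zc: "z \<in> closure (En N)" using tz closure_subset by blast
        have nP: "norm P \<le> r" using tz by (simp add: P_def)
        have aP: "a * (norm P)\<^sup>2 = 1 - G t z" by (simp add: P_def G_def)
        have "1/2 * mdot (A z) (hess (w t) z) + b z \<bullet> grad (w t) z
           = e * (4 * a\<^sup>2 * (P \<bullet> (A z *v P)) - 2 * a * G t z * trace (A z) - 4 * a * G t z * (b z \<bullet> P))"
          by (simp add: hw gw mdot_simps mdot_outer mdot_mat algebra_simps)
        moreover have "- k * (G t z)\<^sup>2 + 4 * a * G t z * (P \<bullet> W)
            < 4 * a\<^sup>2 * (P \<bullet> (A z *v P)) - 2 * a * G t z * trace (A z) - 4 * a * G t z * (b z \<bullet> P)"
        proof -
          have aG: "0 \<le> a * G t z" using a Gpos by simp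
          have "4 * a * c * (1 - G t z) = 4 * a\<^sup>2 * (c * (norm P)\<^sup>2)"
            by (simp add: aP[symmetric] power2_eq_square)
          also have "\<dots> \<le> 4 * a\<^sup>2 * (P \<bullet> (A z *v P))" using c(2)[OF tz(4)] by (intro mult_left_mono) auto
          finally have 1: "4 * a * c * (1 - G t z) \<le> 4 * a\<^sup>2 * (P \<bullet> (A z *v P))" .
          have "P \<bullet> W \<le> r * S"
            using norm_cauchy_schwarz[of P W] mult_mono[OF nP W] r by simp
          then have 2: "a * G t z * (P \<bullet> W) \<le> a * G t z * (r * S)" using aG by (rule mult_left_mono)
          have 3: "a * G t z * trace (A z) \<le> a * G t z * Ct" using Ct(2)[OF zc] aG by (intro mult_left_mono) auto
          have "b z \<bullet> P \<le> Cb * r" using Cb(2)[OF zc, of P] mult_left_mono[OF nP, of Cb] Cb(1) by linarith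
          then have 4: "a * G t z * (b z \<bullet> P) \<le> a * G t z * (Cb * r)" using aG by (rule mult_left_mono)
          have 5: "C * G t z < 4 * a * c * (1 - G t z) + k * (G t z)\<^sup>2"
            unfolding k_def by (rule barrier_quadratic[OF a(1) c(1) C])
          have 6: "C * G t z = 4 * (a * G t z * (r * S)) + 2 * (a * G t z * Ct) + 4 * (a * G t z * (Cb * r))"
            by (simp add: C_def algebra_simps)
          show ?thesis using 1 2 3 4 5 6 by simp
        qed
        ultimately show ?thesis unfolding w'_def using e by (simp only: mult_less_cancel_left_pos)
      qed
      ultimately show False
        using u_super[OF t0 tz(5)] h0 unfolding g0 by simp
    qed
    then show "m + \<rho> * exp (- k * \<tau>) * (1 - (norm (x - (y0 + \<tau> *\<^sub>R W)))\<^sup>2 / r\<^sup>2)\<^sup>2 \<le> u (T + \<tau>) x"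
      by (simp add: w_def G_def y_def a_def)
  qed
qed

text \<open>Star-shapedness supplies the path: a ball is moved from \<open>x1\<close> to the centre
  \<open>x0\<close> and from there to \<open>x\<close>, half a unit of time each, inside
  \<open>En (Suc N)\<close>. The barrier vanishes at the edge, so the second leg starts from a ball
  of half the radius.\<close>

lemma positivity_spreads:
  fixes u u' :: "real \<Rightarrow> real^'d \<Rightarrow> real" and b :: "real^'d \<Rightarrow> real^'d"
  assumes b: "\<And>i. continuous_on E (\<lambda>x. b x $ i)"
    and u_C2: "\<And>t. 0 < t \<Longrightarrow> Ck_on E 2 (u t)"
    and u_der: "\<And>t x. 0 < t \<Longrightarrow> x \<in> E \<Longrightarrow> ((\<lambda>s. u s x) has_real_derivative u' t x) (at t)"
    and u_super: "\<And>t x. 0 < t \<Longrightarrow> x \<in> E \<Longrightarrow> 1/2 * mdot (A x) (hess (u t) x) + b x \<bullet> grad (u t) x \<le> u' t x"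
    and u_cont: "continuous_on ({0..} \<times> E) (\<lambda>p. u (fst p) (snd p))"
    and r: "0 < r"
  obtains \<eta> where "0 < \<eta>" "\<eta> \<le> 1" "\<And>T m \<rho> x1 x. 0 \<le> T \<Longrightarrow> 0 < \<rho> \<Longrightarrow>
     (\<And>t x. T \<le> t \<Longrightarrow> t \<le> T + 1 \<Longrightarrow> x \<in> En (Suc N) \<Longrightarrow> m \<le> u t x) \<Longrightarrow>
     x1 \<in> En N \<Longrightarrow> (\<And>y. norm (x1 - y) \<le> r \<Longrightarrow> m + \<rho> \<le> u T y) \<Longrightarrow>
     x \<in> En N \<Longrightarrow> m + \<eta> * \<rho> \<le> u (T + 1) x"
proof -
  obtain \<rho>1 where \<rho>1: "0 < \<rho>1" "\<And>x. x \<in> closure (En N) \<Longrightarrow> cball x \<rho>1 \<subseteq> En (Suc N)"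
    by (rule cball_in_En[of N]) auto
  define r1 where "r1 = min r \<rho>1"
  have r1: "0 < r1" "r1 \<le> r" "r1 \<le> \<rho>1" using r \<rho>1 by (auto simp: r1_def)
  obtain S0 where S0: "\<And>x. x \<in> En N \<Longrightarrow> norm x \<le> S0"
    using En_bounded[of N] by (auto simp: bounded_iff)
  \<comment> \<open>Distances in \<open>En N\<close> are at most 2 S0, and each leg takes time
    1/2.\<close>
  define S where "S = 4 * S0"
  have "0 \<le> S0" using S0[OF x0] norm_ge_zero[of x0] by linarith
  then have S: "0 \<le> S" by (simp add: S_def)
  have speed: "norm (2 *\<^sub>R (x - y)) \<le> S" if "x \<in> En N" "y \<in> En N" for x y
    using norm_triangle_ineq4[of x y] S0[OF that(1)] S0[OF that(2)] by (simp add: S_def)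
  have r2: "0 < r1 / 2" using r1 by simp
  obtain k1 where k1: "\<forall>T \<tau> y0 W m \<rho>. 0 \<le> T \<longrightarrow> 0 \<le> \<tau> \<longrightarrow> norm W \<le> S \<longrightarrow> 0 < \<rho> \<longrightarrow>
     (\<forall>s\<in>{0..\<tau>}. cball (y0 + s *\<^sub>R W) (r1) \<subseteq> En (Suc N)) \<longrightarrow>
     (\<forall>t\<in>{T..T + \<tau>}. \<forall>x\<in>En (Suc N). m \<le> u t x) \<longrightarrow>
     (\<forall>x\<in>cball y0 (r1). m + \<rho> \<le> u T x) \<longrightarrow>
     (\<forall>x\<in>cball (y0 + \<tau> *\<^sub>R W) (r1). m + \<rho> * exp (- k1 * \<tau>) * (1 - (norm (x - (y0 + \<tau> *\<^sub>R W)))\<^sup>2 / (r1)\<^sup>2)\<^sup>2 \<le> u (T + \<tau>) x)"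
    by (rule exE[OF moving_barrier[OF b u_C2 u_der u_super u_cont r1(1) S, of "Suc N"]]; (assumption | erule that))
  obtain k2 where k2: "\<forall>T \<tau> y0 W m \<rho>. 0 \<le> T \<longrightarrow> 0 \<le> \<tau> \<longrightarrow> norm W \<le> S \<longrightarrow> 0 < \<rho> \<longrightarrow>
     (\<forall>s\<in>{0..\<tau>}. cball (y0 + s *\<^sub>R W) (r1 / 2) \<subseteq> En (Suc N)) \<longrightarrow>
     (\<forall>t\<in>{T..T + \<tau>}. \<forall>x\<in>En (Suc N). m \<le> u t x) \<longrightarrow>
     (\<forall>x\<in>cball y0 (r1 / 2). m + \<rho> \<le> u T x) \<longrightarrow>
     (\<forall>x\<in>cball (y0 + \<tau> *\<^sub>R W) (r1 / 2). m + \<rho> * exp (- k2 * \<tau>) * (1 - (norm (x - (y0 + \<tau> *\<^sub>R W)))\<^sup>2 / (r1 / 2)\<^sup>2)\<^sup>2 \<le> u (T + \<tau>) x)"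
    by (rule exE[OF moving_barrier[OF b u_C2 u_der u_super u_cont r2 S, of "Suc N"]]; (assumption | erule that))
  \<comment> \<open>On the half ball the profile is at least (1 - 1/4)^2 = 9/16; the second barrier
    is read off at its centre, where the profile is 1.\<close>
  define \<eta>1 \<eta>2 where "\<eta>1 = exp (- k1 * (1/2)) * (9/16)" and "\<eta>2 = exp (- k2 * (1/2))"
  have \<eta>p: "0 < \<eta>1" "0 < \<eta>2" by (auto simp: \<eta>1_def \<eta>2_def)
  have seg: "y + s *\<^sub>R (2 *\<^sub>R (x0 - y)) \<in> closure (En N)" "x0 + s *\<^sub>R (2 *\<^sub>R (y - x0)) \<in> closure (En N)"
    if "y \<in> En N" "0 \<le> s" "s \<le> 1/2" for s y
  proof -
    have "y + s *\<^sub>R (2 *\<^sub>R (x0 - y)) = (1 - (1 - 2 * s)) *\<^sub>R x0 + (1 - 2 * s) *\<^sub>R y"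
      "x0 + s *\<^sub>R (2 *\<^sub>R (y - x0)) = (1 - 2 * s) *\<^sub>R x0 + (2 * s) *\<^sub>R y"
      by (simp_all add: algebra_simps)
    then have "y + s *\<^sub>R (2 *\<^sub>R (x0 - y)) \<in> closed_segment x0 y" "x0 + s *\<^sub>R (2 *\<^sub>R (y - x0)) \<in> closed_segment x0 y"
      using that unfolding in_segment
      by (intro exI[of _ "1 - 2 * s"] exI[of _ "2 * s"]; simp)+
    then show "y + s *\<^sub>R (2 *\<^sub>R (x0 - y)) \<in> closure (En N)" "x0 + s *\<^sub>R (2 *\<^sub>R (y - x0)) \<in> closure (En N)"
      using En_star[OF that(1)] closure_subset by blast+
  qed
  have main: "m + (\<eta>1 * \<eta>2) * \<rho> \<le> u (T + 1) x"
    if T: "0 \<le> T" and \<rho>: "0 < \<rho>" and low: "\<And>t x. T \<le> t \<Longrightarrow> t \<le> T + 1 \<Longrightarrow> x \<in> En (Suc N) \<Longrightarrow> m \<le> u t x"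
      and x1: "x1 \<in> En N" and init: "\<And>y. norm (x1 - y) \<le> r \<Longrightarrow> m + \<rho> \<le> u T y" and x: "x \<in> En N" for T m \<rho> x1 x
  proof -
    have mid: "m + \<rho> * \<eta>1 \<le> u (T + 1/2) y" if y: "y \<in> cball x0 (r1 / 2)" for y
    proof -
      have e: "x1 + (1/2) *\<^sub>R (2 *\<^sub>R (x0 - x1)) = x0" by simp
      have ny: "norm (y - x0) \<le> r1 / 2" using y by (simp add: dist_norm norm_minus_commute)
      have 1: "m + \<rho> * exp (- k1 * (1/2)) * (1 - (norm (y - (x1 + (1/2) *\<^sub>R (2 *\<^sub>R (x0 - x1)))))\<^sup>2 / r1\<^sup>2)\<^sup>2 \<le> u (T + 1/2) y"
      proof (rule k1[rule_format, OF T _ speed[OF x0 x1] \<rho>])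
        show "cball (x1 + s *\<^sub>R (2 *\<^sub>R (x0 - x1))) r1 \<subseteq> En (Suc N)" if "s \<in> {0..1/2}" for s
        proof -
          have "0 \<le> s" "s \<le> 1/2" using that by auto
          then show ?thesis using \<rho>1(2)[OF seg(1)[OF x1]] r1(3) by (meson order_trans subset_cball)
        qed
        show "m \<le> u t x" if "t \<in> {T..T + 1/2}" "x \<in> En (Suc N)" for t x using low that by simp
        show "m + \<rho> \<le> u T x" if "x \<in> cball x1 r1" for x using init[of x] that r1(2) by (simp add: dist_norm)
        show "y \<in> cball (x1 + (1/2) *\<^sub>R (2 *\<^sub>R (x0 - x1))) r1" unfolding e using y r1 by simp
      qed simp
      have "(norm (y - x0))\<^sup>2 \<le> (r1 / 2)\<^sup>2" using ny by (intro power_mono) auto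
      then have "(norm (y - x0))\<^sup>2 / r1\<^sup>2 \<le> 1/4" using r1(1) by (simp add: power_divide pos_divide_le_eq)
      then have "(3/4)\<^sup>2 \<le> (1 - (norm (y - x0))\<^sup>2 / r1\<^sup>2)\<^sup>2" by (intro power_mono) auto
      then have "\<rho> * exp (- k1 * (1/2)) * (9/16) \<le> \<rho> * exp (- k1 * (1/2)) * (1 - (norm (y - x0))\<^sup>2 / r1\<^sup>2)\<^sup>2"
        using \<rho> by (intro mult_left_mono) (auto simp: power2_eq_square)
      then show ?thesis using 1 unfolding e \<eta>1_def by simp
    qed
    have e: "x0 + (1/2) *\<^sub>R (2 *\<^sub>R (x - x0)) = x" by simp
    have "m + \<rho> * \<eta>1 * exp (- k2 * (1/2)) * (1 - (norm (x - (x0 + (1/2) *\<^sub>R (2 *\<^sub>R (x - x0)))))\<^sup>2 / (r1 / 2)\<^sup>2)\<^sup>2 \<le> u (T + 1/2 + 1/2) x"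
    proof (rule k2[rule_format, OF _ _ speed[OF x x0]])
      show "cball (x0 + s *\<^sub>R (2 *\<^sub>R (x - x0))) (r1 / 2) \<subseteq> En (Suc N)" if "s \<in> {0..1/2}" for s
      proof -
        have "r1 / 2 \<le> \<rho>1" "0 \<le> s" "s \<le> 1/2" using r1 that by auto
        then show ?thesis using \<rho>1(2)[OF seg(2)[OF x]] by (meson order_trans subset_cball)
      qed
      show "m \<le> u t x" if "t \<in> {T + 1/2..T + 1/2 + 1/2}" "x \<in> En (Suc N)" for t x using low that by simp
      show "x \<in> cball (x0 + (1/2) *\<^sub>R (2 *\<^sub>R (x - x0))) (r1 / 2)" unfolding e using r1 by simp
    qed (use T \<rho> \<eta>p mid in auto)
    then show ?thesis unfolding e by (simp add: \<eta>2_def mult_ac add_ac)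
  qed
  define \<eta> where "\<eta> = min 1 (\<eta>1 * \<eta>2)"
  show ?thesis
  proof (rule that[of \<eta>])
    show "0 < \<eta>" "\<eta> \<le> 1" using \<eta>p by (auto simp: \<eta>_def)
    fix T m \<rho> :: real and x1 x :: "real^'d"
    assume H: "0 \<le> T" "0 < \<rho>" "\<And>t x. T \<le> t \<Longrightarrow> t \<le> T + 1 \<Longrightarrow> x \<in> En (Suc N) \<Longrightarrow> m \<le> u t x"
     "x1 \<in> En N" "\<And>y. norm (x1 - y) \<le> r \<Longrightarrow> m + \<rho> \<le> u T y" "x \<in> En N"
    have "\<eta> * \<rho> \<le> (\<eta>1 * \<eta>2) * \<rho>" using H(2) by (intro mult_right_mono) (auto simp: \<eta>_def)
    then show "m + \<eta> * \<rho> \<le> u (T + 1) x" using main[OF H] by linarith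
  qed
qed

end

section \<open>Long-time behaviour of \<open>h\<close>\<close>

context cauchy_problem
begin

text \<open>The drift of the ergodic diffusion; with it the equation for \<open>h\<close> has the
  form treated in \<open>local_equicontinuity\<close>.\<close>

definition b :: "real^'d \<Rightarrow> real^'d" where "b x = B x + Abar x *v grad vhat x"

lemma b_cont: "continuous_on E (\<lambda>x. b x $ i)"
proof -
  have "(\<lambda>x. b x $ i) = (\<lambda>x. B x $ i + (\<Sum>j\<in>UNIV. Abar x $ i $ j * grad vhat x $ j))"
    by (simp add: b_def matrix_vector_mult_def)
  then show ?thesis
    by (simp only:) (intro cont_rules C2_continuous_grad(1)[OF openE vhat_C2])
qed

lemma L_vhat: "L vhat f x = 1/2 * mdot (A x) (hess f x) + b x \<bullet> grad f x"
  by (simp add: L_op_eq b_def)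

lemma h_C2: "0 < t \<Longrightarrow> Ck_on E 2 (h t)"
  using C2_add_const(1)[OF openE C2_diff(1)[OF openE v_C2 vhat_C2], of t "- lhat * t"]
  by (simp add: h_def[abs_def] algebra_simps)

lemma h_der:
  assumes t: "0 < t" and x: "x \<in> E"
  shows "((\<lambda>s. h s x) has_real_derivative
    L vhat (h t) x + 1/2 * (grad (h t) x \<bullet> (Abar x *v grad (h t) x))) (at t)"
proof -
  have d: "Ck_on E 2 (\<lambda>x. v t x - vhat x)" by (rule C2_diff(1)[OF openE v_C2[OF t] vhat_C2])
  have h: "h t = (\<lambda>x. (v t x - vhat x) + (- lhat * t))" by (auto simp: h_def)
  have g: "grad (h t) x = grad (\<lambda>x. v t x - vhat x) x" and he: "hess (h t) x = hess (\<lambda>x. v t x - vhat x) x"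
    unfolding h by (rule C2_add_const(2,3)[OF openE d x])+
  have "((\<lambda>s. h s x) has_real_derivative F (v t) x - lhat) (at t)"
    unfolding h_def by (auto intro!: derivative_eq_intros v_der t x)
  moreover have "F (v t) x - lhat = L vhat (h t) x + 1/2 * (grad (h t) x \<bullet> (Abar x *v grad (h t) x))"
    using F_diff[OF v_C2[OF t] vhat_C2 x] F_vhat[OF x] L_op_cong[OF g he, of A Abar B vhat] by (simp add: g)
  ultimately show ?thesis by simp
qed

lemma h_cont: "continuous_on ({0..} \<times> E) (\<lambda>p. h (fst p) (snd p))"
  unfolding h_def by (intro continuous_intros v_cont cont_snd cont)

text \<open>The cost factor of \<open>lower_propagation\<close>: an initial weight \<theta> lowers
  the constant by at most \<theta> times this number.\<close>

definition M\<theta> :: real where "M\<theta> = (\<bar>C\<alpha> - lhat\<bar> + 1) / \<alpha>"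

lemma M\<theta>_pos: "0 < M\<theta>" using alpha by (simp add: M\<theta>_def)

lemma h_lower_all: "\<exists>C>0. \<forall>t\<ge>0. \<forall>x\<in>E. - C - C * g x \<le> h t x"
proof -
  obtain C where C: "0 \<le> C" "\<And>x. x \<in> E \<Longrightarrow> - (C * g x) - C \<le> v 0 x - vhat x"
    using v_init unfolding g_def by blast
  \<comment> \<open>The weight C + 1 is positive, as \<open>lower_propagation\<close> requires, even
    if \<open>C\<close> is 0.\<close>
  have init: "- C - (C + 1) * g x \<le> h 0 x" if "x \<in> E" for x
    using C(2)[OF that] g_ge1[OF that] by (simp add: h_def algebra_simps)
  define C' where "C' = C + (C + 1) * M\<theta> + C + 1"
  have "- C' - C' * g x \<le> h t x" if "0 \<le> t" "x \<in> E" for t x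
  proof -
    have "- C - (C + 1) * exp (- \<alpha> * (t - 0)) * g x - (C + 1) * M\<theta> \<le> h t x"
      unfolding M\<theta>_def using lower_propagation[OF _ _ init] that C by simp
    moreover have "(C + 1) * exp (- \<alpha> * (t - 0)) * g x \<le> (C + 1) * g x"
    proof -
      have "exp (- \<alpha> * (t - 0)) \<le> 1" using that alpha by simp
      then show ?thesis using g_ge1[OF that(2)] C(1) by (intro mult_right_mono mult_left_le) auto
    qed
    moreover have "(C + 1) * g x \<le> C' * g x"
      using g_ge1[OF that(2)] C(1) M\<theta>_pos by (intro mult_right_mono) (auto simp: C'_def)
    moreover have "C + (C + 1) * M\<theta> \<le> C'" using C(1) by (simp add: C'_def)
    ultimately show ?thesis by linarith
  qed
  moreover have "0 < C'" using C(1) M\<theta>_pos by (simp add: C'_def add_nonneg_pos)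
  ultimately show ?thesis by blast
qed

text \<open>The upper and lower bounds already found do not involve time, and are continuous in
  space.\<close>

lemma h_bounded: "\<exists>M. \<forall>t\<ge>0. \<forall>x\<in>closure (En n). \<bar>h t x\<bar> \<le> M"
proof -
  obtain C0 where C0: "\<And>x. x \<in> E \<Longrightarrow> v 0 x \<le> \<phi>0 x + C0" using v_upper[of 0] by auto
  obtain C1 where C1: "\<And>t x. 0 \<le> t \<Longrightarrow> x \<in> E \<Longrightarrow> exp (\<kappa> * h t x) \<le> C1 + exp (\<kappa> * (\<phi>0 x + C0 - vhat x))"
    by (rule upper_bound[OF C0]) auto
  obtain C2 where C2: "0 < C2" "\<And>t x. 0 \<le> t \<Longrightarrow> x \<in> E \<Longrightarrow> - C2 - C2 * g x \<le> h t x" using h_lower_all by blast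
  have c1: "continuous_on E (\<lambda>x. exp (\<kappa> * (\<phi>0 x + C0 - vhat x)))" by (intro continuous_intros cont)
  obtain C3 where C3: "0 < C3" "\<And>x. x \<in> closure (En n) \<Longrightarrow> \<bar>exp (\<kappa> * (\<phi>0 x + C0 - vhat x))\<bar> \<le> C3"
    by (rule bounded_on_En[OF c1, of n]) auto
  obtain C4 where C4: "0 < C4" "\<And>x. x \<in> closure (En n) \<Longrightarrow> \<bar>g x\<bar> \<le> C4"
    by (rule bounded_on_En[OF cont(3), of n]) auto
  have "\<bar>h t x\<bar> \<le> max ((\<bar>C1\<bar> + C3) / \<kappa>) (C2 + C2 * C4)" if "0 \<le> t" "x \<in> closure (En n)" for t x
  proof -
    have xE: "x \<in> E" using that closure_En_subset by auto
    have "1 + \<kappa> * h t x \<le> exp (\<kappa> * h t x)" by (rule exp_ge_add_one_self)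
    also have "\<dots> \<le> \<bar>C1\<bar> + C3" using C1[OF that(1) xE] C3(2)[OF that(2)] by simp
    finally have "\<kappa> * h t x \<le> \<bar>C1\<bar> + C3" by simp
    then have "h t x \<le> (\<bar>C1\<bar> + C3) / \<kappa>" using kappa by (simp add: pos_le_divide_eq mult.commute)
    moreover have "C2 * g x \<le> C2 * C4" using C4(2)[OF that(2)] C2(1) by (intro mult_left_mono) auto
    ultimately show ?thesis using C2(2)[OF that(1) xE] by simp
  qed
  then show ?thesis by blast
qed

definition minorant :: "real \<Rightarrow> bool" where
  "minorant c \<longleftrightarrow> (\<forall>\<theta>>0. \<exists>T0\<ge>0. \<forall>T\<ge>T0. \<forall>x\<in>E. c - \<theta> * g x \<le> h T x)"

text \<open>A lower bound at a single time is enough: its weight decays exponentially afterwards, at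
  a cost in the constant that is fixed once and for all.\<close>

lemma minorant_propagates:
  assumes "0 \<le> T1" "0 < \<theta>1" "\<And>x. x \<in> E \<Longrightarrow> c - \<theta>1 * g x \<le> h T1 x"
  shows "minorant (c - \<theta>1 * M\<theta>)"
  unfolding minorant_def
proof (intro allI impI)
  fix \<theta> :: real assume \<theta>: "0 < \<theta>"
  \<comment> \<open>The time at which the decaying weight has fallen to \<theta>; the absolute value
    covers \<theta>1 < \<theta>.\<close>
  define T0 where "T0 = T1 + \<bar>ln (\<theta>1 / \<theta>)\<bar> / \<alpha>"
  have "\<theta>1 * exp (- \<alpha> * (T - T1)) \<le> \<theta>" if "T0 \<le> T" for T
  proof -
    have "\<bar>ln (\<theta>1 / \<theta>)\<bar> \<le> \<alpha> * (T - T1)" using that alpha by (simp add: T0_def field_simps)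
    then have "- \<alpha> * (T - T1) \<le> - ln (\<theta>1 / \<theta>)" by simp
    then have "exp (- \<alpha> * (T - T1)) \<le> exp (- ln (\<theta>1 / \<theta>))" by (simp only: exp_le_cancel_iff)
    also have "\<dots> = \<theta> / \<theta>1" using \<theta> assms(2) by (simp add: exp_minus)
    finally show ?thesis using assms(2) by (simp add: field_simps)
  qed
  then have "c - \<theta>1 * M\<theta> - \<theta> * g x \<le> h T x" if "T0 \<le> T" "x \<in> E" for T x
  proof -
    have "T1 \<le> T" using that alpha by (simp add: T0_def) (smt (verit) divide_nonneg_pos)
    then have "c - \<theta>1 * exp (- \<alpha> * (T - T1)) * g x - \<theta>1 * M\<theta> \<le> h T x"
      unfolding M\<theta>_def using lower_propagation[OF assms(1,2,3) _ that(2)] by simp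
    moreover have "\<theta>1 * exp (- \<alpha> * (T - T1)) * g x \<le> \<theta> * g x"
      using \<open>T0 \<le> T \<Longrightarrow> _\<close>[OF that(1)] g_ge1[OF that(2)] by (intro mult_right_mono) auto
    ultimately show ?thesis by linarith
  qed
  moreover have "0 \<le> T0" using assms(1) alpha by (simp add: T0_def)
  ultimately show "\<exists>T0\<ge>0. \<forall>T\<ge>T0. \<forall>x\<in>E. c - \<theta>1 * M\<theta> - \<theta> * g x \<le> h T x" by blast
qed

lemma minorant_bounded: "\<exists>M. \<forall>c. minorant c \<longrightarrow> c \<le> M"
proof -
  obtain M where M: "\<And>t x. 0 \<le> t \<Longrightarrow> x \<in> closure (En 0) \<Longrightarrow> \<bar>h t x\<bar> \<le> M" using h_bounded[of 0] by blast
  have x0c: "x0 \<in> closure (En 0)" using x0[of 0] closure_subset by blast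
  have "c \<le> M + g x0" if gc: "minorant c" for c
  proof -
    obtain T0 where "0 \<le> T0" "\<forall>T\<ge>T0. \<forall>x\<in>E. c - 1 * g x \<le> h T x"
      using gc unfolding minorant_def by (metis zero_less_one)
    then show ?thesis using M[of T0 x0] x0c x0_E by force
  qed
  then show ?thesis by blast
qed

lemma minorant_nonempty: "\<exists>c. minorant c"
proof -
  obtain C where "0 < C" "\<And>t x. 0 \<le> t \<Longrightarrow> x \<in> E \<Longrightarrow> - C - C * g x \<le> h t x" using h_lower_all by blast
  then have "minorant (- C - C * M\<theta>)" by (intro minorant_propagates[of 0]) auto
  then show ?thesis by blast
qed

definition climit :: real where "climit = Sup {c. minorant c}"

lemma minorant_le_climit: "minorant c \<Longrightarrow> c \<le> climit"
  unfolding climit_def using minorant_bounded by (intro cSup_upper) (auto simp: bdd_above_def)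

text \<open>The supremum is attained: a small loss in the constant can be moved into the weight
  because g \<ge> 1.\<close>

lemma minorant_climit: "minorant climit"
  unfolding minorant_def
proof (intro allI impI)
  fix \<theta> :: real assume \<theta>: "0 < \<theta>"
  have "climit - \<theta> / 2 < Sup {c. minorant c}" using \<theta> by (simp add: climit_def)
  then obtain c where c: "minorant c" "climit - \<theta> / 2 < c"
    using less_cSupE[of "climit - \<theta> / 2" "{c. minorant c}"] minorant_nonempty by auto
  obtain T0 where T0: "0 \<le> T0" "\<And>T x. T0 \<le> T \<Longrightarrow> x \<in> E \<Longrightarrow> c - \<theta> / 2 * g x \<le> h T x"
    using c(1) \<theta> unfolding minorant_def by (metis half_gt_zero)
  have "climit - \<theta> * g x \<le> h T x" if "T0 \<le> T" "x \<in> E" for T x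
  proof -
    have "\<theta> / 2 * 1 \<le> \<theta> / 2 * g x" using \<theta> g_ge1[OF that(2)] by (intro mult_left_mono) auto
    then show ?thesis using T0(2)[OF that] c(2) by simp
  qed
  then show "\<exists>T0\<ge>0. \<forall>T\<ge>T0. \<forall>x\<in>E. climit - \<theta> * g x \<le> h T x" using T0(1) by blast
qed

text \<open>If \<open>h\<close> exceeds \<open>climit\<close> at one late point, then by equicontinuity it does so on a ball, hence
  one unit of time later on a large compact set, and from then on \<open>lower_propagation\<close>
  keeps it above a level larger than \<open>climit\<close>.\<close>

lemma h_upper_limit:
  assumes \<rho>: "0 < \<rho>"
  shows "\<exists>T0\<ge>0. \<forall>T\<ge>T0. \<forall>x\<in>En n. h T x \<le> climit + \<rho>"
proof (rule ccontr)
  assume neg: "\<not> ?thesis"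
  \<comment> \<open>Large enough that an additional weight e / G costs at most e / 4 in the
    constant.\<close>
  define G where "G = 4 * M\<theta> + 1"
  obtain N where N: "n \<le> N" "\<And>x. x \<in> E - En N \<Longrightarrow> G \<le> g x"
    by (rule escapesD[OF esc_vhat, of n G]) (auto simp: g_def)
  obtain c where c: "0 < c" "\<And>x \<xi>. x \<in> En (Suc N) \<Longrightarrow> c * (norm \<xi>)\<^sup>2 \<le> \<xi> \<bullet> (A x *v \<xi>)" using elliptic[of "Suc N"] by blast
  obtain M where M: "\<And>t x. 0 \<le> t \<Longrightarrow> x \<in> closure (En (Suc N)) \<Longrightarrow> \<bar>h t x\<bar> \<le> M" using h_bounded[of "Suc N"] by blast
  have \<rho>4: "0 < \<rho> / 4" using \<rho> by simp
  obtain r where r: "0 < r" "\<And>T z y. 2 \<le> T \<Longrightarrow> z \<in> closure (En N) \<Longrightarrow> norm (z - y) \<le> r \<Longrightarrow> h T z - h T y \<le> \<rho> / 4"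
    by (rule local_equicontinuity[OF c b_cont h_C2 h_der[unfolded L_vhat] h_cont M \<rho>4]; (assumption | auto))
  have super: "1/2 * mdot (A x) (hess (h t) x) + b x \<bullet> grad (h t) x
      \<le> L vhat (h t) x + 1/2 * (grad (h t) x \<bullet> (Abar x *v grad (h t) x))" if "x \<in> E" for t x
    using Abar_nonneg[OF that] by (simp add: L_vhat)
  obtain \<eta> where \<eta>: "0 < \<eta>" "\<eta> \<le> 1" "\<And>T m \<rho> x1 x. 0 \<le> T \<Longrightarrow> 0 < \<rho> \<Longrightarrow>
     (\<And>t x. T \<le> t \<Longrightarrow> t \<le> T + 1 \<Longrightarrow> x \<in> En (Suc N) \<Longrightarrow> m \<le> h t x) \<Longrightarrow>
     x1 \<in> En N \<Longrightarrow> (\<And>y. norm (x1 - y) \<le> r \<Longrightarrow> m + \<rho> \<le> h T y) \<Longrightarrow>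
     x \<in> En N \<Longrightarrow> m + \<eta> * \<rho> \<le> h (T + 1) x"
    using positivity_spreads[OF b_cont h_C2 h_der super h_cont r(1), of N] by metis
  obtain Gm where Gm: "0 < Gm" "\<And>x. x \<in> closure (En (Suc N)) \<Longrightarrow> \<bar>g x\<bar> \<le> Gm"
    by (rule bounded_on_En[OF cont(3), of "Suc N"]) auto
  \<comment> \<open>Half of the gain \<eta> \<rho> / 2 on \<open>En N\<close>; the other half covers
    \<theta> Gm. Of this \<open>e\<close> at most e/4 + e/4 is lost to propagation, so the constant
    strictly improves.\<close>
  define e where "e = \<eta> * \<rho> / 4"
  have e: "0 < e" using \<eta> \<rho> by (simp add: e_def)
  define \<theta> where "\<theta> = min (e / Gm) (e / (4 * M\<theta>))"
  have \<theta>: "0 < \<theta>" "\<theta> * Gm \<le> e" "\<theta> * M\<theta> \<le> e / 4"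
  proof -
    show "0 < \<theta>" using e Gm M\<theta>_pos by (simp add: \<theta>_def)
    have "\<theta> \<le> e / Gm" "\<theta> \<le> e / (4 * M\<theta>)" by (auto simp: \<theta>_def)
    then show "\<theta> * Gm \<le> e" "\<theta> * M\<theta> \<le> e / 4" using Gm M\<theta>_pos by (auto simp: field_simps)
  qed
  obtain T0 where T0: "0 \<le> T0" "\<And>T x. T0 \<le> T \<Longrightarrow> x \<in> E \<Longrightarrow> climit - \<theta> * g x \<le> h T x"
    using minorant_climit \<theta>(1) unfolding minorant_def by blast
  obtain T x1 where Tx: "max T0 2 \<le> T" "x1 \<in> En n" "climit + \<rho> < h T x1"
  proof -
    have "\<not> (\<forall>T\<ge>max T0 2. \<forall>x\<in>En n. h T x \<le> climit + \<rho>)" using neg by (metis max.coboundedI2 zero_le_numeral)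
    then show ?thesis using that by force
  qed
  have x1N: "x1 \<in> En N" using Tx(2) En_mono[OF N(1)] by blast
  define m where "m = climit - \<theta> * Gm"
  have inner: "m + \<eta> * (\<rho> / 2) \<le> h (T + 1) x" if "x \<in> En N" for x
  proof (rule \<eta>(3)[OF _ _ _ x1N _ that])
    show "0 \<le> T" "0 < \<rho> / 2" using Tx(1) \<rho> by auto
    show "m \<le> h t x" if "T \<le> t" "t \<le> T + 1" "x \<in> En (Suc N)" for t x
    proof -
      have "\<theta> * g x \<le> \<theta> * Gm" using Gm(2)[of x] that(3) closure_subset \<theta>(1) by (intro mult_left_mono) force+
      then show ?thesis using T0(2)[of t x] that Tx(1) En_subset unfolding m_def by force
    qed
    show "m + \<rho> / 2 \<le> h T y" if "norm (x1 - y) \<le> r" for y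
    proof -
      have "0 \<le> \<theta> * Gm" using \<theta> Gm by simp
      moreover have "h T x1 - h T y \<le> \<rho> / 4" using r(2)[of T x1 y] Tx(1) x1N closure_subset that by auto
      ultimately show ?thesis using Tx(3) \<rho> by (simp add: m_def)
    qed
  qed
  \<comment> \<open>Off \<open>En N\<close>, where g \<ge> G, the extra weight e / G compensates for
    raising the constant by \<open>e\<close>.\<close>
  define \<theta>1 where "\<theta>1 = \<theta> + e / G"
  have G: "0 < G" using M\<theta>_pos by (simp add: G_def)
  have \<theta>1: "0 < \<theta>1" using \<theta> e G by (simp add: \<theta>1_def add_pos_pos)
  have "minorant ((climit + e) - \<theta>1 * M\<theta>)"
  proof (rule minorant_propagates[OF _ \<theta>1])
    show "0 \<le> T + 1" using Tx(1) by simp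
    fix x assume x: "x \<in> E"
    show "climit + e - \<theta>1 * g x \<le> h (T + 1) x"
    proof (cases "x \<in> En N")
      case True
      have "0 \<le> \<theta>1 * g x" using \<theta>1 g_ge1[OF x] by simp
      then show ?thesis using inner[OF True] \<theta>(2) by (simp add: m_def e_def)
    next
      case False
      have "e / G * G \<le> e / G * g x" using N(2)[of x] False x e G by (intro mult_left_mono) auto
      then have "e \<le> e / G * g x" using G by simp
      then show ?thesis using T0(2)[of "T + 1" x] Tx(1) x by (simp add: \<theta>1_def distrib_right)
    qed
  qed
  then have le: "climit + e - \<theta>1 * M\<theta> \<le> climit" by (rule minorant_le_climit)
  have "e / G * M\<theta> \<le> e / 4"
  proof -
    have "M\<theta> / G \<le> 1/4" using G by (simp add: G_def field_simps)
    then have "e * (M\<theta> / G) \<le> e * (1/4)" using e by (intro mult_left_mono) auto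
    then show ?thesis by simp
  qed
  then show False using le \<theta>(3) e by (simp add: \<theta>1_def distrib_right)
qed

text \<open>By \<open>L_exp_diff_le\<close> the drift is nonpositive wherever F \<phi> \<le> lhat,
  that is, off a compact set.\<close>

lemma L_exp_g_bounded: "\<exists>C\<ge>0. \<forall>x\<in>E. L vhat (\<lambda>x. exp (\<kappa> * g x)) x \<le> C"
proof -
  have le: "L vhat (\<lambda>x. exp (\<kappa> * g x)) x \<le> \<kappa> * exp (\<kappa> * g x) * (F \<phi> x - lhat)" if "x \<in> E" for x
    using L_exp_diff_le[OF \<phi>_C2 vhat_C2 that] F_vhat[OF that] by (simp add: g_def[abs_def])
  obtain n where n: "\<And>x. x \<in> E - En n \<Longrightarrow> F \<phi> x \<le> lhat" using F_\<phi> by blast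
  have c: "continuous_on E (\<lambda>x. \<kappa> * exp (\<kappa> * g x) * (F \<phi> x - lhat))"
    by (intro continuous_intros cont F_continuous \<phi>_C2)
  have "\<kappa> * exp (\<kappa> * g x) * (F \<phi> x - lhat) \<le> 0" if "x \<in> E - En n" for x
    using n[OF that] kappa by (simp add: mult_nonneg_nonpos)
  then obtain C where "\<And>x. x \<in> E \<Longrightarrow> \<kappa> * exp (\<kappa> * g x) * (F \<phi> x - lhat) \<le> C"
    by (rule bounded_above_on[OF c]) auto
  then have "\<forall>x\<in>E. L vhat (\<lambda>x. exp (\<kappa> * g x)) x \<le> max C 0" using le by (meson max.coboundedI1 order_trans)
  then show ?thesis by (intro exI[of _ "max C 0"]) simp
qed

lemma h_lower_limit:
  assumes "0 < \<theta>"
  shows "\<exists>T0\<ge>0. \<forall>T\<ge>T0. \<forall>x\<in>E. climit - \<theta> * g x \<le> h T x"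
  using minorant_climit assms by (simp add: minorant_def)

end

section \<open>Paths and exit times\<close>

text \<open>Meaningful only while the path is in \<open>E\<close>; at the cemetery the value is
  unspecified.\<close>

definition pos :: "'d::finite path \<Rightarrow> real \<Rightarrow> real^'d" where "pos \<omega> s = the (\<omega> s)"

lemma path_range:
  assumes "\<omega> \<in> paths E" "0 \<le> s"
  shows "\<omega> s = None \<or> \<omega> s \<in> Some ` E"
proof -
  have "\<omega> s \<in> topspace (cemetery_ext E)"
    using assms by (auto simp: paths_def continuous_map_def)
  then show ?thesis by (auto simp: cemetery_ext_def)
qed

lemma path_open_times:
  assumes \<omega>: "\<omega> \<in> paths E" and E: "open E" and U: "open U" "U \<subseteq> E"
  shows "openin (top_of_set {0..}) {s \<in> {0..}. \<omega> s \<in> Some ` U}"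
proof -
  have "openin (top_of_set E) U" using U E by (simp add: openin_open_eq)
  then have "openin (cemetery_ext E) (Some ` U)" by (simp add: cemetery_ext_def)
  moreover have "continuous_map (top_of_set {0..}) (cemetery_ext E) \<omega>" using \<omega> by (simp add: paths_def)
  ultimately show ?thesis by (auto simp: continuous_map_def)
qed

text \<open>Compactness makes the image of \<open>C\<close> closed in the compactification, where
  the neighbourhoods of the cemetery are complements of compact sets.\<close>

lemma path_closed_times:
  assumes \<omega>: "\<omega> \<in> paths E" and C: "compact C" "C \<subseteq> E"
  shows "closed {s \<in> {0..}. \<omega> s \<in> Some ` C}"
proof -
  have "closedin (top_of_set E) C" using C by (simp add: closed_subset compact_imp_closed)
  moreover have "compactin (top_of_set E) C" using C by (simp add: compactin_subtopology)
  ultimately have "closedin (cemetery_ext E) (Some ` C)" by (simp add: cemetery_ext_def)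
  moreover have "continuous_map (top_of_set {0..}) (cemetery_ext E) \<omega>" using \<omega> by (simp add: paths_def)
  ultimately have "closedin (top_of_set {0..}) {s \<in> topspace (top_of_set {0..}). \<omega> s \<in> Some ` C}"
    by (rule closedin_continuous_map_preimage[rotated])
  then show ?thesis by (simp add: closedin_closed_eq)
qed

lemma path_continuous:
  assumes \<omega>: "\<omega> \<in> paths E" and E: "open E" and S: "S \<subseteq> {0..}" "\<And>s. s \<in> S \<Longrightarrow> \<omega> s \<in> Some ` E"
  shows "continuous_on S (pos \<omega>)"
proof (rule iffD2[OF continuous_on_open_invariant], intro allI impI)
  fix U :: "(real^'a) set" assume "open U"
  then have "openin (top_of_set {0..}) {s \<in> {0..}. \<omega> s \<in> Some ` (U \<inter> E)}"
    by (intro path_open_times[OF \<omega> E]) (auto simp: E)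
  then obtain T where T: "open T" "{s \<in> {0..}. \<omega> s \<in> Some ` (U \<inter> E)} = {0..} \<inter> T"
    by (auto simp: openin_open)
  have "T \<inter> S = pos \<omega> -` U \<inter> S"
  proof (rule set_eqI)
    fix s
    show "s \<in> T \<inter> S \<longleftrightarrow> s \<in> pos \<omega> -` U \<inter> S"
    proof (cases "s \<in> S")
      case True
      then have "s \<in> T \<longleftrightarrow> \<omega> s \<in> Some ` (U \<inter> E)" using T(2) S(1) by blast
      also have "\<dots> \<longleftrightarrow> pos \<omega> s \<in> U" using S(2)[OF True] by (auto simp: pos_def)
      finally show ?thesis using True by simp
    qed simp
  qed
  then show "\<exists>A. open A \<and> A \<inter> S = pos \<omega> -` U \<inter> S" using T(1) by blast
qed

lemma exit_time_nonneg: "0 \<le> exit_time D \<omega>"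
  unfolding exit_time_def by (intro INF_greatest) auto

text \<open>The exit time is infinite for a path that never leaves; the minimum with
  \<open>t\<close> is finite, so the conversion to a real number loses nothing.\<close>

lemma stopped_ereal: "ereal (stopped D t \<omega>) = min (ereal t) (exit_time D \<omega>)" if "0 \<le> t"
proof -
  have "0 \<le> min (ereal t) (exit_time D \<omega>)" using that exit_time_nonneg by simp
  moreover have "min (ereal t) (exit_time D \<omega>) \<le> ereal t" by simp
  ultimately have "\<bar>min (ereal t) (exit_time D \<omega>)\<bar> \<noteq> \<infinity>" by (metis abs_ereal_ge0 abs_ereal_less0 ereal_infty_less_eq(1) PInfty_neq_ereal(1))
  then show ?thesis by (simp add: stopped_def ereal_real')
qed

lemma stopped_bounds:
  assumes "0 \<le> t"
  shows "0 \<le> stopped D t \<omega>" "stopped D t \<omega> \<le> t"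
proof -
  have "0 \<le> ereal (stopped D t \<omega>)" unfolding stopped_ereal[OF assms] using assms exit_time_nonneg by simp
  then show "0 \<le> stopped D t \<omega>" by simp
  have "ereal (stopped D t \<omega>) \<le> ereal t" unfolding stopped_ereal[OF assms] by simp
  then show "stopped D t \<omega> \<le> t" by simp
qed

lemma stopped_min:
  assumes "0 \<le> s" "s \<le> t"
  shows "stopped D s \<omega> = min s (stopped D t \<omega>)"
proof -
  have "ereal (stopped D s \<omega>) = min (ereal s) (min (ereal t) (exit_time D \<omega>))"
    using stopped_ereal[of s D \<omega>] assms by (simp add: min.assoc[symmetric] min_absorb1)
  also have "\<dots> = ereal (min s (stopped D t \<omega>))"
    using stopped_ereal[of t D \<omega>] assms by (simp add: ereal_min)
  finally show ?thesis by (simp only: ereal.inject)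
qed

lemma inside_before_stopped:
  assumes "0 \<le> t" "0 \<le> s" "s < stopped D t \<omega>"
  shows "\<omega> s \<in> Some ` D"
proof (rule ccontr)
  assume "\<omega> s \<notin> Some ` D"
  then have "exit_time D \<omega> \<le> ereal s" unfolding exit_time_def using assms by (intro INF_lower) auto
  moreover have "ereal s < min (ereal t) (exit_time D \<omega>)" using assms stopped_ereal[of t D \<omega>] by (metis less_ereal.simps(1))
  ultimately show False by (metis min_less_iff_conj not_le)
qed

lemma stopped_eqI:
  assumes "0 \<le> t" "\<And>s. 0 \<le> s \<Longrightarrow> s < t \<Longrightarrow> \<omega> s \<in> Some ` D"
  shows "stopped D t \<omega> = t"
proof -
  have "ereal t \<le> exit_time D \<omega>"
    unfolding exit_time_def
  proof (rule INF_greatest)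
    fix s assume "s \<in> {t. 0 \<le> t \<and> \<omega> t \<notin> Some ` D}"
    then show "ereal t \<le> ereal s" using assms(2)[of s] by (cases "s < t") auto
  qed
  then have "ereal (stopped D t \<omega>) = ereal t" unfolding stopped_ereal[OF assms(1)] by (simp add: min_def)
  then show ?thesis by simp
qed

context exhausted_op
begin

text \<open>The times spent in the compact closure form a closed set that contains all earlier
  times, hence also the exit time. In particular the path is not yet at the cemetery there.\<close>

lemma at_stopped:
  assumes \<omega>: "\<omega> \<in> paths E" and t: "0 \<le> t" and start: "\<omega> 0 \<in> Some ` En n"
    and s: "0 \<le> s" "s \<le> stopped (En n) t \<omega>"
  shows "\<omega> s \<in> Some ` closure (En n)"
proof (cases "s < stopped (En n) t \<omega>")
  case True
  then show ?thesis using inside_before_stopped[OF t s(1)] closure_subset by blast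
next
  case False
  then have s_eq: "s = stopped (En n) t \<omega>" using s by simp
  have cl: "closed {s \<in> {0..}. \<omega> s \<in> Some ` closure (En n)}"
    by (rule path_closed_times[OF \<omega> compact_closure_En closure_En_subset])
  show ?thesis
  proof (cases "s = 0")
    case True
    then show ?thesis using start closure_subset by blast
  next
    case False
    then have "0 < s" using s by simp
    have "{0..<s} \<subseteq> {s \<in> {0..}. \<omega> s \<in> Some ` closure (En n)}"
    proof
      fix r assume r: "r \<in> {0..<s}"
      then have "\<omega> r \<in> Some ` En n" using inside_before_stopped[OF t, of r "En n" \<omega>] s_eq by simp
      then show "r \<in> {s \<in> {0..}. \<omega> s \<in> Some ` closure (En n)}" using r closure_subset by auto
    qed
    then have "closure {0..<s} \<subseteq> {s \<in> {0..}. \<omega> s \<in> Some ` closure (En n)}" using cl by (rule closure_minimal)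
    then show ?thesis using \<open>0 < s\<close> by (auto simp: subset_iff)
  qed
qed

text \<open>Membership in \<open>En n\<close> is an open condition in time: a path still inside at
  the stopped time would remain inside for a while.\<close>

lemma exited:
  assumes \<omega>: "\<omega> \<in> paths E" and t: "0 \<le> t" and lt: "stopped (En n) t \<omega> < t"
  shows "\<omega> (stopped (En n) t \<omega>) \<notin> Some ` En n"
proof
  define r where "r = stopped (En n) t \<omega>"
  assume "\<omega> (stopped (En n) t \<omega>) \<in> Some ` En n"
  then have "r \<in> {s \<in> {0..}. \<omega> s \<in> Some ` En n}" using stopped_bounds[OF t] by (simp add: r_def)
  moreover obtain T where T: "open T" "{s \<in> {0..}. \<omega> s \<in> Some ` En n} = {0..} \<inter> T"
    using path_open_times[OF \<omega> openE En_open En_subset] by (auto simp: openin_open)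
  ultimately have "r \<in> T" by auto
  then obtain d where d: "0 < d" "ball r d \<subseteq> T" using T(1) by (meson open_contains_ball)
  define r' where "r' = min t (r + d / 2)"
  have r': "r < r'" "r' \<le> t" "r' \<le> r + d / 2" using lt d by (auto simp: r'_def r_def)
  have "stopped (En n) r' \<omega> = r'"
  proof (rule stopped_eqI)
    show "0 \<le> r'" using r' stopped_bounds[OF t, of "En n" \<omega>] by (simp add: r_def)
    show "\<omega> s \<in> Some ` En n" if "0 \<le> s" "s < r'" for s
    proof (cases "s < r")
      case True
      then show ?thesis using inside_before_stopped[OF t that(1)] by (simp add: r_def)
    next
      case False
      then have "s \<in> ball r d" using that r' d(1) by (auto simp: dist_real_def)
      then show ?thesis using d(2) T(2) that by blast
    qed
  qed
  moreover have "stopped (En n) r' \<omega> = min r' r"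
    unfolding r_def using r' stopped_bounds[OF t, of "En n" \<omega>] by (intro stopped_min) (auto simp: r_def)
  ultimately show False using r'(1) by simp
qed

lemma stopped_mono_domain:
  assumes "0 \<le> t" "n \<le> m" "stopped (En n) t \<omega> = t"
  shows "stopped (En m) t \<omega> = t"
proof (rule stopped_eqI[OF assms(1)])
  fix s assume "0 \<le> s" "s < t"
  then have "\<omega> s \<in> Some ` En n" using inside_before_stopped[OF assms(1), of s "En n" \<omega>] assms(3) by simp
  then show "\<omega> s \<in> Some ` En m" using En_mono[OF assms(2)] by auto
qed

text \<open>A path alive at time \<open>t\<close> has a compact trace up to \<open>t\<close>, which
  lies in some \<open>En n\<close>.\<close>

lemma not_None_stopped:
  assumes \<omega>: "\<omega> \<in> paths E" and t: "0 \<le> t" and "\<omega> t \<noteq> None"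
  shows "\<exists>n. stopped (En n) t \<omega> = t"
proof -
  have inE: "\<omega> s \<in> Some ` E" if "s \<in> {0..t}" for s
  proof -
    have "\<forall>s t. 0 \<le> s \<and> s \<le> t \<and> \<omega> s = None \<longrightarrow> \<omega> t = None" using \<omega> unfolding paths_def by simp
    then have "\<omega> s \<noteq> None" using assms(3) that by (metis atLeastAtMost_iff)
    then show ?thesis using path_range[OF \<omega>, of s] that by auto
  qed
  have "continuous_on {0..t} (pos \<omega>)" by (rule path_continuous[OF \<omega> openE]) (use inE in auto)
  then have "compact (pos \<omega> ` {0..t})" by (rule compact_continuous_image) simp
  moreover have "pos \<omega> ` {0..t} \<subseteq> E" using inE by (force simp: pos_def)
  ultimately obtain n where n: "pos \<omega> ` {0..t} \<subseteq> En n" by (rule compact_in_En)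
  have "\<omega> s \<in> Some ` En n" if "0 \<le> s" "s < t" for s
  proof -
    have "pos \<omega> s \<in> En n" using n that by auto
    moreover have "\<omega> s = Some (pos \<omega> s)" using inE[of s] that by (auto simp: pos_def)
    ultimately show ?thesis by auto
  qed
  then show ?thesis using stopped_eqI[OF t] by blast
qed

end

section \<open>Riemann sums along a path\<close>

text \<open>Within a cell the position is frozen at its later value while time varies.\<close>

lemma path_increment:
  fixes f ft :: "real \<Rightarrow> 'x::topological_space \<Rightarrow> real" and X :: "real \<Rightarrow> 'x::topological_space"
  assumes ab: "0 \<le> a" "a \<le> b" "b \<le> \<rho>" "\<rho> \<le> T" and X: "\<And>r. r \<in> {0..\<rho>} \<Longrightarrow> X r \<in> S"
    and der: "\<And>r y. r \<in> {0..T} \<Longrightarrow> y \<in> S \<Longrightarrow> ((\<lambda>s. f s y) has_real_derivative ft r y) (at r within {0..T})"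
  shows "((\<lambda>r. ft r (X b)) has_integral (f b (X b) - f a (X b))) {a..b}"
proof (rule fundamental_theorem_of_calculus[OF ab(2)])
  fix r assume r: "r \<in> {a..b}"
  have "((\<lambda>s. f s (X b)) has_real_derivative ft r (X b)) (at r within {a..b})"
    using der[of r "X b"] X[of b] ab r by (auto intro: DERIV_subset)
  then show "((\<lambda>s. f s (X b)) has_vector_derivative ft r (X b)) (at r within {a..b})"
    by (simp add: has_real_derivative_iff_has_vector_derivative)
qed

text \<open>The pathwise half of Ito's formula. Each summand is a martingale increment of the
  function frozen at the left grid time. Restoring the time dependence, at the later position, makes
  the function values telescope and leaves an integral over each cell. Uniform continuity along the
  compact path gives the limit; the second conclusion provides a dominating constant. With
  \<open>Suc m\<close> cells the mesh is defined for m = 0 too.\<close>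

lemma riemann_path:
  fixes f ft l :: "real \<Rightarrow> 'x::metric_space \<Rightarrow> real" and X :: "real \<Rightarrow> 'x::metric_space"
  assumes \<rho>: "0 \<le> \<rho>" "\<rho> \<le> T" and X: "continuous_on {0..\<rho>} X" "\<And>r. r \<in> {0..\<rho>} \<Longrightarrow> X r \<in> S"
    and der: "\<And>r y. r \<in> {0..T} \<Longrightarrow> y \<in> S \<Longrightarrow> ((\<lambda>s. f s y) has_real_derivative ft r y) (at r within {0..T})"
    and ft: "continuous_on ({0..T} \<times> S) (\<lambda>p. ft (fst p) (snd p))"
    and l: "continuous_on ({0..T} \<times> S) (\<lambda>p. l (fst p) (snd p))"
  defines "q \<equiv> \<lambda>m i. real i * (T / real (Suc m))"
  defines "R \<equiv> \<lambda>m. \<Sum>i<Suc m. f (q m i) (X (min (q m (Suc i)) \<rho>)) - f (q m i) (X (min (q m i) \<rho>))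
     - (integral {0..min (q m (Suc i)) \<rho>} (\<lambda>r. l (q m i) (X r)) - integral {0..min (q m i) \<rho>} (\<lambda>r. l (q m i) (X r)))"
  shows "R \<longlonglongrightarrow> f \<rho> (X \<rho>) - f 0 (X 0) - integral {0..\<rho>} (\<lambda>r. ft r (X r) + l r (X r))"
    "\<And>K m. (\<And>r y. r \<in> {0..T} \<Longrightarrow> y \<in> S \<Longrightarrow> \<bar>f r y\<bar> \<le> K \<and> \<bar>ft r y\<bar> \<le> K \<and> \<bar>l r y\<bar> \<le> K) \<Longrightarrow> \<bar>R m\<bar> \<le> 2 * K + 2 * K * T"
proof -
  have T: "0 \<le> T" using \<rho> by simp
  have qmono: "0 \<le> q m i" "q m i \<le> q m (Suc i)" for m i
    using T unfolding q_def by simp (intro mult_right_mono, use T in auto)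
  have qle: "q m i \<le> T" if "i \<le> Suc m" for m i
  proof -
    have "real i / real (Suc m) \<le> 1" using that by simp
    then have "T * (real i / real (Suc m)) \<le> T * 1" using T by (intro mult_left_mono) auto
    then show ?thesis by (simp add: q_def mult.commute)
  qed
  have qtop: "q m (Suc m) = T" for m by (simp add: q_def)
  have qstep: "q m (Suc i) - q m i = T / real (Suc m)" for m i
    unfolding q_def by (simp only: left_diff_distrib[symmetric]) simp
  have compX: "continuous_on ({0..\<rho>} \<times> {0..\<rho>}) (\<lambda>p. k (fst p) (X (snd p)))"
    if "continuous_on ({0..T} \<times> S) (\<lambda>p. k (fst p) (snd p))" for k :: "real \<Rightarrow> 'x \<Rightarrow> real"
  proof -
    have "continuous_on ({0..\<rho>} \<times> {0..\<rho>}) (\<lambda>p. (fst p, X (snd p)))"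
      by (intro continuous_intros continuous_on_compose2[OF X(1)]) auto
    moreover have "(\<lambda>p. (fst p, X (snd p))) ` ({0..\<rho>} \<times> {0..\<rho>}) \<subseteq> {0..T} \<times> S"
      using X(2) \<rho> by auto
    ultimately show ?thesis
      using continuous_on_compose2[OF that, of "{0..\<rho>} \<times> {0..\<rho>}" "\<lambda>p. (fst p, X (snd p))"] by simp
  qed
  have compX': "continuous_on {0..\<rho>} (\<lambda>r. k (a r) (X r))"
    if "continuous_on ({0..T} \<times> S) (\<lambda>p. k (fst p) (snd p))" "continuous_on {0..\<rho>} a" "a ` {0..\<rho>} \<subseteq> {0..\<rho>}" for k :: "real \<Rightarrow> 'x \<Rightarrow> real" and a
  proof -
    have "continuous_on {0..\<rho>} (\<lambda>r. (a r, r))" by (intro continuous_intros that)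
    moreover have "(\<lambda>r. (a r, r)) ` {0..\<rho>} \<subseteq> {0..\<rho>} \<times> {0..\<rho>}" using that(3) by auto
    ultimately show ?thesis using continuous_on_compose2[OF compX[OF that(1)], of "{0..\<rho>}" "\<lambda>r. (a r, r)"] by simp
  qed
  have cl: "continuous_on {0..\<rho>} (\<lambda>r. k c (X r))" if "continuous_on ({0..T} \<times> S) (\<lambda>p. k (fst p) (snd p))" "c \<in> {0..\<rho>}" for k :: "real \<Rightarrow> 'x \<Rightarrow> real" and c
    using compX'[OF that(1), of "\<lambda>_. c"] that(2) by (simp add: image_subset_iff)
  have cd: "continuous_on {0..\<rho>} (\<lambda>r. k r (X r))" if "continuous_on ({0..T} \<times> S) (\<lambda>p. k (fst p) (snd p))" for k :: "real \<Rightarrow> 'x \<Rightarrow> real"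
    using compX'[OF that, of "\<lambda>r. r"] by (simp add: continuous_on_id)
  define \<rho>' where "\<rho>' m i = min (q m i) \<rho>" for m i
  have \<rho>': "0 \<le> \<rho>' m i" "\<rho>' m i \<le> \<rho>'  m (Suc i)" "\<rho>' m i \<le> \<rho>" "\<rho>' m (Suc i) - \<rho>' m i \<le> T / real (Suc m)" for m i
    using qmono[of m i] qstep[of m i] \<rho> by (auto simp: \<rho>'_def)
  define \<tau> where "\<tau> m i = f (q m i) (X (\<rho>' m (Suc i))) - f (q m i) (X (\<rho>' m i))
     - (integral {0..\<rho>' m (Suc i)} (\<lambda>r. l (q m i) (X r)) - integral {0..\<rho>' m i} (\<lambda>r. l (q m i) (X r)))" for m i
  have R: "R m = (\<Sum>i<Suc m. \<tau> m i)" for m by (simp add: R_def \<tau>_def \<rho>'_def)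
  define k where "k m i r = ft r (X (\<rho>' m (Suc i))) + l (q m i) (X r)" for m i r
  have int_sub: "k' integrable_on {a..b}" if "continuous_on {0..\<rho>} k'" "0 \<le> a" "b \<le> \<rho>" for k' :: "real \<Rightarrow> real" and a b
    by (rule integrable_continuous_real[OF continuous_on_subset[OF that(1)]]) (use that in auto)
  \<comment> \<open>The grid point \<open>q m i\<close> only matters while it has not passed \<open>\<rho>\<close>, and then it is \<open>\<rho>' m i\<close>.\<close>
  have step: "\<tau> m i = f (\<rho>' m (Suc i)) (X (\<rho>' m (Suc i))) - f (\<rho>' m i) (X (\<rho>' m i)) - integral {\<rho>' m i..\<rho>' m (Suc i)} (k m i)
     \<and> k m i integrable_on {\<rho>' m i..\<rho>' m (Suc i)}" for m i
  proof (cases "q m i < \<rho>")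
    case False
    then have "\<rho>' m i = \<rho>" "\<rho>' m (Suc i) = \<rho>" using qmono[of m i] by (auto simp: \<rho>'_def)
    then show ?thesis using integrable_on_refl[of "k m i" \<rho>] by (simp add: \<tau>_def)
  next
    case True
    then have e: "\<rho>' m i = q m i" by (simp add: \<rho>'_def)
    define a c where "a = \<rho>' m i" and "c = \<rho>' m (Suc i)"
    have ac: "0 \<le> a" "a \<le> c" "c \<le> \<rho>" using \<rho>'[of m i] \<rho>'(3)[of m "Suc i"] by (auto simp: a_def c_def)
    have qa: "q m i = a" "a \<in> {0..\<rho>}" "c \<in> {0..\<rho>}" using e ac by (auto simp: a_def)
    have i1: "((\<lambda>r. ft r (X c)) has_integral (f c (X c) - f a (X c))) {a..c}"
      by (rule path_increment[OF ac \<rho>(2) X(2) der])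
    have i2: "(\<lambda>r. l a (X r)) integrable_on {0..c}" "(\<lambda>r. l a (X r)) integrable_on {a..c}"
      using int_sub[OF cl[OF l qa(2)]] ac by auto
    have i3: "integral {0..c} (\<lambda>r. l a (X r)) - integral {0..a} (\<lambda>r. l a (X r)) = integral {a..c} (\<lambda>r. l a (X r))"
      using Henstock_Kurzweil_Integration.integral_combine[OF ac(1,2) i2(1)] by simp
    have i4: "(k m i has_integral (f c (X c) - f a (X c)) + integral {a..c} (\<lambda>r. l a (X r))) {a..c}"
      unfolding k_def c_def[symmetric] qa(1) by (intro has_integral_add i1 integrable_integral i2)
    have "\<tau> m i = f a (X c) - f a (X a) - integral {a..c} (\<lambda>r. l a (X r))"
      by (simp add: \<tau>_def a_def[symmetric] c_def[symmetric] qa(1) i3)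
    then show ?thesis using i4 by (auto simp: a_def[symmetric] c_def[symmetric] integral_unique has_integral_integrable)
  qed
  have Rsum: "R m = f \<rho> (X \<rho>) - f 0 (X 0) - (\<Sum>i<Suc m. integral {\<rho>' m i..\<rho>' m (Suc i)} (k m i))" for m
  proof -
    have "R m = (\<Sum>i<Suc m. f (\<rho>' m (Suc i)) (X (\<rho>' m (Suc i))) - f (\<rho>' m i) (X (\<rho>' m i))) - (\<Sum>i<Suc m. integral {\<rho>' m i..\<rho>' m (Suc i)} (k m i))"
      unfolding R sum_subtractf[symmetric] using step by (intro sum.cong) auto
    also have "(\<Sum>i<Suc m. f (\<rho>' m (Suc i)) (X (\<rho>' m (Suc i))) - f (\<rho>' m i) (X (\<rho>' m i))) = f (\<rho>' m (Suc m)) (X (\<rho>' m (Suc m))) - f (\<rho>' m 0) (X (\<rho>' m 0))"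
      by (rule sum_lessThan_telescope)
    also have "\<rho>' m (Suc m) = \<rho>" using qtop[of m] \<rho> by (simp add: \<rho>'_def)
    also have "\<rho>' m 0 = 0" using \<rho> by (simp add: \<rho>'_def q_def)
    finally show ?thesis .
  qed
  have len: "(\<Sum>i<Suc m. \<rho>' m (Suc i) - \<rho>' m i) = \<rho>" for m
  proof -
    have "(\<Sum>i<Suc m. \<rho>' m (Suc i) - \<rho>' m i) = \<rho>' m (Suc m) - \<rho>' m 0" by (rule sum_lessThan_telescope)
    then show ?thesis using qtop[of m] \<rho> by (simp add: \<rho>'_def q_def)
  qed
  show "\<bar>R m\<bar> \<le> 2 * K + 2 * K * T"
    if K: "\<And>r y. r \<in> {0..T} \<Longrightarrow> y \<in> S \<Longrightarrow> \<bar>f r y\<bar> \<le> K \<and> \<bar>ft r y\<bar> \<le> K \<and> \<bar>l r y\<bar> \<le> K" for K m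
  proof -
    have K0: "0 \<le> K" using K[of 0 "X 0"] X(2)[of 0] \<rho> T by auto
    have b: "\<bar>integral {\<rho>' m i..\<rho>' m (Suc i)} (k m i)\<bar> \<le> 2 * K * (\<rho>' m (Suc i) - \<rho>' m i)" if "i < Suc m" for i
    proof -
      have "norm (k m i r) \<le> 2 * K" if r: "r \<in> {\<rho>' m i..\<rho>' m (Suc i)}" for r
      proof -
        have "r \<in> {0..T}" "X (\<rho>' m (Suc i)) \<in> S" "X r \<in> S" "q m i \<in> {0..T}"
          using r \<rho>'[of m i] \<rho>'(3)[of m "Suc i"] \<rho>'(1)[of m "Suc i"] \<rho> qmono(1)[of m i] qle[of i m] \<open>i < Suc m\<close> X(2) by auto
        then show ?thesis using K[of r "X (\<rho>' m (Suc i))"] K[of "q m i" "X r"] by (auto simp: k_def)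
      qed
      then have "norm (integral (cbox (\<rho>' m i) (\<rho>' m (Suc i))) (k m i)) \<le> 2 * K * measure lborel (cbox (\<rho>' m i) (\<rho>' m (Suc i)))"
        using step[of m i] K0 by (intro has_integral_bound[OF _ integrable_integral]) auto
      then show ?thesis using \<rho>'(2)[of m i] by simp
    qed
    have "\<bar>\<Sum>i<Suc m. integral {\<rho>' m i..\<rho>' m (Suc i)} (k m i)\<bar> \<le> (\<Sum>i<Suc m. 2 * K * (\<rho>' m (Suc i) - \<rho>' m i))"
      by (rule order_trans[OF sum_abs sum_mono]) (use b in auto)
    also have "\<dots> = 2 * K * \<rho>" by (simp only: sum_distrib_left[symmetric] len)
    also have "\<dots> \<le> 2 * K * T" using \<rho> K0 by (intro mult_left_mono) auto
    finally show ?thesis using K[of \<rho> "X \<rho>"] K[of 0 "X 0"] X(2)[of \<rho>] X(2)[of 0] \<rho> T unfolding Rsum by auto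
  qed
  define k0 where "k0 r = ft r (X r) + l r (X r)" for r
  have ck0: "continuous_on {0..\<rho>} k0" unfolding k0_def by (intro continuous_on_add cd ft l)
  have splits: "integral {0..\<rho>} k0 = (\<Sum>i<Suc m. integral {\<rho>' m i..\<rho>' m (Suc i)} k0)" for m
  proof -
    have "integral {\<rho>' m i..\<rho>' m (Suc i)} k0 = integral {0..\<rho>' m (Suc i)} k0 - integral {0..\<rho>' m i} k0" for i
      using Henstock_Kurzweil_Integration.integral_combine[OF \<rho>'(1,2) int_sub[OF ck0 order_refl \<rho>'(3)], of m i] by simp
    then have "(\<Sum>i<Suc m. integral {\<rho>' m i..\<rho>' m (Suc i)} k0) = integral {0..\<rho>' m (Suc m)} k0 - integral {0..\<rho>' m 0} k0"
      by (simp only: sum_lessThan_telescope[of "\<lambda>i. integral {0..\<rho>' m i} k0"])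
    then show ?thesis using qtop[of m] \<rho> by (simp add: \<rho>'_def q_def)
  qed
  show "R \<longlonglongrightarrow> f \<rho> (X \<rho>) - f 0 (X 0) - integral {0..\<rho>} (\<lambda>r. ft r (X r) + l r (X r))"
  proof (rule LIMSEQ_I)
    fix \<epsilon> :: real assume \<epsilon>: "0 < \<epsilon>"
    \<comment> \<open>The error in a cell is 2 \<epsilon>' times its length, in total 2 \<epsilon>'
      \<rho>; the added 1 covers \<rho> = 0.\<close>
    define \<epsilon>' where "\<epsilon>' = \<epsilon> / (2 * (2 * \<rho> + 1))"
    have \<epsilon>': "0 < \<epsilon>'" using \<epsilon> \<rho> by (simp add: \<epsilon>'_def)
    have uc: "\<exists>d>0. \<forall>p\<in>{0..\<rho>} \<times> {0..\<rho>}. \<forall>p'\<in>{0..\<rho>} \<times> {0..\<rho>}. dist p' p < d \<longrightarrow> \<bar>kk (fst p') (X (snd p')) - kk (fst p) (X (snd p))\<bar> < \<epsilon>'"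
      if "continuous_on ({0..T} \<times> S) (\<lambda>p. kk (fst p) (snd p))" for kk :: "real \<Rightarrow> 'x \<Rightarrow> real"
      using compact_uniformly_continuous[OF compX[OF that] compact_Times[OF compact_Icc compact_Icc]] \<epsilon>'
      unfolding uniformly_continuous_on_def dist_real_def by blast
    obtain d1 where d1: "0 < d1" "\<forall>p\<in>{0..\<rho>} \<times> {0..\<rho>}. \<forall>p'\<in>{0..\<rho>} \<times> {0..\<rho>}. dist p' p < d1 \<longrightarrow> \<bar>ft (fst p') (X (snd p')) - ft (fst p) (X (snd p))\<bar> < \<epsilon>'"
      using uc[OF ft] by blast
    obtain d2 where d2: "0 < d2" "\<forall>p\<in>{0..\<rho>} \<times> {0..\<rho>}. \<forall>p'\<in>{0..\<rho>} \<times> {0..\<rho>}. dist p' p < d2 \<longrightarrow> \<bar>l (fst p') (X (snd p')) - l (fst p) (X (snd p))\<bar> < \<epsilon>'"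
      using uc[OF l] by blast
    obtain M where M: "T / real (Suc M) < min d1 d2"
    proof -
      obtain M :: nat where "T / min d1 d2 < real M" using reals_Archimedean2 by blast
      then have "T < real M * min d1 d2" using d1(1) d2(1) by (simp add: pos_divide_less_eq)
      also have "\<dots> \<le> real (Suc M) * min d1 d2" using d1(1) d2(1) by (intro mult_right_mono) auto
      finally have "T / real (Suc M) < min d1 d2" by (simp only: pos_divide_less_eq of_nat_0_less_iff zero_less_Suc mult.commute)
      then show ?thesis by (rule that)
    qed
    show "\<exists>no. \<forall>m\<ge>no. norm (R m - (f \<rho> (X \<rho>) - f 0 (X 0) - integral {0..\<rho>} (\<lambda>r. ft r (X r) + l r (X r)))) < \<epsilon>"
    proof (intro exI allI impI)
      fix m assume "M \<le> m"
      then have "T / real (Suc m) \<le> T / real (Suc M)" using T by (intro divide_left_mono) auto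
      then have mesh: "T / real (Suc m) < d1" "T / real (Suc m) < d2" using M by auto
      have b: "\<bar>integral {\<rho>' m i..\<rho>' m (Suc i)} k0 - integral {\<rho>' m i..\<rho>' m (Suc i)} (k m i)\<bar> \<le> 2 * \<epsilon>' * (\<rho>' m (Suc i) - \<rho>' m i)" for i
      proof (cases "q m i < \<rho>")
        case False
        then have "\<rho>' m i = \<rho>" "\<rho>' m (Suc i) = \<rho>" using qmono[of m i] by (auto simp: \<rho>'_def)
        then show ?thesis by simp
      next
        case True
        then have e: "q m i = \<rho>' m i" by (simp add: \<rho>'_def)
        have "norm (k0 r - k m i r) \<le> 2 * \<epsilon>'" if r: "r \<in> {\<rho>' m i..\<rho>' m (Suc i)}" for r
        proof -
          have r': "r \<in> {0..\<rho>}" "\<rho>' m (Suc i) \<in> {0..\<rho>}" "\<rho>' m i \<in> {0..\<rho>}"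
            using r \<rho>'[of m i] \<rho>'(1,3)[of m "Suc i"] by auto
          have near: "\<bar>r - \<rho>' m (Suc i)\<bar> \<le> T / real (Suc m)" "\<bar>r - \<rho>' m i\<bar> \<le> T / real (Suc m)"
            using r \<rho>'(4)[of m i] by auto
          have "\<bar>ft r (X r) - ft r (X (\<rho>' m (Suc i)))\<bar> < \<epsilon>'"
            using d1(2)[rule_format, of "(r, \<rho>' m (Suc i))" "(r, r)"] r' near mesh by (auto simp: dist_Pair_Pair dist_real_def)
          moreover have "\<bar>l r (X r) - l (\<rho>' m i) (X r)\<bar> < \<epsilon>'"
            using d2(2)[rule_format, of "(\<rho>' m i, r)" "(r, r)"] r' near mesh by (auto simp: dist_Pair_Pair dist_real_def)
          ultimately show ?thesis by (simp add: k0_def k_def e)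
        qed
        moreover have i0: "k0 integrable_on {\<rho>' m i..\<rho>' m (Suc i)}" by (rule int_sub[OF ck0 \<rho>'(1) \<rho>'(3)])
        moreover have "k m i integrable_on {\<rho>' m i..\<rho>' m (Suc i)}" using step[of m i] by blast
        ultimately have "norm (integral (cbox (\<rho>' m i) (\<rho>' m (Suc i))) (\<lambda>r. k0 r - k m i r)) \<le> 2 * \<epsilon>' * measure lborel (cbox (\<rho>' m i) (\<rho>' m (Suc i)))"
          using \<epsilon>' by (intro has_integral_bound[OF _ integrable_integral] integrable_diff) auto
        then show ?thesis using \<rho>'(2)[of m i] i0 step[of m i] by (simp add: Henstock_Kurzweil_Integration.integral_diff)
      qed
      have "R m - (f \<rho> (X \<rho>) - f 0 (X 0) - integral {0..\<rho>} k0)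
        = (\<Sum>i<Suc m. integral {\<rho>' m i..\<rho>' m (Suc i)} k0 - integral {\<rho>' m i..\<rho>' m (Suc i)} (k m i))"
        unfolding Rsum splits[of m] by (simp only: sum_subtractf)
      also have "\<bar>\<dots>\<bar> \<le> (\<Sum>i<Suc m. 2 * \<epsilon>' * (\<rho>' m (Suc i) - \<rho>' m i))"
        by (rule order_trans[OF sum_abs sum_mono]) (use b in auto)
      also have "\<dots> = 2 * \<epsilon>' * \<rho>" by (simp only: sum_distrib_left[symmetric] len)
      also have "\<dots> < \<epsilon>"
      proof -
        have "2 * \<epsilon>' * \<rho> = \<epsilon> * (\<rho> / (2 * \<rho> + 1))" using \<rho> by (simp add: \<epsilon>'_def field_simps)
        also have "\<dots> < \<epsilon> * 1" using \<epsilon> \<rho> by (intro mult_strict_left_mono) auto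
        finally show ?thesis by simp
      qed
      finally show "norm (R m - (f \<rho> (X \<rho>) - f 0 (X 0) - integral {0..\<rho>} (\<lambda>r. ft r (X r) + l r (X r)))) < \<epsilon>"
        by (simp add: k0_def[abs_def])
    qed
  qed
qed

section \<open>Martingales and the maximal inequality\<close>

text \<open>The conditional expectation is encoded through integrals over past events, a form that
  passes to dominated limits directly and fits the maximal inequality.\<close>

definition martingale_on :: "'w measure \<Rightarrow> (real \<Rightarrow> 'w measure) \<Rightarrow> real \<Rightarrow> (real \<Rightarrow> 'w \<Rightarrow> real) \<Rightarrow> bool" where
  "martingale_on P Fil T N \<longleftrightarrow>
     (\<forall>s\<in>{0..T}. N s \<in> borel_measurable (Fil s) \<and> integrable P (N s)) \<and>
     (\<forall>a b A. 0 \<le> a \<and> a \<le> b \<and> b \<le> T \<and> A \<in> sets (Fil a) \<longrightarrow>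
        (\<integral>\<omega>. indicator A \<omega> * N b \<omega> \<partial>P) = (\<integral>\<omega>. indicator A \<omega> * N a \<omega> \<partial>P))"

locale filtered_prob = prob_space P for P :: "'w measure" +
  fixes Fil :: "real \<Rightarrow> 'w measure"
  assumes Fil_space: "space (Fil t) = space P" and Fil_sub: "sets (Fil t) \<subseteq> sets P"
    and Fil_mono: "s \<le> t \<Longrightarrow> sets (Fil s) \<subseteq> sets (Fil t)"
begin

lemma Fil_measurable:
  assumes "f \<in> borel_measurable (Fil s)" "s \<le> t"
  shows "f \<in> borel_measurable (Fil t)"
proof (rule measurable_from_subalg[OF _ assms(1)])
  show "subalgebra (Fil t) (Fil s)" using Fil_mono[OF assms(2)] by (simp add: subalgebra_def Fil_space)
qed

lemma P_measurable:
  assumes "f \<in> borel_measurable (Fil s)"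
  shows "f \<in> borel_measurable P"
proof (rule measurable_from_subalg[OF _ assms])
  show "subalgebra P (Fil s)" using Fil_sub by (simp add: subalgebra_def Fil_space)
qed

text \<open>Doob's argument: the events \<open>Bs s\<close> of a first exceedance at time
  \<open>s\<close> are disjoint and known at time \<open>s\<close>, so on each of them
  \<open>N s\<close> may be replaced by \<open>N T\<close> under the integral.\<close>

lemma maximal_inequality_finite:
  assumes mart: "martingale_on P Fil T N" and nn: "AE \<omega> in P. 0 \<le> N T \<omega>" and \<eta>: "0 < \<eta>"
    and S: "finite S" "S \<subseteq> {0..T}"
  shows "\<eta> * prob {\<omega> \<in> space P. \<exists>s\<in>S. \<eta> < N s \<omega>} \<le> (\<integral>\<omega>. N T \<omega> \<partial>P)"
proof (cases "S = {}")
  case True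
  then show ?thesis using nn by (simp add: integral_nonneg_AE)
next
  case False
  then have T: "0 \<le> T" using S(2) by auto
  have N_meas: "N s \<in> borel_measurable (Fil s)" "integrable P (N s)" if "s \<in> {0..T}" for s
    using mart that by (auto simp: martingale_on_def)
  define Bs where "Bs s = {\<omega> \<in> space P. \<eta> < N s \<omega> \<and> (\<forall>r\<in>{r\<in>S. r < s}. N r \<omega> \<le> \<eta>)}" for s
  have Bs: "Bs s \<in> sets (Fil s)" if "s \<in> S" for s
  proof -
    have [measurable]: "N s \<in> borel_measurable (Fil s)" using N_meas(1)[of s] S that by auto
    have m: "N r \<in> borel_measurable (Fil s)" if "r \<in> {r\<in>S. r < s}" for r
      using Fil_measurable[OF N_meas(1)[of r], of s] that S by auto
    have "{\<omega> \<in> space (Fil s). \<eta> < N s \<omega>} \<inter> {\<omega> \<in> space (Fil s). \<forall>r\<in>{r\<in>S. r < s}. N r \<omega> \<le> \<eta>} \<in> sets (Fil s)"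
    proof (rule sets.Int)
      show "{\<omega> \<in> space (Fil s). \<forall>r\<in>{r\<in>S. r < s}. N r \<omega> \<le> \<eta>} \<in> sets (Fil s)"
        by (rule sets.sets_Collect_finite_All) (use m S in \<open>auto intro!: borel_measurable_le\<close>)
    qed measurable
    also have "{\<omega> \<in> space (Fil s). \<eta> < N s \<omega>} \<inter> {\<omega> \<in> space (Fil s). \<forall>r\<in>{r\<in>S. r < s}. N r \<omega> \<le> \<eta>} = Bs s"
      by (auto simp: Bs_def Fil_space)
    finally show ?thesis .
  qed
  have BP: "Bs s \<in> sets P" if "s \<in> S" for s using Bs[OF that] Fil_sub by blast
  have un: "{\<omega> \<in> space P. \<exists>s\<in>S. \<eta> < N s \<omega>} = (\<Union>s\<in>S. Bs s)"
  proof (intro equalityI subsetI)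
    fix \<omega> assume \<omega>: "\<omega> \<in> {\<omega> \<in> space P. \<exists>s\<in>S. \<eta> < N s \<omega>}"
    define S' where "S' = {s\<in>S. \<eta> < N s \<omega>}"
    have S': "finite S'" "S' \<noteq> {}" using S \<omega> by (auto simp: S'_def)
    have "Min S' \<in> S'" using S' by simp
    moreover have "N r \<omega> \<le> \<eta>" if "r \<in> S" "r < Min S'" for r
      using that S' Min_le[of S' r] by (auto simp: S'_def not_le[symmetric])
    ultimately have "\<omega> \<in> Bs (Min S')" using \<omega> by (auto simp: Bs_def S'_def)
    then show "\<omega> \<in> (\<Union>s\<in>S. Bs s)" using \<open>Min S' \<in> S'\<close> by (auto simp: S'_def)
  qed (auto simp: Bs_def)
  have disj: "disjoint_family_on Bs S"
    unfolding disjoint_family_on_def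
  proof (intro ballI impI)
    fix r s assume rs: "r \<in> S" "s \<in> S" "r \<noteq> s"
    have lt: "Bs r \<inter> Bs s = {}" if "r \<in> S" "r < s" for r s
    proof -
      have "N r \<omega> \<le> \<eta>" if "\<omega> \<in> Bs s" for \<omega> using that \<open>r \<in> S\<close> \<open>r < s\<close> by (simp add: Bs_def)
      moreover have "\<eta> < N r \<omega>" if "\<omega> \<in> Bs r" for \<omega> using that by (simp add: Bs_def)
      ultimately show ?thesis by (meson disjoint_iff not_le)
    qed
    show "Bs r \<inter> Bs s = {}"
      using lt[OF rs(1), of s] lt[OF rs(2), of r] rs(3) by (cases "r < s") (auto simp: Int_commute)
  qed
  have ind_le: "(\<Sum>s\<in>S. indicator (Bs s) \<omega>) \<le> (1::real)" for \<omega>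
  proof -
    have "(\<Sum>s\<in>S. indicator (Bs s) \<omega>) = (indicator (\<Union>s\<in>S. Bs s) \<omega> :: real)"
      by (rule indicator_UN_disjoint[OF S(1) disj, symmetric])
    then show ?thesis by (simp add: indicator_def)
  qed
  have int1: "integrable P (\<lambda>\<omega>. indicator (Bs s) \<omega> * N r \<omega>)" if "s \<in> S" "r \<in> {0..T}" for s r
    using integrable_mult_indicator[OF BP[OF that(1)] N_meas(2)[OF that(2)]] by simp
  have each: "\<eta> * prob (Bs s) \<le> (\<integral>\<omega>. indicator (Bs s) \<omega> * N T \<omega> \<partial>P)" if s: "s \<in> S" for s
  proof -
    have sT: "s \<in> {0..T}" using S s by auto
    have "\<eta> * prob (Bs s) = (\<integral>\<omega>. \<eta> * indicator (Bs s) \<omega> \<partial>P)"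
      using BP[OF s] by simp
    also have "\<dots> \<le> (\<integral>\<omega>. indicator (Bs s) \<omega> * N s \<omega> \<partial>P)"
    proof (rule integral_mono)
      show "integrable P (\<lambda>\<omega>. \<eta> * indicator (Bs s) \<omega>)" using BP[OF s] by (simp add: integrable_real_indicator emeasure_eq_measure)
      show "integrable P (\<lambda>\<omega>. indicator (Bs s) \<omega> * N s \<omega>)" by (rule int1[OF s sT])
      show "\<eta> * indicator (Bs s) \<omega> \<le> indicator (Bs s) \<omega> * N s \<omega>" for \<omega>
        by (auto simp: Bs_def indicator_def)
    qed
    also have "\<dots> = (\<integral>\<omega>. indicator (Bs s) \<omega> * N T \<omega> \<partial>P)"
    proof -
      have "\<And>a b A. 0 \<le> a \<and> a \<le> b \<and> b \<le> T \<and> A \<in> sets (Fil a) \<Longrightarrow>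
        (\<integral>\<omega>. indicator A \<omega> * N b \<omega> \<partial>P) = (\<integral>\<omega>. indicator A \<omega> * N a \<omega> \<partial>P)"
        using mart by (simp add: martingale_on_def)
      from this[of s T "Bs s"] show ?thesis using Bs[OF s] sT by simp
    qed
    finally show ?thesis .
  qed
  have "\<eta> * prob {\<omega> \<in> space P. \<exists>s\<in>S. \<eta> < N s \<omega>} = (\<Sum>s\<in>S. \<eta> * prob (Bs s))"
    unfolding un using finite_measure_finite_Union[OF S(1) _ disj] BP by (simp add: image_subset_iff sum_distrib_left)
  also have "\<dots> \<le> (\<Sum>s\<in>S. \<integral>\<omega>. indicator (Bs s) \<omega> * N T \<omega> \<partial>P)" using each by (rule sum_mono)
  also have "\<dots> = (\<integral>\<omega>. (\<Sum>s\<in>S. indicator (Bs s) \<omega> * N T \<omega>) \<partial>P)"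
    using int1 T by (intro Bochner_Integration.integral_sum[symmetric]) auto
  also have "\<dots> \<le> (\<integral>\<omega>. N T \<omega> \<partial>P)"
  proof (rule integral_mono_AE)
    show "integrable P (\<lambda>\<omega>. \<Sum>s\<in>S. indicator (Bs s) \<omega> * N T \<omega>)" using int1 T by (intro Bochner_Integration.integrable_sum) auto
    show "integrable P (N T)" using N_meas(2)[of T] T by auto
    show "AE \<omega> in P. (\<Sum>s\<in>S. indicator (Bs s) \<omega> * N T \<omega>) \<le> N T \<omega>"
      using nn
    proof eventually_elim
      case (elim \<omega>)
      show ?case using mult_right_mono[OF ind_le[of \<omega>] elim] by (simp add: sum_distrib_right)
    qed
  qed
  finally show ?thesis .
qed

text \<open>The countable set is exhausted by finite ones, and the probabilities converge
  monotonically.\<close>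

lemma maximal_inequality:
  assumes mart: "martingale_on P Fil T N" and nn: "AE \<omega> in P. 0 \<le> N T \<omega>" and \<eta>: "0 < \<eta>"
    and D: "countable D" "D \<subseteq> {0..T}"
  shows "emeasure P {\<omega> \<in> space P. \<exists>s\<in>D. \<eta> < N s \<omega>} \<le> ennreal ((\<integral>\<omega>. N T \<omega> \<partial>P) / \<eta>)"
proof (cases "D = {}")
  case True
  then show ?thesis by simp
next
  case False
  define d where "d = from_nat_into D"
  have d: "range d = D" unfolding d_def using range_from_nat_into[OF False D(1)] .
  define Aj where "Aj j = {\<omega> \<in> space P. \<exists>s\<in>d ` {..j}. \<eta> < N s \<omega>}" for j :: nat
  have Nm: "N s \<in> borel_measurable P" if "s \<in> D" for s
    using mart D that by (intro P_measurable[of "N s" s]) (auto simp: martingale_on_def)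
  have A: "Aj j \<in> sets P" for j
    unfolding Aj_def
    by (rule sets.sets_Collect_finite_Ex) (use Nm d in \<open>auto intro!: borel_measurable_less\<close>)
  have "emeasure P (Aj j) \<le> ennreal ((\<integral>\<omega>. N T \<omega> \<partial>P) / \<eta>)" for j
  proof -
    have "\<eta> * prob (Aj j) \<le> (\<integral>\<omega>. N T \<omega> \<partial>P)"
      unfolding Aj_def by (rule maximal_inequality_finite[OF mart nn \<eta>]) (use d D in auto)
    then have "prob (Aj j) \<le> (\<integral>\<omega>. N T \<omega> \<partial>P) / \<eta>" using \<eta> by (simp add: pos_le_divide_eq mult.commute)
    then show ?thesis by (simp add: emeasure_eq_measure ennreal_leI)
  qed
  moreover have "{\<omega> \<in> space P. \<exists>s\<in>D. \<eta> < N s \<omega>} = (\<Union>j. Aj j)"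
    unfolding Aj_def d[symmetric] by auto
  moreover have "incseq Aj" unfolding incseq_def Aj_def by (auto; meson le_trans atMost_iff imageI)
  ultimately show ?thesis
    using SUP_emeasure_incseq[of Aj P] A by (metis (no_types, lifting) SUP_least image_subset_iff)
qed

text \<open>Dyadic levels: \<open>W\<close> is at most \<open>a\<close> plus the sum of 2^(k+1) a
  over the levels 2^k a that it exceeds. The inverse square tail makes the expectations a geometric
  series with sum 4 c / a. This turns Doob's weak bound for a square into a bound for a first
  moment.\<close>

lemma nn_integral_tail_bound:
  assumes W: "W \<in> borel_measurable P" and a: "0 < a" and c: "0 \<le> c"
    and tail: "\<And>\<mu>. 0 < \<mu> \<Longrightarrow> emeasure P {\<omega> \<in> space P. ennreal \<mu> < W \<omega>} \<le> ennreal (c / \<mu>\<^sup>2)"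
  shows "(\<integral>\<^sup>+\<omega>. W \<omega> \<partial>P) \<le> ennreal (a + 4 * c / a)"
proof -
  define Bk where "Bk k = {\<omega> \<in> space P. ennreal (2 ^ k * a) < W \<omega>}" for k :: nat
  have B: "Bk k \<in> sets P" for k unfolding Bk_def using W by measurable
  define tm where "tm k \<omega> = ennreal (2 ^ Suc k * a) * indicator (Bk k) \<omega>" for k \<omega>
  \<comment> \<open>Testing against finite values below \<open>W\<close> includes the case in which
    \<open>W\<close> is infinite.\<close>
  have pt: "W \<omega> \<le> ennreal a + (\<Sum>k. tm k \<omega>)" if "\<omega> \<in> space P" for \<omega>
  proof (rule dense_le)
    fix x assume x: "x < W \<omega>"
    then have "x < top" by (simp add: less_le_trans)
    then obtain y where y: "x = ennreal y" "0 \<le> y" by (cases x) auto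
    show "x \<le> ennreal a + (\<Sum>k. tm k \<omega>)"
    proof (cases "y \<le> a")
      case True
      then show ?thesis using y by (simp add: add_increasing2 ennreal_leI)
    next
      case False
      obtain K where "y / a < 2 ^ K" using real_arch_pow[of 2 "y / a"] by auto
      then have ex: "\<exists>k. y \<le> 2 ^ k * a" using a by (intro exI[of _ K]) (simp add: pos_divide_less_eq)
      define k where "k = (LEAST k. y \<le> 2 ^ k * a)"
      have k: "y \<le> 2 ^ k * a" unfolding k_def by (rule LeastI_ex[OF ex])
      have "k \<noteq> 0" using k False by (cases k) auto
      then obtain j where j: "k = Suc j" by (cases k) auto
      have "\<not> y \<le> 2 ^ j * a" using not_less_Least[of j "\<lambda>k. y \<le> 2 ^ k * a"] j by (simp add: k_def[symmetric])
      then have "ennreal (2 ^ j * a) < W \<omega>" using x y by (meson ennreal_leI le_less_trans linear)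
      then have "tm j \<omega> = ennreal (2 ^ k * a)" using that by (simp add: tm_def Bk_def j)
      then have "x \<le> tm j \<omega>" using k y by (simp add: ennreal_leI)
      also have "\<dots> \<le> (\<Sum>k. tm k \<omega>)" using sum_le_suminf[of "\<lambda>k. tm k \<omega>" "{j}"] by simp
      finally show ?thesis by (simp add: add_increasing)
    qed
  qed
  have "(\<integral>\<^sup>+\<omega>. W \<omega> \<partial>P) \<le> (\<integral>\<^sup>+\<omega>. ennreal a + (\<Sum>k. tm k \<omega>) \<partial>P)" using pt by (rule nn_integral_mono)
  also have "\<dots> = ennreal a + (\<Sum>k. \<integral>\<^sup>+\<omega>. tm k \<omega> \<partial>P)"
  proof -
    have tmm: "tm k \<in> borel_measurable P" for k unfolding tm_def[abs_def] using B by simp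
    have "(\<integral>\<^sup>+\<omega>. ennreal a + (\<Sum>k. tm k \<omega>) \<partial>P) = (\<integral>\<^sup>+\<omega>. ennreal a \<partial>P) + (\<integral>\<^sup>+\<omega>. (\<Sum>k. tm k \<omega>) \<partial>P)"
      using tmm by (intro nn_integral_add) auto
    also have "(\<integral>\<^sup>+\<omega>. (\<Sum>k. tm k \<omega>) \<partial>P) = (\<Sum>k. \<integral>\<^sup>+\<omega>. tm k \<omega> \<partial>P)" by (rule nn_integral_suminf[OF tmm])
    finally show ?thesis by (simp add: emeasure_space_1)
  qed
  also have "(\<Sum>k. \<integral>\<^sup>+\<omega>. tm k \<omega> \<partial>P) \<le> (\<Sum>k. ennreal (2 * c / a * (1/2) ^ k))"
  proof (rule suminf_le)
    fix k
    have "(\<integral>\<^sup>+\<omega>. tm k \<omega> \<partial>P) = ennreal (2 ^ Suc k * a) * emeasure P (Bk k)"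
      unfolding tm_def using B by (simp add: nn_integral_cmult_indicator)
    also have "\<dots> \<le> ennreal (2 ^ Suc k * a) * ennreal (c / (2 ^ k * a)\<^sup>2)"
      unfolding Bk_def using a by (intro mult_left_mono tail) auto
    also have "\<dots> = ennreal (2 ^ Suc k * a * (c / (2 ^ k * a)\<^sup>2))" using a c by (intro ennreal_mult[symmetric]) auto
    also have "2 ^ Suc k * a * (c / (2 ^ k * a)\<^sup>2) = 2 * c / a * (1/2) ^ k"
      using a by (simp add: power2_eq_square power_one_over field_simps)
    finally show "(\<integral>\<^sup>+\<omega>. tm k \<omega> \<partial>P) \<le> ennreal (2 * c / a * (1/2) ^ k)" .
  qed auto
  also have "(\<Sum>k. ennreal (2 * c / a * (1/2) ^ k)) = ennreal (\<Sum>k. 2 * c / a * (1/2) ^ k)"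
    using a c by (intro suminf_ennreal2 summable_mult summable_geometric) auto
  also have "(\<Sum>k. 2 * c / a * (1/2::real) ^ k) = 4 * c / a"
    by (subst suminf_mult) (auto simp: suminf_geometric intro!: summable_geometric)
  finally show ?thesis using a c by (simp add: ennreal_plus[symmetric] del: ennreal_plus)
qed

end

section \<open>The diffusion\<close>

lemma path_sigma_space: "space (path_sigma E I) = paths E"
  unfolding path_sigma_def by (rule space_measure_of) auto

lemma path_sigma_mono: "I \<subseteq> J \<Longrightarrow> sets (path_sigma E I) \<subseteq> sets (path_sigma E J)"
proof -
  assume IJ: "I \<subseteq> J"
  have "sets (path_sigma E K) = sigma_sets (paths E) {{\<omega> \<in> paths E. \<omega> s \<in> U} |s U. s \<in> K \<and> openin (cemetery_ext E) U}" for K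
    unfolding path_sigma_def by (rule sets_measure_of) auto
  moreover have "{{\<omega> \<in> paths E. \<omega> s \<in> U} |s U. s \<in> I \<and> openin (cemetery_ext E) U}
      \<subseteq> {{\<omega> \<in> paths E. \<omega> s \<in> U} |s U. s \<in> J \<and> openin (cemetery_ext E) U}"
    using IJ by blast
  ultimately show ?thesis by (simp only:) (rule sigma_sets_mono')
qed

locale diffusion = exhausted_op E A Abar B V \<kappa> En x0
  for E :: "(real^'d::finite) set" and A Abar B V \<kappa> En x0 +
  fixes \<phi> :: "real^'d \<Rightarrow> real" and x :: "real^'d" and P :: "'d path measure"
  assumes \<phi>_C2: "Ck_on E 2 \<phi>" and xE: "x \<in> E" and gmp: "gmp_solution A Abar B E En \<phi> x P"
begin

abbreviation "Fil t \<equiv> path_sigma E {0..t}"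

lemma space_P: "space P = paths E" and sets_P: "sets P = sets (path_sigma E {0..})"
  using gmp by (auto simp: gmp_solution_def)

sublocale filtered_prob P "\<lambda>t. path_sigma E {0..t}"
proof -
  interpret prob_space P using gmp by (simp add: gmp_solution_def)
  show "filtered_prob P (\<lambda>t. path_sigma E {0..t})"
  proof unfold_locales
    show "space (path_sigma E {0..t}) = space P" for t :: real by (simp add: path_sigma_space space_P)
    show "sets (path_sigma E {0..t}) \<subseteq> sets P" for t :: real unfolding sets_P by (rule path_sigma_mono) auto
    show "sets (path_sigma E {0..s}) \<subseteq> sets (path_sigma E {0..t})" if "s \<le> t" for s t :: real
      by (rule path_sigma_mono) (use that in auto)
  qed
qed

lemma AE_path: "AE \<omega> in P. \<omega> \<in> paths E \<and> \<omega> 0 = Some x"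
proof -
  have "AE \<omega> in P. \<omega> 0 = Some x" using gmp by (simp add: gmp_solution_def)
  then show ?thesis using AE_space by eventually_elim (simp add: space_P)
qed

definition M :: "nat \<Rightarrow> (real^'d \<Rightarrow> real) \<Rightarrow> real \<Rightarrow> 'd path \<Rightarrow> real" where
  "M n f t \<omega> = f (the (\<omega> (stopped (En n) t \<omega>)))
     - (LBINT s:{0..stopped (En n) t \<omega>}. L \<phi> f (the (\<omega> s)))"

text \<open>The almost sure identity for conditional expectations is passed to integrals over events
  of the past, the form kept in \<open>martingale_on\<close>.\<close>

lemma M_martingale:
  assumes f: "Ck_on E 2 f"
  shows "0 \<le> t \<Longrightarrow> M n f t \<in> borel_measurable (Fil t)" "0 \<le> t \<Longrightarrow> integrable P (M n f t)"
    "0 \<le> a \<Longrightarrow> a \<le> b \<Longrightarrow> G \<in> sets (Fil a) \<Longrightarrow>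
      (\<integral>\<omega>. indicator G \<omega> * M n f b \<omega> \<partial>P) = (\<integral>\<omega>. indicator G \<omega> * M n f a \<omega> \<partial>P)"
proof -
  have mart: "is_martingale P Fil (M n f)"
    using gmp[unfolded gmp_solution_def, THEN conjunct2, THEN conjunct2, THEN conjunct2, THEN conjunct2, rule_format, OF f, of n]
    unfolding M_def[abs_def] .
  show 1: "M n f t \<in> borel_measurable (Fil t)" if "0 \<le> t" for t using mart that by (simp add: is_martingale_def)
  show 2: "integrable P (M n f t)" if "0 \<le> t" for t using mart that by (simp add: is_martingale_def)
  show "(\<integral>\<omega>. indicator G \<omega> * M n f b \<omega> \<partial>P) = (\<integral>\<omega>. indicator G \<omega> * M n f a \<omega> \<partial>P)"
    if ab: "0 \<le> a" "a \<le> b" and G: "G \<in> sets (Fil a)"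
  proof -
    have "subalgebra P (Fil a)" using Fil_space Fil_sub by (simp add: subalgebra_def)
    then interpret finite_measure_subalgebra P "Fil a" by unfold_locales
    have "(\<integral>\<omega>\<in>G. M n f b \<omega> \<partial>P) = (\<integral>\<omega>\<in>G. real_cond_exp P (Fil a) (M n f b) \<omega> \<partial>P)"
      by (rule real_cond_exp_intA) (use 2 ab G in auto)
    also have "\<dots> = (\<integral>\<omega>\<in>G. M n f a \<omega> \<partial>P)"
    proof (rule set_lebesgue_integral_cong_AE)
      show "G \<in> sets P" using G Fil_sub by blast
      show "real_cond_exp P (Fil a) (M n f b) \<in> borel_measurable P" by simp
      show "M n f a \<in> borel_measurable P" using 2 ab by auto
      have "AE \<omega> in P. real_cond_exp P (Fil a) (M n f b) \<omega> = M n f a \<omega>"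
        using mart ab by (simp add: is_martingale_def)
      then show "AE \<omega> in P. \<omega> \<in> G \<longrightarrow> real_cond_exp P (Fil a) (M n f b) \<omega> = M n f a \<omega>" by eventually_elim simp
    qed
    finally show ?thesis by (simp add: set_lebesgue_integral_def)
  qed
qed

lemma stopped_path:
  assumes \<omega>: "\<omega> \<in> paths E" "\<omega> 0 = Some x" and n: "x \<in> En n" and t: "0 \<le> t"
  shows "continuous_on {0..stopped (En n) t \<omega>} (pos \<omega>)"
    "\<And>r. r \<in> {0..stopped (En n) t \<omega>} \<Longrightarrow> pos \<omega> r \<in> closure (En n)" "pos \<omega> 0 = x"
proof -
  have start: "\<omega> 0 \<in> Some ` En n" using \<omega>(2) n by auto
  have in_cl: "\<omega> r \<in> Some ` closure (En n)" if "r \<in> {0..stopped (En n) t \<omega>}" for r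
    using at_stopped[OF \<omega>(1) t start] that by auto
  show "pos \<omega> r \<in> closure (En n)" if "r \<in> {0..stopped (En n) t \<omega>}" for r using in_cl[OF that] by (auto simp: pos_def)
  show "continuous_on {0..stopped (En n) t \<omega>} (pos \<omega>)"
  proof (rule path_continuous[OF \<omega>(1) openE])
    show "\<omega> r \<in> Some ` E" if "r \<in> {0..stopped (En n) t \<omega>}" for r
      using in_cl[OF that] closure_En_subset[of n] by blast
  qed auto
  show "pos \<omega> 0 = x" using \<omega>(2) by (simp add: pos_def)
qed

text \<open>Up to the exit time the integrand is continuous along the path, so the Lebesgue integral
  in \<open>M\<close> is the gauge integral used in \<open>riemann_path\<close>.\<close>

lemma M_eq:
  assumes \<omega>: "\<omega> \<in> paths E" "\<omega> 0 = Some x" and n: "x \<in> En n" and t: "0 \<le> t" and f: "Ck_on E 2 f"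
  shows "M n f t \<omega> = f (pos \<omega> (stopped (En n) t \<omega>)) - integral {0..stopped (En n) t \<omega>} (\<lambda>r. L \<phi> f (pos \<omega> r))"
proof -
  have "continuous_on {0..stopped (En n) t \<omega>} (\<lambda>r. L \<phi> f (pos \<omega> r))"
  proof (rule continuous_on_compose2[OF L_continuous[OF \<phi>_C2 f] stopped_path(1)[OF \<omega> n t]])
    show "pos \<omega> ` {0..stopped (En n) t \<omega>} \<subseteq> E"
      using stopped_path(2)[OF \<omega> n t] closure_En_subset[of n] by blast
  qed
  then have "set_integrable lborel {0..stopped (En n) t \<omega>} (\<lambda>r. L \<phi> f (pos \<omega> r))"
    by (rule borel_integrable_atLeastAtMost')
  from set_borel_integral_eq_integral(2)[OF this] show ?thesis by (simp add: M_def pos_def)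
qed

text \<open>Ito's formula in expectation: the martingale problem only speaks about functions of \<open>X\<close>; the time
  dependence is frozen on the cells of a partition, and the partition is refined.\<close>

lemma time_martingale:
  fixes f ft :: "real \<Rightarrow> real^'d \<Rightarrow> real"
  assumes n: "x \<in> En n" and T: "0 \<le> T"
    and C2: "\<And>s. s \<in> {0..T} \<Longrightarrow> Ck_on E 2 (f s)"
    and der: "\<And>r y. r \<in> {0..T} \<Longrightarrow> y \<in> E \<Longrightarrow> ((\<lambda>s. f s y) has_real_derivative ft r y) (at r within {0..T})"
    and cont: "continuous_on ({0..T} \<times> E) (\<lambda>p. f (fst p) (snd p))"
      "continuous_on ({0..T} \<times> E) (\<lambda>p. ft (fst p) (snd p))"
      "continuous_on ({0..T} \<times> E) (\<lambda>p. L \<phi> (f (fst p)) (snd p))"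
  shows "\<exists>N. martingale_on P Fil T N \<and> (\<forall>\<omega> s. \<omega> \<in> paths E \<longrightarrow> \<omega> 0 = Some x \<longrightarrow> s \<in> {0..T} \<longrightarrow>
     N s \<omega> = f (stopped (En n) s \<omega>) (pos \<omega> (stopped (En n) s \<omega>)) - f 0 x
       - integral {0..stopped (En n) s \<omega>} (\<lambda>r. ft r (pos \<omega> r) + L \<phi> (f r) (pos \<omega> r)))"
proof -
  let ?S = "closure (En n)"
  define q where "q m i = real i * (T / real (Suc m))" for m i
  define Nm where "Nm m s \<omega> = (\<Sum>i<Suc m. M n (f (q m i)) (min (q m (Suc i)) s) \<omega> - M n (f (q m i)) (min (q m i) s) \<omega>)" for m s \<omega>
  \<comment> \<open>Taking \<open>lim\<close> pointwise makes \<open>N s\<close> measurable with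
    respect to the past at once, while convergence is known only for paths started at
    \<open>x\<close>, which have full probability.\<close>
  define N where "N s \<omega> = lim (\<lambda>m. Nm m s \<omega>)" for s \<omega>
  have q: "0 \<le> q m i" for m i using T by (simp add: q_def)
  have qT: "q m i \<in> {0..T}" if "i < Suc m" for m i
  proof -
    have "real i / real (Suc m) \<le> 1" using that by simp
    then have "T * (real i / real (Suc m)) \<le> T * 1" using T by (intro mult_left_mono) auto
    then show ?thesis using q[of m i] by (simp add: q_def mult.commute)
  qed
  have fC2: "Ck_on E 2 (f (q m i))" if "i < Suc m" for m i using C2[OF qT[OF that]] .
  have sub: "{0..T} \<times> ?S \<subseteq> {0..T} \<times> E" using closure_En_subset by auto
  note contS = cont[THEN continuous_on_subset, OF sub]
  obtain K where K: "\<And>r y. r \<in> {0..T} \<Longrightarrow> y \<in> ?S \<Longrightarrow> \<bar>f r y\<bar> \<le> K \<and> \<bar>ft r y\<bar> \<le> K \<and> \<bar>L \<phi> (f r) y\<bar> \<le> K"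
  proof -
    have "\<exists>B. \<forall>p\<in>{0..T} \<times> ?S. \<bar>k p\<bar> \<le> B" if "continuous_on ({0..T} \<times> ?S) k" for k :: "real \<times> (real^'d) \<Rightarrow> real"
    proof -
      have "bounded (k ` ({0..T} \<times> ?S))"
        by (intro compact_imp_bounded compact_continuous_image that compact_Times compact_closure_En) auto
      then show ?thesis unfolding bounded_iff by auto
    qed
    from this[OF contS(1)] this[OF contS(2)] this[OF contS(3)]
    obtain B1 B2 B3 where B: "\<And>p. p \<in> {0..T} \<times> ?S \<Longrightarrow> \<bar>f (fst p) (snd p)\<bar> \<le> B1"
      "\<And>p. p \<in> {0..T} \<times> ?S \<Longrightarrow> \<bar>ft (fst p) (snd p)\<bar> \<le> B2"
      "\<And>p. p \<in> {0..T} \<times> ?S \<Longrightarrow> \<bar>L \<phi> (f (fst p)) (snd p)\<bar> \<le> B3" by blast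
    show ?thesis
    proof (rule that[of "max B1 (max B2 B3)"])
      fix r y assume "r \<in> {0..T}" "y \<in> ?S"
      then show "\<bar>f r y\<bar> \<le> max B1 (max B2 B3) \<and> \<bar>ft r y\<bar> \<le> max B1 (max B2 B3) \<and> \<bar>L \<phi> (f r) y\<bar> \<le> max B1 (max B2 B3)"
        using B(1)[of "(r, y)"] B(2)[of "(r, y)"] B(3)[of "(r, y)"] by (auto simp: le_max_iff_disj)
    qed
  qed
  define K' where "K' = 2 * K + 2 * K * T"
  have path: "(\<lambda>m. Nm m s \<omega>) \<longlonglongrightarrow> f (stopped (En n) s \<omega>) (pos \<omega> (stopped (En n) s \<omega>)) - f 0 x
       - integral {0..stopped (En n) s \<omega>} (\<lambda>r. ft r (pos \<omega> r) + L \<phi> (f r) (pos \<omega> r))"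
    "\<And>m. \<bar>Nm m s \<omega>\<bar> \<le> K'"
    if \<omega>: "\<omega> \<in> paths E" "\<omega> 0 = Some x" and s: "s \<in> {0..T}" for \<omega> s
  proof -
    define \<rho> where "\<rho> = stopped (En n) s \<omega>"
    have s0: "0 \<le> s" "s \<le> T" using s by auto
    have \<rho>: "0 \<le> \<rho>" "\<rho> \<le> s" using stopped_bounds[OF s0(1)] by (auto simp: \<rho>_def)
    have st: "stopped (En n) (min (q m i) s) \<omega> = min (q m i) \<rho>" for m i
    proof -
      have "stopped (En n) (min (q m i) s) \<omega> = min (min (q m i) s) \<rho>"
        unfolding \<rho>_def using q s0 by (intro stopped_min) auto
      then show ?thesis using \<rho> by (simp add: min.assoc)
    qed
    have Meq: "M n (f (q m i)) (min (q m j) s) \<omega> = f (q m i) (pos \<omega> (min (q m j) \<rho>)) - integral {0..min (q m j) \<rho>} (\<lambda>r. L \<phi> (f (q m i)) (pos \<omega> r))"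
      if "i < Suc m" for m i j
      using M_eq[OF \<omega> n, of "min (q m j) s" "f (q m i)"] fC2[OF that] q[of m j] s0 by (simp add: st)
    note gp = stopped_path[OF \<omega> n s0(1), folded \<rho>_def]
    have Nm_eq: "Nm m s \<omega> = (\<Sum>i<Suc m. f (q m i) (pos \<omega> (min (q m (Suc i)) \<rho>)) - f (q m i) (pos \<omega> (min (q m i) \<rho>))
     - (integral {0..min (q m (Suc i)) \<rho>} (\<lambda>r. L \<phi> (f (q m i)) (pos \<omega> r)) - integral {0..min (q m i) \<rho>} (\<lambda>r. L \<phi> (f (q m i)) (pos \<omega> r))))" for m
      unfolding Nm_def by (intro sum.cong) (auto simp: Meq)
    have \<rho>T: "\<rho> \<le> T" using \<rho> s0 by simp
    have derS: "((\<lambda>s. f s y) has_real_derivative ft r y) (at r within {0..T})" if "r \<in> {0..T}" "y \<in> ?S" for r y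
      using der that closure_En_subset by auto
    note rp = riemann_path[OF \<rho>(1) \<rho>T gp(1,2) derS contS(2,3), folded q_def, folded Nm_eq]
    show "(\<lambda>m. Nm m s \<omega>) \<longlonglongrightarrow> f (stopped (En n) s \<omega>) (pos \<omega> (stopped (En n) s \<omega>)) - f 0 x
       - integral {0..stopped (En n) s \<omega>} (\<lambda>r. ft r (pos \<omega> r) + L \<phi> (f r) (pos \<omega> r))"
      using rp(1) by (simp add: gp(3) \<rho>_def)
    show "\<bar>Nm m s \<omega>\<bar> \<le> K'" for m unfolding K'_def by (rule rp(2)) (use K in auto)
  qed
  have N_eq: "N s \<omega> = f (stopped (En n) s \<omega>) (pos \<omega> (stopped (En n) s \<omega>)) - f 0 x
       - integral {0..stopped (En n) s \<omega>} (\<lambda>r. ft r (pos \<omega> r) + L \<phi> (f r) (pos \<omega> r))"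
    and N_lim: "(\<lambda>m. Nm m s \<omega>) \<longlonglongrightarrow> N s \<omega>"
    if "\<omega> \<in> paths E" "\<omega> 0 = Some x" "s \<in> {0..T}" for \<omega> s
    using path(1)[OF that] limI[OF path(1)[OF that]] by (auto simp: N_def)
  have Nm_Fil: "Nm m s \<in> borel_measurable (Fil s)" if "s \<in> {0..T}" for m s
    unfolding Nm_def
  proof (intro borel_measurable_sum borel_measurable_diff)
    fix i assume i: "i \<in> {..<Suc m}"
    have "M n (f (q m i)) (min (q m j) s) \<in> borel_measurable (Fil s)" for j
      by (rule Fil_measurable[OF M_martingale(1)]) (use fC2[of i m] i q[of m j] that in auto)
    then show "M n (f (q m i)) (min (q m (Suc i)) s) \<in> borel_measurable (Fil s)"
      "M n (f (q m i)) (min (q m i) s) \<in> borel_measurable (Fil s)" by blast+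
  qed
  have N_Fil: "N s \<in> borel_measurable (Fil s)" if "s \<in> {0..T}" for s
    unfolding N_def[abs_def] by (rule borel_measurable_lim_metric[OF Nm_Fil[OF that]])
  have Nm_bd: "AE \<omega> in P. \<bar>Nm m s \<omega>\<bar> \<le> K'" if "s \<in> {0..T}" for m s
    using AE_path by eventually_elim (use path(2) that in auto)
  have N_bd: "AE \<omega> in P. \<bar>N s \<omega>\<bar> \<le> K'" if "s \<in> {0..T}" for s
    using AE_path
  proof eventually_elim
    case (elim \<omega>)
    have "(\<lambda>m. \<bar>Nm m s \<omega>\<bar>) \<longlonglongrightarrow> \<bar>N s \<omega>\<bar>" using N_lim elim that by (intro tendsto_rabs) auto
    then show ?case by (rule LIMSEQ_le_const2) (use path(2) elim that in auto)
  qed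
  have N_int: "integrable P (N s)" if "s \<in> {0..T}" for s
    by (rule integrable_const_bound[where B=K']) (use N_bd[OF that] P_measurable[OF N_Fil[OF that]] in auto)
  have Nm_mart: "(\<integral>\<omega>. indicator G \<omega> * Nm m b \<omega> \<partial>P) = (\<integral>\<omega>. indicator G \<omega> * Nm m a \<omega> \<partial>P)"
    if ab: "0 \<le> a" "a \<le> b" "b \<le> T" and G: "G \<in> sets (Fil a)" for a b G m
  proof -
    have GP: "G \<in> sets P" using G Fil_sub by blast
    have i1: "integrable P (\<lambda>\<omega>. indicator G \<omega> * M n (f (q m i)) (min (q m j) c) \<omega>)" if "i < Suc m" "0 \<le> c" for i j c
      using integrable_mult_indicator[OF GP M_martingale(2)[OF fC2[OF that(1)], of "min (q m j) c" n]] q[of m j] that by simp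
    \<comment> \<open>A grid time already passed at time \<open>a\<close> gives a frozen term; for a
      later one the martingale property applies from \<open>a\<close> to the smaller of that grid
      time and \<open>b\<close>.\<close>
    have eq: "(\<integral>\<omega>. indicator G \<omega> * M n (f (q m i)) (min (q m j) b) \<omega> \<partial>P) = (\<integral>\<omega>. indicator G \<omega> * M n (f (q m i)) (min (q m j) a) \<omega> \<partial>P)"
      if "i < Suc m" for i j
    proof (cases "q m j \<le> a")
      case True
      then show ?thesis using ab by (simp add: min_absorb1)
    next
      case False
      then have "min (q m j) a = a" "a \<le> min (q m j) b" using ab by auto
      then show ?thesis using M_martingale(3)[OF fC2[OF that] ab(1) _ G, of "min (q m j) b" n] by simp
    qed
    have ex: "(\<integral>\<omega>. indicator G \<omega> * Nm m c \<omega> \<partial>P) = (\<Sum>i<Suc m. (\<integral>\<omega>. indicator G \<omega> * M n (f (q m i)) (min (q m (Suc i)) c) \<omega> \<partial>P)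
        - (\<integral>\<omega>. indicator G \<omega> * M n (f (q m i)) (min (q m i) c) \<omega> \<partial>P))" if "0 \<le> c" for c
    proof -
      have "(\<integral>\<omega>. indicator G \<omega> * Nm m c \<omega> \<partial>P) = (\<integral>\<omega>. (\<Sum>i<Suc m. indicator G \<omega> * M n (f (q m i)) (min (q m (Suc i)) c) \<omega>
        - indicator G \<omega> * M n (f (q m i)) (min (q m i) c) \<omega>) \<partial>P)"
        by (simp only: Nm_def sum_distrib_left right_diff_distrib)
      also have "\<dots> = (\<Sum>i<Suc m. \<integral>\<omega>. (indicator G \<omega> * M n (f (q m i)) (min (q m (Suc i)) c) \<omega>
        - indicator G \<omega> * M n (f (q m i)) (min (q m i) c) \<omega>) \<partial>P)"
        using i1 that by (intro Bochner_Integration.integral_sum Bochner_Integration.integrable_diff) auto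
      also have "\<dots> = (\<Sum>i<Suc m. (\<integral>\<omega>. indicator G \<omega> * M n (f (q m i)) (min (q m (Suc i)) c) \<omega> \<partial>P)
        - (\<integral>\<omega>. indicator G \<omega> * M n (f (q m i)) (min (q m i) c) \<omega> \<partial>P))"
        using i1 that by (intro sum.cong refl Bochner_Integration.integral_diff) auto
      finally show ?thesis .
    qed
    show ?thesis using ex[of a] ex[of b] eq ab by simp
  qed
  have conv: "(\<lambda>m. \<integral>\<omega>. indicator G \<omega> * Nm m s \<omega> \<partial>P) \<longlonglongrightarrow> (\<integral>\<omega>. indicator G \<omega> * N s \<omega> \<partial>P)"
    if "s \<in> {0..T}" "G \<in> sets P" for s G
  proof (rule integral_dominated_convergence[where w="\<lambda>_. K'"])
    show "(\<lambda>\<omega>. indicator G \<omega> * N s \<omega>) \<in> borel_measurable P"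
      by (intro borel_measurable_times borel_measurable_indicator that(2) P_measurable[OF N_Fil[OF that(1)]])
    show "(\<lambda>\<omega>. indicator G \<omega> * Nm m s \<omega>) \<in> borel_measurable P" for m
      by (intro borel_measurable_times borel_measurable_indicator that(2) P_measurable[OF Nm_Fil[OF that(1)]])
    show "integrable P (\<lambda>_. K')" by simp
    show "AE \<omega> in P. (\<lambda>m. indicator G \<omega> * Nm m s \<omega>) \<longlonglongrightarrow> indicator G \<omega> * N s \<omega>"
      using AE_path
    proof eventually_elim
      case (elim \<omega>)
      show ?case by (intro tendsto_mult tendsto_const N_lim) (use elim that(1) in auto)
    qed
    show "AE \<omega> in P. norm (indicator G \<omega> * Nm m s \<omega>) \<le> K'" for m
      using Nm_bd[OF that(1), of m]
    proof eventually_elim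
      case (elim \<omega>)
      then show ?case by (cases "\<omega> \<in> G") auto
    qed
  qed
  have "martingale_on P Fil T N"
    unfolding martingale_on_def
  proof (intro conjI ballI allI impI)
    fix a b G assume H: "0 \<le> a \<and> a \<le> b \<and> b \<le> T \<and> G \<in> sets (Fil a)"
    then have GP: "G \<in> sets P" using Fil_sub[of a] by (simp add: subset_iff)
    have "(\<lambda>m. \<integral>\<omega>. indicator G \<omega> * Nm m b \<omega> \<partial>P) = (\<lambda>m. \<integral>\<omega>. indicator G \<omega> * Nm m a \<omega> \<partial>P)"
    proof
      fix m show "(\<integral>\<omega>. indicator G \<omega> * Nm m b \<omega> \<partial>P) = (\<integral>\<omega>. indicator G \<omega> * Nm m a \<omega> \<partial>P)"
        by (rule Nm_mart) (use H in simp_all)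
    qed
    moreover have "(\<lambda>m. \<integral>\<omega>. indicator G \<omega> * Nm m b \<omega> \<partial>P) \<longlonglongrightarrow> (\<integral>\<omega>. indicator G \<omega> * N b \<omega> \<partial>P)"
      "(\<lambda>m. \<integral>\<omega>. indicator G \<omega> * Nm m a \<omega> \<partial>P) \<longlonglongrightarrow> (\<integral>\<omega>. indicator G \<omega> * N a \<omega> \<partial>P)"
      by (rule conv; use GP H in simp)+
    ultimately show "(\<integral>\<omega>. indicator G \<omega> * N b \<omega> \<partial>P) = (\<integral>\<omega>. indicator G \<omega> * N a \<omega> \<partial>P)"
      by (simp add: LIMSEQ_unique)
  next
    fix s assume "s \<in> {0..T}"
    then show "N s \<in> borel_measurable (Fil s)" "integrable P (N s)" by (rule N_Fil, rule N_int)
  qed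
  then show ?thesis using N_eq by (intro exI[of _ N] conjI allI impI)
qed

end

section \<open>Dominating martingales, nonexplosion and expected suprema\<close>

context diffusion
begin

text \<open>Adding f 0 x + C T to the martingale of Ito's formula outweighs any admissible drift.
  The process, a supermartingale up to the drift \<open>C\<close>, is thus dominated by a
  nonnegative true martingale with known mean.\<close>

lemma dominating_martingale:
  fixes f ft k :: "real \<Rightarrow> real^'d \<Rightarrow> real"
  assumes n: "x \<in> En n" and T: "0 \<le> T" and C: "0 \<le> C"
    and C2: "\<And>s. s \<in> {0..T} \<Longrightarrow> Ck_on E 2 (f s)"
    and der: "\<And>r y. r \<in> {0..T} \<Longrightarrow> y \<in> E \<Longrightarrow> ((\<lambda>s. f s y) has_real_derivative ft r y) (at r within {0..T})"
    and cont: "continuous_on ({0..T} \<times> E) (\<lambda>p. f (fst p) (snd p))"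
      "continuous_on ({0..T} \<times> E) (\<lambda>p. ft (fst p) (snd p))"
      "continuous_on ({0..T} \<times> E) (\<lambda>p. L \<phi> (f (fst p)) (snd p))"
      "continuous_on ({0..T} \<times> E) (\<lambda>p. k (fst p) (snd p))"
    and nn: "\<And>r y. r \<in> {0..T} \<Longrightarrow> y \<in> E \<Longrightarrow> 0 \<le> f r y" "\<And>r y. r \<in> {0..T} \<Longrightarrow> y \<in> E \<Longrightarrow> 0 \<le> k r y"
    and drift: "\<And>r y. r \<in> {0..T} \<Longrightarrow> y \<in> E \<Longrightarrow> ft r y + L \<phi> (f r) y \<le> C - k r y"
  shows "\<exists>N. martingale_on P Fil T N \<and> (\<integral>\<omega>. N T \<omega> \<partial>P) = f 0 x + C * T \<and>
    (\<forall>\<omega> s. \<omega> \<in> paths E \<longrightarrow> \<omega> 0 = Some x \<longrightarrow> s \<in> {0..T} \<longrightarrow>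
      f (stopped (En n) s \<omega>) (pos \<omega> (stopped (En n) s \<omega>)) + integral {0..stopped (En n) s \<omega>} (\<lambda>r. k r (pos \<omega> r)) \<le> N s \<omega> \<and>
      0 \<le> N s \<omega> \<and> f (stopped (En n) s \<omega>) (pos \<omega> (stopped (En n) s \<omega>)) \<le> N s \<omega>)"
proof -
  obtain N where N: "martingale_on P Fil T N" and N_eq: "\<And>\<omega> s. \<omega> \<in> paths E \<Longrightarrow> \<omega> 0 = Some x \<Longrightarrow> s \<in> {0..T} \<Longrightarrow>
     N s \<omega> = f (stopped (En n) s \<omega>) (pos \<omega> (stopped (En n) s \<omega>)) - f 0 x
       - integral {0..stopped (En n) s \<omega>} (\<lambda>r. ft r (pos \<omega> r) + L \<phi> (f r) (pos \<omega> r))"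
    by (rule exE[OF time_martingale[OF n T C2 der cont(1) cont(2) cont(3)]]; (assumption | (erule conjE, erule that, simp)))
  have Nm: "N s \<in> borel_measurable (Fil s)" "integrable P (N s)" if "s \<in> {0..T}" for s
    using N that by (simp_all add: martingale_on_def)
  have Nint: "(\<integral>\<omega>. indicator G \<omega> * N b \<omega> \<partial>P) = (\<integral>\<omega>. indicator G \<omega> * N a \<omega> \<partial>P)"
    if "0 \<le> a" "a \<le> b" "b \<le> T" "G \<in> sets (Fil a)" for a b G
    using N that by (simp add: martingale_on_def)
  define c where "c = f 0 x + C * T"
  define N' where "N' s \<omega> = N s \<omega> + c" for s \<omega>
  have mart: "martingale_on P Fil T N'"
    unfolding martingale_on_def
  proof (intro conjI ballI allI impI)
    fix s assume s: "s \<in> {0..T}"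
    show "N' s \<in> borel_measurable (Fil s)" unfolding N'_def[abs_def] using Nm(1)[OF s] by simp
    show "integrable P (N' s)" unfolding N'_def[abs_def] using Nm(2)[OF s] by simp
  next
    fix a b G assume H: "0 \<le> a \<and> a \<le> b \<and> b \<le> T \<and> G \<in> sets (Fil a)"
    then have GP: "G \<in> sets P" using Fil_sub[of a] by (simp add: subset_iff)
    have "(\<integral>\<omega>. indicator G \<omega> * N' s \<omega> \<partial>P) = (\<integral>\<omega>. indicator G \<omega> * N s \<omega> \<partial>P) + (\<integral>\<omega>. indicator G \<omega> * c \<partial>P)" if "s \<in> {0..T}" for s
    proof -
      have "integrable P (\<lambda>\<omega>. indicator G \<omega> * N s \<omega>)" using integrable_mult_indicator[OF GP Nm(2)[OF that]] by simp
      moreover have "integrable P (\<lambda>\<omega>. indicator G \<omega> * c)" using integrable_mult_indicator[OF GP, of "\<lambda>_. c"] by simp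
      ultimately show ?thesis unfolding N'_def distrib_left by (rule Bochner_Integration.integral_add)
    qed
    from this[of a] this[of b] show "(\<integral>\<omega>. indicator G \<omega> * N' b \<omega> \<partial>P) = (\<integral>\<omega>. indicator G \<omega> * N' a \<omega> \<partial>P)"
      using Nint[of a b G] H by simp
  qed
  have EN: "(\<integral>\<omega>. N' T \<omega> \<partial>P) = c"
  proof -
    have z: "AE \<omega> in P. N 0 \<omega> = 0"
      using AE_path
    proof eventually_elim
      case (elim \<omega>)
      have "stopped (En n) 0 \<omega> = 0" using stopped_bounds[of 0 "En n" \<omega>] by simp
      then show ?case using N_eq[of \<omega> 0] elim T by (simp add: pos_def)
    qed
    have "(\<integral>\<omega>. N T \<omega> \<partial>P) = (\<integral>\<omega>. N 0 \<omega> \<partial>P)"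
    proof -
      have G: "space P \<in> sets (Fil 0)" using sets.top[of "Fil 0"] unfolding path_sigma_space space_P .
      have e: "(\<integral>\<omega>. indicator (space P) \<omega> * N s \<omega> \<partial>P) = (\<integral>\<omega>. N s \<omega> \<partial>P)" for s
        by (intro Bochner_Integration.integral_cong) auto
      show ?thesis using Nint[OF _ T _ G] e by simp
    qed
    also have "\<dots> = (\<integral>\<omega>. 0 \<partial>P)" using z Nm(2)[of 0] T by (intro integral_cong_AE) auto
    finally have "(\<integral>\<omega>. N T \<omega> \<partial>P) = 0" by simp
    then show ?thesis unfolding N'_def using Nm(2)[of T] T by (simp add: prob_space)
  qed
  have bounds: "f (stopped (En n) s \<omega>) (pos \<omega> (stopped (En n) s \<omega>)) + integral {0..stopped (En n) s \<omega>} (\<lambda>r. k r (pos \<omega> r)) \<le> N' s \<omega> \<and>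
      0 \<le> N' s \<omega> \<and> f (stopped (En n) s \<omega>) (pos \<omega> (stopped (En n) s \<omega>)) \<le> N' s \<omega>"
    if \<omega>: "\<omega> \<in> paths E" "\<omega> 0 = Some x" and s: "s \<in> {0..T}" for \<omega> s
  proof -
    define \<rho> where "\<rho> = stopped (En n) s \<omega>"
    have s0: "0 \<le> s" using s by simp
    have \<rho>: "0 \<le> \<rho>" "\<rho> \<le> T" using stopped_bounds[OF s0, of "En n" \<omega>] s by (auto simp: \<rho>_def)
    note gp = stopped_path[OF \<omega> n s0, folded \<rho>_def]
    have posE: "pos \<omega> r \<in> E" if "r \<in> {0..\<rho>}" for r using gp(2)[OF that] closure_En_subset by blast
    have cp: "continuous_on {0..\<rho>} (\<lambda>r. k' r (pos \<omega> r))" if "continuous_on ({0..T} \<times> E) (\<lambda>p. k' (fst p) (snd p))" for k' :: "real \<Rightarrow> real^'d \<Rightarrow> real"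
    proof -
      have "continuous_on {0..\<rho>} (\<lambda>r. (r, pos \<omega> r))" by (intro continuous_intros gp(1))
      moreover have "(\<lambda>r. (r, pos \<omega> r)) ` {0..\<rho>} \<subseteq> {0..T} \<times> E" using posE \<rho> by auto
      ultimately show ?thesis using continuous_on_compose2[OF that, of "{0..\<rho>}" "\<lambda>r. (r, pos \<omega> r)"] by simp
    qed
    have ik: "(\<lambda>r. k r (pos \<omega> r)) integrable_on {0..\<rho>}" by (intro integrable_continuous_real cp cont)
    have idr: "(\<lambda>r. ft r (pos \<omega> r) + L \<phi> (f r) (pos \<omega> r)) integrable_on {0..\<rho>}"
      by (intro integrable_continuous_real continuous_on_add cp cont)
    have "integral {0..\<rho>} (\<lambda>r. ft r (pos \<omega> r) + L \<phi> (f r) (pos \<omega> r)) \<le> integral {0..\<rho>} (\<lambda>r. C - k r (pos \<omega> r))"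
      using idr ik by (intro integral_le integrable_diff integrable_const_ivl drift posE) (use \<rho> in auto)
    also have "\<dots> = C * \<rho> - integral {0..\<rho>} (\<lambda>r. k r (pos \<omega> r))"
      using ik \<rho> by (subst Henstock_Kurzweil_Integration.integral_diff) (auto simp: mult.commute)
    finally have 1: "integral {0..\<rho>} (\<lambda>r. ft r (pos \<omega> r) + L \<phi> (f r) (pos \<omega> r)) \<le> C * \<rho> - integral {0..\<rho>} (\<lambda>r. k r (pos \<omega> r))" .
    have 2: "0 \<le> integral {0..\<rho>} (\<lambda>r. k r (pos \<omega> r))"
      using nn(2) posE \<rho> ik by (intro Henstock_Kurzweil_Integration.integral_nonneg) auto
    have 3: "C * \<rho> \<le> C * T" using C \<rho> by (intro mult_left_mono)
    have 4: "0 \<le> f \<rho> (pos \<omega> \<rho>)" using nn(1)[of \<rho>] posE \<rho> by auto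
    show ?thesis
      using 1 2 3 4 N_eq[OF \<omega> s] unfolding \<rho>_def[symmetric] N'_def c_def by linarith
  qed
  show ?thesis using mart EN bounds unfolding c_def by (intro exI[of _ N'] conjI allI impI) auto
qed

lemma static_martingale:
  assumes n: "x \<in> En n" and T: "0 \<le> T" and C: "0 \<le> C" and u: "Ck_on E 2 u"
    and nn: "\<And>y. y \<in> E \<Longrightarrow> 0 \<le> u y" and drift: "\<And>y. y \<in> E \<Longrightarrow> L \<phi> u y \<le> C"
  shows "\<exists>N. martingale_on P Fil T N \<and> (\<integral>\<omega>. N T \<omega> \<partial>P) = u x + C * T \<and>
    (\<forall>\<omega> s. \<omega> \<in> paths E \<longrightarrow> \<omega> 0 = Some x \<longrightarrow> s \<in> {0..T} \<longrightarrow> 0 \<le> N s \<omega> \<and> u (pos \<omega> (stopped (En n) s \<omega>)) \<le> N s \<omega>)"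
proof -
  have "\<exists>N. martingale_on P Fil T N \<and> (\<integral>\<omega>. N T \<omega> \<partial>P) = (\<lambda>_. u) (0::real) x + C * T \<and>
    (\<forall>\<omega> s. \<omega> \<in> paths E \<longrightarrow> \<omega> 0 = Some x \<longrightarrow> s \<in> {0..T} \<longrightarrow>
      (\<lambda>_. u) (stopped (En n) s \<omega>) (pos \<omega> (stopped (En n) s \<omega>)) + integral {0..stopped (En n) s \<omega>} (\<lambda>r. (\<lambda>_ _. 0) r (pos \<omega> r)) \<le> N s \<omega> \<and>
      0 \<le> N s \<omega> \<and> (\<lambda>_. u) (stopped (En n) s \<omega>) (pos \<omega> (stopped (En n) s \<omega>)) \<le> N s \<omega>)"
    by (rule dominating_martingale[where ft="\<lambda>_ _. 0", OF n T C])
      (use u nn drift in \<open>auto intro!: cont_snd L_continuous[OF \<phi>_C2 u] Ck_on_continuous[OF u]\<close>)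
  then show ?thesis by auto
qed

text \<open>Markov's inequality: for every \<open>j\<close> the exceptional event has probability at
  most C / (j + 1). The variables differ with \<open>j\<close> because they will belong to different
  stopping domains.\<close>

lemma markov_AE:
  assumes "\<And>j::nat. N j \<in> borel_measurable P" "\<And>j. AE \<omega> in P. 0 \<le> N j \<omega>" "\<And>j. integrable P (N j)"
    "\<And>j. (\<integral>\<omega>. N j \<omega> \<partial>P) \<le> C"
  shows "AE \<omega> in P. \<exists>j. N j \<omega> < real (Suc j)"
proof -
  define Z where "Z = {\<omega> \<in> space P. \<forall>j. real (Suc j) \<le> N j \<omega>}"
  have Z: "Z \<in> sets P" unfolding Z_def
    by (intro sets.sets_Collect_countable_All borel_measurable_le borel_measurable_const assms(1))
  have "prob Z \<le> C / real (Suc j)" for j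
  proof -
    have "(\<integral>\<^sup>+\<omega>. ennreal (N j \<omega>) \<partial>P) = ennreal (\<integral>\<omega>. N j \<omega> \<partial>P)" using assms by (intro nn_integral_eq_integral)
    also have "\<dots> \<le> ennreal C" using assms(4) by (rule ennreal_leI)
    finally have le: "(\<integral>\<^sup>+\<omega>. ennreal (N j \<omega>) \<partial>P) \<le> ennreal C" .
    have "ennreal (real (Suc j)) * emeasure P Z = (\<integral>\<^sup>+\<omega>. ennreal (real (Suc j)) * indicator Z \<omega> \<partial>P)"
      using Z by (simp add: nn_integral_cmult_indicator)
    also have "\<dots> \<le> (\<integral>\<^sup>+\<omega>. ennreal (N j \<omega>) \<partial>P)"
    proof (rule nn_integral_mono)
      show "ennreal (real (Suc j)) * indicator Z \<omega> \<le> ennreal (N j \<omega>)" for \<omega>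
      proof (cases "\<omega> \<in> Z")
        case True
        then have "real (Suc j) \<le> N j \<omega>" by (simp add: Z_def)
        then show ?thesis using True by (simp add: ennreal_leI del: of_nat_Suc)
      qed simp
    qed
    finally have "ennreal (real (Suc j)) * emeasure P Z \<le> ennreal C" using le by (rule order_trans)
    then have "ennreal (real (Suc j) * prob Z) \<le> ennreal C" by (simp add: emeasure_eq_measure ennreal_mult)
    moreover have C0: "0 \<le> C" using integral_nonneg_AE[OF assms(2)[of j]] assms(4)[of j] by linarith
    ultimately have "real (Suc j) * prob Z \<le> C" by (subst (asm) ennreal_le_iff) auto
    then show "prob Z \<le> C / real (Suc j)" by (simp add: pos_le_divide_eq mult.commute)
  qed
  moreover have "(\<lambda>j. C / real (Suc j)) \<longlonglongrightarrow> 0" using LIMSEQ_Suc[OF lim_const_over_n[of C]] .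
  ultimately have "prob Z \<le> 0" by (intro LIMSEQ_le_const[of _ 0]) auto
  then have "emeasure P Z = 0" using measure_nonneg[of P Z] by (simp add: emeasure_eq_measure)
  then show ?thesis using Z by (intro AE_I[of _ _ Z]) (auto simp: Z_def not_less)
qed

text \<open>Khasminskii's criterion: at an exit from \<open>En (n j)\<close> before time
  \<open>t\<close> the function \<open>U\<close> is at least j + 1, while its value at the stopped
  time is dominated by a variable with mean U x + C t.\<close>

lemma nonexploding:
  assumes U: "Ck_on E 2 U" "escapes U" and nn: "\<And>y. y \<in> E \<Longrightarrow> 0 \<le> U y"
    and C: "0 \<le> C" and drift: "\<And>y. y \<in> E \<Longrightarrow> L \<phi> U y \<le> C" and t: "0 \<le> t"
  shows "AE \<omega> in P. \<exists>n. \<forall>m\<ge>n. stopped (En m) t \<omega> = t"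
proof -
  obtain nx where nx: "x \<in> En nx" using xE E_eq by blast
  have "\<forall>j::nat. \<exists>n. nx \<le> n \<and> (\<forall>y\<in>E - En n. real (Suc j) \<le> U y)"
  proof
    fix j :: nat
    obtain n where "nx \<le> n" "\<And>x. x \<in> E - En n \<Longrightarrow> real (Suc j) \<le> U x" by (rule escapesD[OF U(2), of nx "real (Suc j)"]) auto
    then show "\<exists>n. nx \<le> n \<and> (\<forall>y\<in>E - En n. real (Suc j) \<le> U y)" by blast
  qed
  from choice[OF this] obtain n where n: "\<And>j. nx \<le> n j" "\<And>j y. y \<in> E - En (n j) \<Longrightarrow> real (Suc j) \<le> U y"
    by blast
  have xn: "x \<in> En (n j)" for j using nx En_mono[OF n(1)] by blast
  have "\<forall>j. \<exists>N. martingale_on P Fil t N \<and> (\<integral>\<omega>. N t \<omega> \<partial>P) = U x + C * t \<and>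
    (\<forall>\<omega> s. \<omega> \<in> paths E \<longrightarrow> \<omega> 0 = Some x \<longrightarrow> s \<in> {0..t} \<longrightarrow> 0 \<le> N s \<omega> \<and> U (pos \<omega> (stopped (En (n j)) s \<omega>)) \<le> N s \<omega>)"
    using static_martingale[OF xn t C U(1) nn drift] by simp
  from choice[OF this] obtain N where N: "\<And>j. martingale_on P Fil t (N j)" "\<And>j. (\<integral>\<omega>. N j t \<omega> \<partial>P) = U x + C * t"
    "\<And>j \<omega> s. \<omega> \<in> paths E \<Longrightarrow> \<omega> 0 = Some x \<Longrightarrow> s \<in> {0..t} \<Longrightarrow> 0 \<le> N j s \<omega>"
    "\<And>j \<omega> s. \<omega> \<in> paths E \<Longrightarrow> \<omega> 0 = Some x \<Longrightarrow> s \<in> {0..t} \<Longrightarrow> U (pos \<omega> (stopped (En (n j)) s \<omega>)) \<le> N j s \<omega>"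
    by blast
  have "AE \<omega> in P. \<exists>j. N j t \<omega> < real (Suc j)"
  proof (rule markov_AE[where N="\<lambda>j. N j t" and C="U x + C * t"])
    show "N j t \<in> borel_measurable P" "integrable P (N j t)" for j
      using N(1)[of j] t by (auto simp: martingale_on_def intro!: P_measurable)
    show "AE \<omega> in P. 0 \<le> N j t \<omega>" for j
      using AE_path
    proof eventually_elim
      case (elim \<omega>)
      then show ?case using N(3)[of \<omega> t j] t by simp
    qed
  qed (simp add: N(2))
  then show ?thesis
    using AE_path
  proof eventually_elim
    case (elim \<omega>)
    then obtain j where j: "N j t \<omega> < real (Suc j)" by blast
    have "stopped (En (n j)) t \<omega> = t"
    proof (rule ccontr)
      assume ne: "stopped (En (n j)) t \<omega> \<noteq> t"
      then have lt: "stopped (En (n j)) t \<omega> < t" using stopped_bounds[OF t, of "En (n j)" \<omega>] by linarith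
      have \<omega>: "\<omega> \<in> paths E" "\<omega> 0 = Some x" using elim by auto
      have "\<omega> (stopped (En (n j)) t \<omega>) \<in> Some ` closure (En (n j))"
        by (rule at_stopped[OF \<omega>(1) t]) (use \<omega> xn stopped_bounds[OF t] in auto)
      then obtain y where y: "\<omega> (stopped (En (n j)) t \<omega>) = Some y" "y \<in> closure (En (n j))" by auto
      have "y \<notin> En (n j)" using exited[OF \<omega>(1) t lt] y by auto
      then have "real (Suc j) \<le> U y" using n(2)[of y j] y closure_En_subset by auto
      also have "\<dots> \<le> N j t \<omega>" using N(4)[OF \<omega>, of t j] t y by (simp add: pos_def)
      finally show False using j by simp
    qed
    then show ?case using stopped_mono_domain[OF t] by blast
  qed
qed

text \<open>Fatou's lemma over the exhaustion: almost every path eventually satisfies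
  \<open>Q n\<close>, and the bound for the localised variables \<open>W n\<close> is the same for
  all admissible \<open>n\<close>.\<close>

lemma nn_integral_localise:
  assumes ev: "AE \<omega> in P. \<exists>n. \<forall>m\<ge>n. Q m \<omega>"
    and W: "\<And>n. x \<in> En n \<Longrightarrow> W n \<in> borel_measurable P" "\<And>n. x \<in> En n \<Longrightarrow> (\<integral>\<^sup>+\<omega>. W n \<omega> \<partial>P) \<le> c"
    and le: "\<And>n \<omega>. x \<in> En n \<Longrightarrow> \<omega> \<in> paths E \<Longrightarrow> \<omega> 0 = Some x \<Longrightarrow> Q n \<omega> \<Longrightarrow> Y \<omega> \<le> W n \<omega>"
  shows "(\<integral>\<^sup>+\<omega>. Y \<omega> \<partial>P) \<le> c"
proof -
  obtain nx where nx: "x \<in> En nx" using xE E_eq by blast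
  \<comment> \<open>The shift by \<open>nx\<close> keeps only those domains that contain the
    starting point.\<close>
  have xn: "x \<in> En (j + nx)" for j using nx En_mono[of nx "j + nx"] by auto
  have "(\<integral>\<^sup>+\<omega>. Y \<omega> \<partial>P) \<le> (\<integral>\<^sup>+\<omega>. liminf (\<lambda>j. W (j + nx) \<omega>) \<partial>P)"
  proof (rule nn_integral_mono_AE)
    show "AE \<omega> in P. Y \<omega> \<le> liminf (\<lambda>j. W (j + nx) \<omega>)"
      using ev AE_path
    proof eventually_elim
      case (elim \<omega>)
      then obtain n where n: "\<And>m. n \<le> m \<Longrightarrow> Q m \<omega>" by blast
      have "\<forall>\<^sub>F j in sequentially. Y \<omega> \<le> W (j + nx) \<omega>"
        using eventually_ge_at_top[of n] by eventually_elim (use le xn elim n in auto)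
      then show ?case by (rule Liminf_bounded)
    qed
  qed
  also have "\<dots> \<le> liminf (\<lambda>j. \<integral>\<^sup>+\<omega>. W (j + nx) \<omega> \<partial>P)" by (rule nn_integral_liminf) (rule W(1)[OF xn])
  also have "\<dots> \<le> liminf (\<lambda>j::nat. c)" by (rule Liminf_mono) (use W(2) xn in auto)
  finally show ?thesis by (simp add: Liminf_const)
qed

section \<open>Nonexploding case: estimates up to a fixed time\<close>

context
  fixes f ft k :: "real \<Rightarrow> real^'d \<Rightarrow> real" and T C :: real
  assumes T: "0 \<le> T" and C: "0 \<le> C"
    and C2: "\<And>s. s \<in> {0..T} \<Longrightarrow> Ck_on E 2 (f s)"
    and der: "\<And>r y. r \<in> {0..T} \<Longrightarrow> y \<in> E \<Longrightarrow> ((\<lambda>s. f s y) has_real_derivative ft r y) (at r within {0..T})"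
    and cont: "continuous_on ({0..T} \<times> E) (\<lambda>p. f (fst p) (snd p))"
      "continuous_on ({0..T} \<times> E) (\<lambda>p. ft (fst p) (snd p))"
      "continuous_on ({0..T} \<times> E) (\<lambda>p. L \<phi> (f (fst p)) (snd p))"
      "continuous_on ({0..T} \<times> E) (\<lambda>p. k (fst p) (snd p))"
    and nn: "\<And>r y. r \<in> {0..T} \<Longrightarrow> y \<in> E \<Longrightarrow> 0 \<le> f r y" "\<And>r y. r \<in> {0..T} \<Longrightarrow> y \<in> E \<Longrightarrow> 0 \<le> k r y"
    and drift: "\<And>r y. r \<in> {0..T} \<Longrightarrow> y \<in> E \<Longrightarrow> ft r y + L \<phi> (f r) y \<le> C - k r y"
    and nonexp: "AE \<omega> in P. \<exists>n. \<forall>m\<ge>n. stopped (En m) T \<omega> = T"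
begin

lemma dom_mart:
  obtains N where "\<And>n. x \<in> En n \<Longrightarrow> martingale_on P Fil T (N n)" "\<And>n. x \<in> En n \<Longrightarrow> (\<integral>\<omega>. N n T \<omega> \<partial>P) = f 0 x + C * T"
    "\<And>n s \<omega>. x \<in> En n \<Longrightarrow> \<omega> \<in> paths E \<Longrightarrow> \<omega> 0 = Some x \<Longrightarrow> s \<in> {0..T} \<Longrightarrow>
      f (stopped (En n) s \<omega>) (pos \<omega> (stopped (En n) s \<omega>)) + integral {0..stopped (En n) s \<omega>} (\<lambda>r. k r (pos \<omega> r)) \<le> N n s \<omega> \<and>
      0 \<le> N n s \<omega> \<and> f (stopped (En n) s \<omega>) (pos \<omega> (stopped (En n) s \<omega>)) \<le> N n s \<omega>"
proof -
  have "\<forall>n. \<exists>N. x \<in> En n \<longrightarrow> (martingale_on P Fil T N \<and> (\<integral>\<omega>. N T \<omega> \<partial>P) = f 0 x + C * T \<and>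
    (\<forall>\<omega> s. \<omega> \<in> paths E \<longrightarrow> \<omega> 0 = Some x \<longrightarrow> s \<in> {0..T} \<longrightarrow>
      f (stopped (En n) s \<omega>) (pos \<omega> (stopped (En n) s \<omega>)) + integral {0..stopped (En n) s \<omega>} (\<lambda>r. k r (pos \<omega> r)) \<le> N s \<omega> \<and>
      0 \<le> N s \<omega> \<and> f (stopped (En n) s \<omega>) (pos \<omega> (stopped (En n) s \<omega>)) \<le> N s \<omega>))"
  proof
    fix n show "\<exists>N. x \<in> En n \<longrightarrow> (martingale_on P Fil T N \<and> (\<integral>\<omega>. N T \<omega> \<partial>P) = f 0 x + C * T \<and>
    (\<forall>\<omega> s. \<omega> \<in> paths E \<longrightarrow> \<omega> 0 = Some x \<longrightarrow> s \<in> {0..T} \<longrightarrow>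
      f (stopped (En n) s \<omega>) (pos \<omega> (stopped (En n) s \<omega>)) + integral {0..stopped (En n) s \<omega>} (\<lambda>r. k r (pos \<omega> r)) \<le> N s \<omega> \<and>
      0 \<le> N s \<omega> \<and> f (stopped (En n) s \<omega>) (pos \<omega> (stopped (En n) s \<omega>)) \<le> N s \<omega>))"
    proof (cases "x \<in> En n")
      case True
      then show ?thesis using dominating_martingale[OF True T C C2 der cont nn drift] by simp
    qed simp
  qed
  from choice[OF this] obtain N where "\<forall>n. x \<in> En n \<longrightarrow> (martingale_on P Fil T (N n) \<and> (\<integral>\<omega>. N n T \<omega> \<partial>P) = f 0 x + C * T \<and>
    (\<forall>\<omega> s. \<omega> \<in> paths E \<longrightarrow> \<omega> 0 = Some x \<longrightarrow> s \<in> {0..T} \<longrightarrow>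
      f (stopped (En n) s \<omega>) (pos \<omega> (stopped (En n) s \<omega>)) + integral {0..stopped (En n) s \<omega>} (\<lambda>r. k r (pos \<omega> r)) \<le> N n s \<omega> \<and>
      0 \<le> N n s \<omega> \<and> f (stopped (En n) s \<omega>) (pos \<omega> (stopped (En n) s \<omega>)) \<le> N n s \<omega>))" ..
  then show ?thesis by (intro that[of N]) simp_all
qed

lemma AE_nonneg:
  assumes "x \<in> En n" "\<And>\<omega> s. \<omega> \<in> paths E \<Longrightarrow> \<omega> 0 = Some x \<Longrightarrow> s \<in> {0..T} \<Longrightarrow> 0 \<le> N s \<omega>" "s \<in> {0..T}"
  shows "AE \<omega> in P. 0 \<le> (N s \<omega> :: real)"
  using AE_path by eventually_elim (use assms in auto)

lemma whole_path:
  assumes \<omega>: "\<omega> \<in> paths E" "\<omega> 0 = Some x" and n: "x \<in> En n" and st: "stopped (En n) T \<omega> = T"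
    and k': "continuous_on ({0..T} \<times> E) (\<lambda>p. k' (fst p) (snd p) :: real)"
  shows "continuous_on {0..T} (\<lambda>r. k' r (pos \<omega> r))" "r \<in> {0..T} \<Longrightarrow> pos \<omega> r \<in> E"
    "r \<in> {0..T} \<Longrightarrow> stopped (En n) r \<omega> = r"
proof -
  note gp = stopped_path[OF \<omega> n T, unfolded st]
  show posE: "pos \<omega> r \<in> E" if "r \<in> {0..T}" for r using gp(2)[OF that] closure_En_subset by blast
  have "continuous_on {0..T} (\<lambda>r. (r, pos \<omega> r))" by (intro continuous_intros gp(1))
  moreover have "(\<lambda>r. (r, pos \<omega> r)) ` {0..T} \<subseteq> {0..T} \<times> E" using posE by auto
  ultimately show "continuous_on {0..T} (\<lambda>r. k' r (pos \<omega> r))"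
    using continuous_on_compose2[OF k', of "{0..T}" "\<lambda>r. (r, pos \<omega> r)"] by simp
  show "stopped (En n) r \<omega> = r" if "r \<in> {0..T}"
    using stopped_min[of r T "En n" \<omega>] that st by simp
qed

lemma expected_cost:
  "(\<integral>\<^sup>+\<omega>. (\<integral>\<^sup>+s\<in>{0..T}. ennreal (k s (pos \<omega> s)) \<partial>lborel) \<partial>P) \<le> ennreal (f 0 x + C * T)"
proof -
  obtain N where N: "\<And>n. x \<in> En n \<Longrightarrow> martingale_on P Fil T (N n)" "\<And>n. x \<in> En n \<Longrightarrow> (\<integral>\<omega>. N n T \<omega> \<partial>P) = f 0 x + C * T"
    "\<And>n s \<omega>. x \<in> En n \<Longrightarrow> \<omega> \<in> paths E \<Longrightarrow> \<omega> 0 = Some x \<Longrightarrow> s \<in> {0..T} \<Longrightarrow>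
      f (stopped (En n) s \<omega>) (pos \<omega> (stopped (En n) s \<omega>)) + integral {0..stopped (En n) s \<omega>} (\<lambda>r. k r (pos \<omega> r)) \<le> N n s \<omega> \<and>
      0 \<le> N n s \<omega> \<and> f (stopped (En n) s \<omega>) (pos \<omega> (stopped (En n) s \<omega>)) \<le> N n s \<omega>"
    by (rule dom_mart) (assumption | rule that)+
  show ?thesis
  proof (rule nn_integral_localise[OF nonexp, where W="\<lambda>n \<omega>. ennreal (N n T \<omega>)"])
    fix n assume n: "x \<in> En n"
    have int: "integrable P (N n T)" using N(1)[OF n] T by (simp add: martingale_on_def)
    then show "(\<lambda>\<omega>. ennreal (N n T \<omega>)) \<in> borel_measurable P" by simp
    have "AE \<omega> in P. 0 \<le> N n T \<omega>" by (rule AE_nonneg[OF n]) (use N(3)[OF n] T in auto)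
    then show "(\<integral>\<^sup>+\<omega>. ennreal (N n T \<omega>) \<partial>P) \<le> ennreal (f 0 x + C * T)"
      using nn_integral_eq_integral[OF int] N(2)[OF n] by simp
    fix \<omega> assume \<omega>: "\<omega> \<in> paths E" "\<omega> 0 = Some x" and st: "stopped (En n) T \<omega> = T"
    note wp = whole_path[OF \<omega> n st cont(4)]
    have "set_integrable lborel {0..T} (\<lambda>r. k r (pos \<omega> r))" using wp(1) by (rule borel_integrable_atLeastAtMost')
    then have int2: "integrable lborel (\<lambda>r. indicator {0..T} r *\<^sub>R k r (pos \<omega> r))" by (simp add: set_integrable_def)
    have "(\<integral>\<^sup>+s\<in>{0..T}. ennreal (k s (pos \<omega> s)) \<partial>lborel) = (\<integral>\<^sup>+s. ennreal (indicator {0..T} s *\<^sub>R k s (pos \<omega> s)) \<partial>lborel)"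
      by (intro nn_integral_cong) (auto simp: indicator_def)
    also have "\<dots> = ennreal (\<integral>s. indicator {0..T} s *\<^sub>R k s (pos \<omega> s) \<partial>lborel)"
    proof (rule nn_integral_eq_integral[OF int2])
      have "0 \<le> indicator {0..T} s *\<^sub>R k s (pos \<omega> s)" for s
        using nn(2)[of s] wp(2)[of s] by (cases "s \<in> {0..T}") auto
      then show "AE s in lborel. 0 \<le> indicator {0..T} s *\<^sub>R k s (pos \<omega> s)" by simp
    qed
    also have "(\<integral>s. indicator {0..T} s *\<^sub>R k s (pos \<omega> s) \<partial>lborel) = integral {0..T} (\<lambda>r. k r (pos \<omega> r))"
      using set_borel_integral_eq_integral(2)[OF \<open>set_integrable lborel {0..T} (\<lambda>r. k r (pos \<omega> r))\<close>]
      by (simp add: set_lebesgue_integral_def)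
    also have "\<dots> \<le> N n T \<omega>"
    proof -
      have "0 \<le> f T (pos \<omega> T)" using nn(1)[of T] wp(2)[of T] T by auto
      then show ?thesis using N(3)[OF n \<omega>, of T] T st by simp
    qed
    finally show "(\<integral>\<^sup>+s\<in>{0..T}. ennreal (k s (pos \<omega> s)) \<partial>lborel) \<le> ennreal (N n T \<omega>)" by (simp add: ennreal_leI)
  qed
qed

text \<open>Doob's inequality bounds the tail of the supremum at level \<mu> by (f 0 x + C T) /
  \<mu>^2. The level \<open>a\<close> is free, to be balanced against the size of f 0 x + C
  T.\<close>

lemma expected_sup:
  assumes a: "0 < a"
  shows "(\<integral>\<^sup>+\<omega>. (SUP s\<in>{0..T}. ennreal (sqrt (f s (pos \<omega> s)))) \<partial>P) \<le> ennreal (a + 4 * (f 0 x + C * T) / a)"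
proof -
  obtain N where N: "\<And>n. x \<in> En n \<Longrightarrow> martingale_on P Fil T (N n)" "\<And>n. x \<in> En n \<Longrightarrow> (\<integral>\<omega>. N n T \<omega> \<partial>P) = f 0 x + C * T"
    "\<And>n s \<omega>. x \<in> En n \<Longrightarrow> \<omega> \<in> paths E \<Longrightarrow> \<omega> 0 = Some x \<Longrightarrow> s \<in> {0..T} \<Longrightarrow>
      f (stopped (En n) s \<omega>) (pos \<omega> (stopped (En n) s \<omega>)) + integral {0..stopped (En n) s \<omega>} (\<lambda>r. k r (pos \<omega> r)) \<le> N n s \<omega> \<and>
      0 \<le> N n s \<omega> \<and> f (stopped (En n) s \<omega>) (pos \<omega> (stopped (En n) s \<omega>)) \<le> N n s \<omega>"
    by (rule dom_mart) (assumption | rule that)+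
  \<comment> \<open>A countable set keeps the supremum measurable; since \<open>f\<close> is
    continuous along a nonexploding path, a bound at the times in \<open>D\<close> extends to all
    times.\<close>
  obtain D where D: "countable D" "D \<subseteq> {0..T}" "{0..T} \<subseteq> closure D" by (rule separable)
  have clD: "closure D = {0..T}"
    using D closure_minimal[OF D(2)] by auto
  define W where "W n \<omega> = (SUP s\<in>D. ennreal (sqrt (N n s \<omega>)))" for n \<omega>
  have c0: "0 \<le> f 0 x + C * T" using nn(1)[of 0 x] xE T C by simp
  show ?thesis
  proof (rule nn_integral_localise[OF nonexp, where W=W])
    fix n assume n: "x \<in> En n"
    have Nm: "N n s \<in> borel_measurable P" if "s \<in> D" for s
      using N(1)[OF n] D(2) that by (intro P_measurable[of "N n s" s]) (auto simp: martingale_on_def)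
    show Wm: "W n \<in> borel_measurable P"
      unfolding W_def[abs_def] using Nm by (intro borel_measurable_SUP D(1)) auto
    have AEn: "AE \<omega> in P. 0 \<le> N n T \<omega>" by (rule AE_nonneg[OF n]) (use N(3)[OF n] T in auto)
    show "(\<integral>\<^sup>+\<omega>. W n \<omega> \<partial>P) \<le> ennreal (a + 4 * (f 0 x + C * T) / a)"
    proof (rule nn_integral_tail_bound[OF Wm a c0])
      fix \<mu> :: real assume \<mu>: "0 < \<mu>"
      have sub: "{\<omega> \<in> space P. ennreal \<mu> < W n \<omega>} \<subseteq> {\<omega> \<in> space P. \<exists>s\<in>D. \<mu>\<^sup>2 < N n s \<omega>}"
      proof
        fix \<omega> assume \<omega>: "\<omega> \<in> {\<omega> \<in> space P. ennreal \<mu> < W n \<omega>}"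
        then obtain s where s: "s \<in> D" "ennreal \<mu> < ennreal (sqrt (N n s \<omega>))" by (auto simp: W_def less_SUP_iff)
        then have "\<mu> < sqrt (N n s \<omega>)" using \<mu> by (simp add: ennreal_less_iff)
        then have "\<mu>\<^sup>2 < N n s \<omega>" using \<mu> by (metis less_eq_real_def not_less real_le_lsqrt)
        then show "\<omega> \<in> {\<omega> \<in> space P. \<exists>s\<in>D. \<mu>\<^sup>2 < N n s \<omega>}" using s(1) \<omega> by auto
      qed
      have "{\<omega> \<in> space P. \<exists>s\<in>D. \<mu>\<^sup>2 < N n s \<omega>} \<in> sets P"
        by (rule sets.sets_Collect_countable_Ex') (use Nm D(1) in \<open>auto intro!: borel_measurable_less\<close>)
      then have "emeasure P {\<omega> \<in> space P. ennreal \<mu> < W n \<omega>} \<le> emeasure P {\<omega> \<in> space P. \<exists>s\<in>D. \<mu>\<^sup>2 < N n s \<omega>}"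
        using sub by (intro emeasure_mono)
      also have "\<dots> \<le> ennreal ((\<integral>\<omega>. N n T \<omega> \<partial>P) / \<mu>\<^sup>2)"
        by (rule maximal_inequality[OF N(1)[OF n] AEn _ D(1,2)]) (use \<mu> in auto)
      finally show "emeasure P {\<omega> \<in> space P. ennreal \<mu> < W n \<omega>} \<le> ennreal ((f 0 x + C * T) / \<mu>\<^sup>2)"
        by (simp add: N(2)[OF n])
    qed
    fix \<omega> assume \<omega>: "\<omega> \<in> paths E" "\<omega> 0 = Some x" and st: "stopped (En n) T \<omega> = T"
    note wp = whole_path[OF \<omega> n st cont(1)]
    have D_le: "ennreal (sqrt (f s (pos \<omega> s))) \<le> W n \<omega>" if "s \<in> D" for s
    proof -
      have s: "s \<in> {0..T}" using that D by auto
      have "f s (pos \<omega> s) \<le> N n s \<omega>" using N(3)[OF n \<omega> s] wp(3)[OF s] by simp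
      then have "ennreal (sqrt (f s (pos \<omega> s))) \<le> ennreal (sqrt (N n s \<omega>))" by (intro ennreal_leI) simp
      also have "\<dots> \<le> W n \<omega>" unfolding W_def using that by (rule SUP_upper)
      finally show ?thesis .
    qed
    show "(SUP s\<in>{0..T}. ennreal (sqrt (f s (pos \<omega> s)))) \<le> W n \<omega>"
    proof (rule SUP_least)
      fix s assume s: "s \<in> {0..T}"
      show "ennreal (sqrt (f s (pos \<omega> s))) \<le> W n \<omega>"
      proof (cases "W n \<omega>")
        case (real w)
        have "sqrt (f s (pos \<omega> s)) \<le> w"
        proof (rule continuous_le_on_closure[where S=D and f="\<lambda>s. sqrt (f s (pos \<omega> s))"])
          show "continuous_on (closure D) (\<lambda>s. sqrt (f s (pos \<omega> s)))" unfolding clD by (intro continuous_intros wp(1))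
          show "s \<in> closure D" using s clD by simp
          show "sqrt (f r (pos \<omega> r)) \<le> w" if "r \<in> D" for r
          proof -
            have "ennreal (sqrt (f r (pos \<omega> r))) \<le> ennreal w" using D_le[OF that] real by simp
            then show ?thesis by (simp only: ennreal_le_iff[OF real(1)])
          qed
        qed
        then show ?thesis using real by (simp add: ennreal_leI)
      qed simp
    qed
  qed
qed

end

text \<open>A nonnegative supermartingale that starts below the value it takes on \<open>En N\<close>
  would miss \<open>En N\<close> with positive probability.\<close>

lemma recurrent_bound:
  assumes u: "Ck_on E 2 u" and nn: "\<And>y. y \<in> E \<Longrightarrow> 0 \<le> u y" and drift: "\<And>y. y \<in> E \<Longrightarrow> L \<phi> u y \<le> 0"
    and one: "\<And>y. y \<in> En N \<Longrightarrow> 1 \<le> u y" and hit: "AE \<omega> in P. \<exists>t\<ge>0. \<omega> t \<in> Some ` En N"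
  shows "1 \<le> u x"
proof (rule ccontr)
  assume neg: "\<not> 1 \<le> u x"
  \<comment> \<open>A level strictly between \<open>u x\<close> and the value 1 taken on
    \<open>En N\<close>.\<close>
  define \<mu> where "\<mu> = (u x + 1) / 2"
  have \<mu>: "0 < \<mu>" "u x < \<mu>" "\<mu> < 1" using neg nn[OF xE] by (auto simp: \<mu>_def)
  obtain nx where nx: "x \<in> En nx" using xE E_eq by blast
  have xn: "x \<in> En (j + nx)" for j using nx En_mono[of nx "j + nx"] by auto
  have "\<forall>j::nat. \<exists>K. martingale_on P Fil (real j) K \<and> (\<integral>\<omega>. K (real j) \<omega> \<partial>P) = u x + 0 * real j \<and>
    (\<forall>\<omega> s. \<omega> \<in> paths E \<longrightarrow> \<omega> 0 = Some x \<longrightarrow> s \<in> {0..real j} \<longrightarrow> 0 \<le> K s \<omega> \<and> u (pos \<omega> (stopped (En (j + nx)) s \<omega>)) \<le> K s \<omega>)"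
  proof
    fix j :: nat
    show "\<exists>K. martingale_on P Fil (real j) K \<and> (\<integral>\<omega>. K (real j) \<omega> \<partial>P) = u x + 0 * real j \<and>
    (\<forall>\<omega> s. \<omega> \<in> paths E \<longrightarrow> \<omega> 0 = Some x \<longrightarrow> s \<in> {0..real j} \<longrightarrow> 0 \<le> K s \<omega> \<and> u (pos \<omega> (stopped (En (j + nx)) s \<omega>)) \<le> K s \<omega>)"
      by (rule static_martingale[OF xn of_nat_0_le_iff order_refl u nn drift])
  qed
  from choice[OF this] obtain K where KK: "\<forall>j. martingale_on P Fil (real j) (K j) \<and> (\<integral>\<omega>. K j (real j) \<omega> \<partial>P) = u x + 0 * real j \<and>
    (\<forall>\<omega> s. \<omega> \<in> paths E \<longrightarrow> \<omega> 0 = Some x \<longrightarrow> s \<in> {0..real j} \<longrightarrow> 0 \<le> K j s \<omega> \<and> u (pos \<omega> (stopped (En (j + nx)) s \<omega>)) \<le> K j s \<omega>)"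
    by (rule exE)
  have K: "martingale_on P Fil (real j) (K j)" "(\<integral>\<omega>. K j (real j) \<omega> \<partial>P) = u x + 0 * real j"
    "\<omega> \<in> paths E \<Longrightarrow> \<omega> 0 = Some x \<Longrightarrow> s \<in> {0..real j} \<Longrightarrow> 0 \<le> K j s \<omega>"
    "\<omega> \<in> paths E \<Longrightarrow> \<omega> 0 = Some x \<Longrightarrow> s \<in> {0..real j} \<Longrightarrow> u (pos \<omega> (stopped (En (j + nx)) s \<omega>)) \<le> K j s \<omega>" for j s \<omega>
    using KK[THEN spec, of j] by simp_all
  have "\<forall>j::nat. \<exists>D. countable D \<and> D \<subseteq> {0..real j} \<and> {0..real j} \<subseteq> closure D"
  proof
    fix j :: nat
    obtain D where "countable D" "D \<subseteq> {0..real j}" "{0..real j} \<subseteq> closure D" by (rule separable)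
    then show "\<exists>D. countable D \<and> D \<subseteq> {0..real j} \<and> {0..real j} \<subseteq> closure D" by (intro exI conjI)
  qed
  then have "\<exists>D. \<forall>j::nat. countable (D j) \<and> D j \<subseteq> {0..real j} \<and> {0..real j} \<subseteq> closure (D j)" by (rule choice)
  then obtain D where DD: "\<forall>j::nat. countable (D j) \<and> D j \<subseteq> {0..real j} \<and> {0..real j} \<subseteq> closure (D j)" by (rule exE)
  have D: "countable (D j)" "D j \<subseteq> {0..real j}" "{0..real j} \<subseteq> closure (D j)" for j
    using DD[THEN spec, of j] by simp_all
  \<comment> \<open>Almost every path visits \<open>En N\<close> and so lies in \<open>H j\<close>
    for all large \<open>j\<close>, yet each of these events has probability at most u x / \<mu> <
    1.\<close>
  define H where "H j = {\<omega> \<in> space P. \<exists>s\<in>D j. \<mu> < K j s \<omega>}" for j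
  have Km: "K j s \<in> borel_measurable P" if "s \<in> D j" for j s
    using K(1)[of j] D(2)[of j] that by (intro P_measurable[of "K j s" s]) (auto simp: martingale_on_def)
  have Hs: "H j \<in> sets P" for j
    unfolding H_def
  proof (rule sets.sets_Collect_countable_Ex'[OF _ D(1)])
    show "{\<omega> \<in> space P. \<mu> < K j s \<omega>} \<in> sets P" if "s \<in> D j" for s
      by (rule borel_measurable_less[OF borel_measurable_const Km[OF that]])
  qed
  have PH: "emeasure P (H j) \<le> ennreal (u x / \<mu>)" for j
  proof -
    have "AE \<omega> in P. 0 \<le> K j (real j) \<omega>"
      using AE_path
    proof eventually_elim
      case (elim \<omega>)
      show ?case by (rule K(3)) (use elim in auto)
    qed
    from maximal_inequality[OF K(1)[of j] this \<mu>(1) D(1)[of j] D(2)[of j]]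
    show ?thesis unfolding H_def K(2) by simp
  qed
  have "1 = (\<integral>\<^sup>+\<omega>. 1 \<partial>P)" by (simp add: emeasure_space_1)
  also have "\<dots> \<le> (\<integral>\<^sup>+\<omega>. liminf (\<lambda>j. indicator (H j) \<omega>) \<partial>P)"
  proof (rule nn_integral_mono_AE)
    show "AE \<omega> in P. 1 \<le> liminf (\<lambda>j. indicator (H j) \<omega> :: ennreal)"
      using hit AE_path AE_space
    proof eventually_elim
      case (elim \<omega>)
      then obtain t where t: "0 \<le> t" "\<omega> t \<in> Some ` En N" and \<omega>: "\<omega> \<in> paths E" "\<omega> 0 = Some x" by blast
      obtain O' where O': "open O'" "{s \<in> {0..}. \<omega> s \<in> Some ` En N} = {0..} \<inter> O'"
        using path_open_times[OF \<omega>(1) openE En_open En_subset] by (auto simp: openin_open)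
      have "t \<in> O'" using O'(2) t by auto
      then obtain d where d: "0 < d" "ball t d \<subseteq> O'" using O'(1) by (meson open_contains_ball)
      \<comment> \<open>Since \<open>En N\<close> is open, a visit lasts for a whole interval of
        times, which must meet the countable dense set.\<close>
      define t1 where "t1 = t + d / 2"
      have inN: "\<omega> s \<in> Some ` En N" if "t < s" "s \<le> t1" for s
      proof -
        have "s \<in> ball t d" using that d(1) by (auto simp: t1_def dist_real_def)
        then have "s \<in> {0..} \<inter> O'" using d(2) that t(1) by auto
        then show ?thesis using O'(2) by blast
      qed
      have t1: "0 \<le> t1" "t < t1" using t d by (auto simp: t1_def)
      have "\<omega> t1 \<noteq> None" using inN[of t1] t1 by auto
      then obtain n1 where n1: "stopped (En n1) t1 \<omega> = t1" using not_None_stopped[OF \<omega>(1) t1(1)] by blast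
      have "\<forall>\<^sub>F j in sequentially. 1 \<le> (indicator (H j) \<omega> :: ennreal)"
        using eventually_ge_at_top[of n1] eventually_ge_at_top[of "nat \<lceil>t1\<rceil>"]
      proof eventually_elim
        case (elim j)
        have jt: "t1 \<le> real j" using elim(2) by linarith
        have "(t + t1) / 2 \<in> {0..real j}" using t t1 jt by auto
        then have "(t + t1) / 2 \<in> closure (D j)" using D(3)[of j] by blast
        moreover have "(t + t1) / 2 \<in> {t<..<t1}" using t1 by auto
        ultimately have "{t<..<t1} \<inter> closure (D j) \<noteq> {}" by blast
        then have "{t<..<t1} \<inter> D j \<noteq> {}" by (simp add: open_Int_closure_eq_empty)
        then obtain s where s: "s \<in> D j" "s \<in> {t<..<t1}" by blast
        have st: "stopped (En (j + nx)) t1 \<omega> = t1" by (rule stopped_mono_domain[OF t1(1) _ n1]) (use elim in auto)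
        have "stopped (En (j + nx)) s \<omega> = s" using stopped_min[of s t1 "En (j + nx)" \<omega>] s t st by auto
        moreover have "s \<in> {0..real j}" using s(2) t jt by auto
        ultimately have "u (pos \<omega> s) \<le> K j s \<omega>" using K(4)[OF \<omega>, of s j] by simp
        moreover have "1 \<le> u (pos \<omega> s)" using inN[of s] s(2) one by (auto simp: pos_def)
        ultimately have "\<mu> < K j s \<omega>" using \<mu>(3) by simp
        then have "\<omega> \<in> H j" using s(1) \<omega>(1) by (auto simp: H_def space_P)
        then show ?case by simp
      qed
      then show ?case by (rule Liminf_bounded)
    qed
  qed
  also have "\<dots> \<le> liminf (\<lambda>j. \<integral>\<^sup>+\<omega>. indicator (H j) \<omega> \<partial>P)" by (rule nn_integral_liminf) (use Hs in simp)
  also have "\<dots> \<le> liminf (\<lambda>j::nat. ennreal (u x / \<mu>))" by (rule Liminf_mono) (use Hs PH in simp)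
  finally have "1 \<le> ennreal (u x / \<mu>)" by (simp add: Liminf_const)
  then have le: "ennreal 1 \<le> ennreal (u x / \<mu>)" by simp
  have "0 \<le> u x / \<mu>" using nn[OF xE] \<mu> by simp
  then have "1 \<le> u x / \<mu>" using le by (simp only: ennreal_le_iff)
  then show False using \<mu> by simp
qed

end

section \<open>Convergence of the expectations\<close>

lemma vanishes_in_CI:
  assumes "\<And>K \<epsilon>. compact K \<Longrightarrow> K \<subseteq> E \<Longrightarrow> 0 < \<epsilon> \<Longrightarrow> \<exists>T0. \<forall>T\<ge>T0. \<forall>x\<in>K. f T x \<le> ennreal \<epsilon>"
  shows "vanishes_in_C E f"
  unfolding vanishes_in_C_def
proof (intro allI impI order_tendstoI)
  fix K and a :: ennreal assume K: "compact K \<and> K \<subseteq> E" and a: "0 < a"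
  obtain \<epsilon> where \<epsilon>: "0 < \<epsilon>" "ennreal \<epsilon> < a"
  proof (cases a)
    case (real r)
    show ?thesis by (rule that[of "r / 2"]) (use real a in \<open>auto simp: ennreal_less_iff\<close>)
  next
    case top
    show ?thesis by (rule that[of 1]) (use top in auto)
  qed
  obtain T0 where T0: "\<forall>T\<ge>T0. \<forall>x\<in>K. f T x \<le> ennreal \<epsilon>" using assms[of K \<epsilon>] K \<epsilon> by blast
  show "\<forall>\<^sub>F T in at_top. (SUP x\<in>K. f T x) < a"
    using eventually_ge_at_top[of T0]
  proof eventually_elim
    case (elim T)
    have "(SUP x\<in>K. f T x) \<le> ennreal \<epsilon>" by (rule SUP_least) (use T0 elim in blast)
    then show ?case using \<epsilon>(2) by (rule le_less_trans)
  qed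
qed auto

text \<open>For y \<ge> 0 the quadratic Taylor bound suffices. For negative \<open>y\<close> the
  value exp y - 1 is negative: one copy of \<theta> exp z restores nonnegativity, and the other
  dominates y^2 / 4 because y^2 \<le> \<theta>^2 z^2 \<le> 4 \<theta> exp z.\<close>

lemma abs_le_sqrt_exp:
  fixes y z \<theta> :: real
  assumes "- (\<theta> * z) \<le> y" "0 < \<theta>" "\<theta> \<le> 1"
  shows "\<bar>y\<bar> \<le> 2 * sqrt (exp y - 1 + 2 * \<theta> * exp z)" "0 \<le> exp y - 1 + 2 * \<theta> * exp z"
proof -
  have "\<theta> * z \<le> \<theta> * exp z" using exp_ge_add_one_self[of z] assms by (intro mult_left_mono) linarith+
  then have f: "\<theta> * exp z \<le> exp y - 1 + 2 * \<theta> * exp z" using exp_ge_add_one_self[of y] assms(1) by linarith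
  have p: "0 < \<theta> * exp z" using assms by simp
  show "0 \<le> exp y - 1 + 2 * \<theta> * exp z" using f p by linarith
  show "\<bar>y\<bar> \<le> 2 * sqrt (exp y - 1 + 2 * \<theta> * exp z)"
  proof (cases "0 \<le> y")
    case True
    have "y\<^sup>2 / 4 \<le> exp y - 1"
      using exp_lower_Taylor_quadratic[OF True] True zero_le_power2[of y] by linarith
    then have "y\<^sup>2 / 4 \<le> exp y - 1 + 2 * \<theta> * exp z" using p by linarith
    then have "sqrt (y\<^sup>2 / 4) \<le> sqrt (exp y - 1 + 2 * \<theta> * exp z)" by simp
    then show ?thesis using True by (simp add: real_sqrt_divide)
  next
    case False
    have "(\<theta> * z)\<^sup>2 \<le> 4 * (\<theta> * exp z)"
    proof -
      have g0: "0 < z" using False assms(1,2) by (smt (verit) mult_nonneg_nonpos)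
      have "z / 2 \<le> exp (z / 2)" using exp_ge_add_one_self[of "z / 2"] by linarith
      then have "(z / 2)\<^sup>2 \<le> (exp (z / 2))\<^sup>2" using g0 by (intro power_mono) auto
      also have "\<dots> = exp z" by (simp add: power2_eq_square flip: exp_add)
      finally have 1: "z\<^sup>2 \<le> 4 * exp z" by (simp add: power_divide)
      have "\<theta>\<^sup>2 * z\<^sup>2 \<le> \<theta> * z\<^sup>2" using assms by (intro mult_right_mono) (auto simp: power2_eq_square)
      also have "\<dots> \<le> \<theta> * (4 * exp z)" using 1 assms by (intro mult_left_mono) auto
      finally show ?thesis by (simp add: power_mult_distrib)
    qed
    moreover have "y\<^sup>2 \<le> (\<theta> * z)\<^sup>2" using False assms(1) by (intro power2_le_iff_abs_le[THEN iffD2]) auto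
    ultimately have "y\<^sup>2 / 4 \<le> exp y - 1 + 2 * \<theta> * exp z" using f by linarith
    then have "sqrt (y\<^sup>2 / 4) \<le> sqrt (exp y - 1 + 2 * \<theta> * exp z)" by simp
    then show ?thesis by (simp add: real_sqrt_divide)
  qed
qed

locale ergodic_limit = cauchy_problem E A Abar B V \<kappa> En x0 \<phi>0 \<phi> vhat v \<alpha> C\<alpha> lhat
  for E :: "(real^'d::finite) set" and A Abar B V \<kappa> En x0 \<phi>0 \<phi> vhat v \<alpha> C\<alpha> lhat +
  fixes Phat :: "real^'d \<Rightarrow> 'd path measure"
  assumes gmp: "x \<in> E \<Longrightarrow> gmp_solution A Abar B E En vhat x (Phat x)"
    and v_grad_cont: "continuous_on ({0<..} \<times> E) (\<lambda>p. grad (v (fst p)) (snd p) $ i)"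
    and v_hess_cont: "continuous_on ({0<..} \<times> E) (\<lambda>p. hess (v (fst p)) (snd p) $ i $ j)"
begin

lemma diffusion: "x \<in> E \<Longrightarrow> diffusion E A Abar B V \<kappa> En x0 vhat x (Phat x)"
  by unfold_locales (auto intro: vhat_C2 gmp)

definition U :: "real^'d \<Rightarrow> real" where "U x = exp (\<kappa> * g x)"

lemma U_C2: "Ck_on E 2 U"
  unfolding U_def[abs_def] by (rule C2_exp(1)[OF openE g_C2])

lemma U_pos: "0 < U x" and g_le_U: "\<kappa> * g x \<le> U x"
  using exp_ge_add_one_self[of "\<kappa> * g x"] unfolding U_def by (simp, linarith)

lemma escapes_U: "escapes U"
  unfolding escapes_def
proof
  fix c
  obtain n where n: "\<And>x. x \<in> E - En n \<Longrightarrow> c / \<kappa> \<le> g x"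
    by (rule escapesD[OF esc_vhat, of 0 "c / \<kappa>"]) (auto simp: g_def)
  have "c \<le> U x" if "x \<in> E - En n" for x
  proof -
    have "c \<le> \<kappa> * g x" using n[OF that] kappa by (simp add: field_simps)
    then show ?thesis using g_le_U[of x] by simp
  qed
  then show "\<exists>n. \<forall>x\<in>E - En n. c \<le> U x" by blast
qed

definition gradient_cost :: "real \<Rightarrow> real^'d \<Rightarrow> real" where
  "gradient_cost t x = grad (h t) x \<bullet> (Abar x *v grad (h t) x)"

lemma grad_h: "0 < t \<Longrightarrow> x \<in> E \<Longrightarrow> grad (h t) x = grad (v t) x - grad vhat x"
  and hess_h: "0 < t \<Longrightarrow> x \<in> E \<Longrightarrow> hess (h t) x = hess (v t) x - hess vhat x"
proof -
  assume t: "0 < t" and x: "x \<in> E"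
  have e: "h t = (\<lambda>x. (v t x - vhat x) + (- lhat * t))" by (auto simp: h_def)
  show "grad (h t) x = grad (v t) x - grad vhat x" "hess (h t) x = hess (v t) x - hess vhat x"
    unfolding e C2_add_const(2,3)[OF openE C2_diff(1)[OF openE v_C2[OF t] vhat_C2] x]
      C2_diff(2,3)[OF openE v_C2[OF t] vhat_C2 x] by (rule refl)+
qed

lemma h_derivatives_cont:
  shows "continuous_on ({0<..} \<times> E) (\<lambda>p. grad (h (fst p)) (snd p) $ i)"
    "continuous_on ({0<..} \<times> E) (\<lambda>p. hess (h (fst p)) (snd p) $ i $ j)"
proof -
  have "continuous_on ({0<..} \<times> E) (\<lambda>p::real \<times> (real^'d). grad (v (fst p)) (snd p) $ i - grad vhat (snd p) $ i)"
    by (rule continuous_on_diff[OF v_grad_cont cont_snd[OF C2_continuous_grad(1)[OF openE vhat_C2]]])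
  then show "continuous_on ({0<..} \<times> E) (\<lambda>p. grad (h (fst p)) (snd p) $ i)"
    by (rule continuous_on_eq) (auto simp: grad_h)
  have "continuous_on ({0<..} \<times> E) (\<lambda>p::real \<times> (real^'d). hess (v (fst p)) (snd p) $ i $ j - hess vhat (snd p) $ i $ j)"
    by (rule continuous_on_diff[OF v_hess_cont cont_snd[OF C2_continuous_hess[OF vhat_C2]]])
  then show "continuous_on ({0<..} \<times> E) (\<lambda>p. hess (h (fst p)) (snd p) $ i $ j)"
    by (rule continuous_on_eq) (auto simp: hess_h)
qed

lemma quad_cont:
  assumes "\<And>i j. continuous_on E (\<lambda>x. M x $ i $ j)"
  shows "continuous_on ({0<..} \<times> E) (\<lambda>p. grad (h (fst p)) (snd p) \<bullet> (M (snd p) *v grad (h (fst p)) (snd p)))"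
  unfolding inner_matrix_vector
  by (intro continuous_on_sum continuous_on_mult h_derivatives_cont cont_snd assms)

lemma L_h_cont: "continuous_on ({0<..} \<times> E) (\<lambda>p. L vhat (h (fst p)) (snd p))"
  unfolding L_vhat mdot_def inner_vec_def inner_real_def
  by (intro continuous_on_add continuous_on_sum continuous_on_mult continuous_on_const
      h_derivatives_cont cont_snd A_cont b_cont)

text \<open>The condition t < T keeps the reversed times positive, where the derivatives of
  \<open>h\<close> are continuous.\<close>

lemma reversed:
  fixes w :: "real \<Rightarrow> real^'d \<Rightarrow> real"
  assumes "continuous_on ({0<..} \<times> E) (\<lambda>p. w (fst p) (snd p))" "t < T"
  shows "continuous_on ({0..t} \<times> E) (\<lambda>p. w (T - fst p) (snd p))"
proof -
  have "continuous_on ({0..t} \<times> E) (\<lambda>p. (T - fst p, snd p))" by (intro continuous_intros)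
  moreover have "(\<lambda>p. (T - fst p, snd p)) ` ({0..t} \<times> E) \<subseteq> {0<..} \<times> E" using assms(2) by auto
  ultimately show ?thesis using continuous_on_compose2[OF assms(1), of "{0..t} \<times> E" "\<lambda>p. (T - fst p, snd p)"] by simp
qed

lemma h_reversed_der:
  assumes "r \<in> {0..t}" "t < T" "y \<in> E"
  shows "((\<lambda>s. h (T - s) y) has_real_derivative - (L vhat (h (T - r)) y + 1/2 * gradient_cost (T - r) y)) (at r within {0..t})"
proof -
  have "((\<lambda>s. h s y) has_real_derivative L vhat (h (T - r)) y + 1/2 * gradient_cost (T - r) y) (at (T - r))"
    unfolding gradient_cost_def using assms by (intro h_der) auto
  moreover have "((\<lambda>s. T - s) has_real_derivative -1) (at r within {0..t})" by (auto intro!: derivative_eq_intros)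
  ultimately show ?thesis
    using DERIV_chain2[of "\<lambda>s. h s y" _ "\<lambda>s. T - s"] by fastforce
qed

lemma h_cont_pos: "continuous_on ({0<..} \<times> E) (\<lambda>p. h (fst p) (snd p))"
  by (rule continuous_on_subset[OF h_cont]) auto

section \<open>Estimates at a fixed time \<open>T\<close> and weight \<theta>\<close>

context
  fixes x :: "real^'d" and t T \<theta> CU :: real
  assumes x: "x \<in> E" and t: "0 \<le> t" "t < T" and \<theta>: "0 < \<theta>" "\<theta> \<le> 1"
    and CU: "0 \<le> CU" "\<And>y. y \<in> E \<Longrightarrow> L vhat U y \<le> CU"
    and low: "\<And>s y. s \<in> {0..t} \<Longrightarrow> y \<in> E \<Longrightarrow> climit - \<theta> * g y \<le> h (T - s) y"
begin

interpretation D: diffusion E A Abar B V \<kappa> En x0 vhat x "Phat x"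
  by (rule diffusion[OF x])

lemma nonexploding_U: "AE \<omega> in Phat x. \<exists>n. \<forall>m\<ge>n. stopped (En m) t \<omega> = t"
  by (rule D.nonexploding[OF U_C2 escapes_U _ CU t(1)]) (simp_all add: U_pos less_imp_le)

lemma low_U: "s \<in> {0..t} \<Longrightarrow> y \<in> E \<Longrightarrow> - (\<theta> * U y) \<le> \<kappa> * (h (T - s) y - climit)"
proof -
  assume H: "s \<in> {0..t}" "y \<in> E"
  have "\<theta> * (\<kappa> * g y) \<le> \<theta> * U y" using g_le_U[of y] \<theta> by (intro mult_left_mono) auto
  moreover have "\<kappa> * (climit - h (T - s) y) \<le> \<kappa> * (\<theta> * g y)" using low[OF H] kappa by (intro mult_left_mono) auto
  ultimately show ?thesis by (simp add: algebra_simps)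
qed

text \<open>Reversing time cancels L h in the drift of 2 h(T - s, X), which leaves exactly minus the
  cost. The multiple of \<open>U\<close> makes the process nonnegative and adds a drift of order
  \<theta>.\<close>

lemma cost_estimate:
  "(\<integral>\<^sup>+\<omega>. (\<integral>\<^sup>+s\<in>{0..t}. ennreal (gradient_cost (T - s) (pos \<omega> s)) \<partial>lborel) \<partial>Phat x)
    \<le> ennreal (2 * (h T x - climit) + 2 * \<theta> / \<kappa> * (U x + CU * t))"
proof -
  define f where "f s y = (2 * h (T - s) y + 2 * \<theta> / \<kappa> * U y) + (- 2 * climit)" for s y
  define ft where "ft s y = - (2 * L vhat (h (T - s)) y + gradient_cost (T - s) y)" for s y
  have hC2: "Ck_on E 2 (h (T - s))" if "s \<in> {0..t}" for s using h_C2[of "T - s"] t that by auto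
  have sC2: "Ck_on E 2 (\<lambda>y. 2 * h (T - s) y + 2 * \<theta> / \<kappa> * U y)" if "s \<in> {0..t}" for s
    by (intro C2_add(1) C2_cmult(1) openE hC2[OF that] U_C2)
  have Lf: "L vhat (f s) y = 2 * L vhat (h (T - s)) y + 2 * \<theta> / \<kappa> * L vhat U y" if "s \<in> {0..t}" "y \<in> E" for s y
    unfolding f_def[abs_def] L_add_const[OF sC2[OF that(1)] that(2)]
      L_add[OF C2_cmult(1)[OF openE hC2[OF that(1)]] C2_cmult(1)[OF openE U_C2] that(2)]
      L_cmult[OF hC2[OF that(1)] that(2)] L_cmult[OF U_C2 that(2)] ..
  have hq: "continuous_on ({0..t} \<times> E) (\<lambda>p. gradient_cost (T - fst p) (snd p))"
    unfolding gradient_cost_def by (rule reversed[OF quad_cont[OF Abar_cont] t(2)])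
  have "(\<integral>\<^sup>+\<omega>. (\<integral>\<^sup>+s\<in>{0..t}. ennreal (gradient_cost (T - s) (pos \<omega> s)) \<partial>lborel) \<partial>Phat x)
    \<le> ennreal (f 0 x + 2 * \<theta> / \<kappa> * CU * t)"
  proof (rule D.expected_cost[where f=f and ft=ft and k="\<lambda>s. gradient_cost (T - s)"])
    show "0 \<le> 2 * \<theta> / \<kappa> * CU" using \<theta> kappa CU by simp
    show "Ck_on E 2 (f s)" if "s \<in> {0..t}" for s
      unfolding f_def[abs_def] by (rule C2_add_const(1)[OF openE sC2[OF that]])
    show "((\<lambda>s. f s y) has_real_derivative ft r y) (at r within {0..t})" if "r \<in> {0..t}" "y \<in> E" for r y
      unfolding f_def ft_def
      by (rule derivative_eq_intros h_reversed_der[OF that(1) t(2) that(2)] refl | simp)+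
    show "continuous_on ({0..t} \<times> E) (\<lambda>p. f (fst p) (snd p))"
      unfolding f_def by (intro continuous_on_add continuous_on_mult continuous_on_const reversed[OF h_cont_pos t(2)]
          cont_snd Ck_on_continuous[OF U_C2])
    show "continuous_on ({0..t} \<times> E) (\<lambda>p. ft (fst p) (snd p))"
      unfolding ft_def by (intro continuous_on_minus continuous_on_add continuous_on_mult continuous_on_const reversed[OF L_h_cont t(2)] hq)
    have "continuous_on ({0..t} \<times> E) (\<lambda>p. 2 * L vhat (h (T - fst p)) (snd p) + 2 * \<theta> / \<kappa> * L vhat U (snd p))"
      by (intro continuous_on_add continuous_on_mult continuous_on_const reversed[OF L_h_cont t(2)]
          cont_snd L_continuous[OF vhat_C2 U_C2])
    then show "continuous_on ({0..t} \<times> E) (\<lambda>p. L vhat (f (fst p)) (snd p))"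
      by (rule continuous_on_eq) (auto simp: Lf)
    show "continuous_on ({0..t} \<times> E) (\<lambda>p. gradient_cost (T - fst p) (snd p))" by (rule hq)
    show "0 \<le> f r y" if "r \<in> {0..t}" "y \<in> E" for r y
      using low_U[OF that] kappa by (simp add: f_def field_simps)
    show "0 \<le> gradient_cost (T - r) y" if "r \<in> {0..t}" "y \<in> E" for r y
      unfolding gradient_cost_def by (rule Abar_nonneg[OF that(2)])
    show "ft r y + L vhat (f r) y \<le> 2 * \<theta> / \<kappa> * CU - gradient_cost (T - r) y" if "r \<in> {0..t}" "y \<in> E" for r y
    proof -
      have "2 * \<theta> / \<kappa> * L vhat U y \<le> 2 * \<theta> / \<kappa> * CU" using CU(2)[OF that(2)] \<theta> kappa by (intro mult_left_mono) auto
      then show ?thesis unfolding Lf[OF that] ft_def by simp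
    qed
  qed (rule t(1), rule nonexploding_U)
  then show ?thesis by (simp add: f_def algebra_simps)
qed

lemma sup_estimate:
  assumes a: "0 < a"
  shows "(\<integral>\<^sup>+\<omega>. (SUP s\<in>{0..t}. ennreal \<bar>h T x - h (T - s) (pos \<omega> s)\<bar>) \<partial>Phat x)
    \<le> ennreal (a + 4 * (2 * (h T x - climit)\<^sup>2
        + 8 / \<kappa>\<^sup>2 * (exp (\<kappa> * (h T x - climit)) - 1 + 2 * \<theta> * (U x + CU * t))) / a)"
proof -
  \<comment> \<open>The squared increment of \<open>h\<close> is at most twice the sum of the
    squared distances of its endpoints from \<open>climit\<close>. The second of these is at most 4
    / \<kappa>^2 times the exponential expression of \<open>abs_le_sqrt_exp\<close>; hence 8 /
    \<kappa>^2.\<close>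
  define c where "c = 2 * (h T x - climit)\<^sup>2 - 8 / \<kappa>\<^sup>2"
  define c1 where "c1 = 8 / \<kappa>\<^sup>2"
  define c2 where "c2 = c1 * (2 * \<theta>)"
  define w where "w s y = h (T - s) y + (- climit)" for s y
  define e where "e s y = exp (\<kappa> * w s y)" for s y
  define f where "f s y = (c1 * e s y + c2 * U y) + c" for s y
  define ft where "ft s y = - (c1 * (\<kappa> * e s y * (L vhat (h (T - s)) y + 1/2 * gradient_cost (T - s) y)))" for s y
  have c1: "0 < c1" and c2: "0 < c2" using kappa \<theta> by (auto simp: c1_def c2_def)
  have hC2: "Ck_on E 2 (h (T - s))" if "s \<in> {0..t}" for s using h_C2[of "T - s"] t that by auto
  have wC2: "Ck_on E 2 (w s)" if "s \<in> {0..t}" for s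
    unfolding w_def[abs_def] by (rule C2_add_const(1)[OF openE hC2[OF that]])
  have eC2: "Ck_on E 2 (e s)" if "s \<in> {0..t}" for s
    unfolding e_def[abs_def] by (rule C2_exp(1)[OF openE wC2[OF that]])
  have sC2: "Ck_on E 2 (\<lambda>y. c1 * e s y + c2 * U y)" if "s \<in> {0..t}" for s
    by (intro C2_add(1) C2_cmult(1) openE eC2[OF that] U_C2)
  define p where "p s y = grad (h (T - s)) y \<bullet> (A y *v grad (h (T - s)) y)" for s y
  have gw: "grad (w s) y = grad (h (T - s)) y" if "s \<in> {0..t}" "y \<in> E" for s y
    unfolding w_def[abs_def] by (rule C2_add_const(2)[OF openE hC2[OF that(1)] that(2)])
  have Lw: "L vhat (w s) y = L vhat (h (T - s)) y" if "s \<in> {0..t}" "y \<in> E" for s y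
    unfolding w_def[abs_def] by (rule L_add_const[OF hC2[OF that(1)] that(2)])
  have Le: "L vhat (e s) y = \<kappa> * e s y * (L vhat (h (T - s)) y + \<kappa> / 2 * p s y)" if "s \<in> {0..t}" "y \<in> E" for s y
    unfolding e_def[abs_def] L_exp[OF wC2[OF that(1)] that(2)] Lw[OF that] gw[OF that] p_def ..
  have Lf: "L vhat (f s) y = c1 * (\<kappa> * e s y * (L vhat (h (T - s)) y + \<kappa> / 2 * p s y)) + c2 * L vhat U y"
    if "s \<in> {0..t}" "y \<in> E" for s y
    unfolding f_def[abs_def] L_add_const[OF sC2[OF that(1)] that(2)]
      L_add[OF C2_cmult(1)[OF openE eC2[OF that(1)]] C2_cmult(1)[OF openE U_C2] that(2)]
      L_cmult[OF eC2[OF that(1)] that(2)] L_cmult[OF U_C2 that(2)] Le[OF that] ..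
  have hq: "continuous_on ({0..t} \<times> E) (\<lambda>p. gradient_cost (T - fst p) (snd p))"
    unfolding gradient_cost_def by (rule reversed[OF quad_cont[OF Abar_cont] t(2)])
  have hp: "continuous_on ({0..t} \<times> E) (\<lambda>q. p (fst q) (snd q))"
    unfolding p_def by (rule reversed[OF quad_cont[OF A_cont] t(2)])
  have he: "continuous_on ({0..t} \<times> E) (\<lambda>p. e (fst p) (snd p))"
    unfolding e_def w_def by (intro continuous_on_exp continuous_on_add continuous_on_mult continuous_on_const reversed[OF h_cont_pos t(2)])
  have f_eq: "f s y = 2 * (h T x - climit)\<^sup>2 + c1 * (exp (\<kappa> * (h (T - s) y - climit)) - 1 + 2 * \<theta> * U y)" for s y
    by (simp add: f_def c2_def e_def w_def c_def c1_def algebra_simps)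
  have root: "\<bar>h T x - h (T - s) y\<bar> \<le> sqrt (f s y)" "0 \<le> f s y" if "s \<in> {0..t}" "y \<in> E" for s y
  proof -
    define d where "d = exp (\<kappa> * (h (T - s) y - climit)) - 1 + 2 * \<theta> * U y"
    have "\<kappa> * (climit - h (T - s) y) \<le> \<kappa> * (\<theta> * g y)" using low[OF that] kappa by (intro mult_left_mono) auto
    then have "- (\<theta> * (\<kappa> * g y)) \<le> \<kappa> * (h (T - s) y - climit)" by (simp add: algebra_simps)
    note * = abs_le_sqrt_exp[OF this \<theta>, folded U_def, folded d_def]
    show "0 \<le> f s y" unfolding f_eq d_def[symmetric] using *(2) c1 by simp
    have "\<kappa> * \<bar>h (T - s) y - climit\<bar> \<le> 2 * sqrt d" using *(1) kappa by (simp add: abs_mult)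
    then have "\<bar>h (T - s) y - climit\<bar> \<le> 2 * sqrt d / \<kappa>" using kappa by (simp add: field_simps)
    then have "(h (T - s) y - climit)\<^sup>2 \<le> (2 * sqrt d / \<kappa>)\<^sup>2"
      by (metis abs_ge_zero power2_abs power_mono)
    also have "\<dots> = c1 * d / 2" using *(2) kappa by (simp add: c1_def power_divide power_mult_distrib)
    finally have 1: "2 * (h (T - s) y - climit)\<^sup>2 \<le> c1 * d" by simp
    have "(h T x - h (T - s) y)\<^sup>2 \<le> 2 * (h T x - climit)\<^sup>2 + 2 * (h (T - s) y - climit)\<^sup>2"
      using zero_le_power2[of "(h T x - climit) + (h (T - s) y - climit)"] by (simp add: power2_eq_square algebra_simps)
    then have "(h T x - h (T - s) y)\<^sup>2 \<le> f s y" unfolding f_eq d_def[symmetric] using 1 by linarith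
    then have "sqrt ((h T x - h (T - s) y)\<^sup>2) \<le> sqrt (f s y)" by (rule real_sqrt_le_mono)
    then show "\<bar>h T x - h (T - s) y\<bar> \<le> sqrt (f s y)" by simp
  qed
  have "(\<integral>\<^sup>+\<omega>. (SUP s\<in>{0..t}. ennreal \<bar>h T x - h (T - s) (pos \<omega> s)\<bar>) \<partial>Phat x)
    \<le> (\<integral>\<^sup>+\<omega>. (SUP s\<in>{0..t}. ennreal (sqrt (f s (pos \<omega> s)))) \<partial>Phat x)"
  proof (rule nn_integral_mono_AE)
    show "AE \<omega> in Phat x. (SUP s\<in>{0..t}. ennreal \<bar>h T x - h (T - s) (pos \<omega> s)\<bar>) \<le> (SUP s\<in>{0..t}. ennreal (sqrt (f s (pos \<omega> s))))"
      using nonexploding_U D.AE_path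
    proof eventually_elim
      case (elim \<omega>)
      obtain n where n: "\<And>m. n \<le> m \<Longrightarrow> stopped (En m) t \<omega> = t" using elim(1) by blast
      obtain nx where nx: "x \<in> En nx" using x E_eq by blast
      have xn: "x \<in> En (max n nx)" using nx En_mono[of nx "max n nx"] by auto
      have posE: "pos \<omega> s \<in> E" if "s \<in> {0..t}" for s
      proof -
        have "s \<in> {0..stopped (En (max n nx)) t \<omega>}" using that n[of "max n nx"] by simp
        then show ?thesis using D.stopped_path(2)[OF _ _ xn t(1)] elim(2) closure_En_subset by blast
      qed
      show ?case
      proof (rule SUP_mono)
        fix s assume s: "s \<in> {0..t}"
        show "\<exists>r\<in>{0..t}. ennreal \<bar>h T x - h (T - s) (pos \<omega> s)\<bar> \<le> ennreal (sqrt (f r (pos \<omega> r)))"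
          using s root(1)[OF s posE[OF s]] by (intro bexI[of _ s] ennreal_leI)
      qed
    qed
  qed
  also have "\<dots> \<le> ennreal (a + 4 * (f 0 x + c2 * CU * t) / a)"
  proof (rule D.expected_sup[where f=f and ft=ft and k="\<lambda>_ _. 0"])
    show "0 \<le> c2 * CU" using c2 CU by simp
    show "Ck_on E 2 (f s)" if "s \<in> {0..t}" for s
      unfolding f_def[abs_def] by (rule C2_add_const(1)[OF openE sC2[OF that]])
    show "((\<lambda>s. f s y) has_real_derivative ft r y) (at r within {0..t})" if "r \<in> {0..t}" "y \<in> E" for r y
    proof -
      note 1 = DERIV_chain2[OF DERIV_exp DERIV_cmult[OF DERIV_add[OF h_reversed_der[OF that(1) t(2) that(2)] DERIV_const], of \<kappa> "- climit"]]
      note 2 = DERIV_add[OF DERIV_add[OF DERIV_cmult[OF 1, of c1] DERIV_const] DERIV_const, of "c2 * U y" c]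
      show ?thesis
        unfolding f_def e_def w_def by (rule DERIV_cong[OF 2], unfold ft_def e_def w_def) algebra
    qed
    show "continuous_on ({0..t} \<times> E) (\<lambda>p. f (fst p) (snd p))"
      unfolding f_def by (intro continuous_on_add continuous_on_mult continuous_on_const he
          cont_snd Ck_on_continuous[OF U_C2])
    show "continuous_on ({0..t} \<times> E) (\<lambda>p. ft (fst p) (snd p))"
      unfolding ft_def by (intro continuous_on_minus continuous_on_add continuous_on_mult continuous_on_const reversed[OF L_h_cont t(2)] hq he)
    have "continuous_on ({0..t} \<times> E) (\<lambda>q. c1 * (\<kappa> * e (fst q) (snd q) * (L vhat (h (T - fst q)) (snd q) + \<kappa> / 2 * p (fst q) (snd q))) + c2 * L vhat U (snd q))"
      by (intro continuous_on_add continuous_on_mult continuous_on_const reversed[OF L_h_cont t(2)] hp he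
          cont_snd L_continuous[OF vhat_C2 U_C2])
    then show "continuous_on ({0..t} \<times> E) (\<lambda>p. L vhat (f (fst p)) (snd p))"
      by (rule continuous_on_eq) (auto simp: Lf)
    show "0 \<le> f r y" if "r \<in> {0..t}" "y \<in> E" for r y by (rule root(2)[OF that])
    show "ft r y + L vhat (f r) y \<le> c2 * CU - 0" if "r \<in> {0..t}" "y \<in> E" for r y
    proof -
      have "c2 * L vhat U y \<le> c2 * CU" using CU(2)[OF that(2)] c2 by (intro mult_left_mono) auto
      \<comment> \<open>Here \<kappa> A \<le> Abar enters: the term created by exponentiation is
        absorbed by the quadratic term in the equation of \<open>h\<close>.\<close>
      moreover have "c1 * (\<kappa> * e r y * (\<kappa> / 2 * p r y)) \<le> c1 * (\<kappa> * e r y * (1/2 * gradient_cost (T - r) y))"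
        using c1 kappa Abar_ge[OF that(2), of "grad (h (T - r)) y"]
        by (intro mult_left_mono) (auto simp: e_def p_def gradient_cost_def)
      ultimately show ?thesis unfolding Lf[OF that] ft_def by (simp add: algebra_simps)
    qed
  qed (auto intro: t(1) nonexploding_U a)
  also have "f 0 x + c2 * CU * t = 2 * (h T x - climit)\<^sup>2
        + 8 / \<kappa>\<^sup>2 * (exp (\<kappa> * (h T x - climit)) - 1 + 2 * \<theta> * (U x + CU * t))"
    unfolding f_eq c2_def c1_def by (simp add: algebra_simps)
  finally show ?thesis .
qed

end

section \<open>Limits uniform on compact sets\<close>

context
  fixes t :: real and K :: "(real^'d) set"
  assumes t: "0 \<le> t" and K: "compact K" "K \<subseteq> E"
begin

lemma K_bounds:
  obtains CU M where "0 \<le> CU" "\<forall>y\<in>E. L vhat U y \<le> CU" "0 \<le> M" "\<forall>y\<in>K. U y \<le> M"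
    "\<forall>\<theta>>0. \<exists>T0. t < T0 \<and> (\<forall>T\<ge>T0. (\<forall>s\<in>{0..t}. \<forall>y\<in>E. climit - \<theta> * g y \<le> h (T - s) y) \<and>
       (\<forall>x\<in>K. h T x \<le> climit + \<theta>))"
proof -
  obtain CU where CU: "CU \<ge> 0" "\<forall>x\<in>E. L vhat (\<lambda>x. exp (\<kappa> * g x)) x \<le> CU" using L_exp_g_bounded by blast
  obtain n where n: "K \<subseteq> En n" by (rule compact_in_En[OF K])
  obtain M where M: "0 < M" "\<And>y. y \<in> closure (En n) \<Longrightarrow> \<bar>U y\<bar> \<le> M"
    by (rule bounded_on_En[OF Ck_on_continuous[OF U_C2], of n]) auto
  show ?thesis
  proof (rule that[of CU M])
    show "\<forall>y\<in>E. L vhat U y \<le> CU" using CU(2) by (simp add: U_def[abs_def])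
    show "\<forall>y\<in>K. U y \<le> M"
    proof
      fix y assume that: "y \<in> K"
      have "y \<in> closure (En n)" using that n closure_subset by blast
      then show "U y \<le> M" using M(2)[of y] by linarith
    qed
    show "\<forall>\<theta>>0. \<exists>T0. t < T0 \<and> (\<forall>T\<ge>T0. (\<forall>s\<in>{0..t}. \<forall>y\<in>E. climit - \<theta> * g y \<le> h (T - s) y) \<and> (\<forall>x\<in>K. h T x \<le> climit + \<theta>))"
    proof (intro allI impI)
      fix \<theta> :: real assume \<theta>: "0 < \<theta>"
      obtain T1 where T1: "0 \<le> T1" "\<And>T y. T1 \<le> T \<Longrightarrow> y \<in> E \<Longrightarrow> climit - \<theta> * g y \<le> h T y" using h_lower_limit[OF \<theta>] by blast
      obtain T2 where T2: "0 \<le> T2" "\<And>T y. T2 \<le> T \<Longrightarrow> y \<in> En n \<Longrightarrow> h T y \<le> climit + \<theta>" using h_upper_limit[OF \<theta>, of n] by blast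
      show "\<exists>T0. t < T0 \<and> (\<forall>T\<ge>T0. (\<forall>s\<in>{0..t}. \<forall>y\<in>E. climit - \<theta> * g y \<le> h (T - s) y) \<and> (\<forall>x\<in>K. h T x \<le> climit + \<theta>))"
      proof (intro exI[of _ "t + 1 + T1 + T2"] conjI allI impI ballI)
        show "t < t + 1 + T1 + T2" using T1(1) T2(1) by simp
        show "climit - \<theta> * g y \<le> h (T - s) y" if "t + 1 + T1 + T2 \<le> T" "s \<in> {0..t}" "y \<in> E" for T s y
          by (rule T1(2)[OF _ that(3)]) (use that T2(1) in auto)
        show "h T x \<le> climit + \<theta>" if "t + 1 + T1 + T2 \<le> T" "x \<in> K" for T x
          by (rule T2(2)) (use that T1(1) n t in auto)
      qed
    qed
  qed (use CU M in auto)
qed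

lemma cost_limit:
  assumes \<epsilon>: "0 < \<epsilon>"
  shows "\<exists>T0. \<forall>T\<ge>T0. \<forall>x\<in>K. (\<integral>\<^sup>+\<omega>. (\<integral>\<^sup>+s\<in>{0..t}. ennreal (gradient_cost (T - s) (pos \<omega> s)) \<partial>lborel) \<partial>Phat x) \<le> ennreal \<epsilon>"
proof -
  obtain CU M where CU0: "0 \<le> CU" "\<forall>y\<in>E. L vhat U y \<le> CU" and M0: "0 \<le> M" "\<forall>y\<in>K. U y \<le> M"
    and lim: "\<forall>\<theta>>0. \<exists>T0. t < T0 \<and> (\<forall>T\<ge>T0. (\<forall>s\<in>{0..t}. \<forall>y\<in>E. climit - \<theta> * g y \<le> h (T - s) y) \<and>
       (\<forall>x\<in>K. h T x \<le> climit + \<theta>))"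
    by (rule K_bounds)
  have CU: "0 \<le> CU" "\<And>y. y \<in> E \<Longrightarrow> L vhat U y \<le> CU" and M: "0 \<le> M" "\<And>y. y \<in> K \<Longrightarrow> U y \<le> M"
    using CU0 M0 by simp_all
  \<comment> \<open>The bound of \<open>cost_estimate\<close> over \<open>K\<close>, expressed
    through \<theta> alone.\<close>
  have "((\<lambda>\<theta>. 2 * \<theta> + 2 * \<theta> / \<kappa> * (M + CU * t)) \<longlongrightarrow> 2 * 0 + 2 * 0 / \<kappa> * (M + CU * t)) (at_right 0)"
    using kappa by (intro tendsto_intros) auto
  then have "((\<lambda>\<theta>. 2 * \<theta> + 2 * \<theta> / \<kappa> * (M + CU * t)) \<longlongrightarrow> 0) (at_right 0)" by simp
  then have "\<forall>\<^sub>F \<theta> in at_right 0. 2 * \<theta> + 2 * \<theta> / \<kappa> * (M + CU * t) < \<epsilon>" using \<epsilon> by (rule order_tendstoD)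
  moreover have "\<forall>\<^sub>F \<theta> in at_right 0. \<theta> \<in> {0<..<1::real}" by (rule eventually_at_right_real) simp
  ultimately have "\<forall>\<^sub>F \<theta> in at_right 0. \<theta> \<in> {0<..<1} \<and> 2 * \<theta> + 2 * \<theta> / \<kappa> * (M + CU * t) < \<epsilon>"
    by (rule eventually_conj[rotated])
  from eventually_happens'[OF trivial_limit_at_right_real this]
  obtain \<theta> where "\<theta> \<in> {0<..<1} \<and> 2 * \<theta> + 2 * \<theta> / \<kappa> * (M + CU * t) < \<epsilon>" by (rule exE)
  then have \<theta>: "0 < \<theta>" "\<theta> \<le> 1" "2 * \<theta> + 2 * \<theta> / \<kappa> * (M + CU * t) < \<epsilon>" by simp_all
  obtain T0 where TT: "t < T0 \<and> (\<forall>T\<ge>T0. (\<forall>s\<in>{0..t}. \<forall>y\<in>E. climit - \<theta> * g y \<le> h (T - s) y) \<and>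
       (\<forall>x\<in>K. h T x \<le> climit + \<theta>))"
    using lim[rule_format, OF \<theta>(1)] by (rule exE)
  have T0: "t < T0" "T0 \<le> T \<Longrightarrow> s \<in> {0..t} \<Longrightarrow> y \<in> E \<Longrightarrow> climit - \<theta> * g y \<le> h (T - s) y"
    "T0 \<le> T \<Longrightarrow> x \<in> K \<Longrightarrow> h T x \<le> climit + \<theta>" for T s x y
    using TT by simp_all
  show ?thesis
  proof (intro exI allI impI ballI)
    fix T x assume T: "T0 \<le> T" and xK: "x \<in> K"
    have x: "x \<in> E" using xK K by blast
    have "(\<integral>\<^sup>+\<omega>. (\<integral>\<^sup>+s\<in>{0..t}. ennreal (gradient_cost (T - s) (pos \<omega> s)) \<partial>lborel) \<partial>Phat x)
       \<le> ennreal (2 * (h T x - climit) + 2 * \<theta> / \<kappa> * (U x + CU * t))"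
      by (rule cost_estimate[OF x t _ \<theta>(1,2) CU T0(2)[OF T]]) (use T T0(1) in auto)
    also have "\<dots> \<le> ennreal \<epsilon>"
    proof (rule ennreal_leI)
      have "2 * \<theta> / \<kappa> * (U x + CU * t) \<le> 2 * \<theta> / \<kappa> * (M + CU * t)" using \<theta> kappa M(2)[OF xK] by (intro mult_left_mono) auto
      then show "2 * (h T x - climit) + 2 * \<theta> / \<kappa> * (U x + CU * t) \<le> \<epsilon>" 
        using T0(3)[OF T xK] by (intro order_trans[OF add_mono less_imp_le[OF \<theta>(3)]]) auto
    qed
    finally show "(\<integral>\<^sup>+\<omega>. (\<integral>\<^sup>+s\<in>{0..t}. ennreal (gradient_cost (T - s) (pos \<omega> s)) \<partial>lborel) \<partial>Phat x) \<le> ennreal \<epsilon>" .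
  qed
qed

lemma sup_limit:
  assumes \<epsilon>: "0 < \<epsilon>"
  shows "\<exists>T0. \<forall>T\<ge>T0. \<forall>x\<in>K. (\<integral>\<^sup>+\<omega>. (SUP s\<in>{0..t}. ennreal \<bar>h T x - h (T - s) (pos \<omega> s)\<bar>) \<partial>Phat x) \<le> ennreal \<epsilon>"
proof -
  obtain CU M where CU0: "0 \<le> CU" "\<forall>y\<in>E. L vhat U y \<le> CU" and M0: "0 \<le> M" "\<forall>y\<in>K. U y \<le> M"
    and lim: "\<forall>\<theta>>0. \<exists>T0. t < T0 \<and> (\<forall>T\<ge>T0. (\<forall>s\<in>{0..t}. \<forall>y\<in>E. climit - \<theta> * g y \<le> h (T - s) y) \<and>
       (\<forall>x\<in>K. h T x \<le> climit + \<theta>))"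
    by (rule K_bounds)
  have CU: "0 \<le> CU" "\<And>y. y \<in> E \<Longrightarrow> L vhat U y \<le> CU" and M: "0 \<le> M" "\<And>y. y \<in> K \<Longrightarrow> U y \<le> M"
    using CU0 M0 by simp_all
  \<comment> \<open>A bound on \<open>K\<close> for the distance of \<open>h\<close> from
    \<open>climit\<close>: at most \<theta> above it and \<theta> g \<le> \<theta> M / \<kappa>
    below.\<close>
  define r where "r \<theta> = \<theta> * (1 + M / \<kappa>)" for \<theta>
  define R where "R \<theta> = 2 * (r \<theta>)\<^sup>2 + 8 / \<kappa>\<^sup>2 * (exp (\<kappa> * r \<theta>) - 1 + 2 * \<theta> * (M + CU * t))" for \<theta>
  have "(R \<longlongrightarrow> 2 * (0 * (1 + M / \<kappa>))\<^sup>2 + 8 / \<kappa>\<^sup>2 * (exp (\<kappa> * (0 * (1 + M / \<kappa>))) - 1 + 2 * 0 * (M + CU * t))) (at_right 0)"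
    unfolding R_def[abs_def] r_def by (intro tendsto_intros)
  then have "(R \<longlongrightarrow> 0) (at_right 0)" by simp
  \<comment> \<open>With a = \<epsilon> / 2 the estimate reads \<epsilon> / 2 + 8 R / \<epsilon>,
    which is at most \<epsilon> when R \<le> \<epsilon>^2 / 16.\<close>
  moreover have "0 < \<epsilon>\<^sup>2 / 16" using \<epsilon> by simp
  ultimately have "\<forall>\<^sub>F \<theta> in at_right 0. R \<theta> < \<epsilon>\<^sup>2 / 16" by (rule order_tendstoD)
  moreover have "\<forall>\<^sub>F \<theta> in at_right 0. \<theta> \<in> {0<..<1::real}" by (rule eventually_at_right_real) simp
  ultimately have "\<forall>\<^sub>F \<theta> in at_right 0. \<theta> \<in> {0<..<1} \<and> R \<theta> < \<epsilon>\<^sup>2 / 16"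
    by (rule eventually_conj[rotated])
  from eventually_happens'[OF trivial_limit_at_right_real this]
  obtain \<theta> where "\<theta> \<in> {0<..<1} \<and> R \<theta> < \<epsilon>\<^sup>2 / 16" by (rule exE)
  then have \<theta>: "0 < \<theta>" "\<theta> \<le> 1" "R \<theta> < \<epsilon>\<^sup>2 / 16" by simp_all
  obtain T0 where TT: "t < T0 \<and> (\<forall>T\<ge>T0. (\<forall>s\<in>{0..t}. \<forall>y\<in>E. climit - \<theta> * g y \<le> h (T - s) y) \<and>
       (\<forall>x\<in>K. h T x \<le> climit + \<theta>))"
    using lim[rule_format, OF \<theta>(1)] by (rule exE)
  have T0: "t < T0" "T0 \<le> T \<Longrightarrow> s \<in> {0..t} \<Longrightarrow> y \<in> E \<Longrightarrow> climit - \<theta> * g y \<le> h (T - s) y"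
    "T0 \<le> T \<Longrightarrow> x \<in> K \<Longrightarrow> h T x \<le> climit + \<theta>" for T s x y
    using TT by simp_all
  show ?thesis
  proof (intro exI allI impI ballI)
    fix T x assume T: "T0 \<le> T" and xK: "x \<in> K"
    have x: "x \<in> E" using xK K by blast
    let ?R = "2 * (h T x - climit)\<^sup>2 + 8 / \<kappa>\<^sup>2 * (exp (\<kappa> * (h T x - climit)) - 1 + 2 * \<theta> * (U x + CU * t))"
    have "(\<integral>\<^sup>+\<omega>. (SUP s\<in>{0..t}. ennreal \<bar>h T x - h (T - s) (pos \<omega> s)\<bar>) \<partial>Phat x)
       \<le> ennreal (\<epsilon> / 2 + 4 * ?R / (\<epsilon> / 2))"
      by (rule sup_estimate[OF x t _ \<theta>(1,2) CU T0(2)[OF T]]) (use T T0(1) \<epsilon> in auto)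
    also have "\<dots> \<le> ennreal \<epsilon>"
    proof (rule ennreal_leI)
      have gM: "g x \<le> M / \<kappa>" using g_le_U[of x] M(2)[OF xK] kappa by (simp add: field_simps)
      have lo: "climit - \<theta> * g x \<le> h T x" using T0(2)[OF T, of 0 x] t x by simp
      have "\<theta> * g x \<le> \<theta> * (M / \<kappa>)" using gM \<theta> by (intro mult_left_mono) auto
      moreover have "0 \<le> \<theta> * (M / \<kappa>)" using \<theta> M kappa by simp
      ultimately have "\<bar>h T x - climit\<bar> \<le> r \<theta>" using lo T0(3)[OF T xK] \<theta> by (simp add: r_def distrib_left abs_le_iff)
      then have "\<bar>h T x - climit\<bar>\<^sup>2 \<le> (r \<theta>)\<^sup>2" and e: "h T x - climit \<le> r \<theta>" by (rule power_mono, simp_all)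
      then have "(h T x - climit)\<^sup>2 \<le> (r \<theta>)\<^sup>2" by simp
      moreover have "exp (\<kappa> * (h T x - climit)) - 1 + 2 * \<theta> * (U x + CU * t) \<le> exp (\<kappa> * r \<theta>) - 1 + 2 * \<theta> * (M + CU * t)"
        using e M(2)[OF xK] \<theta> kappa CU(1) t by (intro add_mono diff_mono mult_left_mono) auto
      then have "8 / \<kappa>\<^sup>2 * (exp (\<kappa> * (h T x - climit)) - 1 + 2 * \<theta> * (U x + CU * t)) \<le> 8 / \<kappa>\<^sup>2 * (exp (\<kappa> * r \<theta>) - 1 + 2 * \<theta> * (M + CU * t))"
        by (rule mult_left_mono) simp
      ultimately have "?R \<le> \<epsilon>\<^sup>2 / 16" using \<theta>(3) unfolding R_def by linarith
      then have "4 * ?R / (\<epsilon> / 2) \<le> 4 * (\<epsilon>\<^sup>2 / 16) / (\<epsilon> / 2)" using \<epsilon> by (intro divide_right_mono mult_left_mono) auto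
      also have "\<dots> = \<epsilon> / 2" using \<epsilon> by (simp add: power2_eq_square)
      finally have "\<epsilon> / 2 + 4 * ?R / (\<epsilon> / 2) \<le> \<epsilon> / 2 + \<epsilon> / 2" by (rule add_left_mono)
      then show "\<epsilon> / 2 + 4 * ?R / (\<epsilon> / 2) \<le> \<epsilon>" by (simp only: field_sum_of_halves)
    qed
    finally show "(\<integral>\<^sup>+\<omega>. (SUP s\<in>{0..t}. ennreal \<bar>h T x - h (T - s) (pos \<omega> s)\<bar>) \<partial>Phat x) \<le> ennreal \<epsilon>" .
  qed
qed

end

end

section \<open>A bound from recurrence\<close>

text \<open>An exponent of at least 2 removes the kink of the positive part at 0.\<close>

lemma DERIV_pos_part_power:
  "((\<lambda>z. (max 0 z) ^ Suc (Suc n)) has_real_derivative real (Suc (Suc n)) * (max 0 z) ^ Suc n) (at z)"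
proof -
  consider "0 < z" | "z < 0" | "z = 0" by linarith
  then show ?thesis
  proof cases
    case 1
    have "((\<lambda>z. z ^ Suc (Suc n)) has_real_derivative real (Suc (Suc n)) * (max 0 z) ^ Suc n) (at z)"
      by (rule DERIV_cong[OF DERIV_pow]) (use 1 in simp)
    then show ?thesis by (rule has_field_derivative_transform_within_open[where S="{0<..}"]) (use 1 in auto)
  next
    case 2
    have "((\<lambda>z. 0) has_real_derivative real (Suc (Suc n)) * (max 0 z) ^ Suc n) (at z)"
      by (rule DERIV_cong[OF DERIV_const]) (use 2 in simp)
    then show ?thesis by (rule has_field_derivative_transform_within_open[where S="{..<0}"]) (use 2 in auto)
  next
    case 3
    have "((\<lambda>y. (max 0 y) ^ Suc n) \<longlongrightarrow> (max 0 0) ^ Suc n) (at (0::real))" by (intro tendsto_intros)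
    then have "((\<lambda>y. (max 0 y) ^ Suc n) \<longlongrightarrow> 0) (at (0::real))" by simp
    then have "((\<lambda>y. ((max 0 y) ^ Suc (Suc n) - (max 0 0) ^ Suc (Suc n)) / (y - 0)) \<longlongrightarrow> 0) (at (0::real))"
      by (rule Lim_transform_eventually) (auto simp: eventually_at_filter max_def)
    then show ?thesis unfolding 3 by (simp add: has_field_derivative_iff)
  qed
qed

context diffusion
begin

text \<open>For \<open>recurrent_bound\<close> the drift must be nonpositive on \<open>En N\<close>
  as well. Composing with a nondecreasing concave function that is constant above \<open>m\<close>
  kills the drift there, since w \<ge> m on \<open>En N\<close>. The minimum with \<open>m\<close>
  is not smooth enough; the cube of the positive part of 1 - s / m yields a C2 substitute.\<close>

lemma recurrent_lower_bound:
  assumes w: "Ck_on E 2 w" "\<And>y. y \<in> E \<Longrightarrow> 0 < w y"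
    and drift: "\<And>y. y \<in> E - En N \<Longrightarrow> L \<phi> w y \<le> 0"
    and m: "0 < m" "\<And>y. y \<in> En N \<Longrightarrow> m \<le> w y"
    and hit: "AE \<omega> in P. \<exists>t\<ge>0. \<omega> t \<in> Some ` En N"
  shows "m \<le> w x"
proof -
  define p where "p s = max 0 (1 - s / m)" for s :: real
  define G where "G s = 1 - (p s) ^ 3" for s
  define G' where "G' s = 3 / m * (p s)\<^sup>2" for s
  define G'' where "G'' s = - (6 / m\<^sup>2 * p s)" for s
  have lin: "((\<lambda>s. 1 - s / m) has_real_derivative - (1 / m)) (at s)" for s
    using m by (auto intro!: derivative_eq_intros)
  have dG: "(G has_real_derivative G' s) (at s)" for s
  proof -
    have "((\<lambda>s. (p s) ^ Suc (Suc 1)) has_real_derivative real (Suc (Suc 1)) * (p s) ^ Suc 1 * - (1 / m)) (at s)"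
      unfolding p_def by (rule DERIV_chain2[OF DERIV_pos_part_power lin])
    from DERIV_diff[OF DERIV_const this, of 1]
    show ?thesis unfolding G_def[abs_def] by (simp add: G'_def numeral_eq_Suc)
  qed
  have dG': "(G' has_real_derivative G'' s) (at s)" for s
  proof -
    have "((\<lambda>s. (p s) ^ Suc (Suc 0)) has_real_derivative real (Suc (Suc 0)) * (p s) ^ Suc 0 * - (1 / m)) (at s)"
      unfolding p_def by (rule DERIV_chain2[OF DERIV_pos_part_power lin])
    from DERIV_cmult[OF this, of "3 / m"]
    show ?thesis unfolding G'_def[abs_def] by (simp add: G''_def power2_eq_square)
  qed
  have cG'': "continuous_on E (\<lambda>y. G'' (w y))"
    unfolding G''_def p_def using m by (intro continuous_intros Ck_on_continuous[OF w(1)]) auto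
  have p: "0 \<le> p s" for s by (simp add: p_def)
  have p0: "p (w y) = 0" if "y \<in> En N" for y using m(2)[OF that] m(1) by (simp add: p_def)
  have "1 \<le> G (w x)"
  proof (rule recurrent_bound[where u="\<lambda>y. G (w y)" and N=N])
    show "Ck_on E 2 (\<lambda>y. G (w y))" by (rule C2_compose(1)[OF openE w(1) dG dG' cG''])
    show "0 \<le> G (w y)" if "y \<in> E" for y
    proof -
      have "p (w y) \<le> 1" using w(2)[OF that] m by (simp add: p_def)
      then show ?thesis using p[of "w y"] by (simp add: G_def power_le_one)
    qed
    show "L \<phi> (\<lambda>y. G (w y)) y \<le> 0" if y: "y \<in> E" for y
    proof -
      have "L \<phi> (\<lambda>y. G (w y)) y = G' (w y) * L \<phi> w y + 1/2 * G'' (w y) * (grad w y \<bullet> (A y *v grad w y))"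
        by (rule L_compose[OF w(1) y dG dG' cG''])
      moreover have "G' (w y) * L \<phi> w y \<le> 0"
      proof (cases "y \<in> En N")
        case True
        then show ?thesis by (simp add: G'_def p0)
      next
        case False
        then show ?thesis using drift[of y] y m by (intro mult_nonneg_nonpos) (auto simp: G'_def)
      qed
      moreover have "G'' (w y) * (grad w y \<bullet> (A y *v grad w y)) \<le> 0"
        using p[of "w y"] m by (intro mult_nonpos_nonneg A_nonneg[OF y]) (auto simp: G''_def)
      ultimately show ?thesis by simp
    qed
    show "1 \<le> G (w y)" if "y \<in> En N" for y by (simp add: G_def p0[OF that])
  qed (rule hit)
  then have "(p (w x)) ^ 3 \<le> 0" by (simp add: G_def)
  then have "p (w x) \<le> 0" using p[of "w x"] by (simp add: power_le_zero_eq)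
  then show ?thesis using m by (simp add: p_def)
qed

end

context exhausted_op
begin

text \<open>Unlike the lower bound, which is a maximum principle, this one needs recurrence.\<close>

lemma stationary_upper_bound:
  fixes P :: "real^'d \<Rightarrow> 'd path measure"
  assumes w: "Ck_on E 2 w" and f: "Ck_on E 2 f"
    and P: "\<And>x. x \<in> E \<Longrightarrow> gmp_solution A Abar B E En w x (P x)" and rec: "recurrent_family E P"
    and le: "\<And>x. x \<in> E - En N \<Longrightarrow> F f x \<le> F w x"
  obtains C where "\<And>x. x \<in> E \<Longrightarrow> w x \<le> f x + C"
proof -
  have c: "continuous_on E (\<lambda>x. f x - w x)" by (intro continuous_on_diff Ck_on_continuous[OF f] Ck_on_continuous[OF w])
  obtain C where C: "0 < C" "\<And>x. x \<in> closure (En N) \<Longrightarrow> \<bar>f x - w x\<bar> \<le> C" by (rule bounded_on_En[OF c, of N]) auto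
  \<comment> \<open>Recurrence concerns small balls; one inside \<open>En N\<close> ensures that
    \<open>En N\<close> is hit.\<close>
  obtain \<epsilon> where \<epsilon>: "0 < \<epsilon>" "ball x0 \<epsilon> \<subseteq> En N" using En_open x0[of N] open_contains_ball by blast
  have "w x \<le> f x + C" if x: "x \<in> E" for x
  proof -
    interpret diffusion E A Abar B V \<kappa> En x0 w x "P x"
      by unfold_locales (auto intro: w x P)
    have "exp (- (\<kappa> * C)) \<le> exp (\<kappa> * (f x - w x))"
    proof (rule recurrent_lower_bound[where w="\<lambda>x. exp (\<kappa> * (f x - w x))" and N=N])
      show "Ck_on E 2 (\<lambda>x. exp (\<kappa> * (f x - w x)))" by (rule C2_exp(1)[OF openE C2_diff(1)[OF openE f w]])
      show "L w (\<lambda>x. exp (\<kappa> * (f x - w x))) y \<le> 0" if "y \<in> E - En N" for y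
      proof -
        have "\<kappa> * exp (\<kappa> * (f y - w y)) * (F f y - F w y) \<le> 0"
          using le[OF that] kappa by (intro mult_nonneg_nonpos) auto
        then show ?thesis using L_exp_diff_le[OF f w, of y] that by force
      qed
      show "exp (- (\<kappa> * C)) \<le> exp (\<kappa> * (f y - w y))" if "y \<in> En N" for y
      proof -
        have "y \<in> closure (En N)" using that closure_subset by blast
        then have "- C \<le> f y - w y" using C(2)[of y] by linarith
        then have "\<kappa> * (- C) \<le> \<kappa> * (f y - w y)" using kappa by (intro mult_left_mono) auto
        then show ?thesis by simp
      qed
      have "AE \<omega> in P x. \<exists>t\<ge>0. \<omega> t \<in> Some ` (E \<inter> ball x0 \<epsilon>)"
        using rec x x0_E \<epsilon>(1) by (simp add: recurrent_family_def)
      then show "AE \<omega> in P x. \<exists>t\<ge>0. \<omega> t \<in> Some ` En N"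
        by eventually_elim (use \<epsilon>(2) in blast)
    qed auto
    then have "\<kappa> * (w x - f x) \<le> \<kappa> * C" by (simp add: algebra_simps)
    then show ?thesis using kappa by simp
  qed
  then show ?thesis by (rule that)
qed

end

section \<open>From the hypotheses to the abstract setting\<close>

lemma SUP_tendsto_MInfty_imp:
  assumes "(\<lambda>n. SUP x\<in>S n. ereal (f x)) \<longlonglongrightarrow> -\<infinity>"
  shows "\<exists>n. \<forall>x\<in>S n. f x < c"
proof -
  have "\<forall>\<^sub>F n in sequentially. (SUP x\<in>S n. ereal (f x)) < ereal c" using assms by (simp add: tendsto_MInfty)
  from eventually_happens'[OF sequentially_bot this] obtain n where n: "(SUP x\<in>S n. ereal (f x)) < ereal c" by (rule exE)
  have "f x < c" if "x \<in> S n" for x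
    using le_less_trans[OF SUP_upper[OF that, of "\<lambda>x. ereal (f x)"] n] by simp
  then show ?thesis by blast
qed

lemma INF_tendsto_PInfty_imp:
  assumes "(\<lambda>n. INF x\<in>S n. ereal (f x)) \<longlonglongrightarrow> \<infinity>"
  shows "\<exists>n. \<forall>x\<in>S n. c < f x"
proof -
  have "\<forall>\<^sub>F n in sequentially. ereal c < (INF x\<in>S n. ereal (f x))" using assms by (simp add: tendsto_PInfty)
  from eventually_happens'[OF sequentially_bot this] obtain n where n: "ereal c < (INF x\<in>S n. ereal (f x))" by (rule exE)
  have "c < f x" if "x \<in> S n" for x
    using less_le_trans[OF n INF_lower[OF that, of "\<lambda>x. ereal (f x)"]] by simp
  then show ?thesis by blast
qed

lemma SUP_less_PInfty_imp:
  assumes "(SUP x\<in>S. ereal (f x)) < \<infinity>"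
  shows "\<exists>C. \<forall>x\<in>S. f x \<le> C"
proof -
  obtain C where "(SUP x\<in>S. ereal (f x)) \<le> ereal C"
    using assms by (cases "SUP x\<in>S. ereal (f x)") auto
  then show ?thesis using SUP_le_iff[of "\<lambda>x. ereal (f x)" S "ereal C"] by auto
qed

lemma loewner_le_iff: "loewner_le M N \<longleftrightarrow> (\<forall>\<xi>. \<xi> \<bullet> (M *v \<xi>) \<le> \<xi> \<bullet> (N *v \<xi>))"
  by (simp add: loewner_le_def matrix_vector_mult_diff_rdistrib inner_diff_right)

theorem theorem2p9:
  fixes E :: "(real^'d::finite) set"
    and En :: "nat \<Rightarrow> (real^'d) set"
    and x0 :: "real^'d"
    and \<gamma>E \<gamma> :: real
    and A Abar :: "real^'d \<Rightarrow> real^'d^'d"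
    and B :: "real^'d \<Rightarrow> real^'d"
    and V :: "real^'d \<Rightarrow> real"
    and \<kappa>l \<kappa>u \<delta> \<alpha> K lhat t :: real
    and \<phi>0 \<psi>0 v0 vhat mhat :: "real^'d \<Rightarrow> real"
    and v h :: "real \<Rightarrow> real^'d \<Rightarrow> real"
    and Phat :: "real^'d \<Rightarrow> 'd path measure"
  assumes E: "open E" "connected E" "star_shaped_wrt x0 E"
    and \<gamma>E: "0 < \<gamma>E" "\<gamma>E \<le> 1"
    and En: "regular_exhaustion \<gamma>E x0 E En"
    and \<gamma>: "0 < \<gamma>" "\<gamma> \<le> 1"
    and coeffs: "CkH_symm_on \<gamma> E 2 A" "CkH_symm_on \<gamma> E 2 Abar"
      "CkH_vec_on \<gamma> E 1 B" "CkH_on \<gamma> E 1 V"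
    and elliptic: "\<forall>n. \<exists>c>0. \<forall>x\<in>En n. \<forall>\<xi>. \<xi> \<bullet> (A x *v \<xi>) \<ge> c * (norm \<xi>)\<^sup>2"
    and comparable: "0 < \<kappa>l" "\<kappa>l \<le> \<kappa>u"
      "\<forall>x\<in>E. loewner_le (\<kappa>l *\<^sub>R A x) (Abar x) \<and> loewner_le (Abar x) (\<kappa>u *\<^sub>R A x)"
    and \<phi>0: "Ck_on E 3 \<phi>0" "\<forall>x\<in>E. 0 \<le> \<phi>0 x"
      "(\<lambda>n. SUP x\<in>E - En n. ereal (F_op A Abar B V \<phi>0 x)) \<longlonglongrightarrow> -\<infinity>"
    and well_posed: "mp_well_posed A Abar B E En \<phi>0"
    and \<phi>0_growth: "(\<lambda>n. INF x\<in>E - En n. ereal (\<phi>0 x)) \<longlonglongrightarrow> \<infinity>"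
    and \<delta>: "1 < \<delta>"
      "(\<lambda>n. SUP x\<in>E - En n. ereal (F_op A Abar B V (\<lambda>y. \<delta> * \<phi>0 y) x)) \<longlonglongrightarrow> -\<infinity>"
    and \<psi>0: "Ck_on E 3 \<psi>0" "0 < \<alpha>" "0 < K"
      "(\<lambda>n. INF x\<in>E - En n. ereal (F_op A Abar B V \<psi>0 x)) \<longlonglongrightarrow> \<infinity>"
      "(\<lambda>n. INF x\<in>E - En n. ereal (\<phi>0 x - \<psi>0 x)) \<longlonglongrightarrow> \<infinity>"
      "(INF x\<in>E. ereal (\<psi>0 x + K * \<phi>0 x)) > -\<infinity>"
      "(SUP x\<in>E. ereal (F_op A Abar B V (\<lambda>y. \<delta> * \<phi>0 y) x + \<alpha> * (\<delta> * \<phi>0 x - \<psi>0 x))) < \<infinity>"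
    and ergodic_pair: "Ck_on E 2 vhat" "\<forall>x\<in>E. F_op A Abar B V vhat x = lhat"
      "gmp_family A Abar B E En vhat Phat" "ergodic_family E Phat mhat"
    and v0: "continuous_on E v0" "(SUP x\<in>E. ereal (\<bar>v0 x\<bar> - \<phi>0 x)) < \<infinity>"
    and v: "classical_solution A Abar B V E v0 v"
      "\<forall>T\<ge>0. (SUP (s, x)\<in>{0..T} \<times> E. ereal (v s x - \<phi>0 x)) < \<infinity>"
    and h: "h = (\<lambda>s x. v s x - lhat * s - vhat x)"
    and t: "0 \<le> t"
  shows "vanishes_in_C E (\<lambda>T x. \<integral>\<^sup>+\<omega>.
           (\<integral>\<^sup>+s\<in>{0..t}. ennreal (grad (h (T - s)) (the (\<omega> s)) \<bullet>
              (Abar (the (\<omega> s)) *v grad (h (T - s)) (the (\<omega> s)))) \<partial>lborel) \<partial>Phat x)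
       \<and> vanishes_in_C E (\<lambda>T x. \<integral>\<^sup>+\<omega>.
           (SUP s\<in>{0..t}. ennreal \<bar>h T x - h (T - s) (the (\<omega> s))\<bar>) \<partial>Phat x)"
proof -
  interpret X: exhausted_op E A Abar B V \<kappa>l En x0
  proof unfold_locales
    show "open E" by (rule E(1))
    show En_props: "open (En n)" "bounded (En n)" "closure (En n) \<subseteq> En (Suc n)" "x0 \<in> En n"
      "x \<in> En n \<Longrightarrow> closed_segment x0 x \<subseteq> En n" "E = (\<Union>n. En n)" for n x
      using En by (auto simp: regular_exhaustion_def star_shaped_wrt_def)
    show "\<exists>c>0. \<forall>x\<in>En n. \<forall>\<xi>. c * (norm \<xi>)\<^sup>2 \<le> \<xi> \<bullet> (A x *v \<xi>)" for n using elliptic by blast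
    show "psd (A x)" if x: "x \<in> E" for x
    proof -
      obtain n where n: "x \<in> En n" using x En_props(6) by blast
      obtain c where c: "0 < c" "\<forall>x\<in>En n. \<forall>\<xi>. c * (norm \<xi>)\<^sup>2 \<le> \<xi> \<bullet> (A x *v \<xi>)" using elliptic by blast
      have "0 \<le> \<xi> \<bullet> (A x *v \<xi>)" for \<xi>
      proof -
        have "0 \<le> c * (norm \<xi>)\<^sup>2" using c(1) by simp
        then show ?thesis using c(2) n by (meson order_trans)
      qed
      then show ?thesis using coeffs(1) x by (simp add: psd_def CkH_symm_on_def)
    qed
    show "transpose (Abar x) = Abar x" if "x \<in> E" for x using coeffs(2) that by (simp add: CkH_symm_on_def)
    show "0 < \<kappa>l" by (rule comparable(1))
    show "\<kappa>l * (\<xi> \<bullet> (A x *v \<xi>)) \<le> \<xi> \<bullet> (Abar x *v \<xi>)" if "x \<in> E" for x \<xi>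
      using comparable(3) that by (auto simp: loewner_le_iff simp flip: scaleR_matrix_vector_assoc)
    show "continuous_on E (\<lambda>x. A x $ i $ j)" "continuous_on E (\<lambda>x. Abar x $ i $ j)" for i j
      using coeffs(1,2) by (auto simp: CkH_symm_on_def numeral_2_eq_2 intro!: differentiable_imp_continuous_on)
    show "continuous_on E (\<lambda>x. B x $ i)" for i
      using coeffs(3) by (auto simp: CkH_vec_on_def intro!: differentiable_imp_continuous_on)
    show "continuous_on E V" using coeffs(4) by (auto intro!: differentiable_imp_continuous_on)
  qed
  have \<phi>0_C2: "Ck_on E 2 \<phi>0" and \<psi>0_C2: "Ck_on E 2 \<psi>0"
    using \<phi>0(1) \<psi>0(1) Ck_on_Suc_imp[of E 2] by (simp_all add: numeral_3_eq_3 numeral_2_eq_2)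
  have \<phi>0_nn: "0 \<le> \<phi>0 x" if "x \<in> E" for x using \<phi>0(2) that by simp
  have F_vhat: "X.F vhat x = lhat" if "x \<in> E" for x using ergodic_pair(2) that by simp
  have F_\<phi>0: "\<exists>n. \<forall>x\<in>E - En n. X.F \<phi>0 x < c" for c by (rule SUP_tendsto_MInfty_imp[OF \<phi>0(3)])
  have F_\<delta>\<phi>0: "\<exists>n. \<forall>x\<in>E - En n. X.F (\<lambda>y. \<delta> * \<phi>0 y) x < c" for c by (rule SUP_tendsto_MInfty_imp[OF \<delta>(2)])
  have F_\<psi>0: "\<exists>n. \<forall>x\<in>E - En n. c < X.F \<psi>0 x" for c by (rule INF_tendsto_PInfty_imp[OF \<psi>0(4)])
  have esc: "X.escapes \<phi>0" "X.escapes (\<lambda>x. \<phi>0 x - \<psi>0 x)"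
    unfolding X.escapes_def using INF_tendsto_PInfty_imp[OF \<phi>0_growth] INF_tendsto_PInfty_imp[OF \<psi>0(5)]
    by (meson less_imp_le)+
  \<comment> \<open>Off a compact set \<phi>0 is a supersolution of the stationary equation, so
    recurrence bounds \<open>vhat\<close> by it.\<close>
  obtain C3 where C3: "\<And>x. x \<in> E \<Longrightarrow> vhat x \<le> \<phi>0 x + C3"
  proof -
    obtain N where N: "\<forall>x\<in>E - En N. X.F \<phi>0 x < lhat" using F_\<phi>0[of lhat] by (rule exE)
    show ?thesis
    proof (rule X.stationary_upper_bound[OF ergodic_pair(1) \<phi>0_C2, of Phat N])
      show "gmp_solution A Abar B E En vhat x (Phat x)" if "x \<in> E" for x
        using ergodic_pair(3) that by (simp add: gmp_family_def)
      show "recurrent_family E Phat" using ergodic_pair(4) by (simp add: ergodic_family_def)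
      show "X.F \<phi>0 x \<le> X.F vhat x" if "x \<in> E - En N" for x using N F_vhat that by (simp add: less_imp_le)
    qed (rule that)
  qed
  \<comment> \<open>Off a compact set \<psi>0 is a strict subsolution, and \<phi>0 is the penalty,
    since \<phi>0 - \<psi>0 escapes.\<close>
  obtain C2 where C2: "\<And>x. x \<in> E \<Longrightarrow> \<psi>0 x \<le> vhat x + C2"
  proof -
    obtain N1 where N1: "\<forall>x\<in>E - En N1. X.F \<phi>0 x < lhat" using F_\<phi>0[of lhat] by (rule exE)
    obtain N2 where N2: "\<forall>x\<in>E - En N2. lhat < X.F \<psi>0 x" using F_\<psi>0[of lhat] by (rule exE)
    have sub: "E - En (max N1 N2) \<subseteq> E - En N1" "E - En (max N1 N2) \<subseteq> E - En N2"
      using X.En_mono[of N1 "max N1 N2"] X.En_mono[of N2 "max N1 N2"] by auto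
    have lt: "X.F vhat x < X.F \<psi>0 x" "X.F \<phi>0 x < X.F \<psi>0 x" if "x \<in> E - En (max N1 N2)" for x
    proof -
      have "X.F \<phi>0 x < lhat" "lhat < X.F \<psi>0 x" using N1 N2 sub that by blast+
      then show "X.F vhat x < X.F \<psi>0 x" "X.F \<phi>0 x < X.F \<psi>0 x" using F_vhat[of x] that by simp_all
    qed
    show ?thesis
      by (rule X.stationary_lower_bound[OF ergodic_pair(1) \<psi>0_C2 \<phi>0_C2 lt esc(2)]) (assumption, assumption, rule that)
  qed
  obtain C\<alpha> where C\<alpha>: "\<forall>x\<in>E. X.F (\<lambda>y. \<delta> * \<phi>0 y) x + \<alpha> * (\<delta> * \<phi>0 x - \<psi>0 x) \<le> C\<alpha>"
    using SUP_less_PInfty_imp[OF \<psi>0(7)] by (rule exE)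
  obtain C0 where C0: "\<forall>x\<in>E. \<bar>v0 x\<bar> - \<phi>0 x \<le> C0" using SUP_less_PInfty_imp[OF v0(2)] by (rule exE)
  \<comment> \<open>One copy of \<phi>0 plus C3 covers \<open>vhat\<close>. What remains of \<phi> -
    vhat is at least (\<delta> - 1) \<phi>0 + 1, where \<phi>0 is nonnegative and escapes.\<close>
  define C1 where "C1 = C3 + 1"
  define \<phi> where "\<phi> x = \<delta> * \<phi>0 x + C1" for x
  have \<delta>\<phi>0_C2: "Ck_on E 2 (\<lambda>y. \<delta> * \<phi>0 y)" by (rule C2_cmult(1)[OF E(1) \<phi>0_C2])
  have F_\<phi>: "X.F \<phi> x = X.F (\<lambda>y. \<delta> * \<phi>0 y) x" if "x \<in> E" for x
    unfolding \<phi>_def[abs_def] by (rule X.F_add_const[OF \<delta>\<phi>0_C2 that])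
  have gap: "(\<delta> - 1) * \<phi>0 x + 1 \<le> \<phi> x - vhat x" if "x \<in> E" for x
    using C3[OF that] by (simp add: \<phi>_def C1_def algebra_simps)
  have gap0: "0 \<le> (\<delta> - 1) * \<phi>0 x" if "x \<in> E" for x using \<phi>0_nn[OF that] \<delta>(1) by simp
  have esc_\<delta>: "X.escapes (\<lambda>x. (\<delta> - 1) * \<phi>0 x + c)" for c
    unfolding X.escapes_def
  proof
    fix a
    obtain n where n: "\<forall>x\<in>E - En n. (a - c) / (\<delta> - 1) \<le> \<phi>0 x" using esc(1)[unfolded X.escapes_def, rule_format] by (rule exE)
    have "a \<le> (\<delta> - 1) * \<phi>0 x + c" if "x \<in> E - En n" for x
    proof -
      have "(a - c) / (\<delta> - 1) \<le> \<phi>0 x" using n that by blast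
      then show ?thesis using \<delta>(1) by (simp add: pos_divide_le_eq algebra_simps)
    qed
    then show "\<exists>n. \<forall>x\<in>E - En n. a \<le> (\<delta> - 1) * \<phi>0 x + c" by blast
  qed
  note cs = v(1)[unfolded classical_solution_def C12_on_def]
  interpret I: ergodic_limit E A Abar B V \<kappa>l En x0 \<phi>0 \<phi> vhat v \<alpha> "C\<alpha> + \<alpha> * (C1 + C2)" lhat Phat
  proof unfold_locales
    show "Ck_on E 2 \<phi>0" "Ck_on E 2 vhat" by (rule \<phi>0_C2, rule ergodic_pair(1))
    show "Ck_on E 2 \<phi>" unfolding \<phi>_def[abs_def] by (rule C2_add_const(1)[OF E(1) \<delta>\<phi>0_C2])
    show "X.F vhat x = lhat" if "x \<in> E" for x by (rule F_vhat[OF that])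
    show "\<exists>n. \<forall>x\<in>E - En n. X.F \<phi>0 x \<le> lhat - 1" using F_\<phi>0[of "lhat - 1"] by (meson less_imp_le)
    show "\<exists>n. \<forall>x\<in>E - En n. X.F \<phi> x \<le> lhat" using F_\<delta>\<phi>0[of lhat] F_\<phi> by (metis DiffD1 less_imp_le)
    show "0 < \<alpha>" by (rule \<psi>0(2))
    show "X.F \<phi> x + \<alpha> * (\<phi> x - vhat x) \<le> C\<alpha> + \<alpha> * (C1 + C2)" if "x \<in> E" for x
    proof -
      \<comment> \<open>Replacing \<psi>0 by \<open>vhat\<close> costs \<open>C2\<close>, and the
        shift in \<phi> costs \<open>C1\<close>.\<close>
      have "\<alpha> * (\<phi> x - vhat x) \<le> \<alpha> * (\<delta> * \<phi>0 x - \<psi>0 x + (C1 + C2))"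
        using C2[OF that] \<psi>0(2) by (intro mult_left_mono) (auto simp: \<phi>_def)
      moreover have "X.F (\<lambda>y. \<delta> * \<phi>0 y) x + \<alpha> * (\<delta> * \<phi>0 x - \<psi>0 x) \<le> C\<alpha>" using C\<alpha> that by blast
      ultimately show ?thesis unfolding F_\<phi>[OF that] by (simp add: distrib_left)
    qed
    show "1 \<le> \<phi> x - vhat x" if "x \<in> E" for x using gap[OF that] gap0[OF that] by simp
    show "X.escapes (\<lambda>x. \<phi> x - vhat x)"
      unfolding X.escapes_def
    proof
      fix a
      obtain n where n: "\<forall>x\<in>E - En n. a \<le> (\<delta> - 1) * \<phi>0 x + 1" using esc_\<delta>[of 1, unfolded X.escapes_def, rule_format] by (rule exE)
      have "a \<le> \<phi> x - vhat x" if "x \<in> E - En n" for x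
      proof -
        have "a \<le> (\<delta> - 1) * \<phi>0 x + 1" using n that by blast
        then show ?thesis using gap[of x] that by simp
      qed
      then show "\<exists>n. \<forall>x\<in>E - En n. a \<le> \<phi> x - vhat x" by blast
    qed
    show "X.escapes (\<lambda>x. \<phi> x - \<phi>0 x)" using esc_\<delta>[of C1] by (simp add: \<phi>_def left_diff_distrib add_diff_eq diff_add_eq)
    show "Ck_on E 2 (v t)" if "0 < t" for t using cs that by simp
    show "((\<lambda>s. v s x) has_real_derivative X.F (v t) x) (at t)" if "0 < t" "x \<in> E" for t x
    proof -
      have "(\<lambda>s. v s x) differentiable (at t)" "deriv (\<lambda>s. v s x) t = X.F (v t) x" using cs that by simp_all
      then show ?thesis using DERIV_deriv_iff_real_differentiable by metis
    qed
    show "continuous_on ({0..} \<times> E) (\<lambda>p. v (fst p) (snd p))" using cs by (simp add: case_prod_beta)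
    show "\<exists>C. \<forall>s\<in>{0..T}. \<forall>x\<in>E. v s x \<le> \<phi>0 x + C" if "0 \<le> T" for T
    proof -
      have "(SUP p\<in>{0..T} \<times> E. ereal (v (fst p) (snd p) - \<phi>0 (snd p))) < \<infinity>" using v(2) that by (simp add: case_prod_beta)
      from SUP_less_PInfty_imp[OF this]
      obtain C where "\<forall>p\<in>{0..T} \<times> E. v (fst p) (snd p) - \<phi>0 (snd p) \<le> C" by (rule exE)
      then have "\<forall>s\<in>{0..T}. \<forall>x\<in>E. v s x \<le> \<phi>0 x + C" by (auto simp: algebra_simps)
      then show ?thesis ..
    qed
    show "\<exists>C\<ge>0. \<forall>x\<in>E. - (C * (\<phi> x - vhat x)) - C \<le> v 0 x - vhat x"
    proof -
      \<comment> \<open>The initial difference is at least - 2 \<phi>0 - C0 - C3; the factor 2 /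
        (\<delta> - 1) converts the surplus (\<delta> - 1) \<phi>0 contained in \<phi> - vhat into 2
        \<phi>0.\<close>
      define C where "C = 2 / (\<delta> - 1) + \<bar>C0\<bar> + \<bar>C3\<bar>"
      have C: "2 / (\<delta> - 1) \<le> C" "C0 + C3 \<le> C" "0 \<le> C"
      proof -
        have "0 \<le> 2 / (\<delta> - 1)" using \<delta>(1) by simp
        then show "2 / (\<delta> - 1) \<le> C" "C0 + C3 \<le> C" "0 \<le> C" unfolding C_def by linarith+
      qed
      have "- (C * (\<phi> x - vhat x)) - C \<le> v 0 x - vhat x" if "x \<in> E" for x
      proof -
        have "- \<phi>0 x - C0 \<le> v 0 x" using C0 cs that by force
        moreover have "2 * \<phi>0 x \<le> C * (\<phi> x - vhat x)"
        proof -
          have "2 * \<phi>0 x = 2 / (\<delta> - 1) * ((\<delta> - 1) * \<phi>0 x)" using \<delta>(1) by simp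
          also have "\<dots> \<le> C * (\<phi> x - vhat x)"
            using C gap[OF that] gap0[OF that] by (intro mult_mono) auto
          finally show ?thesis .
        qed
        ultimately show ?thesis using C3[OF that] C(2) by linarith
      qed
      then show ?thesis using C(3) by blast
    qed
    show "gmp_solution A Abar B E En vhat x (Phat x)" if "x \<in> E" for x
      using ergodic_pair(3) that by (simp add: gmp_family_def)
    show "continuous_on ({0<..} \<times> E) (\<lambda>p. grad (v (fst p)) (snd p) $ i)" for i
      using cs by (simp add: grad_def case_prod_beta)
    show "continuous_on ({0<..} \<times> E) (\<lambda>p. hess (v (fst p)) (snd p) $ i $ j)" for i j
      using cs by (simp add: hess_def case_prod_beta)
  qed
  have h_eq: "h = I.h" unfolding h by (intro ext) (simp add: I.h_def)
  show ?thesis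
    unfolding h_eq I.gradient_cost_def[symmetric] pos_def[symmetric]
    by (intro conjI vanishes_in_CI I.cost_limit I.sup_limit t)
qed

end
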